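(* The map $f\mapsto\hat f$, $\hat f(s)=\int_0^\infty f(x)x^s\,\mathrm d^\times x$, identifies $\mathcal H_-$ with the space of entire functions $h:\mathbb C\to\mathbb C$ such that $t\mapsto h(s+it)$ is a Schwartz function on $\mathbb R$ for every $s\in\mathbb R$. Under this identification the subspace $Z\mathcal H_\cap$ is mapped onto the space of those such entire functions $h$ for which $t\mapsto h(s+it)/\zeta(s+it)$ is a Schwartz function for every $s\ge 1/2$ and $t\mapsto h(s+it)/\zeta(1-s-it)$ is a Schwartz function for every $s\le 1/2$ (in particular, $h(z)/\zeta(z)$ has no poles with $\operatorname{Re}z\ge1/2$ and $h(z)/\zeta(1-z)$ has no poles with $\operatorname{Re} z\le 1/2$).
   Context: $\mathbb R^\times_+$: positive reals, $\mathrm d^\times x=x^{-1}\mathrm dx$, identified with $\mathbb R$ via $\ln$, Schwartz space $\mathcal S(\mathbb R^\times_+)$. $\mathcal S(\mathbb R^\times_+)_s=\{f\mid x\mapsto f(x)x^s\in\mathcal S(\mathbb R^\times_+)\}$, $\mathcal H_-=\bigcap_{s\in\mathbb R}\mathcal S(\mathbb R^\times_+)_s$. $\mathcal H_+=\{f\in\mathcal S(\mathbb R)\mid f \text{ even}\}$, viewed as functions on $(0,\infty)$. $\mathfrak F f(y)=\int_{\mathbb R}f(x)e^{2\pi ixy}\,\mathrm dx$; $\mathcal H_\cap=\{f\in\mathcal H_+\mid f(0)=\mathfrak Ff(0)=0\}$. $Zf(x)=\sum_{n\ge1}f(nx)$; for $f\in\mathcal H_\cap$ one has $Zf\in\mathcal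 H_-$. $\zeta$ is the Riemann zeta function (meromorphically continued).
   Formalization: The entire functions h are also required to be bounded on every vertical strip of finite width; without this the claim is false, since some entire h are Schwartz on each vertical line yet unbounded on a strip, while every transform of an f in H_- is bounded on strips. *)

theory Defs
  imports "HOL-Complex_Analysis.Complex_Analysis"
begin

definition iter_deriv :: "nat \<Rightarrow> (real \<Rightarrow> complex) \<Rightarrow> real \<Rightarrow> complex" where
  "iter_deriv n f = ((\<lambda>g x. vector_derivative g (at x)) ^^ n) f"

definition schwartz :: "(real \<Rightarrow> complex) set" where
  "schwartz = {f. (\<forall>n x. iter_deriv n f differentiable (at x)) \<and>
                  (\<forall>k n. bounded (range (\<lambda>x. x ^ k *\<^sub>R iter_deriv n f x)))}"

text \<open>A function on the positive reals is represented by its extension by 0 to the whole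
  real line, so that equality of representatives is equality on the positive reals.\<close>

definition schwartz_pos :: "(real \<Rightarrow> complex) set" where
  "schwartz_pos = {f. (\<forall>x\<le>0. f x = 0) \<and> (\<lambda>t. f (exp t)) \<in> schwartz}"

definition schwartz_pos_weight :: "real \<Rightarrow> (real \<Rightarrow> complex) set" where
  "schwartz_pos_weight s =
     {f. (\<forall>x\<le>0. f x = 0) \<and> (\<lambda>x. f x * complex_of_real (x powr s)) \<in> schwartz_pos}"

definition H_minus :: "(real \<Rightarrow> complex) set" where
  "H_minus = (\<Inter>s. schwartz_pos_weight s)"

definition H_plus :: "(real \<Rightarrow> complex) set" where
  "H_plus = {f \<in> schwartz. \<forall>x. f (- x) = f x}"

definition fourier :: "(real \<Rightarrow> complex) \<Rightarrow> real \<Rightarrow> complex" where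
  "fourier f y = (LINT x|lborel. f x * exp (2 * pi * \<i> * x * y))"

definition H_cap :: "(real \<Rightarrow> complex) set" where
  "H_cap = {f \<in> H_plus. f 0 = 0 \<and> fourier f 0 = 0}"

definition Z_map :: "(real \<Rightarrow> complex) \<Rightarrow> real \<Rightarrow> complex" where
  "Z_map f x = (if x > 0 then (\<Sum>n. f (real (Suc n) * x)) else 0)"

definition mellin_integrand :: "(real \<Rightarrow> complex) \<Rightarrow> complex \<Rightarrow> real \<Rightarrow> complex" where
  "mellin_integrand f s x = f x * complex_of_real x powr s / complex_of_real x"

definition mellin :: "(real \<Rightarrow> complex) \<Rightarrow> complex \<Rightarrow> complex" where
  "mellin f s = (LINT x:{0<..}|lborel. mellin_integrand f s x)"

text \<open>The analytic continuation of the Dirichlet series; the value 0 at the pole is an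
  arbitrary normalisation that makes the function unique.\<close>

definition riemann_zeta :: "complex \<Rightarrow> complex" where
  "riemann_zeta = (THE F. F holomorphic_on (- {1}) \<and> F 1 = 0 \<and>
     (\<forall>s. Re s > 1 \<longrightarrow> (\<lambda>n. 1 / of_nat (Suc n) powr s) sums F s))"

text \<open>Boundedness on vertical strips of finite width records that the Schwartz condition on
  the lines is meant locally uniformly in the real part. Without it the space is larger than
  the Mellin image of \<^const>\<open>H_minus\<close>: there are entire functions that are Schwartz
  functions on every single vertical line, but are unbounded on a strip because they are huge
  along a curve asymptotic to a vertical line.\<close>

definition entire_schwartz :: "(complex \<Rightarrow> complex) set" where
  "entire_schwartz = {h. h holomorphic_on UNIV \<and>
     (\<forall>s. (\<lambda>t. h (Complex s t)) \<in> schwartz) \<and>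
     (\<forall>a b. bounded (h ` {z. a \<le> Re z \<and> Re z \<le> b}))}"

text \<open>Quotients by zeta are meromorphic functions, so removable singularities at zeros of
  zeta are filled in. At a genuine pole \<^const>\<open>remove_sings\<close> takes the value 0, but the
  quotient is unbounded near the pole along the line, hence not a Schwartz function.\<close>

definition quot_zeta :: "(complex \<Rightarrow> complex) \<Rightarrow> complex \<Rightarrow> complex" where
  "quot_zeta h = remove_sings (\<lambda>z. h z / riemann_zeta z)"

definition quot_zeta_refl :: "(complex \<Rightarrow> complex) \<Rightarrow> complex \<Rightarrow> complex" where
  "quot_zeta_refl h = remove_sings (\<lambda>z. h z / riemann_zeta (1 - z))"

definition entire_schwartz_zeta :: "(complex \<Rightarrow> complex) set" where
  "entire_schwartz_zeta = {h \<in> entire_schwartz.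
     (\<forall>s\<ge>1/2. (\<lambda>t. quot_zeta h (Complex s t)) \<in> schwartz) \<and>
     (\<forall>s\<le>1/2. (\<lambda>t. quot_zeta_refl h (Complex s t)) \<in> schwartz)}"

end

theory Submission
  imports Defs "HOL-Probability.Probability" "HOL-Real_Asymp.Real_Asymp"
begin

text \<open>On the multiplicative side, the Mellin transform is a two-sided Laplace transform, whose inversion and
  contour shift give the bijection. For \<open>f\<close> in \<open>H_cap\<close> the transform of \<open>Z_map f\<close> is
  \<open>riemann_zeta z * mellin f z\<close>; by Tate's local functional equation and the functional equation of zeta this
  equals \<open>riemann_zeta (1 - z) * mellin (fourier f) (1 - z)\<close>, which gives decay on both sides of the critical line.

  Conversely, let \<open>G = h / riemann_zeta\<close> and let \<open>G2\<close> be the analogous quotient for the reflected function.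
  Being Schwartz on single lines does not bound \<open>G\<close> in a strip. Dividing out the zeros of zeta in discs centred
  on \<open>Re z = 2\<close> and applying Harnack's inequality bounds \<open>G\<close> by \<open>exp (C * ln T / (Re z - 1/2))\<close> at height \<open>T\<close>; a
  maximum principle with exponential factors at the corners of a rectangle turns this into a polynomial bound, and
  the Phragmen-Lindeloef principle into rapid decay. The inverse Mellin transforms of \<open>G\<close> and \<open>G2\<close>, extended
  evenly, are then Fourier transforms of each other, as one sees by pairing them with Gaussians on the critical line.
  Hence both are Schwartz functions; their values at 0 vanish because zeta has a pole at 1.\<close>

text \<open>The inverse Mellin transform of \<open>G\<close> decays at infinity, since its contour
  can be moved arbitrarily far to the right, but near 0 it is only known to be of size
  \<open>x powr (- 1/2)\<close>, since \<open>G\<close> is controlled only for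
  \<open>Re z \<ge> 1/2\<close>. Smoothness at 0 is out of reach from \<open>G\<close> alone. It
  comes from the other quotient: \<open>G2\<close> gives a function with all moments, whose Fourier
  transform is smooth everywhere, and the decay of that Fourier transform is read off from
  \<open>G\<close>. Each quotient supplies what the other lacks, and the critical line is the only
  line on which both \<open>G z\<close> and \<open>G2 (1 - z)\<close> are controlled, which is why
  the pairing takes place there. The same one-sided information shapes the growth estimate: the
  discs may touch the critical line but not cross it, so the bound from Harnack's inequality
  degenerates there. Gaussians serve three times: their theta series continues zeta, their Mellin
  transform has no zeros and can be cancelled from the functional equations, and their translates
  form an approximate identity.\<close>

section \<open>Differentiation of parameter integrals\<close>

lemma has_vector_derivative_iff_quotient:
  fixes f :: "real \<Rightarrow> 'a :: real_normed_vector"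
  shows "(f has_vector_derivative D) (at x) \<longleftrightarrow> ((\<lambda>y. (f y - f x) /\<^sub>R (y - x)) \<longlongrightarrow> D) (at x)"
proof -
  have eq: "norm (f y - f x - (y - x) *\<^sub>R D) / norm (y - x) = norm ((f y - f x) /\<^sub>R (y - x) - D)"
    if "y \<noteq> x" for y
  proof -
    have "(f y - f x) /\<^sub>R (y - x) - D = (f y - f x - (y - x) *\<^sub>R D) /\<^sub>R (y - x)"
      using that by (simp add: scaleR_diff_right)
    thus ?thesis by (simp add: divide_inverse mult.commute)
  qed
  have "(f has_vector_derivative D) (at x) \<longleftrightarrow>
        ((\<lambda>y. norm (f y - f x - (y - x) *\<^sub>R D) / norm (y - x)) \<longlongrightarrow> 0) (at x)"
    unfolding has_vector_derivative_def has_derivative_iff_norm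
    by (simp add: bounded_linear_scaleR_left)
  also have "\<dots> \<longleftrightarrow> ((\<lambda>y. norm ((f y - f x) /\<^sub>R (y - x) - D)) \<longlongrightarrow> 0) (at x)"
    by (rule LIM_cong[OF refl eq refl])
  also have "\<dots> \<longleftrightarrow> ((\<lambda>y. (f y - f x) /\<^sub>R (y - x)) \<longlongrightarrow> D) (at x)"
    by (simp only: tendsto_norm_zero_iff Lim_null[of _ D, symmetric])
  finally show ?thesis .
qed

lemma norm_diff_le_vector_derivative_bound:
  fixes f :: "real \<Rightarrow> 'a :: real_normed_vector"
  assumes "\<And>t. (f has_vector_derivative f' t) (at t)" "\<And>t. t \<in> closed_segment a b \<Longrightarrow> norm (f' t) \<le> B"
  shows "norm (f b - f a) \<le> B * \<bar>b - a\<bar>"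
proof -
  have "norm (f b - f a) \<le> B * norm (b - a)"
  proof (rule differentiable_bound[where S = "closed_segment a b" and f' = "\<lambda>t h. h *\<^sub>R f' t"])
    show "(f has_derivative (\<lambda>h. h *\<^sub>R f' x)) (at x within closed_segment a b)" for x
      using assms(1)[of x] unfolding has_vector_derivative_def
      by (rule has_derivative_at_withinI)
    show "onorm (\<lambda>h. h *\<^sub>R f' x) \<le> B" if "x \<in> closed_segment a b" for x
      using assms(2)[OF that] by (intro onorm_le) (simp add: mult.commute[of B] mult_left_mono)
  qed auto
  thus ?thesis by simp
qed

text \<open>The majorant \<open>w\<close> bounds the derivative for every parameter, so by the mean
  value inequality it also bounds all difference quotients, and dominated convergence along
  sequences applies.\<close>

lemma has_vector_derivative_integral:
  fixes f :: "real \<Rightarrow> 'a \<Rightarrow> 'b :: {banach, second_countable_topology}"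
  assumes int: "\<And>t. integrable M (f t)"
    and der: "\<And>t x. x \<in> space M \<Longrightarrow> ((\<lambda>t. f t x) has_vector_derivative f' t x) (at t)"
    and meas: "f' t \<in> borel_measurable M"
    and bound: "\<And>t x. x \<in> space M \<Longrightarrow> norm (f' t x) \<le> w x"
    and w: "integrable M w"
  shows "((\<lambda>t. integral\<^sup>L M (f t)) has_vector_derivative integral\<^sup>L M (f' t)) (at t)"
  unfolding has_vector_derivative_iff_quotient tendsto_at_iff_sequentially
proof (intro allI impI)
  fix X :: "nat \<Rightarrow> real" assume X: "\<forall>i. X i \<in> UNIV - {t}" "X \<longlonglongrightarrow> t"
  have "(\<lambda>n. \<integral>x. (f (X n) x - f t x) /\<^sub>R (X n - t) \<partial>M) \<longlonglongrightarrow> integral\<^sup>L M (f' t)"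
  proof (rule integral_dominated_convergence[where w = w])
    show "(\<lambda>x. (f (X n) x - f t x) /\<^sub>R (X n - t)) \<in> borel_measurable M" for n
      using int by (intro borel_measurable_scaleR borel_measurable_diff) auto
    show "AE x in M. (\<lambda>n. (f (X n) x - f t x) /\<^sub>R (X n - t)) \<longlonglongrightarrow> f' t x"
      using X der[of _ t] unfolding has_vector_derivative_iff_quotient tendsto_at_iff_sequentially
      by (intro AE_I2) (auto simp: o_def)
    show "AE x in M. norm ((f (X n) x - f t x) /\<^sub>R (X n - t)) \<le> w x" for n
    proof (intro AE_I2)
      fix x assume x: "x \<in> space M"
      have "norm (f (X n) x - f t x) \<le> w x * \<bar>X n - t\<bar>"
        by (rule norm_diff_le_vector_derivative_bound[OF der[OF x] bound[OF x]])
      moreover have "\<bar>X n - t\<bar> > 0" using X(1) by auto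
      ultimately have "norm (f (X n) x - f t x) / \<bar>X n - t\<bar> \<le> w x"
        by (simp add: divide_le_eq)
      thus "norm ((f (X n) x - f t x) /\<^sub>R (X n - t)) \<le> w x"
        by (simp add: divide_inverse mult.commute)
    qed
  qed (use w meas in auto)
  thus "((\<lambda>y. (integral\<^sup>L M (f y) - integral\<^sup>L M (f t)) /\<^sub>R (y - t)) \<circ> X) \<longlonglongrightarrow> integral\<^sup>L M (f' t)"
    using int by (simp add: o_def)
qed

text \<open>A local majorant of \<open>f\<close> itself suffices: Cauchy's inequality on discs of
  half the radius turns it into a majorant of the complex derivatives, hence of the difference
  quotients, and dominated convergence gives the derivative of the integral.\<close>

lemma holomorphic_integral:
  fixes f :: "complex \<Rightarrow> 'a \<Rightarrow> complex"
  assumes S: "open S"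
    and hol: "\<And>x. x \<in> space M \<Longrightarrow> (\<lambda>z. f z x) holomorphic_on S"
    and meas: "\<And>z. z \<in> S \<Longrightarrow> f z \<in> borel_measurable M"
    and bound: "\<And>z0. z0 \<in> S \<Longrightarrow> \<exists>r>0. \<exists>w. cball z0 r \<subseteq> S \<and> integrable M w \<and>
                  (\<forall>z\<in>cball z0 r. \<forall>x\<in>space M. norm (f z x) \<le> w x)"
  shows "(\<lambda>z. integral\<^sup>L M (f z)) holomorphic_on S"
proof (rule holomorphic_onI, rule field_differentiable_at_within)
  fix z0 assume z0: "z0 \<in> S"
  obtain r w where r: "r > 0" "cball z0 r \<subseteq> S" and w: "integrable M w"
      "\<And>z x. z \<in> cball z0 r \<Longrightarrow> x \<in> space M \<Longrightarrow> norm (f z x) \<le> w x"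
    using bound[OF z0] by blast
  have int: "integrable M (f z)" if "z \<in> cball z0 r" for z
    using that r w meas[of z] by (intro Bochner_Integration.integrable_bound[OF w(1)])
      (auto intro!: AE_I2 intro: order.trans[OF _ abs_ge_self])
  let ?D = "\<lambda>z x. deriv (\<lambda>z. f z x) z"
  have hd: "((\<lambda>z. f z x) has_field_derivative ?D z x) (at z)" if "x \<in> space M" "z \<in> cball z0 r" for x z
    using hol[OF that(1)] S r that by (intro holomorphic_derivI) auto
  have Dbound: "norm (?D z x) \<le> w x / (r/2)" if x: "x \<in> space M" and z: "z \<in> cball z0 (r/2)" for z x
  proof -
    have sub: "cball z (r/2) \<subseteq> cball z0 r"
    proof
      fix y assume "y \<in> cball z (r/2)"
      thus "y \<in> cball z0 r" using z dist_triangle[of z0 y z] by (auto simp: )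
    qed
    have holz: "(\<lambda>z. f z x) holomorphic_on cball z (r/2)"
      using hol[OF x] by (rule holomorphic_on_subset) (use sub r in auto)
    have "norm ((deriv ^^ 1) (\<lambda>z. f z x) z) \<le> fact 1 * w x / (r/2) ^ 1"
    proof (rule Cauchy_inequality)
      show "(\<lambda>z. f z x) holomorphic_on ball z (r/2)" using holz by (rule holomorphic_on_subset) auto
      show "continuous_on (cball z (r/2)) (\<lambda>z. f z x)" using holz by (rule holomorphic_on_imp_continuous_on)
      show "norm (f y x) \<le> w x" if "norm (z - y) = r/2" for y
        by (intro w x) (use that sub in \<open>auto simp: dist_norm subset_iff\<close>)
    qed (use r in auto)
    thus ?thesis by simp
  qed
  have "((\<lambda>z. integral\<^sup>L M (f z)) has_field_derivative integral\<^sup>L M (?D z0)) (at z0)"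
    unfolding has_field_derivative_iff tendsto_at_iff_sequentially
  proof (intro allI impI)
    fix X :: "nat \<Rightarrow> complex" assume X: "\<forall>i. X i \<in> UNIV - {z0}" "X \<longlonglongrightarrow> z0"
    from X(2) r have "eventually (\<lambda>n. dist (X n) z0 < r/2) sequentially"
      by (intro tendstoD) auto
    then obtain N where N: "\<And>n. n \<ge> N \<Longrightarrow> dist (X n) z0 < r/2"
      unfolding eventually_sequentially by auto
    \<comment> \<open>Dropping finitely many terms keeps the sequence in the half disc, where the
      Cauchy bound holds.\<close>
    define Y where "Y n = X (n + N)" for n
    have Y: "\<And>n. Y n \<noteq> z0" "\<And>n. Y n \<in> cball z0 (r/2)" "Y \<longlonglongrightarrow> z0"
      using X N LIMSEQ_ignore_initial_segment[OF X(2), of N]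
      by (auto simp: Y_def[abs_def] dist_commute less_imp_le)
    have Yr: "Y n \<in> cball z0 r" for n using Y(2)[of n] r by auto
    have lim: "(\<lambda>n. (f (Y n) x - f z0 x) / (Y n - z0)) \<longlonglongrightarrow> ?D z0 x" if "x \<in> space M" for x
      using hd[OF that, of z0] Y r unfolding has_field_derivative_iff tendsto_at_iff_sequentially
      by (auto simp: o_def)
    have m: "(\<lambda>x. (f (Y n) x - f z0 x) / (Y n - z0)) \<in> borel_measurable M" for n
      using int[OF Yr[of n]] int[of z0] r by (intro borel_measurable_divide borel_measurable_diff) auto
    have "(\<lambda>n. \<integral>x. (f (Y n) x - f z0 x) / (Y n - z0) \<partial>M) \<longlonglongrightarrow> integral\<^sup>L M (?D z0)"
    proof (rule integral_dominated_convergence[where w = "\<lambda>x. w x / (r/2)"])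
      show "?D z0 \<in> borel_measurable M"
        by (rule borel_measurable_LIMSEQ_metric[OF m lim])
      show "AE x in M. norm ((f (Y n) x - f z0 x) / (Y n - z0)) \<le> w x / (r/2)" for n
      proof (intro AE_I2)
        fix x assume x: "x \<in> space M"
        have "norm (f (Y n) x - f z0 x) \<le> w x / (r/2) * norm (Y n - z0)"
          by (rule field_differentiable_bound[where S = "cball z0 (r/2)" and f' = "\<lambda>z. ?D z x"])
            (use Dbound[OF x] hd[OF x] Y(2)[of n] r in \<open>auto intro: has_field_derivative_at_within\<close>)
        thus "norm ((f (Y n) x - f z0 x) / (Y n - z0)) \<le> w x / (r/2)"
          using Y(1)[of n] by (simp add: norm_divide field_simps)
      qed
    qed (use m lim w in \<open>auto intro!: AE_I2 integrable_divide_zero\<close>)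
    hence "(\<lambda>n. (integral\<^sup>L M (f (Y n)) - integral\<^sup>L M (f z0)) / (Y n - z0)) \<longlonglongrightarrow> integral\<^sup>L M (?D z0)"
      using int[OF Yr] int[of z0] r by simp
    hence "(\<lambda>n. ((\<lambda>y. (integral\<^sup>L M (f y) - integral\<^sup>L M (f z0)) / (y - z0)) \<circ> X) (n + N)) \<longlonglongrightarrow> integral\<^sup>L M (?D z0)"
      by (simp add: Y_def o_def)
    thus "((\<lambda>y. (integral\<^sup>L M (f y) - integral\<^sup>L M (f z0)) / (y - z0)) \<circ> X) \<longlonglongrightarrow> integral\<^sup>L M (?D z0)"
      by (rule LIMSEQ_offset)
  qed
  thus "(\<lambda>z. integral\<^sup>L M (f z)) field_differentiable at z0"
    unfolding field_differentiable_def by blast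
qed

section \<open>Rapidly decreasing and Schwartz functions\<close>

text \<open>The weight \<open>1 + \<bar>x\<bar>\<close> is at least 1, so one inequality expresses
  boundedness and decay together, and weights of different orders combine by adding
  exponents.\<close>

definition rapid :: "(real \<Rightarrow> complex) \<Rightarrow> bool" where
  "rapid f \<longleftrightarrow> (\<forall>k::nat. \<exists>C. \<forall>x. (1 + \<bar>x\<bar>) ^ k * norm (f x) \<le> C)"

lemma one_plus_power_le:
  fixes a :: real
  assumes "a \<ge> 0"
  shows "(1 + a) ^ k \<le> 2 ^ k * (1 + a ^ k)"
proof (cases "a \<le> 1")
  case True
  have "(1 + a) ^ k \<le> 2 ^ k * 1" using assms True by (simp add: power_mono)
  also have "\<dots> \<le> 2 ^ k * (1 + a ^ k)" using assms by (intro mult_left_mono) auto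
  finally show ?thesis .
next
  case False
  have "(1 + a) ^ k \<le> (2 * a) ^ k" using False by (intro power_mono) auto
  also have "\<dots> = 2 ^ k * a ^ k" by (simp add: power_mult_distrib)
  also have "\<dots> \<le> 2 ^ k * (1 + a ^ k)" by (intro mult_left_mono) auto
  finally show ?thesis .
qed

lemma rapidI:
  assumes "\<And>k. \<exists>C. \<forall>x. \<bar>x\<bar> ^ k * norm (f x) \<le> C"
  shows "rapid f"
  unfolding rapid_def
proof
  fix k :: nat
  obtain C0 where C0: "\<And>x. norm (f x) \<le> C0" using assms[of 0] by auto
  obtain C where C: "\<And>x. \<bar>x\<bar> ^ k * norm (f x) \<le> C" using assms[of k] by auto
  have "(1 + \<bar>x\<bar>) ^ k * norm (f x) \<le> 2 ^ k * (C0 + C)" for x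
  proof -
    have "(1 + \<bar>x\<bar>) ^ k * norm (f x) \<le> (2 ^ k * (1 + \<bar>x\<bar> ^ k)) * norm (f x)"
      by (intro mult_right_mono one_plus_power_le) auto
    also have "\<dots> = 2 ^ k * (norm (f x) + \<bar>x\<bar> ^ k * norm (f x))" by (simp add: algebra_simps)
    also have "\<dots> \<le> 2 ^ k * (C0 + C)" using C0[of x] C[of x] by (intro mult_left_mono) auto
    finally show ?thesis .
  qed
  thus "\<exists>C. \<forall>x. (1 + \<bar>x\<bar>) ^ k * norm (f x) \<le> C" by blast
qed

lemma rapidD: 
  assumes "rapid f"
  obtains C where "C \<ge> 0" "\<And>x. (1 + \<bar>x\<bar>) ^ k * norm (f x) \<le> C"
proof -
  obtain C where C: "\<And>x. (1 + \<bar>x\<bar>) ^ k * norm (f x) \<le> C" using assms unfolding rapid_def by blast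
  moreover from C[of 0] have "C \<ge> 0" using norm_ge_zero[of "f 0"] by (simp del: norm_ge_zero)
  ultimately show ?thesis using that by blast
qed

lemma rapid_bounded: 
  assumes "rapid f" obtains C where "C \<ge> 0" "\<And>x. norm (f x) \<le> C"
  using rapidD[OF assms, of 0] by auto

lemma rapid_add: assumes "rapid f" "rapid g" shows "rapid (\<lambda>x. f x + g x)"
  unfolding rapid_def
proof
  fix k
  obtain C where C: "\<And>x. (1 + \<bar>x\<bar>) ^ k * norm (f x) \<le> C" using rapidD[OF assms(1)] by blast
  obtain D where D: "\<And>x. (1 + \<bar>x\<bar>) ^ k * norm (g x) \<le> D" using rapidD[OF assms(2)] by blast
  have "(1 + \<bar>x\<bar>) ^ k * norm (f x + g x) \<le> C + D" for x
  proof -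
    have "(1 + \<bar>x\<bar>) ^ k * norm (f x + g x) \<le> (1 + \<bar>x\<bar>) ^ k * (norm (f x) + norm (g x))"
      by (intro mult_left_mono norm_triangle_ineq) auto
    with C[of x] D[of x] show ?thesis by (simp add: algebra_simps)
  qed
  thus "\<exists>C. \<forall>x. (1 + \<bar>x\<bar>) ^ k * norm (f x + g x) \<le> C" by blast
qed

lemma rapid_mult_poly:
  assumes "rapid f" "\<And>x. norm (g x) \<le> B * (1 + \<bar>x\<bar>) ^ m * norm (f x)" "B \<ge> 0"
  shows "rapid g"
  unfolding rapid_def
proof
  fix k
  obtain C where C: "\<And>x. (1 + \<bar>x\<bar>) ^ (k + m) * norm (f x) \<le> C" using rapidD[OF assms(1)] by blast
  have "(1 + \<bar>x\<bar>) ^ k * norm (g x) \<le> B * C" for x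
  proof -
    have "(1 + \<bar>x\<bar>) ^ k * norm (g x) \<le> (1 + \<bar>x\<bar>) ^ k * (B * (1 + \<bar>x\<bar>) ^ m * norm (f x))"
      by (intro mult_left_mono assms) auto
    also have "\<dots> = B * ((1 + \<bar>x\<bar>) ^ (k + m) * norm (f x))" by (simp add: power_add)
    also have "\<dots> \<le> B * C" by (intro mult_left_mono C assms)
    finally show ?thesis .
  qed
  thus "\<exists>C. \<forall>x. (1 + \<bar>x\<bar>) ^ k * norm (g x) \<le> C" by blast
qed

lemma rapid_cmult: "rapid f \<Longrightarrow> rapid (\<lambda>x. c * f x)"
  by (rule rapid_mult_poly[where m = 0 and B = "norm c"]) (auto simp: norm_mult)

text \<open>The mean value inequality on an interval whose length is adapted to the size of \<open>f\<close>
  interpolates the first derivative between \<open>f\<close> and its second derivative.\<close>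

lemma rapid_derivative:
  assumes d: "\<And>x. (f has_vector_derivative f' x) (at x)" "\<And>x. (f' has_vector_derivative f'' x) (at x)"
    and B: "\<And>x. norm (f'' x) \<le> B" and f: "rapid f"
  shows "rapid f'"
  unfolding rapid_def
proof
  fix k
  \<comment> \<open>Decay of order \<open>2 * k\<close> is spent on order \<open>k\<close> for the
    derivative: on a step of length \<open>1 / p\<close> the quotient of the values of
    \<open>f\<close>, of size \<open>p powr (- 2)\<close>, and the error \<open>B / p\<close> of the
    linearisation are both of order \<open>1 / p\<close>.\<close>
  obtain C where C: "C \<ge> 0" "\<And>x. (1 + \<bar>x\<bar>) ^ (2 * k) * norm (f x) \<le> C" using rapidD[OF f] by blast
  have B0: "B \<ge> 0" using B[of 0] norm_ge_zero[of "f'' 0"] by linarith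
  have "(1 + \<bar>x\<bar>) ^ k * norm (f' x) \<le> 2 * 4 ^ k * C + B" for x
  proof -
    define p where "p = (1 + \<bar>x\<bar>) ^ k"
    define \<delta> where "\<delta> = inverse p"
    have p: "p \<ge> 1" by (simp add: p_def)
    have \<delta>: "\<delta> > 0" "\<delta> \<le> 1" using p by (auto simp: \<delta>_def inverse_le_1_iff)
    have A: "p ^ 2 * norm (f y) \<le> 4 ^ k * C" if "y \<in> {x, x + \<delta>}" for y
    proof -
      have "1 + \<bar>x\<bar> \<le> 2 * (1 + \<bar>y\<bar>)"
        using that \<delta> abs_triangle_ineq4[of y "y - x"] abs_ge_zero[of y] by (auto simp del: abs_ge_zero)
      hence "(1 + \<bar>x\<bar>) ^ (2 * k) \<le> (2 * (1 + \<bar>y\<bar>)) ^ (2 * k)" by (intro power_mono) auto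
      also have "\<dots> = 4 ^ k * (1 + \<bar>y\<bar>) ^ (2 * k)" 
        by (simp only: power_mult power_mult_distrib) simp
      finally have "p ^ 2 * norm (f y) \<le> 4 ^ k * (1 + \<bar>y\<bar>) ^ (2 * k) * norm (f y)"
        by (intro mult_right_mono) (auto simp: p_def power_mult[symmetric] mult.commute)
      also have "\<dots> \<le> 4 ^ k * C" using C(2)[of y] by (simp add: mult.assoc)
      finally show ?thesis .
    qed
    have "norm (f' t - f' x) \<le> B * \<delta>" if "t \<in> {x..x + \<delta>}" for t
    proof -
      have "norm (f' t - f' x) \<le> B * \<bar>t - x\<bar>"
        by (rule norm_diff_le_vector_derivative_bound[OF d(2) B])
      also have "\<dots> \<le> B * \<delta>" using that B0 by (intro mult_left_mono) auto
      finally show ?thesis .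
    qed
    hence "norm (f (x + \<delta>) - f x - ((x + \<delta>) - x) *\<^sub>R f' x) \<le> norm ((x + \<delta>) - x) * (B * \<delta>)"
      using \<delta> d(1) by (intro vector_differentiable_bound_linearization[where S = "{x..x+\<delta>}"])
        (auto simp: closed_segment_eq_real_ivl intro: has_vector_derivative_at_within)
    hence "\<delta> * norm (f' x) \<le> \<delta> * (B * \<delta>) + (norm (f (x + \<delta>)) + norm (f x))"
      using norm_triangle_ineq4[of "f (x+\<delta>) - f x" "f (x + \<delta>) - f x - \<delta> *\<^sub>R f' x"]
            norm_triangle_ineq4[of "f (x+\<delta>)" "f x"] \<delta> by simp
    hence "p ^ 2 * (\<delta> * norm (f' x)) \<le> p ^ 2 * (\<delta> * (B * \<delta>) + (norm (f (x + \<delta>)) + norm (f x)))"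
      by (intro mult_left_mono) auto
    also have "\<dots> = B + (p ^ 2 * norm (f (x + \<delta>)) + p ^ 2 * norm (f x))"
      using p by (simp add: \<delta>_def field_simps power2_eq_square)
    also have "\<dots> \<le> 2 * 4 ^ k * C + B" using A[of x] A[of "x + \<delta>"] by simp
    also have "p ^ 2 * (\<delta> * norm (f' x)) = p * norm (f' x)"
      using p by (simp add: \<delta>_def field_simps power2_eq_square)
    finally show ?thesis by (simp add: p_def)
  qed
  thus "\<exists>C. \<forall>x. (1 + \<bar>x\<bar>) ^ k * norm (f' x) \<le> C" by blast
qed

section \<open>Sequences of derivatives and closure properties of \<open>schwartz\<close>\<close>

lemma iter_deriv_Suc: "iter_deriv (Suc n) f x = vector_derivative (iter_deriv n f) (at x)"
  by (simp add: iter_deriv_def)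

lemma iter_deriv_eqI:
  assumes "D 0 = f" "\<And>n x. (D n has_vector_derivative D (Suc n) x) (at x)"
  shows "iter_deriv n f = D n"
proof (induction n)
  case 0 thus ?case using assms(1) by (simp add: iter_deriv_def)
next
  case (Suc n)
  show ?case using assms(2)[of n] Suc by (auto simp: iter_deriv_Suc intro!: ext vector_derivative_at)
qed

text \<open>A sequence \<open>D\<close> of successive derivatives is easier to handle than
  \<open>iter_deriv\<close>: closure properties reduce to finding the formula for the n-th
  derivative and checking one differentiation step.\<close>

lemma schwartzE:
  assumes "f \<in> schwartz"
  obtains D where "D 0 = f" "\<And>n x. (D n has_vector_derivative D (Suc n) x) (at x)" "\<And>n. rapid (D n)"
proof (rule that[of "\<lambda>n. iter_deriv n f"])
  show "iter_deriv 0 f = f" by (simp add: iter_deriv_def)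
  show "(iter_deriv n f has_vector_derivative iter_deriv (Suc n) f x) (at x)" for n x
    using assms by (simp add: iter_deriv_Suc schwartz_def vector_derivative_works[symmetric])
  show "rapid (iter_deriv n f)" for n
  proof (rule rapidI)
    fix k
    have "bounded (range (\<lambda>x. x ^ k *\<^sub>R iter_deriv n f x))" using assms by (simp add: schwartz_def)
    then obtain C where "\<And>x. norm (x ^ k *\<^sub>R iter_deriv n f x) \<le> C" by (auto simp: bounded_iff)
    thus "\<exists>C. \<forall>x. \<bar>x\<bar> ^ k * norm (iter_deriv n f x) \<le> C" by (auto simp: power_abs)
  qed
qed

lemma schwartzI_seq:
  assumes "D 0 = f" "\<And>n x. (D n has_vector_derivative D (Suc n) x) (at x)" "\<And>n. rapid (D n)"
  shows "f \<in> schwartz"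
proof -
  have "bounded (range (\<lambda>x. x ^ k *\<^sub>R D n x))" for k n
  proof -
    obtain C where C: "\<And>x. (1 + \<bar>x\<bar>) ^ k * norm (D n x) \<le> C" using rapidD[OF assms(3)] by blast
    have "norm (x ^ k *\<^sub>R D n x) \<le> C" for x
    proof -
      have "norm (x ^ k *\<^sub>R D n x) \<le> (1 + \<bar>x\<bar>) ^ k * norm (D n x)"
        by (auto simp: power_abs intro!: mult_right_mono power_mono)
      with C[of x] show ?thesis by simp
    qed
    thus ?thesis by (auto simp: bounded_iff)
  qed
  moreover have "iter_deriv n f = D n" for n by (rule iter_deriv_eqI[of D, OF assms(1,2)])
  ultimately show ?thesis
    unfolding schwartz_def using differentiableI_vector[OF assms(2)] by auto
qed

text \<open>By \<open>rapid_derivative\<close>, decay of \<open>D n\<close> and boundedness of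
  \<open>D (n + 2)\<close> give decay of \<open>D (n + 1)\<close>, so decay passes up the sequence
  from \<open>f\<close> alone.\<close>

lemma schwartzI:
  assumes "D 0 = f" "\<And>n x. (D n has_vector_derivative D (Suc n) x) (at x)"
    and "\<And>n. \<exists>C. \<forall>x. norm (D n x) \<le> C" "rapid f"
  shows "f \<in> schwartz"
proof (rule schwartzI_seq[of D, OF assms(1,2)])
  show "rapid (D n)" for n
  proof (induction n)
    case 0 thus ?case using assms by simp
  next
    case (Suc n)
    obtain C where "\<And>x. norm (D (Suc (Suc n)) x) \<le> C" using assms(3) by blast
    thus ?case using rapid_derivative[OF assms(2) assms(2) _ Suc] by blast
  qed
qed

lemma schwartz_rapid: "f \<in> schwartz \<Longrightarrow> rapid f"
  by (erule schwartzE) auto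

lemma schwartz_continuous: "f \<in> schwartz \<Longrightarrow> continuous_on A f"
  by (erule schwartzE) (blast intro: has_vector_derivative_continuous continuous_at_imp_continuous_on)

lemma schwartz_derivative:
  assumes "f \<in> schwartz" 
  obtains f' where "f' \<in> schwartz" "\<And>x. (f has_vector_derivative f' x) (at x)"
proof -
  obtain D where D: "D 0 = f" "\<And>n x. (D n has_vector_derivative D (Suc n) x) (at x)" "\<And>n. rapid (D n)"
    using schwartzE[OF assms] by blast
  have "D 1 \<in> schwartz" by (rule schwartzI_seq[of "\<lambda>n. D (Suc n)"]) (use D in auto)
  thus ?thesis using that[of "D 1"] D(2)[of 0] D(1) by auto
qed

lemma schwartz_add: 
  assumes "f \<in> schwartz" "g \<in> schwartz" shows "(\<lambda>x. f x + g x) \<in> schwartz"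
proof -
  obtain D where D: "D 0 = f" "\<And>n x. (D n has_vector_derivative D (Suc n) x) (at x)" "\<And>n. rapid (D n)"
    using schwartzE[OF assms(1)] by blast
  obtain E where E: "E 0 = g" "\<And>n x. (E n has_vector_derivative E (Suc n) x) (at x)" "\<And>n. rapid (E n)"
    using schwartzE[OF assms(2)] by blast
  show ?thesis
    by (rule schwartzI_seq[of "\<lambda>n x. D n x + E n x"])
      (use D E in \<open>auto intro!: has_vector_derivative_add rapid_add\<close>)
qed

lemma schwartz_cmult: 
  assumes "f \<in> schwartz" shows "(\<lambda>x. c * f x) \<in> schwartz"
proof -
  obtain D where D: "D 0 = f" "\<And>n x. (D n has_vector_derivative D (Suc n) x) (at x)" "\<And>n. rapid (D n)"
    using schwartzE[OF assms(1)] by blast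
  show ?thesis
    by (rule schwartzI_seq[of "\<lambda>n x. c * D n x"])
      (use D in \<open>auto intro!: has_vector_derivative_mult_right rapid_cmult\<close>)
qed

lemma schwartz_mult_ident: 
  assumes "f \<in> schwartz" shows "(\<lambda>x. of_real x * f x) \<in> schwartz"
proof -
  obtain D where D: "D 0 = f" "\<And>n x. (D n has_vector_derivative D (Suc n) x) (at x)" "\<And>n. rapid (D n)"
    using schwartzE[OF assms(1)] by blast
  have r: "rapid (\<lambda>x. of_real x * D n x)" for n
    by (rule rapid_mult_poly[OF D(3)[of n], where m = 1 and B = 1]) (auto simp: norm_mult intro!: mult_right_mono)
  show ?thesis
  \<comment> \<open>This is Leibniz's formula. For \<open>n = 0\<close> the index
    \<open>n - 1\<close> is 0, which is harmless because the term carries the factor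
    \<open>of_nat 0\<close>.\<close>
  proof (rule schwartzI_seq[of "\<lambda>n x. of_real x * D n x + of_nat n * D (n - 1) x"])
    fix n x
    have "((\<lambda>x. of_real x * D n x + of_nat n * D (n - 1) x) has_vector_derivative
            (of_real x * D (Suc n) x + 1 * D n x) + of_nat n * D (Suc (n - 1)) x) (at x)"
      using D(2)[of n x] D(2)[of "n-1" x]
      by (intro has_vector_derivative_add has_vector_derivative_mult has_vector_derivative_mult_right)
        (auto intro!: has_vector_derivative_of_real[of "\<lambda>x. x" 1, simplified])
    also have "(of_real x * D (Suc n) x + 1 * D n x) + of_nat n * D (Suc (n - 1)) x =
               of_real x * D (Suc n) x + of_nat (Suc n) * D (Suc n - 1) x"
      by (cases n) (auto simp: algebra_simps)
    finally show "((\<lambda>x. of_real x * D n x + of_nat n * D (n - 1) x) has_vector_derivative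
                    of_real x * D (Suc n) x + of_nat (Suc n) * D (Suc n - 1) x) (at x)" .
  qed (use D r in \<open>auto intro!: rapid_add rapid_cmult\<close>)
qed

lemma integrable_inverse_square: "integrable lborel (\<lambda>x::real. 1 / (1 + \<bar>x\<bar>)\<^sup>2)"
proof (rule Bochner_Integration.integrable_bound)
  show "integrable lborel (\<lambda>x::real. inverse (1 + x\<^sup>2))"
    using integrable_inverse_1_plus_square by (simp add: set_integrable_def einterval_def)
  show "AE x in lborel. norm (1 / (1 + \<bar>x\<bar>)\<^sup>2) \<le> norm (inverse (1 + x\<^sup>2 :: real))"
  proof (intro AE_I2)
    fix x :: real
    have "1 + x\<^sup>2 \<le> (1 + \<bar>x\<bar>)\<^sup>2" by (simp add: power2_eq_square algebra_simps abs_mult[symmetric])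
    moreover have "0 < 1 + x\<^sup>2" by (intro add_pos_nonneg) auto
    ultimately show "norm (1 / (1 + \<bar>x\<bar>)\<^sup>2) \<le> norm (inverse (1 + x\<^sup>2 :: real))"
      by (simp add: divide_inverse le_imp_inverse_le)
  qed
qed auto

lemma rapid_integrable:
  assumes "rapid f" "f \<in> borel_measurable borel"
  shows "integrable lborel f"
proof -
  obtain C where C: "\<And>x. (1 + \<bar>x\<bar>) ^ 2 * norm (f x) \<le> C" using rapidD[OF assms(1)] by blast
  show ?thesis
  proof (rule Bochner_Integration.integrable_bound)
    show "integrable lborel (\<lambda>x. C * (1 / (1 + \<bar>x\<bar>)\<^sup>2))"
      using integrable_inverse_square by (rule integrable_mult_right)
    show "AE x in lborel. norm (f x) \<le> norm (C * (1 / (1 + \<bar>x\<bar>)\<^sup>2))"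
      using C by (intro AE_I2) (auto simp: field_simps intro: order.trans[OF _ abs_ge_self])
  qed (use assms in auto)
qed

lemma schwartz_integrable: "f \<in> schwartz \<Longrightarrow> integrable lborel f"
  by (intro rapid_integrable schwartz_rapid borel_measurable_continuous_onI schwartz_continuous)

section \<open>The Fourier transform\<close>

lemma fourier_cis: "fourier f y = (LINT x|lborel. f x * cis (2 * pi * x * y))"
  unfolding fourier_def cis_conv_exp by (simp add: mult_ac)

lemma has_vector_derivative_cis:
  "((\<lambda>t. cis (c * t)) has_vector_derivative \<i> * of_real c * cis (c * t)) (at t)"
  by (auto simp: has_vector_derivative_complex_iff intro!: derivative_eq_intros)

lemma borel_measurable_cis [measurable (raw)]:
  "f \<in> borel_measurable M \<Longrightarrow> (\<lambda>x. cis (f x)) \<in> borel_measurable M"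
  unfolding cis_conv_exp by measurable

text \<open>The factor \<open>c\<close> covers both normalisations of the kernel:
  \<open>2 * pi\<close> for the Fourier transform and \<open>-1\<close> for integrals over vertical
  lines. Differentiation in \<open>t\<close> brings down \<open>\<i> * c * x\<close>, so smoothness
  is paid for with moments of \<open>H\<close>.\<close>

lemma trig_integral_smooth:
  fixes H :: "real \<Rightarrow> complex" and c :: real
  assumes [measurable]: "H \<in> borel_measurable borel"
    and mom: "\<And>k. integrable lborel (\<lambda>x. \<bar>x\<bar> ^ k * norm (H x))"
  defines "D \<equiv> \<lambda>n t. LINT x|lborel. (\<i> * of_real (c * x)) ^ n * H x * cis (c * x * t)"
  shows "(D n has_vector_derivative D (Suc n) t) (at t)" "\<exists>C. \<forall>t. norm (D n t) \<le> C"
proof -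
  have norm_eq: "norm ((\<i> * of_real (c * x)) ^ n * H x * cis (c * x * t)) = \<bar>c\<bar> ^ n * (\<bar>x\<bar> ^ n * norm (H x))" for n t x
    by (simp add: norm_mult norm_power power_mult_distrib abs_mult)
  have int: "integrable lborel (\<lambda>x. \<bar>c\<bar> ^ n * (\<bar>x\<bar> ^ n * norm (H x)))" for n
    by (intro integrable_mult_right mom)
  have int': "integrable lborel (\<lambda>x. (\<i> * of_real (c * x)) ^ n * H x * cis (c * x * t))" for n t
    by (rule Bochner_Integration.integrable_bound[OF int[of n]]) (auto simp only: norm_eq, auto)
  show "(D n has_vector_derivative D (Suc n) t) (at t)"
    unfolding D_def
  proof (rule has_vector_derivative_integral[OF int' _ _ _ int[of "Suc n"]])
    fix t x
    have "((\<lambda>t. (\<i> * of_real (c * x)) ^ n * H x * cis (c * x * t)) has_vector_derivative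
            (\<i> * of_real (c * x)) ^ n * H x * (\<i> * of_real (c * x) * cis (c * x * t))) (at t)"
      by (intro has_vector_derivative_mult_right has_vector_derivative_cis)
    thus "((\<lambda>t. (\<i> * of_real (c * x)) ^ n * H x * cis (c * x * t)) has_vector_derivative
            (\<i> * of_real (c * x)) ^ Suc n * H x * cis (c * x * t)) (at t)"
      by (simp add: mult_ac)
  qed (auto simp only: norm_eq, auto)
  have "norm (D n t) \<le> (LINT x|lborel. \<bar>c\<bar> ^ n * (\<bar>x\<bar> ^ n * norm (H x)))" for t
    unfolding D_def by (rule Bochner_Integration.integral_norm_bound_integral[OF int' int]) (rule eq_refl, rule norm_eq)
  thus "\<exists>C. \<forall>t. norm (D n t) \<le> C" by blast
qed

text \<open>Moments give smoothness with bounded derivatives, and \<open>schwartzI\<close> does the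
  rest. In this way a function known to be a Fourier transform is recognised as Schwartz once its
  decay is known from elsewhere.\<close>

lemma trig_integral_schwartz:
  fixes H :: "real \<Rightarrow> complex" and c :: real
  assumes H: "H \<in> borel_measurable borel" "\<And>k. integrable lborel (\<lambda>x. \<bar>x\<bar> ^ k * norm (H x))"
    and r: "rapid (\<lambda>t. LINT x|lborel. H x * cis (c * x * t))"
  shows "(\<lambda>t. LINT x|lborel. H x * cis (c * x * t)) \<in> schwartz"
  by (rule schwartzI[where D = "\<lambda>n t. LINT x|lborel. (\<i> * of_real (c * x)) ^ n * H x * cis (c * x * t)"])
    (use trig_integral_smooth[OF H, of c] r in auto)

lemma rapid_moments:
  assumes "rapid f" "f \<in> borel_measurable borel"
  shows "integrable lborel (\<lambda>x. \<bar>x\<bar> ^ k * norm (f x))"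
proof -
  have "rapid (\<lambda>x. of_real (\<bar>x\<bar> ^ k) * f x)"
    by (rule rapid_mult_poly[OF assms(1), where m = k and B = 1])
      (auto simp: norm_mult norm_power power_mono intro!: mult_right_mono)
  hence "integrable lborel (\<lambda>x. norm (of_real (\<bar>x\<bar> ^ k) * f x))"
    using assms(2) by (intro integrable_norm rapid_integrable) auto
  thus ?thesis by (simp add: norm_mult norm_power)
qed

text \<open>Integration by parts is applied in this form: a product is differentiated as a whole and
  its boundary values vanish.\<close>

lemma integral_vector_derivative_eq_0:
  fixes g g' :: "real \<Rightarrow> complex"
  assumes "\<And>x. (g has_vector_derivative g' x) (at x)" "continuous_on UNIV g'" "integrable lborel g'"
    and "(g \<longlongrightarrow> 0) at_top" "(g \<longlongrightarrow> 0) at_bot"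
  shows "(LINT x|lborel. g' x) = 0"
proof -
  have "(LBINT x=-\<infinity>..\<infinity>. g' x) = 0 - 0"
  proof (rule interval_integral_FTC_integrable)
    show "set_integrable lborel (einterval (- \<infinity>) \<infinity>) g'"
      using assms(3) by (simp add: set_integrable_def einterval_def)
    show "((g \<circ> real_of_ereal) \<longlongrightarrow> 0) (at_right (- \<infinity>))" "((g \<circ> real_of_ereal) \<longlongrightarrow> 0) (at_left \<infinity>)"
      using assms(4,5) by (simp_all add: ereal_tendsto_simps)
    show "isCont g' x" for x using assms(2) by (simp add: continuous_on_eq_continuous_at)
  qed (use assms(1) in auto)
  thus ?thesis by (simp add: interval_lebesgue_integral_def set_lebesgue_integral_def einterval_def)
qed

lemma rapid_tendsto_0:
  assumes "rapid f" shows "(f \<longlongrightarrow> 0) at_top" "(f \<longlongrightarrow> 0) at_bot"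
proof -
  obtain C where C: "\<And>x. (1 + \<bar>x\<bar>) ^ 1 * norm (f x) \<le> C" using rapidD[OF assms] by blast
  have le: "norm (f x) \<le> C / (1 + \<bar>x\<bar>)" for x
    using C[of x] by (simp add: field_simps)
  have "((\<lambda>x::real. C / (1 + \<bar>x\<bar>)) \<longlongrightarrow> 0) at_top" "((\<lambda>x::real. C / (1 + \<bar>x\<bar>)) \<longlongrightarrow> 0) at_bot"
    by real_asymp+
  note lim = this
  show "(f \<longlongrightarrow> 0) at_top"
    by (rule Lim_null_comparison[OF always_eventually[OF allI[OF le]] lim(1)])
  show "(f \<longlongrightarrow> 0) at_bot"
    by (rule Lim_null_comparison[OF always_eventually[OF allI[OF le]] lim(2)])
qed

lemma fourier_derivative:
  assumes f: "f \<in> schwartz" and f': "f' \<in> schwartz" and d: "\<And>x. (f has_vector_derivative f' x) (at x)"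
  shows "fourier f' y = - (\<i> * of_real (2 * pi * y)) * fourier f y"
proof -
  note [measurable] = borel_measurable_continuous_onI[OF schwartz_continuous[OF f]]
    borel_measurable_continuous_onI[OF schwartz_continuous[OF f']]
  let ?c = "\<i> * of_real (2 * pi * y)"
  have r: "rapid (\<lambda>x. h x * cis (2 * pi * x * y))" if "rapid h" for h
    by (rule rapid_mult_poly[OF that, where m = 0 and B = 1]) (auto simp: norm_mult)
  have i1: "integrable lborel (\<lambda>x. f x * cis (2 * pi * x * y))"
    and i2: "integrable lborel (\<lambda>x. f' x * cis (2 * pi * x * y))"
    by (rule rapid_integrable[OF r[OF schwartz_rapid[OF f]]], measurable)
      (rule rapid_integrable[OF r[OF schwartz_rapid[OF f']]], measurable)
  have "(LINT x|lborel. f' x * cis (2 * pi * x * y) + ?c * (f x * cis (2 * pi * x * y))) = 0"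
  proof (rule integral_vector_derivative_eq_0[where g = "\<lambda>x. f x * cis (2 * pi * x * y)"])
    fix x
    have "((\<lambda>x. f x * cis (2 * pi * y * x)) has_vector_derivative
           (f x * (\<i> * of_real (2 * pi * y) * cis (2 * pi * y * x)) + f' x * cis (2 * pi * y * x))) (at x)"
      by (intro has_vector_derivative_mult d has_vector_derivative_cis)
    thus "((\<lambda>x. f x * cis (2 * pi * x * y)) has_vector_derivative
             f' x * cis (2 * pi * x * y) + ?c * (f x * cis (2 * pi * x * y))) (at x)"
      by (simp add: algebra_simps)
    show "continuous_on UNIV (\<lambda>x. f' x * cis (2 * pi * x * y) + ?c * (f x * cis (2 * pi * x * y)))"
      using schwartz_continuous[OF f] schwartz_continuous[OF f'] by (auto intro!: continuous_intros)
  qed (use i1 i2 rapid_tendsto_0[OF r[OF schwartz_rapid[OF f]]] in auto)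
  hence "fourier f' y + ?c * fourier f y = 0"
    using i1 i2 unfolding fourier_cis by simp
  thus ?thesis by (simp add: add_eq_0_iff)
qed

lemma fourier_norm_le:
  assumes "integrable lborel f"
  shows "norm (fourier f y) \<le> (LINT x|lborel. norm (f x))"
proof -
  note [measurable] = borel_measurable_integrable[OF assms, simplified]
  show ?thesis
    unfolding fourier_cis
    by (intro Bochner_Integration.integral_norm_bound_integral Bochner_Integration.integrable_bound[OF assms] integrable_norm)
      (use assms in \<open>auto simp: norm_mult\<close>)
qed

lemma fourier_schwartz:
  assumes f: "f \<in> schwartz"
  shows "fourier f \<in> schwartz"
proof -
  note [measurable] = borel_measurable_continuous_onI[OF schwartz_continuous[OF f]]
  note mom = rapid_moments[OF schwartz_rapid[OF f] borel_measurable_continuous_onI[OF schwartz_continuous[OF f]]]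
  have r: "rapid (fourier f)"
  proof (rule rapidI)
    fix k :: nat
    obtain D where D: "D 0 = f" "\<And>n x. (D n has_vector_derivative D (Suc n) x) (at x)" "\<And>n. rapid (D n)"
      using schwartzE[OF f] by blast
    have S: "D n \<in> schwartz" for n
      by (rule schwartzI_seq[of "\<lambda>m. D (n + m)"]) (use D in auto)
    have "fourier (D n) y = (- (\<i> * of_real (2 * pi * y))) ^ n * fourier f y" for n y
    proof (induction n)
      case (Suc n)
      show ?case by (subst fourier_derivative[OF S S D(2)]) (simp add: Suc)
    qed (simp add: D(1))
    hence "norm (fourier (D k) y) = (2 * pi * \<bar>y\<bar>) ^ k * norm (fourier f y)" for y
      by (simp add: norm_mult norm_power abs_mult)
    moreover have "norm (fourier (D k) y) \<le> (LINT x|lborel. norm (D k x))" for y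
      by (intro fourier_norm_le schwartz_integrable S)
    ultimately have *: "(2 * pi * \<bar>y\<bar>) ^ k * norm (fourier f y) \<le> (LINT x|lborel. norm (D k x))" for y
      by metis
    have "\<bar>y\<bar> ^ k * norm (fourier f y) \<le> (2 * pi * \<bar>y\<bar>) ^ k * norm (fourier f y)" for y
      using pi_gt3 by (intro mult_right_mono power_mono) (auto simp: mult_le_cancel_right1)
    with * show "\<exists>C. \<forall>x. \<bar>x\<bar> ^ k * norm (fourier f x) \<le> C" by (blast intro: order.trans)
  qed
  have *: "fourier f = (\<lambda>t. LINT x|lborel. f x * cis (2 * pi * x * t))"
    by (simp add: fun_eq_iff fourier_cis)
  show ?thesis using r unfolding * by (intro trig_integral_schwartz mom) auto
qed

subsection \<open>Gaussians and Fourier inversion\<close>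

text \<open>Normalised so that \<open>gauss 1\<close> is its own Fourier transform; the parameter is
  a dilation, as needed for theta series and for Tate's argument.\<close>

definition gauss :: "real \<Rightarrow> real \<Rightarrow> complex" where
  "gauss a x = of_real (exp (- (pi * (a * x)\<^sup>2)))"

lemma gauss_measurable [measurable]: "gauss a \<in> borel_measurable borel"
  unfolding gauss_def by measurable

lemma gauss_even: "gauss a (- x) = gauss a x"
  by (simp add: gauss_def)

lemma norm_gauss: "norm (gauss a x) = exp (- (pi * (a * x)\<^sup>2))"
  unfolding gauss_def by (subst norm_of_real) simp

lemma norm_gauss_le_1: "norm (gauss a x) \<le> 1"
  by (simp add: norm_gauss)

lemma gauss_fourier_aux:
  assumes a: "a > 0"
  shows "integrable lborel (gauss a)" and "fourier (gauss a) y = gauss (1 / a) y / of_real a"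
proof -
  \<comment> \<open>The transform is read off from the characteristic function of the standard
    normal distribution: \<open>s\<close> turns \<open>exp (- (s * x)\<^sup>2 / 2)\<close> into the
    Gaussian, and \<open>t\<close> is chosen so that
    \<open>t * (s * x) = 2 * pi * x * y\<close>.\<close>
  define s where "s = a * sqrt (2 * pi)"
  have s: "s > 0" using a by (simp add: s_def)
  define t where "t = 2 * pi * y / s"
  have dens: "std_normal_density (s * x) = exp (- (pi * (a * x)\<^sup>2)) / sqrt (2 * pi)" for x
    by (simp add: std_normal_density_def s_def power_mult_distrib)
  have "integrable lborel (\<lambda>x. std_normal_density (0 + s * x))"
    by (rule lborel_integrable_real_affine) (use s in \<open>auto intro!: integrable_normal_density\<close>)
  hence "integrable lborel (\<lambda>x. std_normal_density (s * x) * sqrt (2 * pi))" by simp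
  hence "integrable lborel (\<lambda>x. exp (- (pi * (a * x)\<^sup>2)))" by (simp add: dens)
  thus "integrable lborel (gauss a)" unfolding gauss_def by (rule integrable_of_real)
  have "of_real (exp (- (t\<^sup>2) / 2)) = char std_normal_distribution t"
    by (simp add: char_std_normal_distribution)
  also have "\<dots> = (LINT x|lborel. std_normal_density x *\<^sub>R cis (t * x))"
    unfolding char_def by (subst integral_density) (auto simp: cis_conv_exp)
  also have "\<dots> = \<bar>s\<bar> *\<^sub>R (LINT x|lborel. std_normal_density (0 + s * x) *\<^sub>R cis (t * (0 + s * x)))"
    by (rule lborel_integral_real_affine) (use s in auto)
  also have "\<dots> = (LINT x|lborel. of_real a * (gauss a x * cis (2 * pi * x * y)))"
  proof -
    have "s *\<^sub>R (std_normal_density (s * x) *\<^sub>R cis (t * (s * x))) = of_real a * (gauss a x * cis (2 * pi * x * y))" for x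
    proof -
      have "s * std_normal_density (s * x) = a * exp (- (pi * (a * x)\<^sup>2))"
        unfolding dens by (simp add: s_def)
      moreover have "t * (s * x) = 2 * pi * x * y" using s by (simp add: t_def)
      ultimately have "s *\<^sub>R (std_normal_density (s * x) *\<^sub>R cis (t * (s * x))) =
          (a * exp (- (pi * (a * x)\<^sup>2))) *\<^sub>R cis (2 * pi * x * y)"
        by (simp only: scaleR_scaleR)
      thus ?thesis by (simp add: gauss_def scaleR_conv_of_real)
    qed
    thus ?thesis using s by (simp flip: integral_scaleR_right)
  qed
  also have "\<dots> = of_real a * fourier (gauss a) y" by (simp add: fourier_cis)
  also have "- (t\<^sup>2) / 2 = - (pi * (1 / a * y)\<^sup>2)"
    using a by (simp add: t_def s_def power_mult_distrib power_divide field_simps power2_eq_square)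
  finally have "gauss (1 / a) y = of_real a * fourier (gauss a) y" by (subst gauss_def)
  thus "fourier (gauss a) y = gauss (1 / a) y / of_real a" using a by simp
qed

lemmas gauss_integrable = gauss_fourier_aux(1)
lemmas fourier_gauss = gauss_fourier_aux(2)

lemma integral_gauss: "a > 0 \<Longrightarrow> (LINT x|lborel. gauss a x) = 1 / of_real a"
  using fourier_gauss[of a 0] by (simp add: fourier_cis gauss_def)

text \<open>The kernels in question are values of \<open>cis\<close>, of modulus 1, so the product
  of the two integrable factors dominates the integrand on the plane.\<close>

lemma Fubini_mult_bounded:
  fixes f g :: "real \<Rightarrow> complex" and K :: "real \<Rightarrow> real \<Rightarrow> complex"
  assumes f: "integrable lborel f" and g: "integrable lborel g"
    and K [measurable]: "(\<lambda>(x,y). K x y) \<in> borel_measurable (borel \<Otimes>\<^sub>M borel)" "\<And>x y. norm (K x y) \<le> 1"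
  shows "(LINT y|lborel. LINT x|lborel. f x * g y * K x y) = (LINT x|lborel. LINT y|lborel. f x * g y * K x y)"
proof -
  note [measurable] = borel_measurable_integrable[OF f, simplified] borel_measurable_integrable[OF g, simplified]
  have K' [measurable]: "(\<lambda>p. K (fst p) (snd p)) \<in> borel_measurable (borel \<Otimes>\<^sub>M borel)"
    using K(1) by (simp add: case_prod_beta)
  have m: "(\<lambda>(x,y). f x * g y * K x y) \<in> borel_measurable (lborel \<Otimes>\<^sub>M lborel)"
    unfolding case_prod_beta by measurable
  have "integrable (lborel \<Otimes>\<^sub>M lborel) (\<lambda>(x,y). f x * g y * K x y)"
  proof (rule lborel_pair.Fubini_integrable[OF m])
    have i: "integrable lborel (\<lambda>y. f x * g y * K x y)" for x
    proof (rule Bochner_Integration.integrable_bound)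
      show "integrable lborel (\<lambda>y. f x * g y)" using g by simp
      show "AE y in lborel. norm (f x * g y * K x y) \<le> norm (f x * g y)"
        using K(2) by (intro AE_I2) (auto simp: norm_mult intro!: mult_left_le)
    qed measurable
    thus "AE x in lborel. integrable lborel (\<lambda>y. case (x, y) of (x, y) \<Rightarrow> f x * g y * K x y)" by simp
    have le: "(LINT y|lborel. norm (f x * g y * K x y)) \<le> norm (f x) * (LINT y|lborel. norm (g y))" for x
    proof -
      have "(LINT y|lborel. norm (f x * g y * K x y)) \<le> (LINT y|lborel. norm (f x) * norm (g y))"
        using i[of x] g K(2) by (intro integral_mono integrable_norm integrable_mult_right)
          (auto simp: norm_mult intro!: mult_left_le)
      thus ?thesis by simp
    qed
    show "integrable lborel (\<lambda>x. LINT y|lborel. norm (case (x, y) of (x, y) \<Rightarrow> f x * g y * K x y))"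
    proof (rule Bochner_Integration.integrable_bound)
      show "integrable lborel (\<lambda>x. norm (f x) * (LINT y|lborel. norm (g y)))"
        using f by (intro integrable_mult_left integrable_norm)
      show "AE x in lborel. norm (LINT y|lborel. norm (case (x, y) of (x, y) \<Rightarrow> f x * g y * K x y))
          \<le> norm (norm (f x) * (LINT y|lborel. norm (g y)))"
        using le by (intro AE_I2) (auto intro: order.trans[OF _ abs_ge_self])
    qed measurable
  qed
  from lborel_pair.Fubini_integral[OF this] show ?thesis .
qed

text \<open>Continuity at the single point \<open>x\<close> makes the function bounded near
  \<open>x\<close>, where the substitution \<open>t = x + s / n\<close> and dominated convergence
  apply. Away from \<open>x\<close> the kernel tends to 0 uniformly, which suffices against an
  integrable function. The lemma is later applied to functions with a possible singularity at
  0.\<close>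

lemma gauss_approximate_identity:
  fixes \<psi> :: "real \<Rightarrow> complex"
  assumes int: "integrable lborel \<psi>" and cont: "isCont \<psi> x"
  shows "(\<lambda>n. LINT t|lborel. \<psi> t * (of_nat (Suc n) * gauss (real (Suc n)) (t - x))) \<longlonglongrightarrow> \<psi> x"
proof -
  note [measurable] = borel_measurable_integrable[OF int, simplified]
  let ?K = "\<lambda>n t. of_nat (Suc n) * gauss (real (Suc n)) (t - x)"
  obtain \<delta> where \<delta>: "\<delta> > 0" "\<And>t. dist t x < \<delta> \<Longrightarrow> dist (\<psi> t) (\<psi> x) < 1"
    using cont unfolding continuous_at_eps_delta by (metis zero_less_one)
  define A where "A = {t. dist t x < \<delta>}"
  have A [measurable]: "A \<in> sets borel" by (simp add: A_def)
  define \<psi>1 where "\<psi>1 t = indicator A t *\<^sub>R \<psi> t" for t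
  define \<psi>2 where "\<psi>2 t = indicator (- A) t *\<^sub>R \<psi> t" for t
  have m [measurable]: "\<psi>1 \<in> borel_measurable borel" "\<psi>2 \<in> borel_measurable borel"
    unfolding \<psi>1_def \<psi>2_def by measurable
  have i1: "integrable lborel \<psi>1" and i2: "integrable lborel \<psi>2"
    unfolding \<psi>1_def \<psi>2_def by (auto intro!: integrable_mult_indicator int)
  have Kle: "norm (?K n t) \<le> real (Suc n)" for n t
    using norm_gauss_le_1[of "real (Suc n)" "t - x"] by (auto simp: norm_mult mult_left_le simp del: of_nat_Suc)
  have iK: "integrable lborel (\<lambda>t. h t * ?K n t)" if "integrable lborel h" for h :: "real \<Rightarrow> complex" and n
  proof (rule Bochner_Integration.integrable_bound)
    show "integrable lborel (\<lambda>t. h t * of_nat (Suc n))" using that by simp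
    show "AE t in lborel. norm (h t * ?K n t) \<le> norm (h t * of_nat (Suc n))"
      using Kle[of n] by (auto simp: norm_mult mult_left_mono simp del: of_nat_Suc)
  qed (use borel_measurable_integrable[OF that] in measurable)
  have split: "\<psi> t = \<psi>1 t + \<psi>2 t" for t by (auto simp: \<psi>1_def \<psi>2_def indicator_def)
  have lim1: "(\<lambda>n. LINT t|lborel. \<psi>1 t * ?K n t) \<longlonglongrightarrow> \<psi> x"
  proof -
    have eq: "(LINT t|lborel. \<psi>1 t * ?K n t) = (LINT s|lborel. \<psi>1 (x + s / real (Suc n)) * gauss 1 s)" for n
    proof -
      have "(LINT t|lborel. \<psi>1 t * ?K n t) =
          \<bar>1 / real (Suc n)\<bar> *\<^sub>R (LINT s|lborel. \<psi>1 (x + 1 / real (Suc n) * s) * ?K n (x + 1 / real (Suc n) * s))"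
        by (rule lborel_integral_real_affine) simp
      also have "\<dots> = (LINT s|lborel. (1 / real (Suc n)) *\<^sub>R (\<psi>1 (x + 1 / real (Suc n) * s) * ?K n (x + 1 / real (Suc n) * s)))"
        by (subst integral_scaleR_right) simp
      also have "\<dots> = (LINT s|lborel. \<psi>1 (x + s / real (Suc n)) * gauss 1 s)"
        by (intro Bochner_Integration.integral_cong refl)
          (simp add: gauss_def scaleR_conv_of_real field_simps del: of_nat_Suc)
      finally show ?thesis .
    qed
    have "(\<lambda>n. LINT s|lborel. \<psi>1 (x + s / real (Suc n)) * gauss 1 s) \<longlonglongrightarrow> (LINT s|lborel. \<psi> x * gauss 1 s)"
    proof (rule integral_dominated_convergence[where w = "\<lambda>s. (norm (\<psi> x) + 1) * norm (gauss 1 s)"])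
      show "integrable lborel (\<lambda>s. (norm (\<psi> x) + 1) * norm (gauss 1 s))"
        by (intro integrable_mult_right integrable_norm gauss_integrable) simp
      have "norm (\<psi>1 t) \<le> norm (\<psi> x) + 1" for t
      proof (cases "t \<in> A")
        case True
        hence "dist (\<psi> t) (\<psi> x) < 1" by (auto simp: A_def \<delta>)
        thus ?thesis using True norm_triangle_ineq2[of "\<psi> t" "\<psi> x"] by (simp add: \<psi>1_def dist_norm)
      qed (simp add: \<psi>1_def)
      thus "AE s in lborel. norm (\<psi>1 (x + s / real (Suc n)) * gauss 1 s) \<le> (norm (\<psi> x) + 1) * norm (gauss 1 s)" for n
        by (auto simp: norm_mult intro!: mult_right_mono)
      show "AE s in lborel. (\<lambda>n. \<psi>1 (x + s / real (Suc n)) * gauss 1 s) \<longlonglongrightarrow> \<psi> x * gauss 1 s"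
      proof (intro AE_I2 tendsto_mult tendsto_const)
        fix s :: real
        have l: "(\<lambda>n. x + s / real (Suc n)) \<longlonglongrightarrow> x + 0"
          by (intro tendsto_add tendsto_const LIMSEQ_Suc lim_const_over_n)
        have "(\<lambda>n. \<psi> (x + s / real (Suc n))) \<longlonglongrightarrow> \<psi> x"
          using isCont_tendsto_compose[OF cont, of "\<lambda>n. x + s / real (Suc n)" sequentially] l by simp
        moreover have "eventually (\<lambda>n. \<psi> (x + s / real (Suc n)) = \<psi>1 (x + s / real (Suc n))) sequentially"
          using tendstoD[OF l \<delta>(1)] by eventually_elim (auto simp: \<psi>1_def A_def)
        ultimately show "(\<lambda>n. \<psi>1 (x + s / real (Suc n))) \<longlonglongrightarrow> \<psi> x"
          by (blast intro: Lim_transform_eventually)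
      qed
    qed auto
    thus ?thesis unfolding eq by (simp add: integral_gauss del: of_nat_Suc)
  qed
  have lim2: "(\<lambda>n. LINT t|lborel. \<psi>2 t * ?K n t) \<longlonglongrightarrow> 0"
  proof (rule Lim_null_comparison[OF always_eventually])
    show "\<forall>n. norm (LINT t|lborel. \<psi>2 t * ?K n t) \<le> (LINT t|lborel. norm (\<psi>2 t)) * (1 / (pi * \<delta>\<^sup>2)) * (1 / real (Suc n))"
    proof
      fix n
      have "norm (\<psi>2 t * ?K n t) \<le> norm (\<psi>2 t) * ((1 / (pi * \<delta>\<^sup>2)) * (1 / real (Suc n)))" for t
      proof (cases "t \<in> A")
        case False
        define u where "u = pi * (real (Suc n) * (t - x))\<^sup>2"
        have "(t - x)\<^sup>2 \<ge> \<delta>\<^sup>2" using False \<delta>(1)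
          by (auto simp: A_def dist_real_def abs_le_square_iff[symmetric])
        hence u: "u \<ge> pi * (real (Suc n))\<^sup>2 * \<delta>\<^sup>2"
          by (auto simp: u_def power_mult_distrib mult_left_mono simp del: of_nat_Suc)
        moreover have u0: "pi * (real (Suc n))\<^sup>2 * \<delta>\<^sup>2 > 0" using \<delta>(1) by (simp del: of_nat_Suc)
        moreover have "u \<le> exp u" using exp_ge_add_one_self[of u] by linarith
        ultimately have "exp (- u) \<le> 1 / u"
          by (simp add: exp_minus divide_inverse le_imp_inverse_le)
        also have "\<dots> \<le> 1 / (pi * (real (Suc n))\<^sup>2 * \<delta>\<^sup>2)" using u u0 by (intro divide_left_mono) auto
        finally have "norm (?K n t) \<le> real (Suc n) * (1 / (pi * (real (Suc n))\<^sup>2 * \<delta>\<^sup>2))"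
          unfolding norm_mult norm_gauss u_def norm_of_nat by (intro mult_left_mono) auto
        also have "\<dots> = (1 / (pi * \<delta>\<^sup>2)) * (1 / real (Suc n))" using \<delta>(1) by (simp add: field_simps power2_eq_square del: of_nat_Suc)
        finally have le: "norm (?K n t) \<le> (1 / (pi * \<delta>\<^sup>2)) * (1 / real (Suc n))" .
        show ?thesis unfolding norm_mult[of "\<psi>2 t"] by (rule mult_left_mono[OF le]) simp
      qed (simp add: \<psi>2_def)
      hence "norm (LINT t|lborel. \<psi>2 t * ?K n t) \<le> (LINT t|lborel. norm (\<psi>2 t) * ((1 / (pi * \<delta>\<^sup>2)) * (1 / real (Suc n))))"
        by (intro Bochner_Integration.integral_norm_bound_integral iK i2 integrable_mult_left integrable_norm)
      thus "norm (LINT t|lborel. \<psi>2 t * ?K n t) \<le> (LINT t|lborel. norm (\<psi>2 t)) * (1 / (pi * \<delta>\<^sup>2)) * (1 / real (Suc n))"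
        by (simp add: mult.assoc)
    qed
    show "(\<lambda>n. (LINT t|lborel. norm (\<psi>2 t)) * (1 / (pi * \<delta>\<^sup>2)) * (1 / real (Suc n))) \<longlonglongrightarrow> 0"
      by (intro tendsto_mult_right_zero LIMSEQ_Suc lim_const_over_n)
  qed
  have "(LINT t|lborel. \<psi> t * ?K n t) = (LINT t|lborel. \<psi>1 t * ?K n t) + (LINT t|lborel. \<psi>2 t * ?K n t)" for n
    unfolding split distrib_right by (rule Bochner_Integration.integral_add[OF iK[OF i1] iK[OF i2]])
  thus ?thesis using tendsto_add[OF lim1 lim2] by simp
qed

text \<open>A Gaussian of growing width is inserted into the outer integral. Fubini turns the result
  into a convolution of \<open>f\<close> with the approximate identity, while dominated convergence
  removes the Gaussian. Both transforms use the kernel with positive sign, hence the argument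
  \<open>- x\<close>.\<close>

theorem fourier_inversion:
  assumes f: "integrable lborel f" and cont: "isCont f x" and Ff: "integrable lborel (fourier f)"
  shows "fourier (fourier f) (- x) = f x"
proof -
  note [measurable] = borel_measurable_integrable[OF f, simplified] borel_measurable_integrable[OF Ff, simplified]
  have eq: "(LINT y|lborel. fourier f y * gauss (1 / real (Suc n)) y * cis (2 * pi * y * (- x)))
          = (LINT t|lborel. f t * (of_nat (Suc n) * gauss (real (Suc n)) (t - x)))" for n
  proof -
    let ?a = "1 / real (Suc n)"
    have "(LINT y|lborel. fourier f y * gauss ?a y * cis (2 * pi * y * (- x)))
        = (LINT y|lborel. LINT t|lborel. f t * gauss ?a y * cis (2 * pi * y * (t - x)))"
    proof (intro Bochner_Integration.integral_cong refl)
      fix y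
      have "fourier f y * (gauss ?a y * cis (2 * pi * y * (- x))) =
            (LINT t|lborel. f t * cis (2 * pi * t * y) * (gauss ?a y * cis (2 * pi * y * (- x))))"
        unfolding fourier_cis by (rule integral_mult_left_zero[symmetric])
      also have "\<dots> = (LINT t|lborel. f t * gauss ?a y * cis (2 * pi * y * (t - x)))"
      proof (intro Bochner_Integration.integral_cong refl)
        fix t
        have "cis (2 * pi * y * (t - x)) = cis (2 * pi * t * y) * cis (2 * pi * y * (- x))"
          by (simp add: cis_mult algebra_simps)
        thus "f t * cis (2 * pi * t * y) * (gauss ?a y * cis (2 * pi * y * (- x))) =
              f t * gauss ?a y * cis (2 * pi * y * (t - x))" by (simp add: mult_ac)
      qed
      finally show "fourier f y * gauss ?a y * cis (2 * pi * y * (- x)) = 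
            (LINT t|lborel. f t * gauss ?a y * cis (2 * pi * y * (t - x)))" by (simp only: mult.assoc)
    qed
    also have "\<dots> = (LINT t|lborel. LINT y|lborel. f t * gauss ?a y * cis (2 * pi * y * (t - x)))"
      by (rule Fubini_mult_bounded[OF f gauss_integrable]) (auto simp: case_prod_beta)
    also have "\<dots> = (LINT t|lborel. f t * (of_nat (Suc n) * gauss (real (Suc n)) (t - x)))"
    proof (intro Bochner_Integration.integral_cong refl)
      fix t
      have "(LINT y|lborel. f t * gauss ?a y * cis (2 * pi * y * (t - x))) = f t * fourier (gauss ?a) (t - x)"
        unfolding fourier_cis by (simp add: mult.assoc)
      thus "(LINT y|lborel. f t * gauss ?a y * cis (2 * pi * y * (t - x))) = 
              f t * (of_nat (Suc n) * gauss (real (Suc n)) (t - x))"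
        by (subst (asm) fourier_gauss) (auto simp: field_simps)
    qed
    finally show ?thesis .
  qed
  have "(\<lambda>n. LINT y|lborel. fourier f y * gauss (1 / real (Suc n)) y * cis (2 * pi * y * (- x)))
          \<longlonglongrightarrow> (LINT y|lborel. fourier f y * 1 * cis (2 * pi * y * (- x)))"
  proof (rule integral_dominated_convergence[where w = "\<lambda>y. norm (fourier f y)"])
    show "AE y in lborel. (\<lambda>n. fourier f y * gauss (1 / real (Suc n)) y * cis (2 * pi * y * (- x)))
            \<longlonglongrightarrow> fourier f y * 1 * cis (2 * pi * y * (- x))"
    proof (intro AE_I2 tendsto_mult tendsto_const)
      fix y
      have "(\<lambda>n. exp (- (pi * (1 / real (Suc n) * y)\<^sup>2))) \<longlonglongrightarrow> exp (- (pi * (0 * y)\<^sup>2))"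
        by (intro tendsto_intros LIMSEQ_Suc lim_const_over_n)
      thus "(\<lambda>n. gauss (1 / real (Suc n)) y) \<longlonglongrightarrow> 1"
        unfolding gauss_def using tendsto_of_real by fastforce
    qed
    show "AE y in lborel. norm (fourier f y * gauss (1 / real (Suc n)) y * cis (2 * pi * y * (- x))) \<le> norm (fourier f y)" for n
      using norm_gauss_le_1 by (auto simp: norm_mult mult_left_le)
  qed (use Ff in auto)
  moreover have "(\<lambda>n. LINT y|lborel. fourier f y * gauss (1 / real (Suc n)) y * cis (2 * pi * y * (- x))) \<longlonglongrightarrow> f x"
    unfolding eq by (rule gauss_approximate_identity[OF f cont])
  ultimately have "(LINT y|lborel. fourier f y * 1 * cis (2 * pi * y * (- x))) = f x"
    by (rule LIMSEQ_unique)
  thus ?thesis by (simp add: fourier_cis)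
qed

section \<open>Decay in vertical strips\<close>

text \<open>The uniform counterpart of \<open>rapid\<close> on a closed vertical strip: decay on
  each line separately does not suffice for contour shifts.\<close>

definition strip_decay :: "(complex \<Rightarrow> complex) \<Rightarrow> real \<Rightarrow> real \<Rightarrow> bool" where
  "strip_decay h a b \<longleftrightarrow>
     (\<forall>k. \<exists>C. \<forall>z. a \<le> Re z \<longrightarrow> Re z \<le> b \<longrightarrow> (1 + \<bar>Im z\<bar>) ^ k * norm (h z) \<le> C)"

lemma strip_decayD:
  assumes "strip_decay h a b"
  obtains C where "C \<ge> 0" "\<And>z. a \<le> Re z \<Longrightarrow> Re z \<le> b \<Longrightarrow> (1 + \<bar>Im z\<bar>) ^ k * norm (h z) \<le> C"
proof -
  obtain C where C: "\<And>z. a \<le> Re z \<Longrightarrow> Re z \<le> b \<Longrightarrow> (1 + \<bar>Im z\<bar>) ^ k * norm (h z) \<le> C"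
    using assms unfolding strip_decay_def by blast
  show ?thesis
    by (rule that[of "\<bar>C\<bar>"]) (auto intro: order.trans[OF C abs_ge_self])
qed

lemma strip_decay_rapid: 
  assumes "strip_decay h a b" "a \<le> s" "s \<le> b" shows "rapid (\<lambda>t. h (Complex s t))"
  unfolding rapid_def
proof
  fix k
  obtain C where "\<And>z. a \<le> Re z \<Longrightarrow> Re z \<le> b \<Longrightarrow> (1 + \<bar>Im z\<bar>) ^ k * norm (h z) \<le> C"
    using strip_decayD[OF assms(1)] by blast
  from this[of "Complex s _"] assms(2,3)
  show "\<exists>C. \<forall>x. (1 + \<bar>x\<bar>) ^ k * norm (h (Complex s x)) \<le> C" by auto
qed

lemma strip_decay_join:
  assumes "strip_decay h a b" "strip_decay h b c" shows "strip_decay h a c"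
  unfolding strip_decay_def
proof
  fix k
  obtain C where C: "C \<ge> 0" "\<And>z. a \<le> Re z \<Longrightarrow> Re z \<le> b \<Longrightarrow> (1 + \<bar>Im z\<bar>) ^ k * norm (h z) \<le> C"
    using strip_decayD[OF assms(1)] by blast
  obtain D where D: "D \<ge> 0" "\<And>z. b \<le> Re z \<Longrightarrow> Re z \<le> c \<Longrightarrow> (1 + \<bar>Im z\<bar>) ^ k * norm (h z) \<le> D"
    using strip_decayD[OF assms(2)] by blast
  have "(1 + \<bar>Im z\<bar>) ^ k * norm (h z) \<le> C + D" if "a \<le> Re z" "Re z \<le> c" for z
    using C(1) C(2)[of z] D(1) D(2)[of z] that by (cases "Re z \<le> b") auto
  thus "\<exists>C. \<forall>z. a \<le> Re z \<longrightarrow> Re z \<le> c \<longrightarrow> (1 + \<bar>Im z\<bar>) ^ k * norm (h z) \<le> C" by blast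
qed

lemma strip_decay_cong:
  assumes "strip_decay h a b" "\<And>z. a \<le> Re z \<Longrightarrow> Re z \<le> b \<Longrightarrow> h' z = h z"
  shows "strip_decay h' a b"
  using assms unfolding strip_decay_def by simp

lemma strip_decay_reflect:
  assumes "strip_decay h a b" shows "strip_decay (\<lambda>z. h (1 - z)) (1 - b) (1 - a)"
  unfolding strip_decay_def
proof
  fix k
  obtain C where C: "\<And>z. a \<le> Re z \<Longrightarrow> Re z \<le> b \<Longrightarrow> (1 + \<bar>Im z\<bar>) ^ k * norm (h z) \<le> C"
    using strip_decayD[OF assms(1)] by blast
  show "\<exists>C. \<forall>z. 1 - b \<le> Re z \<longrightarrow> Re z \<le> 1 - a \<longrightarrow> (1 + \<bar>Im z\<bar>) ^ k * norm (h (1 - z)) \<le> C"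
    using C[of "1 - _"] by (intro exI[of _ C]) auto
qed

lemma strip_decay_mult_poly_growth:
  assumes "strip_decay h a b" "B \<ge> 0"
    and "\<And>z. a \<le> Re z \<Longrightarrow> Re z \<le> b \<Longrightarrow> norm (g z) \<le> B * (1 + \<bar>Im z\<bar>) ^ m * norm (h z)"
  shows "strip_decay g a b"
  unfolding strip_decay_def
proof
  fix k
  obtain C where C: "C \<ge> 0" "\<And>z. a \<le> Re z \<Longrightarrow> Re z \<le> b \<Longrightarrow> (1 + \<bar>Im z\<bar>) ^ (k + m) * norm (h z) \<le> C"
    using strip_decayD[OF assms(1)] by blast
  have "(1 + \<bar>Im z\<bar>) ^ k * norm (g z) \<le> B * C" if z: "a \<le> Re z" "Re z \<le> b" for z
  proof -
    have "(1 + \<bar>Im z\<bar>) ^ k * norm (g z) \<le> (1 + \<bar>Im z\<bar>) ^ k * (B * (1 + \<bar>Im z\<bar>) ^ m * norm (h z))"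
      by (intro mult_left_mono assms z) auto
    also have "\<dots> = B * ((1 + \<bar>Im z\<bar>) ^ (k + m) * norm (h z))" by (simp add: power_add)
    also have "\<dots> \<le> B * C" by (intro mult_left_mono C z assms)
    finally show ?thesis .
  qed
  thus "\<exists>C. \<forall>z. a \<le> Re z \<longrightarrow> Re z \<le> b \<longrightarrow> (1 + \<bar>Im z\<bar>) ^ k * norm (g z) \<le> C" by blast
qed

lemma open_strip: "open {z. a < Re z \<and> Re z < b}"
  by (intro open_Collect_conj open_halfspace_Re_gt open_halfspace_Re_lt)

text \<open>Derivatives along the line are powers of \<open>\<i>\<close> times complex derivatives,
  which Cauchy's inequality bounds on discs inside the open strip; \<open>schwartzI\<close> then
  asks for the decay of \<open>h\<close> only.\<close>

lemma strip_lines_schwartz: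
  assumes hol: "h holomorphic_on {z. a < Re z \<and> Re z < b}"
    and dec: "\<And>a' b'. a < a' \<Longrightarrow> b' < b \<Longrightarrow> strip_decay h a' b'"
    and s: "a < s" "s < b"
  shows "(\<lambda>t. h (Complex s t)) \<in> schwartz"
proof -
  let ?S = "{z. a < Re z \<and> Re z < b}"
  have S: "open ?S" by (rule open_strip)
  define r where "r = min (s - a) (b - s) / 2"
  have r: "r > 0" "a < s - r" "s + r < b" using s by (auto simp: r_def min_def field_simps)
  have dec': "strip_decay h (s - r) (s + r)" using r by (intro dec) auto
  show ?thesis
  proof (rule schwartzI[of "\<lambda>n t. \<i> ^ n * (deriv ^^ n) h (Complex s t)"])
    show "rapid (\<lambda>t. h (Complex s t))" using dec' r by (intro strip_decay_rapid) auto
    show "((\<lambda>t. \<i> ^ n * (deriv ^^ n) h (Complex s t)) has_vector_derivative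
            \<i> ^ Suc n * (deriv ^^ Suc n) h (Complex s x)) (at x)" for n x
    proof -
      have "(deriv ^^ n) h holomorphic_on ?S" by (rule holomorphic_higher_deriv[OF hol S])
      hence "((deriv ^^ n) h has_field_derivative deriv ((deriv ^^ n) h) (Complex s x)) (at (Complex s x))"
        using S s by (intro holomorphic_derivI) auto
      moreover have "((\<lambda>t. Complex s t) has_vector_derivative \<i>) (at x)"
        by (auto simp: has_vector_derivative_complex_iff)
      ultimately have "((deriv ^^ n) h \<circ> (\<lambda>t. Complex s t) has_vector_derivative
           \<i> * deriv ((deriv ^^ n) h) (Complex s x)) (at x)"
        by (intro field_vector_diff_chain_at)
      hence "((\<lambda>t. \<i> ^ n * (deriv ^^ n) h (Complex s t)) has_vector_derivative
              \<i> ^ n * (\<i> * deriv ((deriv ^^ n) h) (Complex s x))) (at x)"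
        by (intro has_vector_derivative_mult_right) (simp add: o_def)
      thus ?thesis by (simp add: mult_ac)
    qed
    show "\<exists>C. \<forall>x. norm (\<i> ^ n * (deriv ^^ n) h (Complex s x)) \<le> C" for n
    proof -
      obtain C where C: "\<And>z. s - r \<le> Re z \<Longrightarrow> Re z \<le> s + r \<Longrightarrow> (1 + \<bar>Im z\<bar>) ^ 0 * norm (h z) \<le> C"
        using strip_decayD[OF dec'] by blast
      have "norm ((deriv ^^ n) h (Complex s x)) \<le> fact n * C / r ^ n" for x
      proof (rule Cauchy_inequality)
        have sub: "s - r \<le> Re y \<and> Re y \<le> s + r" if "dist (Complex s x) y \<le> r" for y
          using abs_Re_le_cmod[of "Complex s x - y"] that unfolding dist_norm by auto
        have "h holomorphic_on cball (Complex s x) r"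
          using hol by (rule holomorphic_on_subset) (use sub r in force)
        thus "h holomorphic_on ball (Complex s x) r" "continuous_on (cball (Complex s x) r) h"
          by (auto intro: holomorphic_on_subset holomorphic_on_imp_continuous_on)
        show "norm (h y) \<le> C" if "norm (Complex s x - y) = r" for y
          using C[of y] sub[of y] that by (auto simp: dist_norm)
      qed (use r in auto)
      thus ?thesis by (auto simp: norm_mult norm_power)
    qed
  qed auto
qed

section \<open>Maximum modulus and the Phragmen-Lindeloef principle in a strip\<close>

lemma max_modulus_rectangle:
  assumes cont: "continuous_on (cbox (Complex a c) (Complex b d)) F"
    and hol: "F holomorphic_on box (Complex a c) (Complex b d)"
    and vert: "\<And>y. c \<le> y \<Longrightarrow> y \<le> d \<Longrightarrow> norm (F (Complex a y)) \<le> M" 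
              "\<And>y. c \<le> y \<Longrightarrow> y \<le> d \<Longrightarrow> norm (F (Complex b y)) \<le> M"
    and hori: "\<And>x. a \<le> x \<Longrightarrow> x \<le> b \<Longrightarrow> norm (F (Complex x c)) \<le> M"
              "\<And>x. a \<le> x \<Longrightarrow> x \<le> b \<Longrightarrow> norm (F (Complex x d)) \<le> M"
    and z: "a \<le> Re z" "Re z \<le> b" "c \<le> Im z" "Im z \<le> d"
  shows "norm (F z) \<le> M"
proof (rule maximum_modulus_frontier[where S = "cbox (Complex a c) (Complex b d)" and f = F and \<xi> = z])
  show "norm (F w) \<le> M" if w: "w \<in> frontier (cbox (Complex a c) (Complex b d))" for w
  proof -
    have in_cbox: "a \<le> Re w" "Re w \<le> b" "c \<le> Im w" "Im w \<le> d"
      using w by (auto simp: frontier_def in_cbox_complex_iff)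
    have "\<not> (a < Re w \<and> Re w < b \<and> c < Im w \<and> Im w < d)"
      using w by (auto simp: frontier_def interior_cbox in_box_complex_iff)
    hence "Re w = a \<or> Re w = b \<or> Im w = c \<or> Im w = d" using in_cbox by auto
    moreover have "w = Complex (Re w) (Im w)" by simp
    ultimately show ?thesis using in_cbox vert[of "Im w"] hori[of "Re w"] by metis
  qed
qed (use cont hol z in \<open>auto simp: in_cbox_complex_iff interior_cbox\<close>)

text \<open>The factor \<open>exp (\<epsilon> * z\<^sup>2)\<close> decays like
  \<open>exp (- \<epsilon> * (Im z)\<^sup>2)\<close> in the strip and beats polynomial growth on
  high horizontal sides. On the vertical sides it costs at most
  \<open>exp (\<epsilon> * m\<^sup>2)\<close>, which disappears as \<open>\<epsilon>\<close> tends
  to 0.\<close>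

theorem phragmen_lindelof_strip:
  assumes cont: "continuous_on {z. a \<le> Re z \<and> Re z \<le> b} F"
    and hol: "F holomorphic_on {z. a < Re z \<and> Re z < b}"
    and growth: "\<And>z. a \<le> Re z \<Longrightarrow> Re z \<le> b \<Longrightarrow> norm (F z) \<le> B * (1 + \<bar>Im z\<bar>) ^ N"
    and M: "M > 0" "\<And>t. norm (F (Complex a t)) \<le> M" "\<And>t. norm (F (Complex b t)) \<le> M"
    and z: "a \<le> Re z" "Re z \<le> b"
  shows "norm (F z) \<le> M"
proof -
  define m where "m = max \<bar>a\<bar> \<bar>b\<bar>"
  have ineq: "norm (F z) * exp (\<epsilon> * ((Re z)\<^sup>2 - (Im z)\<^sup>2)) \<le> M * exp (\<epsilon> * m\<^sup>2)" if \<epsilon>: "\<epsilon> > 0" for \<epsilon>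
  proof -
    define G where "G w = F w * exp (of_real \<epsilon> * w\<^sup>2)" for w
    have normG: "norm (G w) = norm (F w) * exp (\<epsilon> * ((Re w)\<^sup>2 - (Im w)\<^sup>2))" for w
      by (simp add: G_def norm_mult Re_power2)
    have Re_le: "(Re w)\<^sup>2 \<le> m\<^sup>2" if "a \<le> Re w" "Re w \<le> b" for w
      using that by (subst abs_le_square_iff[symmetric]) (auto simp: m_def)
    have "((\<lambda>T::real. B * (1 + T) ^ N * exp (- \<epsilon> * T\<^sup>2)) \<longlongrightarrow> 0) at_top"
      using \<epsilon> by real_asymp
    hence "eventually (\<lambda>T. B * (1 + T) ^ N * exp (- \<epsilon> * T\<^sup>2) < M) at_top"
      using M(1) by (intro order_tendstoD)
    moreover have "eventually (\<lambda>T. T > \<bar>Im z\<bar>) at_top" by (rule eventually_gt_at_top)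
    ultimately have "eventually (\<lambda>T. B * (1 + T) ^ N * exp (- \<epsilon> * T\<^sup>2) < M \<and> T > \<bar>Im z\<bar>) at_top"
      by (rule eventually_conj)
    then obtain T where T: "B * (1 + T) ^ N * exp (- \<epsilon> * T\<^sup>2) < M" "T > \<bar>Im z\<bar>"
      unfolding eventually_at_top_linorder by blast
    have vert: "norm (G w) \<le> M * exp (\<epsilon> * m\<^sup>2)" if "norm (F w) \<le> M" "a \<le> Re w" "Re w \<le> b" for w
    proof -
      have "(Re w)\<^sup>2 - (Im w)\<^sup>2 \<le> m\<^sup>2" using Re_le[of w] that by (smt (verit) zero_le_power2)
      thus ?thesis unfolding normG using that \<epsilon> M(1) by (intro mult_mono) auto
    qed
    have hori: "norm (G w) \<le> M * exp (\<epsilon> * m\<^sup>2)" if w: "a \<le> Re w" "Re w \<le> b" "\<bar>Im w\<bar> = T" for w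
    proof -
      have "norm (G w) \<le> (B * (1 + T) ^ N) * (exp (\<epsilon> * m\<^sup>2) * exp (- \<epsilon> * T\<^sup>2))"
      proof -
        have "(Im w)\<^sup>2 = T\<^sup>2" using w by (metis power2_abs)
        hence "\<epsilon> * ((Re w)\<^sup>2 - (Im w)\<^sup>2) \<le> \<epsilon> * m\<^sup>2 + - \<epsilon> * T\<^sup>2"
          using Re_le[OF w(1,2)] \<epsilon> by (simp add: algebra_simps)
        hence "exp (\<epsilon> * ((Re w)\<^sup>2 - (Im w)\<^sup>2)) \<le> exp (\<epsilon> * m\<^sup>2) * exp (- \<epsilon> * T\<^sup>2)"
          unfolding exp_add[symmetric] by simp
        moreover have "norm (F w) \<le> B * (1 + T) ^ N" using growth[of w] w by simp
        moreover from this have "0 \<le> B * (1 + T) ^ N" using norm_ge_zero[of "F w"] by linarith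
        ultimately show ?thesis unfolding normG by (intro mult_mono) auto
      qed
      also have "\<dots> = B * (1 + T) ^ N * exp (- \<epsilon> * T\<^sup>2) * exp (\<epsilon> * m\<^sup>2)" by simp
      also have "\<dots> \<le> M * exp (\<epsilon> * m\<^sup>2)" using T(1) by (intro mult_right_mono) auto
      finally show ?thesis .
    qed
    have "norm (G z) \<le> M * exp (\<epsilon> * m\<^sup>2)"
    proof (rule max_modulus_rectangle[where F = G and a = a and b = b and c = "-T" and d = T])
      show "continuous_on (cbox (Complex a (- T)) (Complex b T)) G"
        unfolding G_def by (intro continuous_intros continuous_on_subset[OF cont])
          (auto simp: in_cbox_complex_iff)
      show "G holomorphic_on box (Complex a (- T)) (Complex b T)"
        unfolding G_def by (intro holomorphic_intros holomorphic_on_subset[OF hol])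
          (auto simp: in_box_complex_iff)
      show "norm (G (Complex a y)) \<le> M * exp (\<epsilon> * m\<^sup>2)" "norm (G (Complex b y)) \<le> M * exp (\<epsilon> * m\<^sup>2)" for y
        using z M(2,3) by (auto intro!: vert)
    qed (use z T(2) in \<open>auto intro!: hori\<close>)
    thus ?thesis by (simp add: normG)
  qed
  have "norm (F z) * exp (0 * ((Re z)\<^sup>2 - (Im z)\<^sup>2)) \<le> M * exp (0 * m\<^sup>2)"
  proof (rule tendsto_le[where F = "at_right (0::real)"])
    show "((\<lambda>\<epsilon>. M * exp (\<epsilon> * m\<^sup>2)) \<longlongrightarrow> M * exp (0 * m\<^sup>2)) (at_right 0)"
      by (intro tendsto_intros)
    show "((\<lambda>\<epsilon>. norm (F z) * exp (\<epsilon> * ((Re z)\<^sup>2 - (Im z)\<^sup>2))) \<longlongrightarrow>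
             norm (F z) * exp (0 * ((Re z)\<^sup>2 - (Im z)\<^sup>2))) (at_right 0)"
      by (intro tendsto_intros)
    show "\<forall>\<^sub>F \<epsilon> in at_right 0. norm (F z) * exp (\<epsilon> * ((Re z)\<^sup>2 - (Im z)\<^sup>2)) \<le> M * exp (\<epsilon> * m\<^sup>2)"
      using eventually_at_right_less[of "0::real"] by eventually_elim (rule ineq)
  qed auto
  thus ?thesis by simp
qed

theorem strip_decay_of_lines:
  assumes cont: "continuous_on {z. a \<le> Re z \<and> Re z \<le> b} F"
    and hol: "F holomorphic_on {z. a < Re z \<and> Re z < b}"
    and growth: "\<And>z. a \<le> Re z \<Longrightarrow> Re z \<le> b \<Longrightarrow> norm (F z) \<le> B * (1 + \<bar>Im z\<bar>) ^ N"
    and lines: "rapid (\<lambda>t. F (Complex a t))" "rapid (\<lambda>t. F (Complex b t))"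
  shows "strip_decay F a b"
  unfolding strip_decay_def
proof
  fix k
  show "\<exists>C. \<forall>z. a \<le> Re z \<longrightarrow> Re z \<le> b \<longrightarrow> (1 + \<bar>Im z\<bar>) ^ k * norm (F z) \<le> C"
  proof (cases "a \<le> b")
    case ab: True
    \<comment> \<open>The shift by \<open>a - 1\<close> gives \<open>Re (p z) \<ge> 1\<close> in the
      strip, so \<open>norm (p z)\<close> is comparable to \<open>1 + \<bar>Im z\<bar>\<close> from
      both sides. Holomorphic powers of \<open>p\<close> can then replace the weights of
      \<open>strip_decay\<close>.\<close>
    define p where "p z = z - of_real (a - 1)" for z :: complex
    define L where "L = b - a + 1"
    have L: "L \<ge> 1" using ab by (simp add: L_def)
    have p_le: "norm (p z) \<le> L * (1 + \<bar>Im z\<bar>)" if "a \<le> Re z" "Re z \<le> b" for z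
    proof -
      have "norm (p z) \<le> \<bar>Re (p z)\<bar> + \<bar>Im (p z)\<bar>" by (rule cmod_le)
      also have "\<dots> \<le> L + \<bar>Im z\<bar>" using that by (simp add: p_def L_def)
      also have "\<dots> \<le> L * (1 + \<bar>Im z\<bar>)" using L by (simp add: algebra_simps mult_le_cancel_right1)
      finally show ?thesis .
    qed
    have p_ge: "1 + \<bar>Im z\<bar> \<le> 2 * norm (p z)" if "a \<le> Re z" for z
      using abs_Re_le_cmod[of "p z"] abs_Im_le_cmod[of "p z"] that by (simp add: p_def)
    have "\<exists>M. \<forall>t. norm (p (Complex s t) ^ k * F (Complex s t)) \<le> M"
      if r: "rapid (\<lambda>t. F (Complex s t))" and s: "a \<le> s" "s \<le> b" for s
    proof -
      obtain C where C: "\<And>t. (1 + \<bar>t\<bar>) ^ k * norm (F (Complex s t)) \<le> C" using rapidD[OF r] by blast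
      have "norm (p (Complex s t) ^ k * F (Complex s t)) \<le> L ^ k * C" for t
      proof -
        have "norm (p (Complex s t) ^ k * F (Complex s t)) \<le> (L * (1 + \<bar>t\<bar>)) ^ k * norm (F (Complex s t))"
          unfolding norm_mult norm_power using p_le[of "Complex s t"] s
          by (intro mult_right_mono power_mono) auto
        also have "\<dots> = L ^ k * ((1 + \<bar>t\<bar>) ^ k * norm (F (Complex s t)))" by (simp add: power_mult_distrib)
        also have "\<dots> \<le> L ^ k * C" using L by (intro mult_left_mono C) auto
        finally show ?thesis .
      qed
      thus ?thesis by blast
    qed
    from this[OF lines(1)] this[OF lines(2)] ab obtain M1 M2 where
      M1: "\<And>t. norm (p (Complex a t) ^ k * F (Complex a t)) \<le> M1" and
      M2: "\<And>t. norm (p (Complex b t) ^ k * F (Complex b t)) \<le> M2" by auto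
    define M where "M = max 1 (max M1 M2)"
    have "norm (p z ^ k * F z) \<le> M" if z: "a \<le> Re z" "Re z \<le> b" for z
    proof (rule phragmen_lindelof_strip[where F = "\<lambda>z. p z ^ k * F z", OF _ _ _ _ _ _ z])
      show "continuous_on {z. a \<le> Re z \<and> Re z \<le> b} (\<lambda>z. p z ^ k * F z)"
        unfolding p_def by (intro continuous_intros cont)
      show "(\<lambda>z. p z ^ k * F z) holomorphic_on {z. a < Re z \<and> Re z < b}"
        unfolding p_def by (intro holomorphic_intros hol)
      show "norm (p z ^ k * F z) \<le> (L ^ k * B) * (1 + \<bar>Im z\<bar>) ^ (k + N)" if z: "a \<le> Re z" "Re z \<le> b" for z
      proof -
        have "norm (p z ^ k * F z) \<le> (L * (1 + \<bar>Im z\<bar>)) ^ k * (B * (1 + \<bar>Im z\<bar>) ^ N)"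
          unfolding norm_mult norm_power using L by (intro mult_mono power_mono p_le growth z) auto
        thus ?thesis by (simp add: power_mult_distrib power_add mult_ac)
      qed
      show "M > 0" by (simp add: M_def)
      show "norm (p (Complex a t) ^ k * F (Complex a t)) \<le> M" "norm (p (Complex b t) ^ k * F (Complex b t)) \<le> M" for t
        using M1[of t] M2[of t] by (auto simp: M_def)
    qed
    hence "(1 + \<bar>Im z\<bar>) ^ k * norm (F z) \<le> 2 ^ k * M" if z: "a \<le> Re z" "Re z \<le> b" for z
    proof -
      have "(1 + \<bar>Im z\<bar>) ^ k * norm (F z) \<le> (2 * norm (p z)) ^ k * norm (F z)"
        using p_ge[OF z(1)] by (intro mult_right_mono power_mono) auto
      also have "\<dots> = 2 ^ k * norm (p z ^ k * F z)" by (simp add: norm_mult norm_power power_mult_distrib)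
      also have "\<dots> \<le> 2 ^ k * M" using \<open>\<And>z. a \<le> Re z \<Longrightarrow> Re z \<le> b \<Longrightarrow> norm (p z ^ k * F z) \<le> M\<close>[OF z] by simp
      finally show ?thesis .
    qed
    thus ?thesis by blast
  qed auto
qed

text \<open>The boundedness on strips in \<open>entire_schwartz\<close> serves as the growth
  condition of Phragmen-Lindeloef, with exponent 0; the Schwartz condition on the two boundary lines
  does the rest.\<close>

lemma entire_schwartz_strip_decay:
  assumes "h \<in> entire_schwartz" shows "strip_decay h a b"
proof -
  have "bounded (h ` {z. a \<le> Re z \<and> Re z \<le> b})" using assms by (auto simp: entire_schwartz_def)
  then obtain B where "\<And>z. a \<le> Re z \<Longrightarrow> Re z \<le> b \<Longrightarrow> norm (h z) \<le> B" by (auto simp: bounded_iff)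
  moreover have hol: "h holomorphic_on UNIV" using assms by (auto simp: entire_schwartz_def)
  ultimately show ?thesis using assms
    by (intro strip_decay_of_lines[where B = B and N = 0])
      (auto intro: holomorphic_on_subset[OF hol] holomorphic_on_imp_continuous_on schwartz_rapid
            simp: entire_schwartz_def)
qed

lemma entire_schwartzI:
  assumes "h holomorphic_on UNIV" "\<And>a b. strip_decay h a b"
  shows "h \<in> entire_schwartz"
  unfolding entire_schwartz_def
proof (intro CollectI conjI allI)
  show "(\<lambda>t. h (Complex s t)) \<in> schwartz" for s
    by (rule strip_lines_schwartz[where a = "s - 1" and b = "s + 1"])
      (use assms in \<open>auto intro: holomorphic_on_subset\<close>)
  show "bounded (h ` {z. a \<le> Re z \<and> Re z \<le> b})" for a b
    by (rule strip_decayD[OF assms(2)[of a b], of 0]) (auto simp: bounded_iff)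
qed fact

section \<open>The Mellin transform as a two-sided Laplace transform\<close>

definition laplace :: "(real \<Rightarrow> complex) \<Rightarrow> complex \<Rightarrow> complex" where
  "laplace u z = (LINT t|lborel. u t * exp (z * of_real t))"

text \<open>\<open>I\<close> is the set of admissible exponential weights. Functions in
  \<open>H_minus\<close> allow all real weights. A Schwartz function on the half-line allows the
  nonnegative ones, as it is merely bounded near 0. Two weights bound the open strip on which the
  transform is studied.\<close>

definition laplace_class :: "real set \<Rightarrow> (real \<Rightarrow> complex) \<Rightarrow> bool" where
  "laplace_class I u \<longleftrightarrow> (\<exists>U. U 0 = u \<and> (\<forall>k t. (U k has_vector_derivative U (Suc k) t) (at t)) \<and>
     (\<forall>k. \<forall>\<sigma>\<in>I. \<exists>C. \<forall>t. exp (\<sigma> * t) * norm (U k t) \<le> C))"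

lemma power_le_fact_exp:
  fixes x :: real assumes "x \<ge> 0" shows "x ^ k \<le> fact k * exp x"
proof -
  have "sum (\<lambda>n. inverse (fact n) *\<^sub>R x ^ n) {k} \<le> (\<Sum>n. inverse (fact n) *\<^sub>R x ^ n)"
    using assms by (intro sum_le_suminf summable_exp_generic) auto
  hence "inverse (fact k) * x ^ k \<le> exp x" by (simp add: exp_def)
  thus ?thesis by (simp add: field_simps)
qed

lemma rapid_exp_decay:
  assumes "\<delta> > 0" "\<And>t. norm (f t) \<le> C * exp (- \<delta> * \<bar>t\<bar>)"
  shows "rapid f"
  unfolding rapid_def
proof
  fix k
  have C: "C \<ge> 0" using assms(2)[of 0] norm_ge_zero[of "f 0"] by (simp del: norm_ge_zero)
  have "(1 + \<bar>t\<bar>) ^ k * norm (f t) \<le> fact k * exp \<delta> / \<delta> ^ k * C" for t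
  proof -
    have "(\<delta> * (1 + \<bar>t\<bar>)) ^ k \<le> fact k * exp (\<delta> * (1 + \<bar>t\<bar>))"
      using assms(1) by (intro power_le_fact_exp) auto
    hence "\<delta> ^ k * (1 + \<bar>t\<bar>) ^ k \<le> fact k * (exp \<delta> * exp (\<delta> * \<bar>t\<bar>))"
      by (simp add: power_mult_distrib[symmetric] exp_add[symmetric] distrib_left)
    hence "(1 + \<bar>t\<bar>) ^ k \<le> fact k * exp \<delta> / \<delta> ^ k * exp (\<delta> * \<bar>t\<bar>)"
      using assms(1) by (simp add: field_simps)
    hence "(1 + \<bar>t\<bar>) ^ k * norm (f t) \<le> (fact k * exp \<delta> / \<delta> ^ k * exp (\<delta> * \<bar>t\<bar>)) * (C * exp (- \<delta> * \<bar>t\<bar>))"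
      using assms C by (intro mult_mono) auto
    also have "\<dots> = fact k * exp \<delta> / \<delta> ^ k * C * (exp (\<delta> * \<bar>t\<bar>) * exp (- \<delta> * \<bar>t\<bar>))"
      by (simp only: mult_ac)
    also have "exp (\<delta> * \<bar>t\<bar>) * exp (- \<delta> * \<bar>t\<bar>) = 1" by (simp add: exp_minus)
    finally show ?thesis by simp
  qed
  thus "\<exists>C. \<forall>t. (1 + \<bar>t\<bar>) ^ k * norm (f t) \<le> C" by blast
qed

text \<open>For \<open>t \<ge> 0\<close> the larger weight leaves room for a decaying exponential,
  for \<open>t < 0\<close> the smaller one does.\<close>

lemma exp_interpolate:
  fixes u :: "real \<Rightarrow> complex"
  assumes "\<alpha> + \<delta> \<le> \<sigma>" "\<sigma> \<le> \<beta> - \<delta>" "\<delta> \<ge> 0"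
    and "\<And>t. exp (\<alpha> * t) * norm (u t) \<le> C" "\<And>t. exp (\<beta> * t) * norm (u t) \<le> C"
  shows "norm (u t * of_real (exp (\<sigma> * t))) \<le> C * exp (- \<delta> * \<bar>t\<bar>)"
proof -
  have C: "C \<ge> 0" using assms(4)[of 0] norm_ge_zero[of "u 0"] by (simp del: norm_ge_zero)
  have "exp (\<sigma> * t) * norm (u t) \<le> C * exp (- \<delta> * \<bar>t\<bar>)"
  proof (cases "t \<ge> 0")
    case True
    have "\<sigma> * t \<le> (\<beta> - \<delta>) * t" using assms(2) True by (rule mult_right_mono)
    hence "exp (\<sigma> * t) * norm (u t) \<le> exp (- \<delta> * t + \<beta> * t) * norm (u t)"
      by (intro mult_right_mono) (auto simp: algebra_simps)
    also have "\<dots> = exp (- \<delta> * t) * (exp (\<beta> * t) * norm (u t))" by (simp only: exp_add mult.assoc)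
    also have "\<dots> \<le> exp (- \<delta> * t) * C" by (intro mult_left_mono assms) auto
    finally show ?thesis using True by (simp add: mult.commute)
  next
    case False
    have "(\<alpha> + \<delta>) * (-t) \<le> \<sigma> * (-t)" using assms(1) False by (intro mult_right_mono) auto
    hence "exp (\<sigma> * t) * norm (u t) \<le> exp (\<delta> * t + \<alpha> * t) * norm (u t)"
      by (intro mult_right_mono) (auto simp: algebra_simps)
    also have "\<dots> = exp (\<delta> * t) * (exp (\<alpha> * t) * norm (u t))" by (simp only: exp_add mult.assoc)
    also have "\<dots> \<le> exp (\<delta> * t) * C" by (intro mult_left_mono assms) auto
    finally show ?thesis using False by (simp add: mult.commute)
  qed
  thus ?thesis by (simp add: norm_mult mult.commute)
qed

lemma laplace_class_bounds:
  assumes U: "\<And>k t. (U k has_vector_derivative U (Suc k) t) (at t)"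
    and bnd: "\<And>k \<sigma>. \<sigma> \<in> {\<alpha>, \<beta>} \<Longrightarrow> \<exists>C. \<forall>t. exp (\<sigma> * t) * norm (U k t) \<le> C"
    and ab: "\<alpha> < a" "b < \<beta>"
  obtains \<delta> C where "\<delta> > 0" "\<And>z t. a \<le> Re z \<Longrightarrow> Re z \<le> b \<Longrightarrow> norm (U k t * exp (z * of_real t)) \<le> C * exp (- \<delta> * \<bar>t\<bar>)"
proof -
  obtain C1 C2 where C: "\<And>t. exp (\<alpha> * t) * norm (U k t) \<le> C1" "\<And>t. exp (\<beta> * t) * norm (U k t) \<le> C2"
    using bnd[of \<alpha> k] bnd[of \<beta> k] by auto
  define \<delta> where "\<delta> = min (a - \<alpha>) (\<beta> - b)"
  show ?thesis
  proof (rule that[of \<delta> "max C1 C2"])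
    show "\<delta> > 0" using ab by (simp add: \<delta>_def)
    fix z :: complex and t :: real assume z: "a \<le> Re z" "Re z \<le> b"
    have "norm (U k t * of_real (exp (Re z * t))) \<le> max C1 C2 * exp (- \<delta> * \<bar>t\<bar>)"
      by (rule exp_interpolate[where \<alpha> = \<alpha> and \<beta> = \<beta>])
        (use ab z in \<open>auto simp: \<delta>_def intro: order.trans[OF C(1)] order.trans[OF C(2)]\<close>)
    thus "norm (U k t * exp (z * of_real t)) \<le> max C1 C2 * exp (- \<delta> * \<bar>t\<bar>)"
      by (simp add: norm_mult)
  qed
qed

lemma laplace_class_continuous:
  assumes u: "laplace_class I u" shows "continuous_on A u"
proof -
  obtain U where "U 0 = u" "\<And>k t. (U k has_vector_derivative U (Suc k) t) (at t)"
    using u unfolding laplace_class_def by blast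
  thus ?thesis by (metis has_vector_derivative_continuous continuous_at_imp_continuous_on)
qed

context
  fixes I :: "real set" and u :: "real \<Rightarrow> complex" and \<alpha> \<beta> :: real
  assumes u: "laplace_class I u" and I: "\<alpha> \<in> I" "\<beta> \<in> I"
begin

lemma laplace_class_integrable:
  assumes "\<alpha> < Re z" "Re z < \<beta>"
  shows "integrable lborel (\<lambda>t. u t * exp (z * of_real t))"
proof -
  obtain U where U: "U 0 = u" "\<And>k t. (U k has_vector_derivative U (Suc k) t) (at t)"
      "\<And>k \<sigma>. \<sigma> \<in> {\<alpha>, \<beta>} \<Longrightarrow> \<exists>C. \<forall>t. exp (\<sigma> * t) * norm (U k t) \<le> C"
    using u I unfolding laplace_class_def by blast
  obtain \<delta> C where "\<delta> > 0" "\<And>w t. Re z \<le> Re w \<Longrightarrow> Re w \<le> Re z \<Longrightarrow> norm (U 0 t * exp (w * of_real t)) \<le> C * exp (- \<delta> * \<bar>t\<bar>)"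
    using laplace_class_bounds[of U \<alpha> \<beta> "Re z" "Re z" 0, OF U(2,3) assms] by blast
  hence "rapid (\<lambda>t. U 0 t * exp (z * of_real t))" by (intro rapid_exp_decay) auto
  thus ?thesis unfolding U(1)
    by (rule rapid_integrable) (intro borel_measurable_continuous_onI continuous_intros laplace_class_continuous[OF u])
qed

lemma laplace_class_holomorphic: "laplace u holomorphic_on {z. \<alpha> < Re z \<and> Re z < \<beta>}"
  unfolding laplace_def
proof (rule holomorphic_integral[OF open_strip])
  show "(\<lambda>z. u x * exp (z * of_real x)) holomorphic_on {z. \<alpha> < Re z \<and> Re z < \<beta>}" for x
    by (intro holomorphic_intros)
  have "(\<lambda>t. u t * exp (z * of_real t)) \<in> borel_measurable borel" for z
    by (intro borel_measurable_continuous_onI continuous_intros laplace_class_continuous[OF u])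
  thus "(\<lambda>t. u t * exp (z * of_real t)) \<in> borel_measurable lborel" for z by simp
  fix z0 assume "z0 \<in> {z. \<alpha> < Re z \<and> Re z < \<beta>}"
  hence z0: "\<alpha> < Re z0" "Re z0 < \<beta>" by auto
  define r where "r = min (Re z0 - \<alpha>) (\<beta> - Re z0) / 2"
  have r: "r > 0" "\<alpha> < Re z0 - r" "Re z0 + r < \<beta>" using z0 by (auto simp: r_def min_def field_simps)
  have sub: "Re z0 - r \<le> Re y \<and> Re y \<le> Re z0 + r" if "y \<in> cball z0 r" for y
    using abs_Re_le_cmod[of "z0 - y"] that unfolding mem_cball dist_norm by auto
  obtain U where U: "U 0 = u" "\<And>k t. (U k has_vector_derivative U (Suc k) t) (at t)"
      "\<And>k \<sigma>. \<sigma> \<in> {\<alpha>, \<beta>} \<Longrightarrow> \<exists>C. \<forall>t. exp (\<sigma> * t) * norm (U k t) \<le> C"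
    using u I unfolding laplace_class_def by blast
  obtain \<delta> C where \<delta>: "\<delta> > 0" "\<And>w t. Re z0 - r \<le> Re w \<Longrightarrow> Re w \<le> Re z0 + r \<Longrightarrow> norm (U 0 t * exp (w * of_real t)) \<le> C * exp (- \<delta> * \<bar>t\<bar>)"
    using laplace_class_bounds[of U \<alpha> \<beta> "Re z0 - r" "Re z0 + r" 0, OF U(2,3) r(2,3)] by blast
  have "rapid (\<lambda>t. of_real (C * exp (- \<delta> * \<bar>t\<bar>)))"
    by (rule rapid_exp_decay[OF \<delta>(1), of _ "\<bar>C\<bar>"]) (simp add: norm_mult)
  hence "integrable lborel (\<lambda>t. complex_of_real (C * exp (- \<delta> * \<bar>t\<bar>)))"
    by (rule rapid_integrable) measurable
  hence "integrable lborel (\<lambda>t. C * exp (- \<delta> * \<bar>t\<bar>))"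
    using integrable_Re by fastforce
  thus "\<exists>r>0. \<exists>w. cball z0 r \<subseteq> {z. \<alpha> < Re z \<and> Re z < \<beta>} \<and> integrable lborel w \<and>
        (\<forall>z\<in>cball z0 r. \<forall>x\<in>space lborel. norm (u x * exp (z * of_real x)) \<le> w x)"
    using r sub \<delta>(2) unfolding U(1) by (intro exI[of _ r] conjI exI[of _ "\<lambda>t. C * exp (- \<delta> * \<bar>t\<bar>)"]) force+
qed

text \<open>Each integration by parts produces a factor \<open>- z\<close>, so the transform of the
  k-th derivative, which is bounded on the strip, controls \<open>norm z ^ k\<close> times the
  transform of \<open>u\<close>.\<close>

lemma laplace_class_decay:
  assumes ab: "\<alpha> < a" "b < \<beta>"
  shows "strip_decay (laplace u) a b"
  unfolding strip_decay_def
proof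
  fix k
  show "\<exists>C. \<forall>z. a \<le> Re z \<longrightarrow> Re z \<le> b \<longrightarrow> (1 + \<bar>Im z\<bar>) ^ k * norm (laplace u z) \<le> C"
  proof -
    obtain U where U: "U 0 = u" "\<And>k t. (U k has_vector_derivative U (Suc k) t) (at t)"
        "\<And>k \<sigma>. \<sigma> \<in> {\<alpha>, \<beta>} \<Longrightarrow> \<exists>C. \<forall>t. exp (\<sigma> * t) * norm (U k t) \<le> C"
      using u I unfolding laplace_class_def by blast
    have cont: "continuous_on A (U k)" for A k
      using U(2) by (metis has_vector_derivative_continuous continuous_at_imp_continuous_on)
    have r: "rapid (\<lambda>t. U k t * exp (z * of_real t))" if z: "a \<le> Re z" "Re z \<le> b" for z k
    proof -
      obtain \<delta> C where "\<delta> > 0" "\<And>w t. a \<le> Re w \<Longrightarrow> Re w \<le> b \<Longrightarrow> norm (U k t * exp (w * of_real t)) \<le> C * exp (- \<delta> * \<bar>t\<bar>)"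
        using laplace_class_bounds[of U \<alpha> \<beta> a b k, OF U(2,3) ab] by blast
      thus ?thesis using z by (intro rapid_exp_decay) auto
    qed
    have int: "integrable lborel (\<lambda>t. U k t * exp (z * of_real t))" if z: "a \<le> Re z" "Re z \<le> b" for z k
      by (intro rapid_integrable r[OF z] borel_measurable_continuous_onI continuous_intros cont)
    have step: "laplace (U (Suc k)) z = - z * laplace (U k) z" if z: "a \<le> Re z" "Re z \<le> b" for z k
    proof -
      have "(LINT t|lborel. U (Suc k) t * exp (z * of_real t) + z * (U k t * exp (z * of_real t))) = 0"
      proof (rule integral_vector_derivative_eq_0[where g = "\<lambda>t. U k t * exp (z * of_real t)"])
        fix t
        have "((\<lambda>t. exp (z * of_real t)) has_vector_derivative z * exp (z * of_real t)) (at t)"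
          by (rule has_vector_derivative_real_field[where f = "\<lambda>w. exp (z * w)"])
            (auto intro!: derivative_eq_intros)
        from has_vector_derivative_mult[OF U(2)[of k t] this]
        show "((\<lambda>t. U k t * exp (z * of_real t)) has_vector_derivative
               U (Suc k) t * exp (z * of_real t) + z * (U k t * exp (z * of_real t))) (at t)"
          by (simp add: algebra_simps)
      qed (use int[OF z] rapid_tendsto_0[OF r[OF z]] cont in \<open>auto intro!: continuous_intros\<close>)
      hence "laplace (U (Suc k)) z + z * laplace (U k) z = 0"
        using int[OF z] unfolding laplace_def by simp
      thus ?thesis by (simp add: add_eq_0_iff2)
    qed
    have pow: "laplace (U k) z = (- z) ^ k * laplace u z" if z: "a \<le> Re z" "Re z \<le> b" for z k
      by (induction k) (auto simp: U(1) step[OF z])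
    have bound: "\<exists>C. \<forall>z. a \<le> Re z \<longrightarrow> Re z \<le> b \<longrightarrow> norm z ^ k * norm (laplace u z) \<le> C" for k
    proof -
      obtain \<delta> C where \<delta>: "\<delta> > 0" "\<And>w t. a \<le> Re w \<Longrightarrow> Re w \<le> b \<Longrightarrow> norm (U k t * exp (w * of_real t)) \<le> C * exp (- \<delta> * \<bar>t\<bar>)"
        using laplace_class_bounds[of U \<alpha> \<beta> a b k, OF U(2,3) ab] by blast
      have "rapid (\<lambda>t. of_real (C * exp (- \<delta> * \<bar>t\<bar>)))"
        by (rule rapid_exp_decay[OF \<delta>(1), of _ "\<bar>C\<bar>"]) (simp add: norm_mult)
      hence "integrable lborel (\<lambda>t. complex_of_real (C * exp (- \<delta> * \<bar>t\<bar>)))"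
        by (rule rapid_integrable) measurable
      hence i: "integrable lborel (\<lambda>t. C * exp (- \<delta> * \<bar>t\<bar>))"
        using integrable_Re by fastforce
      have "norm (laplace (U k) z) \<le> (LINT t|lborel. C * exp (- \<delta> * \<bar>t\<bar>))" if z: "a \<le> Re z" "Re z \<le> b" for z
        unfolding laplace_def by (rule Bochner_Integration.integral_norm_bound_integral[OF int[OF z] i \<delta>(2)[OF z]])
      thus ?thesis using pow by (intro exI[of _ "LINT t|lborel. C * exp (- \<delta> * \<bar>t\<bar>)"])
          (simp add: norm_mult norm_power)
    qed
    obtain C0 where C0: "\<And>z. a \<le> Re z \<Longrightarrow> Re z \<le> b \<Longrightarrow> norm (laplace u z) \<le> C0" using bound[of 0] by auto
    obtain C where C: "\<And>z. a \<le> Re z \<Longrightarrow> Re z \<le> b \<Longrightarrow> norm z ^ k * norm (laplace u z) \<le> C" using bound[of k] by auto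
    have "(1 + \<bar>Im z\<bar>) ^ k * norm (laplace u z) \<le> 2 ^ k * (C0 + C)" if z: "a \<le> Re z" "Re z \<le> b" for z
    proof -
      have "(1 + \<bar>Im z\<bar>) ^ k \<le> (1 + norm z) ^ k" by (intro power_mono) (auto simp: abs_Im_le_cmod)
      also have "\<dots> \<le> 2 ^ k * (1 + norm z ^ k)" by (intro one_plus_power_le) auto
      finally have "(1 + \<bar>Im z\<bar>) ^ k * norm (laplace u z) \<le> 2 ^ k * (1 + norm z ^ k) * norm (laplace u z)"
        by (rule mult_right_mono) auto
      also have "\<dots> = 2 ^ k * (norm (laplace u z) + norm z ^ k * norm (laplace u z))" by (simp add: algebra_simps)
      also have "\<dots> \<le> 2 ^ k * (C0 + C)" using C0[OF z] C[OF z] by (intro mult_left_mono) auto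
      finally show ?thesis .
    qed
    thus ?thesis by blast
  qed
qed

end

subsection \<open>Inversion\<close>

text \<open>The Bromwich integral over \<open>Re z = \<sigma>\<close>; the factor
  \<open>\<i>\<close> of the line element cancels against that in \<open>2 * pi * \<i>\<close>. The
  abscissa stays an argument because independence of it has to be proved from properties of
  \<open>h\<close>.\<close>

definition inv_laplace :: "(complex \<Rightarrow> complex) \<Rightarrow> real \<Rightarrow> real \<Rightarrow> complex" where
  "inv_laplace h \<sigma> t = (LINT \<tau>|lborel. h (Complex \<sigma> \<tau>) * exp (- Complex \<sigma> \<tau> * of_real t)) / of_real (2 * pi)"

lemma exp_Complex_times: "exp (Complex \<sigma> \<tau> * of_real t) = of_real (exp (\<sigma> * t)) * cis (\<tau> * t)"
  by (simp add: exp_eq_polar)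

lemma exp_minus_Complex_times: "exp (- Complex \<sigma> \<tau> * of_real t) = of_real (exp (- \<sigma> * t)) * cis (- \<tau> * t)"
proof -
  have "- Complex \<sigma> \<tau> = Complex (- \<sigma>) (- \<tau>)" by (simp add: complex_eq_iff)
  thus ?thesis using exp_Complex_times[of "-\<sigma>" "-\<tau>" t] by simp
qed

lemma inv_laplace_cis:
  "inv_laplace h \<sigma> t = of_real (exp (- \<sigma> * t)) * (LINT \<tau>|lborel. h (Complex \<sigma> \<tau>) * cis (- 1 * \<tau> * t)) / of_real (2 * pi)"
proof -
  have "(LINT \<tau>|lborel. h (Complex \<sigma> \<tau>) * exp (- Complex \<sigma> \<tau> * of_real t)) =
        (LINT \<tau>|lborel. of_real (exp (- \<sigma> * t)) * (h (Complex \<sigma> \<tau>) * cis (- 1 * \<tau> * t)))"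
    by (intro Bochner_Integration.integral_cong refl) (simp only: exp_minus_Complex_times, simp add: mult_ac)
  thus ?thesis by (simp add: inv_laplace_def)
qed

lemma inv_laplace_bound:
  assumes "integrable lborel (\<lambda>\<tau>. h (Complex \<sigma> \<tau>))"
  obtains C where "\<And>t. exp (\<sigma> * t) * norm (inv_laplace h \<sigma> t) \<le> C"
proof -
  note [measurable] = borel_measurable_integrable[OF assms, simplified]
  define J where "J t = (LINT \<tau>|lborel. h (Complex \<sigma> \<tau>) * cis (- 1 * \<tau> * t))" for t
  have "norm (J t) \<le> (LINT \<tau>|lborel. norm (h (Complex \<sigma> \<tau>)))" for t
    unfolding J_def
    by (intro Bochner_Integration.integral_norm_bound_integral Bochner_Integration.integrable_bound[OF assms] integrable_norm)
      (use assms in \<open>auto simp: norm_mult\<close>)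
  hence "exp (\<sigma> * t) * norm (inv_laplace h \<sigma> t) \<le> (LINT \<tau>|lborel. norm (h (Complex \<sigma> \<tau>))) / (2 * pi)" for t
    unfolding inv_laplace_cis J_def[symmetric]
    by (simp add: norm_mult norm_divide exp_minus field_simps divide_right_mono)
  thus ?thesis using that by blast
qed

text \<open>Passes between the frequency on a vertical line and the variable of
  \<open>fourier\<close>, which differ by the factor \<open>2 * pi\<close>.\<close>

lemma fourier_scale:
  assumes "c > 0"
  shows "(LINT \<tau>|lborel. G (\<tau> / c) * cis (\<tau> * s)) = of_real c * (LINT y|lborel. G y * cis (c * y * s))"
proof -
  have "(LINT \<tau>|lborel. G (\<tau> / c) * cis (\<tau> * s)) =
        \<bar>c\<bar> *\<^sub>R (LINT y|lborel. G ((0 + c * y) / c) * cis ((0 + c * y) * s))"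
    using assms by (intro lborel_integral_real_affine) auto
  thus ?thesis using assms by (simp add: scaleR_conv_of_real)
qed

lemma inv_laplace_laplace:
  assumes u: "integrable lborel (\<lambda>t. u t * of_real (exp (\<sigma> * t)))" "isCont u t"
    and L: "integrable lborel (\<lambda>\<tau>. laplace u (Complex \<sigma> \<tau>))"
  shows "inv_laplace (laplace u) \<sigma> t = u t"
proof -
  \<comment> \<open>On a fixed line the Laplace transform of \<open>u\<close> is the Fourier
    transform of this weighted function, so the claim becomes Fourier inversion.\<close>
  define f where "f t = u t * of_real (exp (\<sigma> * t))" for t
  have fl: "fourier f (\<tau> / (2 * pi)) = laplace u (Complex \<sigma> \<tau>)" for \<tau>
    unfolding fourier_cis laplace_def exp_Complex_times
    by (intro Bochner_Integration.integral_cong refl) (simp add: f_def mult_ac)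
  have fl': "fourier f y = laplace u (Complex \<sigma> (0 + 2 * pi * y))" for y
    using fl[of "2 * pi * y"] by simp
  have Ff: "integrable lborel (fourier f)"
    unfolding fl' by (rule lborel_integrable_real_affine[OF L]) simp
  have "f t = fourier (fourier f) (- t)"
    by (rule fourier_inversion[symmetric]) (use u Ff in \<open>auto simp: f_def[abs_def] intro!: continuous_intros\<close>)
  also have "\<dots> = (LINT y|lborel. fourier f y * cis (2 * pi * y * (- t)))" by (simp add: fourier_cis)
  also have "\<dots> = (LINT \<tau>|lborel. fourier f (\<tau> / (2 * pi)) * cis (\<tau> * (- t))) / of_real (2 * pi)"
    by (subst fourier_scale) auto
  also have "\<dots> = of_real (exp (\<sigma> * t)) * inv_laplace (laplace u) \<sigma> t"
    unfolding fl inv_laplace_cis by (simp add: exp_minus)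
  finally show ?thesis by (simp add: f_def mult.commute)
qed

lemma laplace_inv_laplace:
  assumes h: "integrable lborel (\<lambda>\<tau>. h (Complex \<sigma> \<tau>))" "isCont (\<lambda>\<tau>. h (Complex \<sigma> \<tau>)) \<tau>"
    and u: "integrable lborel (\<lambda>t. inv_laplace h \<sigma> t * of_real (exp (\<sigma> * t)))"
  shows "laplace (inv_laplace h \<sigma>) (Complex \<sigma> \<tau>) = h (Complex \<sigma> \<tau>)"
proof -
  define G where "G y = h (Complex \<sigma> (0 + 2 * pi * y))" for y
  have G: "integrable lborel G" unfolding G_def by (rule lborel_integrable_real_affine[OF h(1)]) simp
  have FG: "fourier G (- t) = inv_laplace h \<sigma> t * of_real (exp (\<sigma> * t))" for t
  proof -
    have "fourier G (- t) = (LINT \<tau>|lborel. G (\<tau> / (2 * pi)) * cis (\<tau> * (- t))) / of_real (2 * pi)"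
      unfolding fourier_cis by (subst fourier_scale) auto
    thus ?thesis unfolding inv_laplace_cis by (simp add: G_def  exp_minus)
  qed
  have FG': "fourier G t = inv_laplace h \<sigma> (0 + (-1) * t) * of_real (exp (\<sigma> * (0 + (-1) * t)))" for t
    using FG[of "-t"] by simp
  have iFG: "integrable lborel (fourier G)"
    unfolding FG' by (rule lborel_integrable_real_affine[OF u]) simp
  have "laplace (inv_laplace h \<sigma>) (Complex \<sigma> \<tau>) = (LINT t|lborel. fourier G (- t) * cis (\<tau> * t))"
    unfolding laplace_def exp_Complex_times FG
    by (intro Bochner_Integration.integral_cong refl) (simp add: )
  also have "\<dots> = \<bar>-1\<bar> *\<^sub>R (LINT t|lborel. fourier G (- (0 + (-1) * t)) * cis (\<tau> * (0 + (-1) * t)))"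
    by (rule lborel_integral_real_affine) auto
  also have "\<dots> = fourier (fourier G) (- (\<tau> / (2 * pi)))"
    unfolding fourier_cis[of "fourier G"] by (simp add: mult_ac)
  also have "\<dots> = G (\<tau> / (2 * pi))"
  proof (rule fourier_inversion[OF G _ iFG])
    have "isCont ((\<lambda>\<tau>. h (Complex \<sigma> \<tau>)) \<circ> (\<lambda>y. 0 + 2 * pi * y)) (\<tau> / (2 * pi))"
      by (rule continuous_at_compose) (use h(2) in \<open>auto intro!: continuous_intros\<close>)
    thus "isCont G (\<tau> / (2 * pi))" by (simp add: G_def[abs_def] o_def)
  qed
  finally show ?thesis by (simp add: G_def)
qed

lemma strip_decay_line_integrable:
  assumes "strip_decay h a b" "continuous_on {z. a \<le> Re z \<and> Re z \<le> b} h" "a \<le> \<sigma>" "\<sigma> \<le> b"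
  shows "continuous_on A (\<lambda>\<tau>. h (Complex \<sigma> \<tau>))" "integrable lborel (\<lambda>\<tau>. h (Complex \<sigma> \<tau>))"
proof -
  show c: "continuous_on A (\<lambda>\<tau>. h (Complex \<sigma> \<tau>))" for A
    by (rule continuous_on_compose2[OF assms(2)]) (use assms in \<open>auto intro!: continuous_intros simp: Complex_eq\<close>)
  show "integrable lborel (\<lambda>\<tau>. h (Complex \<sigma> \<tau>))"
    by (intro rapid_integrable strip_decay_rapid[OF assms(1,3,4)] borel_measurable_continuous_onI c)
qed

text \<open>The integral over the vertical line through \<open>w\<close> is holomorphic in \<open>w\<close> and invariant under
  vertical translations, hence constant.\<close>

lemma vertical_integral_constant:
  assumes cont: "continuous_on {z. a \<le> Re z \<and> Re z \<le> b} k"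
    and hol: "k holomorphic_on {z. a < Re z \<and> Re z < b}"
    and dec: "\<And>z. a \<le> Re z \<Longrightarrow> Re z \<le> b \<Longrightarrow> (1 + \<bar>Im z\<bar>)\<^sup>2 * norm (k z) \<le> C" and C: "C \<ge> 0"
    and \<sigma>: "a \<le> \<sigma>1" "\<sigma>1 \<le> b" "a \<le> \<sigma>2" "\<sigma>2 \<le> b"
  shows "(LINT \<tau>|lborel. k (Complex \<sigma>1 \<tau>)) = (LINT \<tau>|lborel. k (Complex \<sigma>2 \<tau>))"
proof (cases "a < b")
  case False
  thus ?thesis using \<sigma> by (metis order.antisym order.trans linorder_not_le)
next
  case ab: True
  let ?S = "{z. a < Re z \<and> Re z < b}"
  define J where "J w = (LINT \<tau>|lborel. k (w + \<i> * of_real \<tau>))" for w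
  have k_le: "norm (k z) \<le> C * (1 / (1 + \<bar>Im z\<bar>)\<^sup>2)" if "a \<le> Re z" "Re z \<le> b" for z
    using dec[OF that] by (simp add: field_simps)
  have "(\<lambda>\<tau>. k (w + \<i> * of_real \<tau>)) \<in> borel_measurable borel" if "a \<le> Re w" "Re w \<le> b" for w
    by (intro borel_measurable_continuous_onI continuous_on_compose2[OF cont] continuous_intros) (use that in auto)
  hence m [measurable]: "(\<lambda>\<tau>. k (w + \<i> * of_real \<tau>)) \<in> borel_measurable lborel" if "a \<le> Re w" "Re w \<le> b" for w
    using that by simp
  have Jhol: "J holomorphic_on ?S"
    unfolding J_def
  proof (rule holomorphic_integral[OF open_strip])
    show "(\<lambda>z. k (z + \<i> * of_real x)) holomorphic_on ?S" for x
      by (rule holomorphic_on_compose_gen[OF _ hol, unfolded o_def]) (auto intro!: holomorphic_intros)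
    fix z0 assume z0: "z0 \<in> ?S"
    then obtain r0 where r0: "r0 > 0" "cball z0 r0 \<subseteq> ?S" using open_strip open_contains_cball by blast
    define r where "r = min r0 1"
    have r: "r > 0" "r \<le> 1" "cball z0 r \<subseteq> ?S" using r0 by (auto simp: r_def)
    \<comment> \<open>On a disc of radius at most 1 about \<open>z0\<close>, moving the argument by
      \<open>Im z\<close> changes \<open>1 + \<bar>x\<bar>\<close> by at most this factor, so one
      integrable majorant serves the whole disc.\<close>
    define c where "c = 2 + \<bar>Im z0\<bar>"
    show "\<exists>r>0. \<exists>w. cball z0 r \<subseteq> ?S \<and> integrable lborel w \<and>
            (\<forall>z\<in>cball z0 r. \<forall>x\<in>space lborel. norm (k (z + \<i> * of_real x)) \<le> w x)"
    proof (intro exI[of _ r] exI[of _ "\<lambda>x. C * c\<^sup>2 * (1 / (1 + \<bar>x\<bar>)\<^sup>2)"] conjI ballI)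
      show "integrable lborel (\<lambda>x. C * c\<^sup>2 * (1 / (1 + \<bar>x\<bar>)\<^sup>2))"
        by (intro integrable_mult_right integrable_inverse_square)
      fix z x assume z: "z \<in> cball z0 r"
      hence "z \<in> ?S" using r by blast
      hence zS: "a \<le> Re z" "Re z \<le> b" by auto
      have "\<bar>Im z\<bar> \<le> \<bar>Im z0\<bar> + 1"
        using abs_Im_le_cmod[of "z0 - z"] z r(2) by (simp add: dist_norm)
      hence "1 + \<bar>x\<bar> \<le> c + \<bar>Im z + x\<bar>" by (simp add: c_def)
      also have "\<dots> \<le> c * (1 + \<bar>Im z + x\<bar>)" by (simp add: c_def algebra_simps)
      finally have "(1 + \<bar>x\<bar>)\<^sup>2 \<le> (c * (1 + \<bar>Im z + x\<bar>))\<^sup>2" by (intro power_mono) auto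
      hence "(1 + \<bar>x\<bar>)\<^sup>2 \<le> c\<^sup>2 * (1 + \<bar>Im z + x\<bar>)\<^sup>2" by (simp only: power_mult_distrib)
      hence le: "1 / (1 + \<bar>Im z + x\<bar>)\<^sup>2 \<le> c\<^sup>2 * (1 / (1 + \<bar>x\<bar>)\<^sup>2)"
        by (simp add: field_simps)
      have "norm (k (z + \<i> * of_real x)) \<le> C * (1 / (1 + \<bar>Im z + x\<bar>)\<^sup>2)"
        using k_le[of "z + \<i> * of_real x"] zS by simp
      also have "\<dots> \<le> C * (c\<^sup>2 * (1 / (1 + \<bar>x\<bar>)\<^sup>2))" by (intro mult_left_mono le C)
      finally show "norm (k (z + \<i> * of_real x)) \<le> C * c\<^sup>2 * (1 / (1 + \<bar>x\<bar>)\<^sup>2)" by (simp add: mult.assoc)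
    qed (use r in auto)
  qed (use m in auto)
  have Jtrans: "J (w + \<i> * of_real y) = J w" for w y
  proof -
    have "J w = \<bar>1\<bar> *\<^sub>R (LINT \<tau>|lborel. k (w + \<i> * of_real (y + 1 * \<tau>)))"
      unfolding J_def by (rule lborel_integral_real_affine) simp
    thus ?thesis by (simp add: J_def algebra_simps)
  qed
  have "\<exists>c. \<forall>w\<in>?S. J w = c"
  proof (rule has_field_derivative_zero_constant)
    show "convex ?S"
      by (simp only: Collect_conj_eq) (intro convex_Int convex_halfspace_Re_gt convex_halfspace_Re_lt)
    fix w assume w: "w \<in> ?S"
    have d: "(J has_field_derivative deriv J w) (at w)"
      using Jhol open_strip w by (rule holomorphic_derivI)
    have "((\<lambda>y. w + \<i> * of_real y) has_vector_derivative \<i>) (at 0)"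
      by (auto simp: has_vector_derivative_complex_iff intro!: derivative_eq_intros)
    from field_vector_diff_chain_at[OF this, of J "deriv J w"] d
    have "(J \<circ> (\<lambda>y. w + \<i> * of_real y) has_vector_derivative \<i> * deriv J w) (at 0)" by simp
    moreover have "J \<circ> (\<lambda>y. w + \<i> * of_real y) = (\<lambda>_. J w)" by (auto simp: Jtrans fun_eq_iff)
    ultimately have "((\<lambda>_::real. J w) has_vector_derivative \<i> * deriv J w) (at 0)" by simp
    moreover have "((\<lambda>_::real. J w) has_vector_derivative 0) (at 0)" by simp
    ultimately have "\<i> * deriv J w = 0" by (rule vector_derivative_unique_at)
    thus "(J has_field_derivative 0) (at w within ?S)" using d has_field_derivative_at_within by fastforce
  qed
  then obtain c where c: "\<And>w. w \<in> ?S \<Longrightarrow> J w = c" by blast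
  have eq: "(LINT \<tau>|lborel. k (Complex \<sigma> \<tau>)) = J (of_real \<sigma>)" for \<sigma>
    by (simp add: J_def Complex_eq)
  have "J (of_real \<sigma>) = c" if \<sigma>: "a \<le> \<sigma>" "\<sigma> \<le> b" for \<sigma>
  proof -
    \<comment> \<open>Holomorphy gives constancy in the open strip only. A line on the boundary is
      approached by interior lines, on the segment towards the midpoint; this later makes the
      critical line itself available.\<close>
    define X where "X n = \<sigma> + ((a + b) / 2 - \<sigma>) * inverse (real (Suc (Suc n)))" for n
    have X: "a < X n \<and> X n < b" for n
    proof -
      define q where "q = inverse (real (Suc (Suc n)))"
      have q: "0 < q" "q < 1" by (auto simp: q_def inverse_less_1_iff)
      have "X n = (1 - q) * \<sigma> + q * ((a + b) / 2)" by (simp add: X_def q_def algebra_simps)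
      moreover have "(1 - q) * a \<le> (1 - q) * \<sigma>" "(1 - q) * \<sigma> \<le> (1 - q) * b"
        using q \<sigma> by (auto intro!: mult_left_mono)
      moreover have "q * a < q * ((a + b) / 2)" "q * ((a + b) / 2) < q * b"
        using q ab by (auto intro!: mult_strict_left_mono)
      moreover have "(1 - q) * a + q * a = a" "(1 - q) * b + q * b = b" by (simp_all add: algebra_simps)
      ultimately show ?thesis by linarith
    qed
    have Xlim: "X \<longlonglongrightarrow> \<sigma>"
    proof -
      have "(\<lambda>n. \<sigma> + ((a + b) / 2 - \<sigma>) * inverse (real (Suc (Suc n)))) \<longlonglongrightarrow> \<sigma> + ((a + b) / 2 - \<sigma>) * 0"
        by (intro tendsto_add tendsto_mult tendsto_const LIMSEQ_Suc[OF LIMSEQ_inverse_real_of_nat])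
      thus ?thesis by (simp add: X_def[abs_def])
    qed
    have "(\<lambda>n. J (of_real (X n))) \<longlonglongrightarrow> J (of_real \<sigma>)"
      unfolding J_def
    proof (rule integral_dominated_convergence[where w = "\<lambda>\<tau>. C * (1 / (1 + \<bar>\<tau>\<bar>)\<^sup>2)"])
      show "integrable lborel (\<lambda>x. C * (1 / (1 + \<bar>x\<bar>)\<^sup>2))"
        by (intro integrable_mult_right integrable_inverse_square)
      show "AE \<tau> in lborel. norm (k (of_real (X n) + \<i> * of_real \<tau>)) \<le> C * (1 / (1 + \<bar>\<tau>\<bar>)\<^sup>2)" for n
      proof (intro AE_I2)
        fix \<tau>
        show "norm (k (of_real (X n) + \<i> * of_real \<tau>)) \<le> C * (1 / (1 + \<bar>\<tau>\<bar>)\<^sup>2)"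
          using k_le[of "of_real (X n) + \<i> * of_real \<tau>"] X[of n] by simp
      qed
      show "AE \<tau> in lborel. (\<lambda>n. k (of_real (X n) + \<i> * of_real \<tau>)) \<longlonglongrightarrow> k (of_real \<sigma> + \<i> * of_real \<tau>)"
      proof (intro AE_I2 continuous_on_tendsto_compose[OF cont])
        show "(\<lambda>n. of_real (X n) + \<i> * of_real \<tau>) \<longlonglongrightarrow> of_real \<sigma> + \<i> * of_real \<tau>" for \<tau>
          by (intro tendsto_intros Xlim)
      qed (use X \<sigma> in \<open>auto intro!: always_eventually simp: less_imp_le\<close>)
      show "(\<lambda>\<tau>. k (of_real \<sigma> + \<i> * of_real \<tau>)) \<in> borel_measurable lborel" using \<sigma> by (intro m) auto
      show "(\<lambda>\<tau>. k (of_real (X n) + \<i> * of_real \<tau>)) \<in> borel_measurable lborel" for n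
        using X[of n] by (intro m) auto
    qed
    moreover have "J (of_real (X n)) = c" for n using X[of n] by (intro c) auto
    ultimately show ?thesis by (simp add: LIMSEQ_const_iff)
  qed
  thus ?thesis using \<sigma> by (simp add: eq)
qed

lemma inv_laplace_shift:
  assumes cont: "continuous_on {z. a \<le> Re z \<and> Re z \<le> b} h"
    and hol: "h holomorphic_on {z. a < Re z \<and> Re z < b}"
    and dec: "strip_decay h a b"
    and \<sigma>: "a \<le> \<sigma>1" "\<sigma>1 \<le> b" "a \<le> \<sigma>2" "\<sigma>2 \<le> b"
  shows "inv_laplace h \<sigma>1 t = inv_laplace h \<sigma>2 t"
proof -
  define m where "m = max \<bar>a\<bar> \<bar>b\<bar> * \<bar>t\<bar>"
  obtain C where C: "C \<ge> 0" "\<And>z. a \<le> Re z \<Longrightarrow> Re z \<le> b \<Longrightarrow> (1 + \<bar>Im z\<bar>) ^ 2 * norm (h z) \<le> C"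
    using strip_decayD[OF dec] by blast
  have "(LINT \<tau>|lborel. h (Complex \<sigma>1 \<tau>) * exp (- Complex \<sigma>1 \<tau> * of_real t)) =
        (LINT \<tau>|lborel. h (Complex \<sigma>2 \<tau>) * exp (- Complex \<sigma>2 \<tau> * of_real t))"
  proof (rule vertical_integral_constant[where k = "\<lambda>z. h z * exp (- z * of_real t)" and C = "C * exp m", OF _ _ _ _ \<sigma>])
    show "continuous_on {z. a \<le> Re z \<and> Re z \<le> b} (\<lambda>z. h z * exp (- z * of_real t))"
      by (intro continuous_intros cont)
    show "(\<lambda>z. h z * exp (- z * of_real t)) holomorphic_on {z. a < Re z \<and> Re z < b}"
      by (intro holomorphic_intros hol)
    fix z assume z: "a \<le> Re z" "Re z \<le> b"
    have "- (Re z * t) \<le> \<bar>Re z\<bar> * \<bar>t\<bar>" by (metis abs_ge_minus_self abs_mult)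
    also have "\<dots> \<le> m" unfolding m_def using z by (intro mult_right_mono) auto
    finally have "(1 + \<bar>Im z\<bar>) ^ 2 * norm (h z) * exp (- (Re z * t)) \<le> C * exp m"
      using C z by (intro mult_mono) auto
    thus "(1 + \<bar>Im z\<bar>)\<^sup>2 * norm (h z * exp (- z * of_real t)) \<le> C * exp m"
      by (simp add: norm_mult mult.assoc)
  qed (use C in auto)
  thus ?thesis by (simp add: inv_laplace_def)
qed

section \<open>From the half-line to the real line by \<open>x = exp t\<close>\<close>

lemma exp_substitution:
  fixes F :: "real \<Rightarrow> complex"
  assumes m: "(\<lambda>t. F (exp t)) \<in> borel_measurable borel"
  shows "set_integrable lborel {0<..} F \<longleftrightarrow> integrable lborel (\<lambda>t. exp t *\<^sub>R F (exp t))"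
    and "(LINT x:{0<..}|lborel. F x) = (LINT t|lborel. exp t *\<^sub>R F (exp t))"
    and "F absolutely_integrable_on {0<..} \<longleftrightarrow> set_integrable lborel {0<..} F"
proof -
  have rng: "range exp = {0::real<..}" by (auto simp: image_iff) (metis exp_ln)
  have inj: "inj (exp :: real \<Rightarrow> real)" by (simp add: inj_on_def)
  have d: "(exp has_field_derivative exp x) (at x within UNIV)" for x :: real by (rule DERIV_exp)
  have "(\<lambda>x. indicator {0<..} x *\<^sub>R F x) = (\<lambda>x. indicator {0<..} x *\<^sub>R F (exp (ln x)))"
    by (auto simp: indicator_def fun_eq_iff)
  also have "\<dots> \<in> borel_measurable borel"
    by (intro borel_measurable_scaleR borel_measurable_indicator measurable_compose[OF borel_measurable_ln m]) auto
  finally have m1: "(\<lambda>x. indicator {0<..} x *\<^sub>R F x) \<in> borel_measurable lborel" by simp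
  have m2: "(\<lambda>t. exp t *\<^sub>R F (exp t)) \<in> borel_measurable lborel" using m by simp
  show i1: "F absolutely_integrable_on {0<..} \<longleftrightarrow> set_integrable lborel {0<..} F"
    unfolding set_integrable_def using m1 by (simp add: integrable_completion)
  have i2: "(\<lambda>t. exp t *\<^sub>R F (exp t)) absolutely_integrable_on UNIV \<longleftrightarrow> integrable lborel (\<lambda>t. exp t *\<^sub>R F (exp t))"
    unfolding set_integrable_def using m2 by (simp add: integrable_completion)
  show iff: "set_integrable lborel {0<..} F \<longleftrightarrow> integrable lborel (\<lambda>t. exp t *\<^sub>R F (exp t))"
    using absolutely_integrable_change_of_variables_real[of UNIV exp exp F] d i1 i2 by (simp add: rng inj)
  show "(LINT x:{0<..}|lborel. F x) = (LINT t|lborel. exp t *\<^sub>R F (exp t))"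
  proof (cases "integrable lborel (\<lambda>t. exp t *\<^sub>R F (exp t))")
    \<comment> \<open>Without integrability both sides have the default value 0, so the substitution
      formula holds unconditionally.\<close>
    case False
    thus ?thesis using iff
      by (simp add: set_lebesgue_integral_def set_integrable_def not_integrable_integral_eq)
  next
    case True
    have "(LINT t|lborel. exp t *\<^sub>R F (exp t)) = integral UNIV (\<lambda>t. exp t *\<^sub>R F (exp t))"
      using True by (rule integral_lborel[symmetric])
    also have "\<dots> = integral {0<..} F"
      using has_absolute_integral_change_of_variables_real[of UNIV exp exp F "integral {0<..} F"] d True i1 i2 iff
      by (simp add: rng inj)
    also have "\<dots> = (LINT x:{0<..}|lborel. F x)"
      using set_borel_integral_eq_integral(2)[of "{0<..}" F] True iff by simp
    finally show ?thesis by simp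
  qed
qed

lemma mellin_integrand_exp: "exp t *\<^sub>R mellin_integrand f z (exp t) = f (exp t) * exp (z * of_real t)"
  by (simp add: mellin_integrand_def powr_def Ln_of_real scaleR_conv_of_real)

lemma mellin_laplace:
  assumes "(\<lambda>t. f (exp t)) \<in> borel_measurable borel"
  shows "mellin f z = laplace (\<lambda>t. f (exp t)) z"
    and "set_integrable lborel {0<..} (mellin_integrand f z) \<longleftrightarrow>
         integrable lborel (\<lambda>t. f (exp t) * exp (z * of_real t))"
proof -
  have "(\<lambda>t. exp (- t) *\<^sub>R (exp t *\<^sub>R mellin_integrand f z (exp t))) \<in> borel_measurable borel"
    unfolding mellin_integrand_exp using assms by measurable
  hence "(\<lambda>t. mellin_integrand f z (exp t)) \<in> borel_measurable borel"
    by (simp add: exp_minus)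
  note * = exp_substitution[OF this, unfolded mellin_integrand_exp]
  show "mellin f z = laplace (\<lambda>t. f (exp t)) z" 
    "set_integrable lborel {0<..} (mellin_integrand f z) \<longleftrightarrow>
         integrable lborel (\<lambda>t. f (exp t) * exp (z * of_real t))"
    using * by (simp_all add: mellin_def laplace_def)
qed

subsection \<open>The Mellin transform on \<open>H_minus\<close>\<close>

lemma H_minus_iff:
  "f \<in> H_minus \<longleftrightarrow> (\<forall>x\<le>0. f x = 0) \<and> (\<forall>\<sigma>. (\<lambda>t. f (exp t) * of_real (exp (\<sigma> * t))) \<in> schwartz)"
  by (auto simp: H_minus_def schwartz_pos_weight_def schwartz_pos_def powr_def)

text \<open>\<open>H_minus\<close> makes the weighted function Schwartz, whereas the class asks for
  weighted derivatives. The product rule expresses the weighted derivative as the derivative of the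
  weighted function minus \<open>\<sigma>\<close> times that function, and induction goes
  through.\<close>

lemma H_minus_laplace_class:
  assumes "f \<in> H_minus"
  shows "laplace_class UNIV (\<lambda>t. f (exp t))"
proof -
  have S: "(\<lambda>t. f (exp t) * of_real (exp (\<sigma> * t))) \<in> schwartz" for \<sigma> using assms by (simp add: H_minus_iff)
  have "(\<lambda>t. f (exp t)) \<in> schwartz" using S[of 0] by simp
  then obtain D where D: "D 0 = (\<lambda>t. f (exp t))" "\<And>n x. (D n has_vector_derivative D (Suc n) x) (at x)"
    using schwartzE by metis
  have DS: "(\<lambda>t. D n t * of_real (exp (\<sigma> * t))) \<in> schwartz" for n \<sigma>
  proof (induction n)
    case (Suc n)
    obtain g where g: "g \<in> schwartz" "\<And>t. ((\<lambda>t. D n t * of_real (exp (\<sigma> * t))) has_vector_derivative g t) (at t)"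
      using schwartz_derivative[OF Suc] by blast
    have "g t = D n t * of_real (exp (\<sigma> * t) * \<sigma>) + D (Suc n) t * of_real (exp (\<sigma> * t))" for t
    proof -
      have "((\<lambda>t. complex_of_real (exp (\<sigma> * t))) has_vector_derivative of_real (exp (\<sigma> * t) * \<sigma>)) (at t)"
        by (rule has_vector_derivative_of_real) (auto intro!: derivative_eq_intros)
      from vector_derivative_unique_at[OF g(2)[of t] has_vector_derivative_mult[OF D(2)[of n t] this]]
      show ?thesis .
    qed
    hence "(\<lambda>t. D (Suc n) t * of_real (exp (\<sigma> * t))) = (\<lambda>t. g t + (- of_real \<sigma>) * (D n t * of_real (exp (\<sigma> * t))))"
      by (auto simp: fun_eq_iff)
    also have "\<dots> \<in> schwartz" by (intro schwartz_add schwartz_cmult g Suc)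
    finally show ?case .
  qed (use D S in auto)
  have "\<exists>C. \<forall>t. exp (\<sigma> * t) * norm (D k t) \<le> C" for k \<sigma>
  proof -
    obtain C where "\<And>t. norm (D k t * of_real (exp (\<sigma> * t))) \<le> C"
      using rapid_bounded[OF schwartz_rapid[OF DS[of k \<sigma>]]] by blast
    thus ?thesis by (auto simp: norm_mult mult.commute)
  qed
  thus ?thesis unfolding laplace_class_def using D by blast
qed

lemma laplace_class_measurable: "laplace_class I u \<Longrightarrow> u \<in> borel_measurable borel"
  by (intro borel_measurable_continuous_onI laplace_class_continuous)

lemma mellin_H_minus:
  assumes "f \<in> H_minus"
  shows "set_integrable lborel {0<..} (mellin_integrand f s)"
    and "mellin f \<in> entire_schwartz"
    and "mellin f = laplace (\<lambda>t. f (exp t))"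
proof -
  note cls = H_minus_laplace_class[OF assms]
  note ml = mellin_laplace[OF laplace_class_measurable[OF cls]]
  show "set_integrable lborel {0<..} (mellin_integrand f s)"
    unfolding ml using laplace_class_integrable[OF cls UNIV_I UNIV_I, of "Re s - 1" s "Re s + 1"] by simp
  show eq: "mellin f = laplace (\<lambda>t. f (exp t))" by (intro ext ml)
  show "mellin f \<in> entire_schwartz"
    unfolding eq
  proof (rule entire_schwartzI)
    show "strip_decay (laplace (\<lambda>t. f (exp t))) a b" for a b
      by (rule laplace_class_decay[OF cls UNIV_I UNIV_I, of "a - 1" _ _ "b + 1"]) auto
    have "(laplace (\<lambda>t. f (exp t))) field_differentiable at z" for z
      using laplace_class_holomorphic[OF cls UNIV_I UNIV_I, of "Re z - 1" "Re z + 1"]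
      by (rule holomorphic_on_imp_differentiable_at[OF _ open_strip]) auto
    thus "laplace (\<lambda>t. f (exp t)) holomorphic_on UNIV"
      by (simp add: holomorphic_on_def)
  qed
qed

text \<open>The line \<open>Re z = 0\<close> stands for all lines, by
  \<open>entire_schwartz_shift\<close>; the value 0 for \<open>x \<le> 0\<close> matches the
  representation of functions on the positive reals.\<close>

definition inv_mellin :: "(complex \<Rightarrow> complex) \<Rightarrow> real \<Rightarrow> complex" where
  "inv_mellin h x = (if x > 0 then inv_laplace h 0 (ln x) else 0)"

context
  fixes h assumes h: "h \<in> entire_schwartz"
begin

lemma entire_schwartz_line_integrable: "integrable lborel (\<lambda>\<tau>. h (Complex \<sigma> \<tau>))"
  using h by (intro schwartz_integrable) (auto simp: entire_schwartz_def)

lemma entire_schwartz_shift: "inv_laplace h \<sigma>1 t = inv_laplace h \<sigma>2 t"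
proof (rule inv_laplace_shift[where a = "min \<sigma>1 \<sigma>2" and b = "max \<sigma>1 \<sigma>2"])
  have "h holomorphic_on UNIV" using h by (simp add: entire_schwartz_def)
  thus "continuous_on {z. min \<sigma>1 \<sigma>2 \<le> Re z \<and> Re z \<le> max \<sigma>1 \<sigma>2} h"
    "h holomorphic_on {z. min \<sigma>1 \<sigma>2 < Re z \<and> Re z < max \<sigma>1 \<sigma>2}"
    by (auto intro: holomorphic_on_subset holomorphic_on_imp_continuous_on)
qed (auto intro: entire_schwartz_strip_decay h)

text \<open>Moving the contour to \<open>Re z = \<sigma>\<close> absorbs the weight and leaves a
  trigonometric integral of a Schwartz function. Moving it to \<open>\<sigma> - 1\<close> and
  \<open>\<sigma> + 1\<close> yields decay like \<open>exp (- \<bar>t\<bar>)\<close>.\<close>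

lemma inv_laplace_weight_schwartz: "(\<lambda>t. inv_laplace h 0 t * of_real (exp (\<sigma> * t))) \<in> schwartz"
proof -
  have eq: "inv_laplace h 0 t * of_real (exp (\<sigma> * t)) =
        (1 / of_real (2 * pi)) * (LINT \<tau>|lborel. h (Complex \<sigma> \<tau>) * cis (- 1 * \<tau> * t))" for t
    unfolding entire_schwartz_shift[of 0 t \<sigma>] unfolding inv_laplace_cis by (simp add: exp_minus)
  have "\<exists>C. \<forall>t. exp (\<sigma> * t) * norm (inv_laplace h 0 t) \<le> C" for \<sigma>
    using inv_laplace_bound[OF entire_schwartz_line_integrable[of \<sigma>]] entire_schwartz_shift[of 0 _ \<sigma>] by metis
  then obtain C1 C2 where C: "\<And>t. exp ((\<sigma> - 1) * t) * norm (inv_laplace h 0 t) \<le> C1"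
     "\<And>t. exp ((\<sigma> + 1) * t) * norm (inv_laplace h 0 t) \<le> C2" by metis
  have r: "rapid (\<lambda>t. inv_laplace h 0 t * of_real (exp (\<sigma> * t)))"
  proof (rule rapid_exp_decay[of 1])
    show "norm (inv_laplace h 0 t * of_real (exp (\<sigma> * t))) \<le> max C1 C2 * exp (- 1 * \<bar>t\<bar>)" for t
      by (rule exp_interpolate[where \<alpha> = "\<sigma> - 1" and \<beta> = "\<sigma> + 1"])
        (auto intro: order.trans[OF C(1)] order.trans[OF C(2)])
  qed auto
  have "(\<lambda>t. LINT \<tau>|lborel. h (Complex \<sigma> \<tau>) * cis (- 1 * \<tau> * t)) \<in> schwartz"
  proof (rule trig_integral_schwartz)
    have S: "(\<lambda>\<tau>. h (Complex \<sigma> \<tau>)) \<in> schwartz" using h by (auto simp: entire_schwartz_def)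
    show m: "(\<lambda>\<tau>. h (Complex \<sigma> \<tau>)) \<in> borel_measurable borel"
      by (intro borel_measurable_continuous_onI schwartz_continuous S)
    show "integrable lborel (\<lambda>x. \<bar>x\<bar> ^ k * norm (h (Complex \<sigma> x)))" for k
      by (rule rapid_moments[OF schwartz_rapid[OF S] m])
    have "rapid (\<lambda>t. of_real (2 * pi) * (inv_laplace h 0 t * of_real (exp (\<sigma> * t))))"
      by (rule rapid_cmult[OF r])
    thus "rapid (\<lambda>t. LINT \<tau>|lborel. h (Complex \<sigma> \<tau>) * cis (- 1 * \<tau> * t))"
      unfolding eq by simp
  qed
  thus ?thesis unfolding eq by (rule schwartz_cmult)
qed

lemma inv_mellin_exp: "inv_mellin h (exp t) = inv_laplace h 0 t"
  by (simp add: inv_mellin_def)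

lemma inv_mellin_H_minus: "inv_mellin h \<in> H_minus"
  unfolding H_minus_iff inv_mellin_exp using inv_laplace_weight_schwartz by (auto simp: inv_mellin_def)

lemma mellin_inv_mellin: "mellin (inv_mellin h) = h"
proof
  fix z
  define \<sigma> where "\<sigma> = Re z"
  have z: "z = Complex \<sigma> (Im z)" by (simp add: \<sigma>_def)
  have eq: "inv_laplace h 0 = inv_laplace h \<sigma>" by (intro ext entire_schwartz_shift)
  have "mellin (inv_mellin h) z = laplace (inv_laplace h \<sigma>) z"
    unfolding mellin_H_minus(3)[OF inv_mellin_H_minus] inv_mellin_exp eq by simp
  also have "\<dots> = h z"
  proof (subst (1 2) z, rule laplace_inv_laplace[OF entire_schwartz_line_integrable])
    have "(\<lambda>\<tau>. h (Complex \<sigma> \<tau>)) \<in> schwartz" using h by (auto simp: entire_schwartz_def)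
    thus "isCont (\<lambda>\<tau>. h (Complex \<sigma> \<tau>)) (Im z)"
      using schwartz_continuous[of _ UNIV] by (auto simp: continuous_on_eq_continuous_at)
    show "integrable lborel (\<lambda>t. inv_laplace h \<sigma> t * of_real (exp (\<sigma> * t)))"
      using inv_laplace_weight_schwartz[of \<sigma>] unfolding eq by (rule schwartz_integrable)
  qed
  finally show "mellin (inv_mellin h) z = h z" .
qed

end

lemma inv_mellin_mellin:
  assumes "f \<in> H_minus" shows "inv_mellin (mellin f) = f"
proof
  fix x
  note cls = H_minus_laplace_class[OF assms]
  show "inv_mellin (mellin f) x = f x"
  proof (cases "x > 0")
    case True
    have "inv_laplace (laplace (\<lambda>t. f (exp t))) 0 (ln x) = f (exp (ln x))"
    proof (rule inv_laplace_laplace)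
      have S: "(\<lambda>t. f (exp t) * of_real (exp (0 * t))) \<in> schwartz" using assms unfolding H_minus_iff by blast
      thus "integrable lborel (\<lambda>t. f (exp t) * of_real (exp (0 * t)))" by (rule schwartz_integrable)
      show "isCont (\<lambda>t. f (exp t)) (ln x)"
        using schwartz_continuous[OF S, of UNIV] by (auto simp: continuous_on_eq_continuous_at)
      show "integrable lborel (\<lambda>\<tau>. laplace (\<lambda>t. f (exp t)) (Complex 0 \<tau>))"
        using mellin_H_minus(2,3)[OF assms] entire_schwartz_line_integrable by metis
    qed
    thus ?thesis using True by (simp add: inv_mellin_def mellin_H_minus(3)[OF assms])
  next
    case False
    thus ?thesis using assms by (simp add: inv_mellin_def H_minus_iff)
  qed
qed

theorem bij_betw_mellin: "bij_betw mellin H_minus entire_schwartz"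
  by (rule bij_betw_byWitness[where f' = inv_mellin])
    (auto simp: inv_mellin_mellin mellin_inv_mellin mellin_H_minus(2) inv_mellin_H_minus)

lemma mellin_add:
  assumes "set_integrable lborel {0<..} (mellin_integrand f s)" "set_integrable lborel {0<..} (mellin_integrand g s)"
  shows "mellin (\<lambda>x. f x + g x) s = mellin f s + mellin g s"
proof -
  have "mellin_integrand (\<lambda>x. f x + g x) s = (\<lambda>x. mellin_integrand f s x + mellin_integrand g s x)"
    by (auto simp: mellin_integrand_def fun_eq_iff field_simps add_divide_distrib)
  thus ?thesis using assms by (simp add: mellin_def set_integral_add)
qed

lemma mellin_cmult: "mellin (\<lambda>x. c * f x) s = c * mellin f s"
proof -
  have "mellin_integrand (\<lambda>x. c * f x) s = (\<lambda>x. c * mellin_integrand f s x)"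
    by (auto simp: mellin_integrand_def fun_eq_iff)
  thus ?thesis by (simp add: mellin_def)
qed

subsection \<open>The Mellin transform of a Schwartz function\<close>

lemma schwartz_laplace_class:
  assumes "f \<in> schwartz"
  shows "laplace_class {0..} (\<lambda>t. f (exp t))"
proof -
  \<comment> \<open>The Euler operator \<open>x * d/dx\<close> is \<open>d/dt\<close> in the
    variable \<open>x = exp t\<close>. It preserves Schwartz functions, so its iterates supply all
    derivatives of \<open>f (exp t)\<close>.\<close>
  define \<theta> where "\<theta> f = (\<lambda>x. of_real x * vector_derivative f (at x))" for f :: "real \<Rightarrow> complex"
  have d: "(g has_vector_derivative vector_derivative g (at x)) (at x)" and \<theta>: "\<theta> g \<in> schwartz"
    if g: "g \<in> schwartz" for g x
  proof -
    obtain g' where g': "g' \<in> schwartz" "\<And>x. (g has_vector_derivative g' x) (at x)"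
      using schwartz_derivative[OF g] by blast
    hence eq: "vector_derivative g (at x) = g' x" for x by (intro vector_derivative_at)
    show "(g has_vector_derivative vector_derivative g (at x)) (at x)" using g' eq by simp
    show "\<theta> g \<in> schwartz" unfolding \<theta>_def eq by (rule schwartz_mult_ident[OF g'(1)])
  qed
  define U where "U k = (\<lambda>t. (\<theta> ^^ k) f (exp t))" for k
  have S: "(\<theta> ^^ k) f \<in> schwartz" for k by (induction k) (auto simp: assms \<theta>)
  have "(U k has_vector_derivative U (Suc k) t) (at t)" for k t
  proof -
    have "((\<theta> ^^ k) f \<circ> exp has_vector_derivative exp t *\<^sub>R vector_derivative ((\<theta> ^^ k) f) (at (exp t))) (at t)"
      by (rule vector_diff_chain_at) (use DERIV_exp[of t] in \<open>auto intro!: d S simp: has_real_derivative_iff_has_vector_derivative\<close>)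
    thus ?thesis by (simp add: U_def o_def \<theta>_def scaleR_conv_of_real)
  qed
  moreover have "\<exists>C. \<forall>t. exp (\<sigma> * t) * norm (U k t) \<le> C" if \<sigma>: "\<sigma> \<ge> 0" for k \<sigma>
  proof -
    obtain n :: nat where n: "\<sigma> \<le> real n" using real_arch_simple by blast
    obtain C where C: "\<And>x. (1 + \<bar>x\<bar>) ^ n * norm ((\<theta> ^^ k) f x) \<le> C" using rapidD[OF schwartz_rapid[OF S]] by blast
    have "exp (\<sigma> * t) * norm (U k t) \<le> C" for t
    proof -
      have "exp (\<sigma> * t) = exp t powr \<sigma>" by (simp add: powr_def)
      also have "\<dots> \<le> (1 + exp t) powr \<sigma>" using \<sigma> by (intro powr_mono2) auto
      also have "\<dots> \<le> (1 + exp t) powr real n" using n by (intro powr_mono) auto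
      also have "\<dots> = (1 + \<bar>exp t\<bar>) ^ n" by (subst powr_realpow) (auto intro: add_pos_pos)
      finally have "exp (\<sigma> * t) * norm (U k t) \<le> (1 + \<bar>exp t\<bar>) ^ n * norm (U k t)"
        by (rule mult_right_mono) simp
      thus ?thesis using C[of "exp t"] by (simp add: U_def)
    qed
    thus ?thesis by blast
  qed
  ultimately show ?thesis unfolding laplace_class_def
    by (intro exI[of _ U]) (auto simp: U_def)
qed

lemma mellin_schwartz:
  assumes f: "f \<in> schwartz"
  shows "Re z > 0 \<Longrightarrow> set_integrable lborel {0<..} (mellin_integrand f z)"
    and "mellin f = laplace (\<lambda>t. f (exp t))"
    and "mellin f holomorphic_on {z. Re z > 0}"
    and "a > 0 \<Longrightarrow> strip_decay (mellin f) a b"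
proof -
  note cls = schwartz_laplace_class[OF f]
  note ml = mellin_laplace[OF laplace_class_measurable[OF cls]]
  show "set_integrable lborel {0<..} (mellin_integrand f z)" if "Re z > 0"
    unfolding ml using laplace_class_integrable[OF cls, of 0 "Re z + 1" z] that by simp
  show eq: "mellin f = laplace (\<lambda>t. f (exp t))" by (intro ext ml)
  show "strip_decay (mellin f) a b" if "a > 0"
    unfolding eq
    by (rule laplace_class_decay[OF cls, of 0 "max 0 b + 1"]) (use that in auto)
  have "(laplace (\<lambda>t. f (exp t))) field_differentiable at z" if "Re z > 0" for z
    using laplace_class_holomorphic[OF cls, of 0 "Re z + 1"] that
    by (intro holomorphic_on_imp_differentiable_at[OF _ open_strip[of 0 "Re z + 1"]]) auto
  thus "mellin f holomorphic_on {z. Re z > 0}"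
    unfolding eq by (auto simp: holomorphic_on_def intro: field_differentiable_at_within)
qed

text \<open>Through this identity \<open>fourier f 0 = 0\<close> becomes a zero of the Mellin
  transform at 1, which cancels the pole of zeta.\<close>

lemma mellin_1_even:
  assumes i: "integrable lborel f" and ev: "\<And>x. f (- x) = f x"
  shows "2 * mellin f 1 = (LINT x|lborel. f x)"
proof -
  have m1: "mellin f 1 = (LINT x:{0<..}|lborel. f x)"
    unfolding mellin_def by (rule set_lebesgue_integral_cong) (auto simp: mellin_integrand_def)
  have "(LINT x:{0<..}|lborel. f x) = \<bar>-1\<bar> *\<^sub>R (LINT x|lborel. indicator {0<..} (0 + (-1) * x) *\<^sub>R f (0 + (-1) * x))"
    unfolding set_lebesgue_integral_def by (rule lborel_integral_real_affine) auto
  also have "\<dots> = (LINT x|lborel. indicator {..<0} x *\<^sub>R f x)"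
    by (simp add: ev) (intro Bochner_Integration.integral_cong refl, auto simp: indicator_def)
  finally have m2: "mellin f 1 = (LINT x|lborel. indicator {..<0} x *\<^sub>R f x)" using m1 by simp
  have "mellin f 1 + mellin f 1 = (LINT x|lborel. indicator {0<..} x *\<^sub>R f x + indicator {..<0} x *\<^sub>R f x)"
    using i by (subst Bochner_Integration.integral_add)
      (auto simp: m1[unfolded set_lebesgue_integral_def, symmetric] m2[symmetric] intro!: integrable_mult_indicator)
  also have "\<dots> = (LINT x|lborel. f x)"
    using i by (intro integral_cong_AE)
      (auto intro!: AE_I'[of "{0}"] simp: null_sets_def indicator_def split: if_splits)
  finally show ?thesis by simp
qed

section \<open>Poisson summation\<close>

lemma borel_measurable_cnj [measurable (raw)]:
  "f \<in> borel_measurable M \<Longrightarrow> (\<lambda>x. cnj (f x)) \<in> borel_measurable M"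
  by (rule measurable_compose[OF _ borel_measurable_continuous_onI]) (auto intro: continuous_intros)

text \<open>Orthonormality of the characters. The interval is half-open so that its integer
  translates partition the line, as the unfolding in Poisson summation requires.\<close>

lemma integral_unit_interval_cis:
  "(LINT x|lborel. indicator {-(1/2)<..1/2} x *\<^sub>R cis (2 * pi * of_int k * x)) = (if k = 0 then 1 else 0)"
proof (cases "k = 0")
  case True
  have "(LINT x|lborel. indicator {-(1/2)<..1/2::real} x *\<^sub>R (1::complex)) = 1"
    by simp
  thus ?thesis using True by simp
next
  case False
  let ?c = "2 * pi * of_int k :: real"
  have c: "?c \<noteq> 0" using False by simp
  have cis_half: "cis (?c * (1 / 2)) = cis (?c * (-(1/2)))"
  proof -
    have "cis (?c * (1 / 2)) = cis (?c * (-(1/2))) * cis (2 * pi * of_int k)"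
      by (subst cis_mult, rule arg_cong[of _ _ cis]) (simp add: algebra_simps)
    also have "cis (2 * pi * of_int k) = 1" by (rule cis_multiple_2pi) simp
    finally show ?thesis by simp
  qed
  have "((\<lambda>x. cis (?c * x)) has_integral (cis (?c * (1/2)) / (\<i> * of_real ?c) - cis (?c * (-(1/2))) / (\<i> * of_real ?c))) {-(1/2)..1/2}"
  proof (rule fundamental_theorem_of_calculus)
    fix x
    have "((\<lambda>x. cis (?c * x) / (\<i> * of_real ?c)) has_vector_derivative (\<i> * of_real ?c * cis (?c * x)) / (\<i> * of_real ?c)) (at x within {-(1/2)..1/2})"
      by (intro has_vector_derivative_divide has_vector_derivative_at_within[OF has_vector_derivative_cis])
    thus "((\<lambda>x. cis (?c * x) / (\<i> * of_real ?c)) has_vector_derivative cis (?c * x)) (at x within {-(1/2)..1/2})"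
      using c by simp
  qed simp
  hence 0: "integral {-(1/2)..1/2} (\<lambda>x. cis (?c * x)) = 0" using cis_half by (simp add: integral_unique)
  have "set_integrable lborel {-(1/2)..1/2} (\<lambda>x. cis (?c * x))"
    by (rule borel_integrable_atLeastAtMost') (auto intro!: continuous_intros simp: cis_conv_exp)
  hence "(LINT x:{-(1/2)..1/2}|lborel. cis (?c * x)) = 0"
    using 0 set_borel_integral_eq_integral(2) by metis
  moreover have "(LINT x|lborel. indicator {-(1/2)<..1/2} x *\<^sub>R cis (?c * x)) = (LINT x:{-(1/2)..1/2}|lborel. cis (?c * x))"
    unfolding set_lebesgue_integral_def
    by (intro integral_cong_AE AE_I'[of "{-(1/2)}"]) (auto simp: indicator_def split: if_splits)
  ultimately show ?thesis using False by simp
qed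

text \<open>Proved by Bessel's inequality.\<close>

lemma fourier_coefficients_tendsto_0:
  fixes R :: "real \<Rightarrow> complex" and m :: "nat \<Rightarrow> int"
  assumes [measurable]: "R \<in> borel_measurable borel" and B: "\<And>x. norm (R x) \<le> B" and m: "inj m"
  defines "c \<equiv> \<lambda>k::int. LINT x|lborel. indicator {-(1/2)<..1/2} x *\<^sub>R (R x * cis (- (2 * pi * of_int k * x)))"
  shows "(\<lambda>n. c (m n)) \<longlonglongrightarrow> 0"
proof -
  let ?I = "{-(1/2)<..1/2::real}"
  let ?ind = "indicator ?I :: real \<Rightarrow> real"
  have int: "integrable lborel (\<lambda>x. ?ind x *\<^sub>R g x)" if [measurable]: "g \<in> borel_measurable borel" and "\<And>x. norm (g x) \<le> K" for g :: "real \<Rightarrow> complex" and K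
  proof (rule Bochner_Integration.integrable_bound)
    show "integrable lborel (\<lambda>x. ?ind x * K)" by simp
    show "AE x in lborel. norm (?ind x *\<^sub>R g x) \<le> norm (?ind x * K)"
      using that(2) by (auto simp: indicator_def intro: order.trans[OF _ abs_ge_self])
  qed measurable
  have B0: "B \<ge> 0" using B[of 0] norm_ge_zero[of "R 0"] by linarith
  have bessel: "(\<Sum>n<N. (norm (c (m n)))\<^sup>2) \<le> B\<^sup>2" for N
  proof -
    define e where "e n x = cis (2 * pi * of_int (m n) * x)" for n x
    define S where "S x = (\<Sum>n<N. c (m n) * e n x)" for x
    have [measurable]: "e n \<in> borel_measurable borel" for n unfolding e_def by measurable
    have [measurable]: "S \<in> borel_measurable borel" unfolding S_def by measurable
    have ne: "norm (e n x) = 1" for n x by (simp add: e_def)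
    have cnje: "cnj (e n x) = cis (- (2 * pi * of_int (m n) * x))" for n x by (simp add: e_def cis_cnj)
    have orth: "(LINT x|lborel. ?ind x *\<^sub>R (e n x * cnj (e l x))) = (if n = l then 1 else 0)" for n l
    proof -
      have "e n x * cnj (e l x) = cis (2 * pi * of_int (m n - m l) * x)" for x
        by (simp add: e_def cis_cnj cis_mult algebra_simps)
      hence "(LINT x|lborel. ?ind x *\<^sub>R (e n x * cnj (e l x))) = (if m n - m l = 0 then 1 else 0)"
        by (simp only: integral_unit_interval_cis)
      thus ?thesis using m by (auto simp: inj_eq)
    qed
    define K where "K = (\<Sum>n<N. norm (c (m n)))"
    have SK: "norm (S x) \<le> K" for x
      unfolding S_def K_def by (rule sum_norm_le) (simp add: norm_mult ne)
    have iRe: "integrable lborel (\<lambda>x. ?ind x *\<^sub>R (R x * cnj (e n x)))" for n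
      by (rule int[of _ B]) (auto simp: norm_mult ne B cnje)
    have iSe: "integrable lborel (\<lambda>x. ?ind x *\<^sub>R (e n x * cnj (e l x)))" for n l
      by (rule int[of _ 1]) (auto simp: norm_mult ne cnje)
    have RS: "(LINT x|lborel. ?ind x *\<^sub>R (R x * cnj (S x))) = (\<Sum>n<N. c (m n) * cnj (c (m n)))"
    proof -
      have "(LINT x|lborel. ?ind x *\<^sub>R (R x * cnj (S x))) = (LINT x|lborel. (\<Sum>n<N. cnj (c (m n)) * (?ind x *\<^sub>R (R x * cnj (e n x)))))"
        by (intro Bochner_Integration.integral_cong refl) (simp add: S_def sum_distrib_left scaleR_sum_right mult_ac)
      also have "\<dots> = (\<Sum>n<N. cnj (c (m n)) * (LINT x|lborel. ?ind x *\<^sub>R (R x * cnj (e n x))))"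
        by (simp only: Bochner_Integration.integral_sum[OF integrable_mult_right[OF iRe]] integral_mult_right_zero)
      also have "\<dots> = (\<Sum>n<N. c (m n) * cnj (c (m n)))" by (simp add: c_def cnje mult.commute)
      finally show ?thesis .
    qed
    have SS: "(LINT x|lborel. ?ind x *\<^sub>R (S x * cnj (S x))) = (\<Sum>n<N. c (m n) * cnj (c (m n)))"
    proof -
      have "(LINT x|lborel. ?ind x *\<^sub>R (S x * cnj (S x))) =
         (LINT x|lborel. (\<Sum>n<N. \<Sum>l<N. c (m n) * cnj (c (m l)) * (?ind x *\<^sub>R (e n x * cnj (e l x)))))"
        by (intro Bochner_Integration.integral_cong refl)
          (simp add: S_def sum_product scaleR_sum_right mult_ac)
      also have "\<dots> = (\<Sum>n<N. \<Sum>l<N. c (m n) * cnj (c (m l)) * (LINT x|lborel. ?ind x *\<^sub>R (e n x * cnj (e l x))))"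
        by (simp only: Bochner_Integration.integral_sum[OF Bochner_Integration.integrable_sum[OF integrable_mult_right[OF iSe]]]
              Bochner_Integration.integral_sum[OF integrable_mult_right[OF iSe]] integral_mult_right_zero)
      also have "\<dots> = (\<Sum>n<N. c (m n) * cnj (c (m n)))" unfolding orth by (simp add: if_distrib cong: if_cong)
      finally show ?thesis .
    qed
    have iR2: "integrable lborel (\<lambda>x. ?ind x *\<^sub>R (R x * cnj (R x)))"
      using B B0 by (intro int[of _ "B * B"]) (auto simp: norm_mult intro!: mult_mono)
    have K0: "K \<ge> 0" by (simp add: K_def sum_nonneg)
    have iRS: "integrable lborel (\<lambda>x. ?ind x *\<^sub>R (R x * cnj (S x)))" "integrable lborel (\<lambda>x. ?ind x *\<^sub>R (S x * cnj (R x)))"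
       "integrable lborel (\<lambda>x. ?ind x *\<^sub>R (S x * cnj (S x)))"
      using B B0 SK K0 by (intro int[of _ "B * K"] int[of _ "K * B"] int[of _ "K * K"]; auto simp: norm_mult intro!: mult_mono)+
    have SR: "(LINT x|lborel. ?ind x *\<^sub>R (S x * cnj (R x))) = (\<Sum>n<N. c (m n) * cnj (c (m n)))"
    proof -
      have "(LINT x|lborel. ?ind x *\<^sub>R (S x * cnj (R x))) = (LINT x|lborel. cnj (?ind x *\<^sub>R (R x * cnj (S x))))"
        by (intro Bochner_Integration.integral_cong refl) (simp add: mult.commute)
      also have "\<dots> = cnj (LINT x|lborel. ?ind x *\<^sub>R (R x * cnj (S x)))" by (rule Bochner_Integration.integral_cnj)
      finally show ?thesis by (simp add: RS mult.commute)
    qed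
    \<comment> \<open>The square of the error \<open>R - S\<close> has nonnegative integral, and
      each of the three inner products involving the partial sum \<open>S\<close> equals the sum of
      the squared coefficients.\<close>
    have "(LINT x|lborel. ?ind x *\<^sub>R ((R x - S x) * cnj (R x - S x))) =
       (LINT x|lborel. ?ind x *\<^sub>R (R x * cnj (R x)) - ?ind x *\<^sub>R (R x * cnj (S x)) - ?ind x *\<^sub>R (S x * cnj (R x)) + ?ind x *\<^sub>R (S x * cnj (S x)))"
      by (intro Bochner_Integration.integral_cong refl) (simp add: algebra_simps)
    also have "\<dots> = (LINT x|lborel. ?ind x *\<^sub>R (R x * cnj (R x))) - (\<Sum>n<N. c (m n) * cnj (c (m n)))"
      using iR2 iRS by (simp add: RS SS SR)
    finally have eq: "(LINT x|lborel. ?ind x *\<^sub>R ((R x - S x) * cnj (R x - S x))) + (\<Sum>n<N. c (m n) * cnj (c (m n))) = (LINT x|lborel. ?ind x *\<^sub>R (R x * cnj (R x)))" by simp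
    have norm2: "?ind x *\<^sub>R (w * cnj w) = of_real (?ind x * (norm w)\<^sup>2)" for x w
      unfolding of_real_mult complex_norm_square by (simp add: scaleR_conv_of_real)
    have sum2: "(\<Sum>n<N. c (m n) * cnj (c (m n))) = of_real (\<Sum>n<N. (norm (c (m n)))\<^sup>2)"
      unfolding of_real_sum complex_norm_square ..
    have "of_real ((LINT x|lborel. ?ind x * (norm (R x - S x))\<^sup>2) + (\<Sum>n<N. (norm (c (m n)))\<^sup>2)) = complex_of_real (LINT x|lborel. ?ind x * (norm (R x))\<^sup>2)"
      using eq unfolding norm2 integral_complex_of_real sum2 by (simp only: of_real_add)
    hence "(LINT x|lborel. ?ind x * (norm (R x - S x))\<^sup>2) + (\<Sum>n<N. (norm (c (m n)))\<^sup>2) = (LINT x|lborel. ?ind x * (norm (R x))\<^sup>2)"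
      by (simp only: of_real_eq_iff)
    moreover have "(LINT x|lborel. ?ind x * (norm (R x - S x))\<^sup>2) \<ge> 0" by (rule integral_nonneg_AE) auto
    moreover have "(LINT x|lborel. ?ind x * (norm (R x))\<^sup>2) \<le> (LINT x|lborel. ?ind x * B\<^sup>2)"
    proof (rule integral_mono)
      have "integrable lborel (\<lambda>x. norm (?ind x *\<^sub>R (R x * cnj (R x))))" using iR2 by (rule integrable_norm)
      thus "integrable lborel (\<lambda>x. ?ind x * (norm (R x))\<^sup>2)" by (simp add: norm_mult power2_eq_square)
      show "?ind x * (norm (R x))\<^sup>2 \<le> ?ind x * B\<^sup>2" for x using B by (intro mult_left_mono power_mono) auto
    qed simp
    moreover have "(LINT x|lborel. ?ind x * B\<^sup>2) = B\<^sup>2" by simp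
    ultimately show ?thesis by linarith
  qed
  have "summable (\<lambda>n. (norm (c (m n)))\<^sup>2)"
    by (rule bounded_imp_summable[of _ "B\<^sup>2"]) (use bessel[of "Suc _"] in \<open>auto simp: lessThan_Suc_atMost\<close>)
  hence "(\<lambda>n. (norm (c (m n)))\<^sup>2) \<longlonglongrightarrow> 0" by (rule summable_LIMSEQ_zero)
  hence "(\<lambda>n. sqrt ((norm (c (m n)))\<^sup>2)) \<longlonglongrightarrow> sqrt 0" by (intro tendsto_real_sqrt)
  thus ?thesis by (simp add: tendsto_norm_zero_iff)
qed

lemma summable_inverse_square_Suc: "summable (\<lambda>n. 1 / (1 + real (Suc n))\<^sup>2)"
  using summable_ignore_initial_segment[OF inverse_power_summable[of 2, where 'a = real], of 2]
  by (simp add: divide_inverse power2_eq_square algebra_simps)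

text \<open>Chernoff's argument: if \<open>P\<close> is the periodisation of \<open>f\<close>, then \<open>P - P 0 = R * (cis (2 * pi * x) - 1)\<close>
  with \<open>R\<close> bounded, so that the Fourier coefficients of \<open>P - P 0\<close> telescope.\<close>

theorem poisson_summation:
  assumes f: "f \<in> schwartz"
  shows "(\<lambda>N. fourier f 0 + (\<Sum>n<N. fourier f (real (Suc n)) + fourier f (- real (Suc n))))
           \<longlonglongrightarrow> f 0 + (\<Sum>n. f (real (Suc n)) + f (- real (Suc n)))"
proof -
  let ?I = "{-(1/2)<..1/2::real}"
  let ?ind = "indicator ?I :: real \<Rightarrow> real"
  note [measurable] = borel_measurable_continuous_onI[OF schwartz_continuous[OF f]]
  obtain f' where f': "f' \<in> schwartz" "\<And>x. (f has_vector_derivative f' x) (at x)"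
    using schwartz_derivative[OF f] by blast
  \<comment> \<open>One bound per integer \<open>m\<close>, valid on the whole window of half-width
    \<open>1/2\<close> around it. It is used for \<open>f\<close>, to sum the periodisation, and for
    its derivative, to get a Lipschitz estimate at 0.\<close>
  have decay: "\<exists>C\<ge>0. \<forall>y m. \<bar>y - m\<bar> \<le> 1/2 \<longrightarrow> norm (g y) \<le> C * (1 / (1 + \<bar>m\<bar>)\<^sup>2)" if g: "g \<in> schwartz" for g
  proof -
    obtain C where C: "C \<ge> 0" "\<And>x. (1 + \<bar>x\<bar>)\<^sup>2 * norm (g x) \<le> C" using rapidD[OF schwartz_rapid[OF g]] by blast
    have "norm (g y) \<le> 4 * C * (1 / (1 + \<bar>m\<bar>)\<^sup>2)" if "\<bar>y - m\<bar> \<le> 1/2" for y m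
    proof -
      have "1 + \<bar>m\<bar> \<le> 2 * (1 + \<bar>y\<bar>)" using that by (smt (verit) field_sum_of_halves)
      hence "(1 + \<bar>m\<bar>)\<^sup>2 \<le> (2 * (1 + \<bar>y\<bar>))\<^sup>2" by (intro power_mono) auto
      also have "\<dots> = 4 * (1 + \<bar>y\<bar>)\<^sup>2" by (simp only: power_mult_distrib) simp
      finally have "(1 + \<bar>m\<bar>)\<^sup>2 * norm (g y) \<le> 4 * (1 + \<bar>y\<bar>)\<^sup>2 * norm (g y)" by (rule mult_right_mono) simp
      also have "\<dots> \<le> 4 * C" using C(2)[of y] by simp
      finally show ?thesis by (simp add: field_simps)
    qed
    thus ?thesis using C(1) by (intro exI[of _ "4 * C"]) auto
  qed
  obtain C where C: "C \<ge> 0" "\<And>y m. \<bar>y - m\<bar> \<le> 1/2 \<Longrightarrow> norm (f y) \<le> C * (1 / (1 + \<bar>m\<bar>)\<^sup>2)" using decay[OF f] by blast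
  obtain C' where C': "C' \<ge> 0" "\<And>y m. \<bar>y - m\<bar> \<le> 1/2 \<Longrightarrow> norm (f' y) \<le> C' * (1 / (1 + \<bar>m\<bar>)\<^sup>2)" using decay[OF f'(1)] by blast
  define p where "p n x = f (x + real (Suc n)) + f (x - real (Suc n))" for n x
  have [measurable]: "p n \<in> borel_measurable borel" for n unfolding p_def by measurable
  define q where "q n = 1 / (1 + real (Suc n))\<^sup>2" for n
  have q: "summable q" unfolding q_def[abs_def] by (rule summable_inverse_square_Suc)
  have q0: "q n \<ge> 0" for n by (simp add: q_def)
  have p_le: "norm (p n x) \<le> 2 * C * q n" if "\<bar>x\<bar> \<le> 1/2" for n x
  proof -
    have "norm (f (x + real (Suc n))) \<le> C * q n" "norm (f (x - real (Suc n))) \<le> C * q n"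
      using C(2)[of "x + real (Suc n)" "real (Suc n)"] C(2)[of "x - real (Suc n)" "- real (Suc n)"] that
      by (simp_all add: q_def)
    thus ?thesis unfolding p_def by (intro norm_triangle_le) simp
  qed
  have lip: "norm (f (x + m) - f m) \<le> C' * (1 / (1 + \<bar>m\<bar>)\<^sup>2) * \<bar>x\<bar>" if "\<bar>x\<bar> \<le> 1/2" for x m
  proof -
    have "norm (f (x + m) - f m) \<le> C' * (1 / (1 + \<bar>m\<bar>)\<^sup>2) * \<bar>(x + m) - m\<bar>"
    proof (rule norm_diff_le_vector_derivative_bound[OF f'(2)])
      fix t assume "t \<in> closed_segment m (x + m)"
      hence "\<bar>t - m\<bar> \<le> 1/2" using that by (auto simp: closed_segment_eq_real_ivl split: if_splits)
      thus "norm (f' t) \<le> C' * (1 / (1 + \<bar>m\<bar>)\<^sup>2)" by (rule C'(2))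
    qed
    thus ?thesis by simp
  qed
  have p_lip: "norm (p n x - p n 0) \<le> 2 * C' * q n * \<bar>x\<bar>" if "\<bar>x\<bar> \<le> 1/2" for n x
  proof -
    have "p n x - p n 0 = (f (x + real (Suc n)) - f (real (Suc n))) + (f (x + (- real (Suc n))) - f (- real (Suc n)))"
      by (simp add: p_def del: of_nat_Suc)
    also have "norm \<dots> \<le> C' * q n * \<bar>x\<bar> + C' * q n * \<bar>x\<bar>"
      using lip[OF that, of "real (Suc n)"] lip[OF that, of "- real (Suc n)"]
      by (intro norm_triangle_mono) (simp_all add: q_def)
    finally show ?thesis by (simp add: mult_ac)
  qed
  define P where "P x = f x + (\<Sum>n. p n x)" for x
  have p_summable: "summable (\<lambda>n. p n x)" if "\<bar>x\<bar> \<le> 1/2" for x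
    by (rule summable_comparison_test'[of "\<lambda>n. 2 * C * q n" 0]) (use p_le[OF that] q in \<open>auto intro!: summable_mult\<close>)
  have [measurable]: "P \<in> borel_measurable borel" unfolding P_def by measurable
  define Q where "Q = (\<Sum>n. q n)"
  have P_le: "norm (P x) \<le> C + 2 * C * Q" and PM_le: "norm (f x + (\<Sum>n<M. p n x)) \<le> C + 2 * C * Q" if "\<bar>x\<bar> \<le> 1/2" for x M
  proof -
    have fx: "norm (f x) \<le> C" using C(2)[of x 0] that by simp
    have s: "summable (\<lambda>n. norm (p n x))"
      by (rule summable_comparison_test'[of "\<lambda>n. 2 * C * q n" 0]) (use p_le[OF that] q in \<open>auto intro!: summable_mult\<close>)
    have "norm (\<Sum>n. p n x) \<le> (\<Sum>n. norm (p n x))" by (rule summable_norm[OF s])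
    also have le: "\<dots> \<le> (\<Sum>n. 2 * C * q n)"
      using s q p_le[OF that] by (intro suminf_le) (auto intro!: summable_mult)
    also have Q: "\<dots> = 2 * C * Q" using q by (simp add: Q_def suminf_mult)
    finally have "norm (\<Sum>n. p n x) \<le> 2 * C * Q" .
    thus "norm (P x) \<le> C + 2 * C * Q" unfolding P_def using fx by (intro norm_triangle_mono)
    have "norm (\<Sum>n<M. p n x) \<le> (\<Sum>n<M. norm (p n x))" by (rule norm_sum)
    also have "\<dots> \<le> (\<Sum>n. norm (p n x))" by (rule sum_le_suminf[OF s]) auto
    also note le
    also note Q
    finally show "norm (f x + (\<Sum>n<M. p n x)) \<le> C + 2 * C * Q" using fx by (intro norm_triangle_mono)
  qed
  have P_lip: "norm (P x - P 0) \<le> (C' + 2 * C' * Q) * \<bar>x\<bar>" if x: "\<bar>x\<bar> \<le> 1/2" for x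
  proof -
    have "P x - P 0 = (f (x + 0) - f 0) + ((\<Sum>n. p n x) - (\<Sum>n. p n 0))" by (simp add: P_def)
    also have "(\<Sum>n. p n x) - (\<Sum>n. p n 0) = (\<Sum>n. p n x - p n 0)"
      using p_summable[OF x] p_summable[of 0] by (subst suminf_diff) auto
    finally have eq: "P x - P 0 = (f (x + 0) - f 0) + (\<Sum>n. p n x - p n 0)" .
    have s': "summable (\<lambda>n. 2 * C' * q n * \<bar>x\<bar>)" using q by (intro summable_mult2 summable_mult)
    have s: "summable (\<lambda>n. norm (p n x - p n 0))"
      by (rule summable_comparison_test'[OF s', of 0]) (use p_lip[OF x] in auto)
    have "norm (\<Sum>n. p n x - p n 0) \<le> (\<Sum>n. norm (p n x - p n 0))" by (rule summable_norm[OF s])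
    also have "\<dots> \<le> (\<Sum>n. 2 * C' * q n * \<bar>x\<bar>)"
      using s s' p_lip[OF x] by (intro suminf_le) auto
    also have "\<dots> = 2 * C' * Q * \<bar>x\<bar>" using q by (simp add: Q_def suminf_mult suminf_mult2[symmetric] summable_mult)
    finally have "norm (\<Sum>n. p n x - p n 0) \<le> 2 * C' * Q * \<bar>x\<bar>" .
    moreover have "norm (f (x + 0) - f 0) \<le> C' * \<bar>x\<bar>" using lip[OF x, of 0] by simp
    ultimately have "norm (P x - P 0) \<le> C' * \<bar>x\<bar> + 2 * C' * Q * \<bar>x\<bar>"
      unfolding eq by (intro norm_triangle_mono)
    thus ?thesis by (simp add: algebra_simps)
  qed
  define R where "R x = ?ind x *\<^sub>R ((P x - P 0) / (cis (2 * pi * x) - 1))" for x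
  have [measurable]: "R \<in> borel_measurable borel" unfolding R_def by measurable
  \<comment> \<open>Jordan's inequality, from concavity of the sine: the denominator of
    \<open>R\<close> vanishes at 0 to first order only and nowhere else on the interval, so the
    Lipschitz bound on \<open>P\<close> bounds \<open>R\<close>.\<close>
  have cis_ge: "4 * \<bar>x\<bar> \<le> norm (cis (2 * pi * x) - 1)" if "\<bar>x\<bar> \<le> 1/2" for x
  proof -
    have "norm (cis (2 * pi * x) - 1) = 2 * \<bar>sin (pi * x)\<bar>"
    proof -
      have "cis (2 * pi * x) - 1 = cis (pi * x) * (2 * \<i> * of_real (sin (pi * x)))"
        using sin_squared_eq[of "pi * x"] 
        by (auto simp: complex_eq_iff cos_double_sin sin_double power2_eq_square mult.assoc simp flip: mult_2)
      thus ?thesis by (simp add: norm_mult)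
    qed
    moreover have "2 * \<bar>x\<bar> \<le> \<bar>sin (pi * x)\<bar>"
    proof -
      have *: "2 * y \<le> sin (pi * y)" if "0 \<le> y" "y \<le> 1/2" for y
      proof -
        have "concave_on {0..pi} sin"
          by (rule f''_le0_imp_concave[of _ _ cos "\<lambda>x. - sin x"]) (auto intro!: derivative_eq_intros simp: sin_ge_zero)
        hence "(1 - 2 * y) * sin 0 + (2 * y) * sin (pi / 2) \<le> sin ((1 - 2 * y) *\<^sub>R 0 + (2 * y) *\<^sub>R (pi / 2))"
          using that by (intro concave_onD) auto
        thus ?thesis by (simp add: mult.commute)
      qed
      show ?thesis
      proof (cases "x \<ge> 0")
        case True
        thus ?thesis using *[of x] that by simp
      next
        case False
        thus ?thesis using *[of "-x"] that by simp
      qed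
    qed
    ultimately show ?thesis by linarith
  qed
  have Q0: "Q \<ge> 0" unfolding Q_def by (rule suminf_nonneg[OF q q0])
  define B where "B = (C' + 2 * C' * Q) / 4"
  have B0: "B \<ge> 0" using Q0 C'(1) by (simp add: B_def)
  have R_le: "norm (R x) \<le> B" for x
  proof (cases "x \<in> ?I \<and> x \<noteq> 0")
    case True
    hence x: "\<bar>x\<bar> \<le> 1/2" "\<bar>x\<bar> > 0" by auto
    have "norm (R x) = norm (P x - P 0) / norm (cis (2 * pi * x) - 1)"
      using True by (simp add: R_def norm_divide)
    also have "\<dots> \<le> (C' + 2 * C' * Q) * \<bar>x\<bar> / (4 * \<bar>x\<bar>)"
      using cis_ge[OF x(1)] P_lip[OF x(1)] x Q0 C'(1) by (intro frac_le) auto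
    finally have "norm (R x) \<le> (C' + 2 * C' * Q) * \<bar>x\<bar> / (4 * \<bar>x\<bar>)" .
    thus ?thesis using x by (simp add: B_def)
  next
    case False
    thus ?thesis using B0 by (auto simp: R_def)
  qed
  \<comment> \<open>At \<open>x = 0\<close> the quotient has the default value 0, and the identity
    survives because both sides vanish there.\<close>
  have R_eq: "?ind x *\<^sub>R (P x - P 0) = ?ind x *\<^sub>R (R x * (cis (2 * pi * x) - 1))" for x
  proof (cases "x \<in> ?I \<and> x \<noteq> 0")
    case True
    hence "\<bar>x\<bar> \<le> 1/2" "x \<noteq> 0" by auto
    hence "norm (cis (2 * pi * x) - 1) \<noteq> 0" using cis_ge[of x] by auto
    thus ?thesis by (simp add: R_def indicator_def)
  next
    case False
    thus ?thesis by (auto simp: indicator_def)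
  qed
  have int: "integrable lborel (\<lambda>x. ?ind x *\<^sub>R g x)" if [measurable]: "g \<in> borel_measurable borel" and "\<And>x. \<bar>x\<bar> \<le> 1/2 \<Longrightarrow> norm (g x) \<le> K" for g :: "real \<Rightarrow> complex" and K
  proof (rule Bochner_Integration.integrable_bound)
    show "integrable lborel (\<lambda>x. ?ind x * K)" by simp
    show "AE x in lborel. norm (?ind x *\<^sub>R g x) \<le> norm (?ind x * K)"
    proof (intro AE_I2)
      fix x
      have "\<bar>x\<bar> \<le> 1/2" if "x \<in> ?I" using that by auto
      with that(2)[of x] show "norm (?ind x *\<^sub>R g x) \<le> norm (?ind x * K)"
        by (cases "x \<in> ?I") auto
    qed
  qed measurable
  define c where "c g k = (LINT x|lborel. ?ind x *\<^sub>R (g x * cis (- (2 * pi * of_int k * x))))" for g :: "real \<Rightarrow> complex" and k :: int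
  have cP: "c P k = fourier f (- of_int k)" for k
  proof -
    define ec where "ec x = cis (- (2 * pi * of_int k * x))" for x
    have [measurable]: "ec \<in> borel_measurable borel" unfolding ec_def by measurable
    have ne: "norm (ec x) = 1" for x by (simp add: ec_def)
    have ec_shift: "ec (x + of_int j) = ec x" for x j
    proof -
      have "ec (x + of_int j) = ec x * cis (2 * pi * of_int (- k * j))" by (simp add: ec_def cis_mult algebra_simps)
      also have "cis (2 * pi * of_int (- k * j)) = 1" by (rule cis_multiple_2pi) (rule Ints_of_int)
      finally show ?thesis by simp
    qed
    \<comment> \<open>Integrating the translate by \<open>j\<close> over the unit interval is
      integrating \<open>f\<close> over the cell of points with
      \<open>\<lceil>x - 1/2\<rceil> = j\<close>, since the character is 1-periodic.\<close>
    have shift: "(LINT x|lborel. ?ind x *\<^sub>R (f (x + of_int j) * ec x)) = (LINT x|lborel. (if \<lceil>x - 1/2\<rceil> = j then f x * ec x else 0))" for j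
    proof -
      have "(LINT x|lborel. ?ind x *\<^sub>R (f (x + of_int j) * ec x)) =
         \<bar>1\<bar> *\<^sub>R (LINT x|lborel. ?ind (- of_int j + 1 * x) *\<^sub>R (f ((- of_int j + 1 * x) + of_int j) * ec (- of_int j + 1 * x)))"
        by (rule lborel_integral_real_affine) simp
      also have "\<dots> = (LINT x|lborel. (if \<lceil>x - 1/2\<rceil> = j then f x * ec x else 0))"
      proof (simp, intro Bochner_Integration.integral_cong refl)
        fix x
        have "ec (x - of_int j) = ec x" using ec_shift[of x "-j"] by simp
        moreover have "x - of_int j \<in> ?I \<longleftrightarrow> \<lceil>x - 1/2\<rceil> = j" by (auto simp: ceiling_eq_iff)
        ultimately show "?ind (x - of_int j) *\<^sub>R (f x * ec (x - of_int j)) = (if \<lceil>x - 1/2\<rceil> = j then f x * ec x else 0)"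
          by (simp add: indicator_def)
      qed
      finally show ?thesis .
    qed
    have i1: "integrable lborel (\<lambda>x. ?ind x *\<^sub>R (f (x + of_int j) * ec x))" for j
    proof -
      obtain K where "\<And>x. norm (f x) \<le> K" using rapid_bounded[OF schwartz_rapid[OF f]] by blast
      thus ?thesis by (intro int[of _ K]) (auto simp: norm_mult ne)
    qed
    have i2: "integrable lborel (\<lambda>x. if \<lceil>x - 1/2\<rceil> = j then f x * ec x else 0)" for j
      by (rule Bochner_Integration.integrable_bound[OF schwartz_integrable[OF f]]) (auto simp: norm_mult ne)
    let ?SM = "\<lambda>M x. f x + (\<Sum>n<M. p n x)"
    have "\<bar>\<lceil>x - 1/2\<rceil>\<bar> \<le> int M \<longleftrightarrow> - real M - 1 < x - 1/2 \<and> x - 1/2 \<le> real M" for x M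
      unfolding abs_le_iff minus_le_iff[of "\<lceil>x - 1/2\<rceil>"] le_ceiling_iff ceiling_le_iff by auto
    hence [measurable]: "(\<lambda>x. if \<bar>\<lceil>x - 1/2\<rceil>\<bar> \<le> int M then f x * ec x else 0) \<in> borel_measurable borel" for M
      by simp
    \<comment> \<open>The M-th symmetric partial sum unfolds to the integral over the cells with
      index at most \<open>M\<close> in absolute value; letting \<open>M\<close> grow gives the
      whole line.\<close>
    have SM_eq: "(LINT x|lborel. ?ind x *\<^sub>R (?SM M x * ec x)) = (LINT x|lborel. (if \<bar>\<lceil>x - 1/2\<rceil>\<bar> \<le> int M then f x * ec x else 0))" for M
    proof (induction M)
      case 0
      show ?case using shift[of 0] by simp
    next
      case (Suc M)
      let ?j = "int (Suc M)"
      have iM: "integrable lborel (\<lambda>x. ?ind x *\<^sub>R (?SM M x * ec x))"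
        using PM_le by (intro int[of _ "C + 2 * C * Q"]) (auto simp: norm_mult ne)
      have iM': "integrable lborel (\<lambda>x. if \<bar>\<lceil>x - 1/2\<rceil>\<bar> \<le> int M then f x * ec x else 0)"
        by (rule Bochner_Integration.integrable_bound[OF schwartz_integrable[OF f]]) (auto simp: norm_mult ne)
      have "(LINT x|lborel. ?ind x *\<^sub>R (?SM (Suc M) x * ec x)) =
        (LINT x|lborel. ?ind x *\<^sub>R (?SM M x * ec x) + (?ind x *\<^sub>R (f (x + of_int ?j) * ec x) + ?ind x *\<^sub>R (f (x + of_int (- ?j)) * ec x)))"
        by (intro Bochner_Integration.integral_cong refl) (simp add: p_def algebra_simps)
      also have "\<dots> = (LINT x|lborel. ?ind x *\<^sub>R (?SM M x * ec x)) + ((LINT x|lborel. ?ind x *\<^sub>R (f (x + of_int ?j) * ec x)) + (LINT x|lborel. ?ind x *\<^sub>R (f (x + of_int (- ?j)) * ec x)))"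
        using iM i1[of ?j] i1[of "- ?j"] by (subst Bochner_Integration.integral_add; (intro Bochner_Integration.integrable_add)?; simp?)+
      also have "\<dots> = (LINT x|lborel. (if \<bar>\<lceil>x - 1/2\<rceil>\<bar> \<le> int M then f x * ec x else 0)) + ((LINT x|lborel. (if \<lceil>x - 1/2\<rceil> = ?j then f x * ec x else 0)) + (LINT x|lborel. (if \<lceil>x - 1/2\<rceil> = - ?j then f x * ec x else 0)))"
        by (simp only: Suc shift)
      also have "\<dots> = (LINT x|lborel. (if \<bar>\<lceil>x - 1/2\<rceil>\<bar> \<le> int M then f x * ec x else 0) + ((if \<lceil>x - 1/2\<rceil> = ?j then f x * ec x else 0) + (if \<lceil>x - 1/2\<rceil> = - ?j then f x * ec x else 0)))"
        using iM' i2[of ?j] i2[of "- ?j"] by (subst Bochner_Integration.integral_add; (intro Bochner_Integration.integrable_add)?; simp?)+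
      also have "\<dots> = (LINT x|lborel. (if \<bar>\<lceil>x - 1/2\<rceil>\<bar> \<le> int (Suc M) then f x * ec x else 0))"
        by (intro Bochner_Integration.integral_cong refl) auto
      finally show ?case .
    qed
    have "(\<lambda>M. LINT x|lborel. ?ind x *\<^sub>R (?SM M x * ec x)) \<longlonglongrightarrow> (LINT x|lborel. ?ind x *\<^sub>R (P x * ec x))"
    proof (rule integral_dominated_convergence[where w = "\<lambda>x. ?ind x * (C + 2 * C * Q)"])
      show "AE x in lborel. (\<lambda>M. ?ind x *\<^sub>R (?SM M x * ec x)) \<longlonglongrightarrow> ?ind x *\<^sub>R (P x * ec x)"
      proof (intro AE_I2)
        fix x
        show "(\<lambda>M. ?ind x *\<^sub>R (?SM M x * ec x)) \<longlonglongrightarrow> ?ind x *\<^sub>R (P x * ec x)"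
        proof (cases "x \<in> ?I")
          case True
          hence "(\<lambda>M. \<Sum>n<M. p n x) \<longlonglongrightarrow> (\<Sum>n. p n x)" using p_summable[of x] by (intro summable_LIMSEQ) auto
          thus ?thesis unfolding P_def by (intro tendsto_intros)
        qed simp
      qed
      show "AE x in lborel. norm (?ind x *\<^sub>R (?SM M x * ec x)) \<le> ?ind x * (C + 2 * C * Q)" for M
      proof (intro AE_I2)
        fix x
        have "\<bar>x\<bar> \<le> 1/2" if "x \<in> ?I" using that by auto
        with PM_le[of x M] show "norm (?ind x *\<^sub>R (?SM M x * ec x)) \<le> ?ind x * (C + 2 * C * Q)"
          by (cases "x \<in> ?I") (auto simp: norm_mult ne)
      qed
    qed auto
    moreover have "(\<lambda>M. LINT x|lborel. (if \<bar>\<lceil>x - 1/2\<rceil>\<bar> \<le> int M then f x * ec x else 0)) \<longlonglongrightarrow> (LINT x|lborel. f x * ec x)"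
    proof (rule integral_dominated_convergence[where w = "\<lambda>x. norm (f x)"])
      show "AE x in lborel. (\<lambda>M. if \<bar>\<lceil>x - 1/2\<rceil>\<bar> \<le> int M then f x * ec x else 0) \<longlonglongrightarrow> f x * ec x"
      proof (intro AE_I2 tendsto_eventually)
        fix x
        show "\<forall>\<^sub>F M in sequentially. (if \<bar>\<lceil>x - 1/2\<rceil>\<bar> \<le> int M then f x * ec x else 0) = f x * ec x"
          using eventually_ge_at_top[of "nat \<bar>\<lceil>x - 1/2\<rceil>\<bar>"] by eventually_elim auto
      qed
    qed (use schwartz_integrable[OF f] in \<open>auto simp: norm_mult ne\<close>)
    ultimately have "(LINT x|lborel. ?ind x *\<^sub>R (P x * ec x)) = (LINT x|lborel. f x * ec x)"
      unfolding SM_eq by (rule LIMSEQ_unique)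
    thus ?thesis unfolding c_def fourier_cis ec_def by (simp add: mult_ac)
  qed
  \<comment> \<open>Multiplication by \<open>cis (2 * pi * x)\<close> shifts Fourier coefficients by
    one, so the coefficients of \<open>P\<close> are consecutive differences of those of
    \<open>R\<close>, apart from the contribution of the constant \<open>P 0\<close> at index
    0.\<close>
  have cR: "c P k = (if k = 0 then P 0 else 0) + (c R (k - 1) - c R k)" for k
  proof -
    let ?e = "\<lambda>k x. cis (- (2 * pi * of_int k * x))"
    have i1: "integrable lborel (\<lambda>x. ?ind x *\<^sub>R (P 0 * ?e k x))"
      by (rule int[of _ "norm (P 0)"]) (auto simp: norm_mult)
    have i2: "integrable lborel (\<lambda>x. ?ind x *\<^sub>R (R x * ?e k x))" for k
      by (rule int[of _ B]) (auto simp: norm_mult R_le)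
    have "c P k = (LINT x|lborel. ?ind x *\<^sub>R (P 0 * ?e k x) + (?ind x *\<^sub>R (R x * ?e (k - 1) x) - ?ind x *\<^sub>R (R x * ?e k x)))"
      unfolding c_def
    proof (intro Bochner_Integration.integral_cong refl)
      fix x
      have e: "?e (k - 1) x = cis (2 * pi * x) * ?e k x" by (simp add: cis_mult algebra_simps)
      have "?ind x *\<^sub>R (P x * ?e k x) = ?ind x *\<^sub>R (P 0 * ?e k x) + ?ind x *\<^sub>R (P x - P 0) * ?e k x"
        by (simp add: algebra_simps)
      also have "?ind x *\<^sub>R (P x - P 0) * ?e k x = ?ind x *\<^sub>R (R x * ?e (k - 1) x) - ?ind x *\<^sub>R (R x * ?e k x)"
        unfolding R_eq e by (simp add: algebra_simps)
      finally show "?ind x *\<^sub>R (P x * ?e k x) = ?ind x *\<^sub>R (P 0 * ?e k x) + (?ind x *\<^sub>R (R x * ?e (k - 1) x) - ?ind x *\<^sub>R (R x * ?e k x))" .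
    qed
    also have "\<dots> = (LINT x|lborel. ?ind x *\<^sub>R (P 0 * ?e k x)) + ((LINT x|lborel. ?ind x *\<^sub>R (R x * ?e (k - 1) x)) - (LINT x|lborel. ?ind x *\<^sub>R (R x * ?e k x)))"
      using i1 i2[of k] i2[of "k - 1"] by simp
    also have "(LINT x|lborel. ?ind x *\<^sub>R (P 0 * ?e k x)) = P 0 * (LINT x|lborel. ?ind x *\<^sub>R cis (2 * pi * of_int (- k) * x))"
      by (subst integral_mult_right_zero[symmetric]) (intro Bochner_Integration.integral_cong refl, simp)
    finally show ?thesis unfolding integral_unit_interval_cis c_def by simp
  qed
  have "fourier f 0 + (\<Sum>n<N. fourier f (real (Suc n)) + fourier f (- real (Suc n))) = P 0 + (c R (- int N - 1) - c R (int N))" for N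
  proof (induction N)
    case 0
    show ?case using cP[of 0] cR[of 0] by simp
  next
    case (Suc N)
    have 1: "fourier f (real (Suc N)) = c R (- int (Suc N) - 1) - c R (- int N - 1)"
    proof -
      have "fourier f (real (Suc N)) = c P (- int (Suc N))" using cP[of "- int (Suc N)"] by (simp add: add.commute)
      also have "\<dots> = c R (- int (Suc N) - 1) - c R (- int (Suc N))" using cR[of "- int (Suc N)"] by simp
      also have "- int (Suc N) = - int N - 1" by simp
      finally show ?thesis by simp
    qed
    have 2: "fourier f (- real (Suc N)) = c R (int N) - c R (int (Suc N))"
    proof -
      have "fourier f (- real (Suc N)) = c P (int (Suc N))" using cP[of "int (Suc N)"] by simp
      also have "\<dots> = c R (int (Suc N) - 1) - c R (int (Suc N))" using cR[of "int (Suc N)"] by simp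
      also have "int (Suc N) - 1 = int N" by simp
      finally show ?thesis .
    qed
    have "fourier f 0 + (\<Sum>n<Suc N. fourier f (real (Suc n)) + fourier f (- real (Suc n))) =
          P 0 + (c R (- int N - 1) - c R (int N)) + (fourier f (real (Suc N)) + fourier f (- real (Suc N)))"
      by (simp only: Suc[symmetric] sum.lessThan_Suc add.assoc)
    also have "\<dots> = P 0 + (c R (- int (Suc N) - 1) - c R (int (Suc N)))"
      unfolding 1 2 by (simp only: algebra_simps)
    finally show ?case .
  qed
  moreover have "(\<lambda>N. P 0 + (c R (- int N - 1) - c R (int N))) \<longlonglongrightarrow> P 0 + (0 - 0)"
    unfolding c_def
    by (intro tendsto_add tendsto_diff tendsto_const fourier_coefficients_tendsto_0[OF _ R_le]) (auto simp: inj_on_def)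
  ultimately have "(\<lambda>N. fourier f 0 + (\<Sum>n<N. fourier f (real (Suc n)) + fourier f (- real (Suc n)))) \<longlonglongrightarrow> P 0" by simp
  thus ?thesis by (simp add: P_def p_def del: of_nat_Suc)
qed

section \<open>The theta function and the zeta function\<close>

text \<open>Completing the square trades the quadratic exponent for a linear one, which is the form
  required by \<open>rapid_exp_decay\<close>.\<close>

lemma gauss_exp_bound:
  assumes "a > 0"
  shows "norm (gauss a (x - x0)) \<le> exp (1 / (4 * pi * a\<^sup>2) + \<bar>x0\<bar>) * exp (- 1 * \<bar>x\<bar>)"
proof -
  define A where "A = pi * a\<^sup>2"
  have A: "A > 0" using assms by (simp add: A_def)
  define y where "y = \<bar>x - x0\<bar>"
  have "0 \<le> A * (y - 1 / (2 * A))\<^sup>2" using A by simp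
  also have "\<dots> = A * y\<^sup>2 - y + 1 / (4 * A)" using A by (simp add: power2_eq_square field_simps)
  finally have "- (A * y\<^sup>2) \<le> 1 / (4 * A) + - y" by simp
  moreover have "- y \<le> \<bar>x0\<bar> - \<bar>x\<bar>" by (simp add: y_def)
  ultimately have "- (A * y\<^sup>2) \<le> (1 / (4 * A) + \<bar>x0\<bar>) + - 1 * \<bar>x\<bar>" by simp
  hence "exp (- (A * y\<^sup>2)) \<le> exp (1 / (4 * A) + \<bar>x0\<bar>) * exp (- 1 * \<bar>x\<bar>)"
    unfolding exp_add[symmetric] by simp
  thus ?thesis by (simp add: norm_gauss A_def y_def power_mult_distrib mult.assoc)
qed

lemma rapid_gauss: "a > 0 \<Longrightarrow> rapid (\<lambda>x. gauss a (x - x0))"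
  by (rule rapid_exp_decay[OF zero_less_one gauss_exp_bound])

text \<open>A translated Gaussian is the trigonometric integral of a modulated Gaussian, so its
  derivatives come from \<open>trig_integral_smooth\<close> and need no explicit formula.\<close>

lemma gauss_schwartz:
  assumes a: "a > 0"
  shows "(\<lambda>x. gauss a (x - x0)) \<in> schwartz"
proof -
  define H where "H t = gauss (1 / a) (t - 0) / of_real a * cis (- (2 * pi * t * x0))" for t
  have [measurable]: "H \<in> borel_measurable borel" unfolding H_def by measurable
  have eq: "gauss a (x - x0) = (LINT t|lborel. H t * cis (2 * pi * t * x))" for x
  proof -
    have "of_real a * gauss a (x - x0) = fourier (gauss (1 / a)) (x - x0)"
      using fourier_gauss[of "1 / a" "x - x0"] a by simp
    also have "\<dots> = (LINT t|lborel. of_real a * (H t * cis (2 * pi * t * x)))"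
      unfolding fourier_cis
    proof (intro Bochner_Integration.integral_cong refl)
      fix t
      have "cis (2 * pi * t * (x - x0)) = cis (- (2 * pi * t * x0)) * cis (2 * pi * t * x)"
        by (simp add: cis_mult algebra_simps)
      thus "gauss (1 / a) t * cis (2 * pi * t * (x - x0)) = of_real a * (H t * cis (2 * pi * t * x))"
        using a by (simp add: H_def)
    qed
    finally show ?thesis using a by simp
  qed
  have "rapid (\<lambda>x. gauss (1 / a) (x - 0))" using a by (intro rapid_gauss) simp
  hence "rapid H" by (rule rapid_mult_poly[where m = 0 and B = "1 / a"])
      (use a in \<open>auto simp: H_def norm_mult norm_divide\<close>)
  thus ?thesis using rapid_gauss[OF a, of x0] unfolding eq
    by (intro trig_integral_schwartz rapid_moments) auto
qed

lemma gauss_schwartz0: "a > 0 \<Longrightarrow> gauss a \<in> schwartz"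
  using gauss_schwartz[of a 0] by simp

text \<open>In Riemann's notation this is \<open>psi\<close> at the square of \<open>x\<close>. The
  argument is the dilation itself, so that the series runs over values of \<open>gauss x\<close> at
  integers.\<close>

definition theta_tail :: "real \<Rightarrow> real" where
  "theta_tail x = (\<Sum>n. exp (- (pi * (real (Suc n) * x)\<^sup>2)))"

lemma theta_tail_measurable [measurable]: "theta_tail \<in> borel_measurable borel"
  unfolding theta_tail_def by measurable

lemma summable_inverse_squares: "summable (\<lambda>n. 1 / (real (Suc n))\<^sup>2)"
  using inverse_squares_sums by (simp add: sums_iff add.commute)

text \<open>The free exponent \<open>k\<close> gives decay of any order in \<open>x\<close>, while
  one inverse square of the index is kept back for summation.\<close>

lemma theta_term_bound:
  assumes "x > 0" "k \<ge> 1"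
  shows "exp (- (pi * (real (Suc n) * x)\<^sup>2)) \<le> fact k / x ^ (2 * k) * (1 / (real (Suc n))\<^sup>2)"
proof -
  let ?m = "real (Suc n)"
  define u where "u = pi * (?m * x)\<^sup>2"
  have m: "?m \<ge> 1" by simp
  have le: "(?m * x)\<^sup>2 \<le> u" using pi_gt3 by (simp add: u_def mult_le_cancel_right1)
  have "?m\<^sup>2 \<le> ?m ^ (2 * k)" using m assms by (intro power_increasing) auto
  hence "?m\<^sup>2 * x ^ (2 * k) \<le> ?m ^ (2 * k) * x ^ (2 * k)" using assms by (intro mult_right_mono) auto
  also have "\<dots> = ((?m * x)\<^sup>2) ^ k" by (simp only: power_mult power_mult_distrib)
  also have "\<dots> \<le> u ^ k" using le by (intro power_mono) auto
  also have "\<dots> \<le> fact k * exp u" by (rule power_le_fact_exp) (simp add: u_def)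
  finally have "exp (- u) * (?m\<^sup>2 * x ^ (2 * k)) \<le> exp (- u) * (fact k * exp u)" by (intro mult_left_mono) auto
  hence "exp (- u) * (?m\<^sup>2 * x ^ (2 * k)) \<le> fact k" by (simp add: exp_minus field_simps)
  hence "exp (- u) \<le> fact k / x ^ (2 * k) * (1 / ?m\<^sup>2)" using assms by (simp add: field_simps del: of_nat_Suc)
  thus ?thesis by (simp only: u_def)
qed

lemma theta_tail_summable: 
  assumes "x > 0" shows "summable (\<lambda>n. exp (- (pi * (real (Suc n) * x)\<^sup>2)))"
proof (rule summable_comparison_test'[where N = 0])
  show "summable (\<lambda>n. fact 1 / x ^ (2 * 1) * (1 / (real (Suc n))\<^sup>2))"
    by (intro summable_mult summable_inverse_squares)
  show "norm (exp (- (pi * (real (Suc n) * x)\<^sup>2))) \<le> fact 1 / x ^ (2 * 1) * (1 / (real (Suc n))\<^sup>2)" for n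
    using theta_term_bound[OF assms, of 1 n] by simp
qed

lemma theta_tail_bound:
  assumes "x > 0" "k \<ge> 1"
  shows "\<bar>theta_tail x\<bar> \<le> fact k * (pi\<^sup>2 / 6) / x ^ (2 * k)"
proof -
  have "theta_tail x \<ge> 0" unfolding theta_tail_def by (rule suminf_nonneg[OF theta_tail_summable[OF assms(1)]]) auto
  hence "\<bar>theta_tail x\<bar> = theta_tail x" by simp
  also have "\<dots> \<le> (\<Sum>n. fact k / x ^ (2 * k) * (1 / (real (Suc n))\<^sup>2))"
    unfolding theta_tail_def
    by (intro suminf_le theta_term_bound assms theta_tail_summable summable_mult summable_inverse_squares)
  also have "\<dots> = fact k / x ^ (2 * k) * (\<Sum>n. 1 / (real (Suc n))\<^sup>2)"
    by (intro suminf_mult summable_inverse_squares)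
  also have "(\<Sum>n. 1 / (real (Suc n))\<^sup>2) = pi\<^sup>2 / 6" using inverse_squares_sums by (simp add: sums_iff add.commute)
  finally show ?thesis by simp
qed

lemma theta_functional_equation:
  assumes x: "x > 0"
  shows "1 + 2 * theta_tail x = (1 + 2 * theta_tail (1 / x)) / x"
proof -
  have g: "(\<lambda>n. gauss a (real (Suc n)) + gauss a (- real (Suc n))) sums of_real (2 * theta_tail a)" if "a > 0" for a
  proof -
    have "(\<lambda>n. 2 * exp (- (pi * (real (Suc n) * a)\<^sup>2))) sums (2 * theta_tail a)"
      unfolding theta_tail_def by (intro sums_mult summable_sums theta_tail_summable that)
    hence "(\<lambda>n. complex_of_real (2 * exp (- (pi * (real (Suc n) * a)\<^sup>2)))) sums of_real (2 * theta_tail a)"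
      by (rule sums_of_real)
    moreover have "gauss a (real (Suc n)) + gauss a (- real (Suc n)) = of_real (2 * exp (- (pi * (real (Suc n) * a)\<^sup>2)))" for n
      unfolding gauss_even by (simp add: gauss_def mult.commute del: of_nat_Suc)
    ultimately show ?thesis by (simp only:)
  qed
  have g0: "gauss a 0 = 1" for a by (simp add: gauss_def)
  have "(\<lambda>N. fourier (gauss x) 0 + (\<Sum>n<N. fourier (gauss x) (real (Suc n)) + fourier (gauss x) (- real (Suc n))))
          \<longlonglongrightarrow> gauss x 0 + (\<Sum>n. gauss x (real (Suc n)) + gauss x (- real (Suc n)))"
    by (rule poisson_summation[OF gauss_schwartz0[OF x]])
  also have "gauss x 0 + (\<Sum>n. gauss x (real (Suc n)) + gauss x (- real (Suc n))) = 1 + of_real (2 * theta_tail x)"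
    using g[OF x] by (simp add: g0 sums_iff)
  finally have l1: "(\<lambda>N. fourier (gauss x) 0 + (\<Sum>n<N. fourier (gauss x) (real (Suc n)) + fourier (gauss x) (- real (Suc n))))
          \<longlonglongrightarrow> 1 + of_real (2 * theta_tail x)" .
  have "(\<lambda>N. 1 / of_real x * (1 + (\<Sum>n<N. gauss (1 / x) (real (Suc n)) + gauss (1 / x) (- real (Suc n)))))
     \<longlonglongrightarrow> 1 / of_real x * (1 + of_real (2 * theta_tail (1 / x)))"
    using g[of "1 / x"] x unfolding sums_def by (intro tendsto_intros) auto
  also have "(\<lambda>N. 1 / of_real x * (1 + (\<Sum>n<N. gauss (1 / x) (real (Suc n)) + gauss (1 / x) (- real (Suc n))))) = 
      (\<lambda>N. fourier (gauss x) 0 + (\<Sum>n<N. fourier (gauss x) (real (Suc n)) + fourier (gauss x) (- real (Suc n))))"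
    unfolding fourier_gauss[OF x]
    by (simp add: fun_eq_iff g0 distrib_left sum_distrib_left add_divide_distrib sum_divide_distrib del: of_nat_Suc)
  finally have "1 / of_real x * (1 + of_real (2 * theta_tail (1 / x))) = complex_of_real 1 + of_real (2 * theta_tail x)"
    using LIMSEQ_unique[OF l1] by simp
  hence "complex_of_real ((1 + 2 * theta_tail (1 / x)) / x) = of_real (1 + 2 * theta_tail x)" by simp
  thus ?thesis by (simp only: of_real_eq_iff)
qed

lemma integrable_exp_abs:
  fixes \<delta> :: real assumes \<delta>: "\<delta> > 0" shows "integrable lborel (\<lambda>t. exp (- \<delta> * \<bar>t\<bar>))"
proof -
  have "rapid (\<lambda>t. of_real (exp (- \<delta> * \<bar>t\<bar>)))"
    by (rule rapid_exp_decay[OF \<delta>, of _ 1]) simp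
  hence "integrable lborel (\<lambda>t. complex_of_real (exp (- \<delta> * \<bar>t\<bar>)))"
    by (rule rapid_integrable) measurable
  thus ?thesis using integrable_Re by fastforce
qed

subsection \<open>The Mellin transform of the Gaussian\<close>

text \<open>For positive real part this is half of \<open>pi powr (- z / 2) * Gamma (z / 2)\<close>,
  the archimedean factor of zeta; as the Mellin transform of a Gaussian it fits directly into both
  functional equations.\<close>

definition Phi :: "complex \<Rightarrow> complex" where "Phi z = mellin (gauss 1) z"

lemma Phi_laplace: "Phi z = laplace (\<lambda>t. gauss 1 (exp t)) z"
  unfolding Phi_def by (subst mellin_schwartz(2)[OF gauss_schwartz0]) auto

lemma Phi_Gamma:
  assumes z: "Re z > 0"
  shows "2 * of_real pi powr (z / 2) * Phi z = Gamma (z / 2)"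
proof -
  define w where "w = z / 2"
  have w: "Re w > 0" using z by (simp add: w_def)
  define F where "F t = of_real t powr (w - 1) / of_real (exp t)" for t :: real
  have Fexp: "F (exp t) = exp ((w - 1) * of_real t) / of_real (exp (exp t))" for t
    by (simp add: F_def powr_def Ln_of_real)
  have m: "(\<lambda>t. F (exp t)) \<in> borel_measurable borel" unfolding Fexp by measurable
  have "F absolutely_integrable_on {0<..}" unfolding F_def by (rule absolutely_integrable_Gamma_integral'[OF w])
  hence "set_integrable lborel {0<..} F" using exp_substitution(3)[OF m] by simp
  hence "(LINT x:{0<..}|lborel. F x) = integral {0<..} F" by (rule set_borel_integral_eq_integral)
  also have "\<dots> = Gamma w" unfolding F_def by (rule integral_unique[OF Gamma_integral_complex'[OF w]])
  finally have "Gamma w = (LINT t|lborel. exp t *\<^sub>R F (exp t))" using exp_substitution(2)[OF m] by simp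
  \<comment> \<open>The substitution makes the exponential of the new variable equal to
    \<open>pi * (exp t)\<^sup>2\<close>, so that Euler's \<open>exp (- x)\<close> becomes the
    Gaussian at \<open>exp t\<close>.\<close>
  also have "\<dots> = \<bar>2\<bar> *\<^sub>R (LINT t|lborel. exp (ln pi + 2 * t) *\<^sub>R F (exp (ln pi + 2 * t)))"
    by (rule lborel_integral_real_affine) simp
  also have "\<dots> = 2 * (LINT t|lborel. of_real pi powr w * (gauss 1 (exp t) * exp (z * of_real t)))"
  proof -
    have "exp (ln pi + 2 * t) *\<^sub>R F (exp (ln pi + 2 * t)) = of_real pi powr w * (gauss 1 (exp t) * exp (z * of_real t))" for t
    proof -
      let ?s = "ln pi + 2 * t"
      have "exp ?s *\<^sub>R F (exp ?s) = exp (of_real ?s) * exp ((w - 1) * of_real ?s) / of_real (exp (exp ?s))"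
        by (simp add: Fexp scaleR_conv_of_real flip: exp_of_real)
      also have "exp (of_real ?s) * exp ((w - 1) * of_real ?s) = exp (w * of_real ?s)"
        by (simp add: exp_add[symmetric] algebra_simps)
      also have "\<dots> = of_real pi powr w * exp (z * of_real t)"
        by (simp add: powr_def Ln_of_real exp_add[symmetric] w_def algebra_simps)
      finally have X: "exp ?s *\<^sub>R F (exp ?s) = of_real pi powr w * exp (z * of_real t) / of_real (exp (exp ?s))" .
      have "exp ?s = pi * (1 * exp t)\<^sup>2" by (simp add: exp_add exp_double)
      hence "inverse (complex_of_real (exp (exp ?s))) = gauss 1 (exp t)" by (simp add: gauss_def exp_minus)
      thus ?thesis unfolding X divide_inverse by (simp only: mult_ac)
    qed
    thus ?thesis by (simp add: scaleR_conv_of_real)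
  qed
  also have "\<dots> = 2 * of_real pi powr w * Phi z" by (simp add: Phi_laplace laplace_def)
  finally show ?thesis by (simp add: w_def)
qed

lemma not_nonpos_Ints_half: "Re z > 0 \<Longrightarrow> z / 2 \<notin> \<int>\<^sub>\<le>\<^sub>0"
  by (auto elim!: nonpos_Ints_cases simp: complex_eq_iff)

lemma Phi_nonzero: "Re z > 0 \<Longrightarrow> Phi z \<noteq> 0"
  using Phi_Gamma[of z] not_nonpos_Ints_half[of z] by (auto simp: Gamma_eq_zero_iff)

lemma Phi_rGamma: 
  assumes "Re z > 0" shows "2 * of_real pi powr (z / 2) * rGamma (z / 2) * Phi z = 1"
proof -
  have "2 * of_real pi powr (z / 2) * rGamma (z / 2) * Phi z = rGamma (z / 2) * Gamma (z / 2)"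
    using Phi_Gamma[OF assms] by (simp add: mult_ac)
  thus ?thesis using not_nonpos_Ints_half[OF assms] by (simp add: rGamma_inverse_Gamma Gamma_eq_zero_iff)
qed

subsection \<open>Analytic continuation of zeta\<close>

text \<open>Riemann's integral: the Mellin integral of the theta tail over \<open>x > 1\<close>,
  together with the part over \<open>x < 1\<close> folded onto it by the functional equation. The
  result is entire and symmetric, and the polar terms are kept apart.\<close>

definition theta_mellin :: "complex \<Rightarrow> complex" where
  "theta_mellin z = (LINT t|lborel. indicator {0<..} t *\<^sub>R
      (of_real (theta_tail (exp t)) * (exp (z * of_real t) + exp ((1 - z) * of_real t))))"

lemma theta_mellin_reflect: "theta_mellin (1 - z) = theta_mellin z"
  unfolding theta_mellin_def by (simp add: add.commute)

lemma theta_mellin_dominated: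
  obtains C where "\<And>z t. \<bar>Re z\<bar> \<le> K \<Longrightarrow> t > 0 \<Longrightarrow> norm (of_real (theta_tail (exp t)) * exp (z * of_real t)) \<le> C * exp (- 1 * \<bar>t\<bar>)"
proof -
  obtain k :: nat where k: "K + 1 \<le> real k" using real_arch_simple by blast
  define C where "C = fact (Suc k) * (pi\<^sup>2 / 6)"
  have C: "C \<ge> 0" by (simp add: C_def)
  show ?thesis
  proof (rule that[of C])
    fix z :: complex and t :: real assume z: "\<bar>Re z\<bar> \<le> K" and t: "t > 0"
    have "\<bar>theta_tail (exp t)\<bar> \<le> C / exp t ^ (2 * Suc k)"
      unfolding C_def by (rule theta_tail_bound) auto
    also have "\<dots> = C * exp (- (real (2 * Suc k) * t))" 
      by (simp only: exp_of_nat_mult[symmetric] divide_inverse exp_minus)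
    also have "\<dots> \<le> C * exp (- ((K + 1) * t))"
      using k t C by (intro mult_left_mono) (auto intro!: mult_right_mono)
    finally have "norm (of_real (theta_tail (exp t)) * exp (z * of_real t)) \<le> C * exp (- ((K + 1) * t)) * exp (K * t)"
      using z t C unfolding norm_mult by (intro mult_mono) auto
    also have "\<dots> = C * exp (- 1 * \<bar>t\<bar>)" using t by (simp add: exp_add[symmetric] algebra_simps)
    finally show "norm (of_real (theta_tail (exp t)) * exp (z * of_real t)) \<le> C * exp (- 1 * \<bar>t\<bar>)" .
  qed
qed

lemma theta_half_integrable: 
  fixes z :: complex
  shows "integrable lborel (\<lambda>t. indicator {0<..} t *\<^sub>R (of_real (theta_tail (exp t)) * exp (z * of_real t)))"
proof -
  obtain C where C: "\<And>w t. \<bar>Re w\<bar> \<le> \<bar>Re z\<bar> \<Longrightarrow> t > 0 \<Longrightarrow> norm (of_real (theta_tail (exp t)) * exp (w * of_real t)) \<le> C * exp (- 1 * \<bar>t\<bar>)"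
    using theta_mellin_dominated by blast
  show ?thesis
  proof (rule Bochner_Integration.integrable_bound)
    show "integrable lborel (\<lambda>t. C * exp (- 1 * \<bar>t\<bar>))"
      by (intro integrable_mult_right integrable_exp_abs) simp
    show "AE t in lborel. norm (indicator {0<..} t *\<^sub>R (of_real (theta_tail (exp t)) * exp (z * of_real t))) \<le> norm (C * exp (- 1 * \<bar>t\<bar>))"
      using C[of z] by (intro AE_I2) (auto simp: indicator_def intro: order.trans[OF _ abs_ge_self])
  qed measurable
qed

lemma theta_mellin_holomorphic: "theta_mellin holomorphic_on UNIV"
  unfolding theta_mellin_def
proof (rule holomorphic_integral)
  show "(\<lambda>t. indicator {0<..} t *\<^sub>R (of_real (theta_tail (exp t)) * (exp (z * of_real t) + exp ((1 - z) * of_real t))))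
          \<in> borel_measurable lborel" for z :: complex by measurable
  fix z0 :: complex
  obtain C where C: "\<And>w t. \<bar>Re w\<bar> \<le> \<bar>Re z0\<bar> + 2 \<Longrightarrow> t > 0 \<Longrightarrow> norm (of_real (theta_tail (exp t)) * exp (w * of_real t)) \<le> C * exp (- 1 * \<bar>t\<bar>)"
    using theta_mellin_dominated by blast
  show "\<exists>r>0. \<exists>w. cball z0 r \<subseteq> UNIV \<and> integrable lborel w \<and>
     (\<forall>z\<in>cball z0 r. \<forall>t\<in>space lborel. norm (indicator {0<..} t *\<^sub>R (of_real (theta_tail (exp t)) * (exp (z * of_real t) + exp ((1 - z) * of_real t)))) \<le> w t)"
  proof (intro exI[of _ 1] exI[of _ "\<lambda>t. 2 * \<bar>C\<bar> * exp (- 1 * \<bar>t\<bar>)"] conjI ballI)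
    show "integrable lborel (\<lambda>t. 2 * \<bar>C\<bar> * exp (- 1 * \<bar>t\<bar>))"
      by (intro integrable_mult_right integrable_exp_abs) simp
    fix z t assume "z \<in> cball z0 1"
    hence z: "\<bar>Re z\<bar> \<le> \<bar>Re z0\<bar> + 1" using abs_Re_le_cmod[of "z0 - z"] by (auto simp: dist_norm)
    show "norm (indicator {0<..} t *\<^sub>R (of_real (theta_tail (exp t)) * (exp (z * of_real t) + exp ((1 - z) * of_real t)))) \<le> 2 * \<bar>C\<bar> * exp (- 1 * \<bar>t\<bar>)"
    proof (cases "t > 0")
      case True
      have "norm (of_real (theta_tail (exp t)) * exp (z * of_real t) + of_real (theta_tail (exp t)) * exp ((1 - z) * of_real t))
          \<le> C * exp (- 1 * \<bar>t\<bar>) + C * exp (- 1 * \<bar>t\<bar>)"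
        using z True by (intro norm_triangle_mono C) auto
      also have "\<dots> = 2 * C * exp (- 1 * \<bar>t\<bar>)" by simp
      also have "\<dots> \<le> 2 * \<bar>C\<bar> * exp (- 1 * \<bar>t\<bar>)" by (intro mult_right_mono) auto
      finally show ?thesis using True by (simp add: distrib_left)
    qed simp
  qed auto
qed (auto intro!: holomorphic_intros)

lemma laplace_scale:
  assumes "m > 0"
  shows "(LINT t|lborel. g (m * exp t) * exp (z * of_real t)) = exp (- z * of_real (ln m)) * laplace (\<lambda>t. g (exp t)) z"
proof -
  have "(LINT t|lborel. g (m * exp t) * exp (z * of_real t)) =
       \<bar>1\<bar> *\<^sub>R (LINT t|lborel. g (m * exp (- ln m + 1 * t)) * exp (z * of_real (- ln m + 1 * t)))"
    by (rule lborel_integral_real_affine) simp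
  also have "\<dots> = (LINT t|lborel. exp (- z * of_real (ln m)) * (g (exp t) * exp (z * of_real t)))"
  proof -
    have "m * exp (- ln m + 1 * t) = exp t" for t using assms by (simp add: exp_diff)
    moreover have "exp (z * of_real (- ln m + 1 * t)) = exp (- z * of_real (ln m)) * exp (z * of_real t)" for t
      by (simp add: exp_add[symmetric] algebra_simps)
    ultimately show ?thesis by (simp add: mult_ac)
  qed
  finally show ?thesis by (simp add: laplace_def)
qed

lemma powr_Suc_exp: "1 / of_nat (Suc n) powr (z :: complex) = exp (- z * of_real (ln (real (Suc n))))"
proof -
  have "Ln (of_nat (Suc n)) = of_real (ln (real (Suc n)))"
    using Ln_of_real[of "real (Suc n)"] by simp
  thus ?thesis by (simp add: powr_def exp_minus divide_inverse del: of_nat_Suc)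
qed

lemma norm_powr_Suc: "norm (1 / of_nat (Suc n) powr z) = real (Suc n) powr (- Re z)"
  unfolding powr_Suc_exp by (simp add: powr_def del: of_nat_Suc)

lemma summable_Suc_powr: "s > 1 \<Longrightarrow> summable (\<lambda>n. real (Suc n) powr (- s))"
  using summable_real_powr_iff[of "- s"] by (subst summable_Suc_iff) simp

text \<open>Each Gaussian term is a translate in the variable \<open>t\<close>, so it contributes
  \<open>Phi z\<close> times a term of the Dirichlet series. The norms scale by the real powers,
  whose sum converges for \<open>Re z > 1\<close> and allows the exchange.\<close>

lemma theta_laplace:
  assumes z: "Re z > 1"
  shows "integrable lborel (\<lambda>t. of_real (theta_tail (exp t)) * exp (z * of_real t))"
    and "(\<lambda>n. 1 / of_nat (Suc n) powr z * Phi z) sums (LINT t|lborel. of_real (theta_tail (exp t)) * exp (z * of_real t))"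
proof -
  note cls = schwartz_laplace_class[OF gauss_schwartz0[OF zero_less_one]]
  define f where "f n t = gauss 1 (real (Suc n) * exp t) * exp (z * of_real t)" for n t
  have [measurable]: "f n \<in> borel_measurable borel" for n unfolding f_def by measurable
  have f_int: "(LINT t|lborel. f n t) = 1 / of_nat (Suc n) powr z * Phi z" for n
    unfolding f_def powr_Suc_exp Phi_laplace by (rule laplace_scale) simp
  have int: "integrable lborel (f n)" for n
  proof -
    have "integrable lborel (\<lambda>t. gauss 1 (exp t) * exp (z * of_real t))"
      using laplace_class_integrable[OF cls, of 0 "Re z + 1" z] z by simp
    hence "integrable lborel (\<lambda>t. gauss 1 (exp (ln (real (Suc n)) + 1 * t)) * exp (z * of_real (ln (real (Suc n)) + 1 * t)))"
      by (rule lborel_integrable_real_affine) simp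
    hence "integrable lborel (\<lambda>t. exp (- z * of_real (ln (real (Suc n)))) * (gauss 1 (exp (ln (real (Suc n)) + 1 * t)) * exp (z * of_real (ln (real (Suc n)) + 1 * t))))"
      by (rule integrable_mult_right)
    moreover have "exp (- z * of_real (ln (real (Suc n)))) * (gauss 1 (exp (ln (real (Suc n)) + 1 * t)) * exp (z * of_real (ln (real (Suc n)) + 1 * t))) = f n t" for t
    proof -
      have "exp (ln (real (Suc n)) + 1 * t) = real (Suc n) * exp t" by (simp add: exp_add)
      moreover have "exp (- z * of_real (ln (real (Suc n)))) * exp (z * of_real (ln (real (Suc n)) + 1 * t)) = exp (z * of_real t)"
        by (simp add: exp_add[symmetric] algebra_simps)
      ultimately show ?thesis unfolding f_def by (simp only: mult_ac)
    qed
    ultimately show ?thesis by (simp only:)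
  qed
  have fnorm: "norm (f n t) = exp (- (pi * (real (Suc n) * exp t)\<^sup>2)) * exp (Re z * t)" for n t
    by (simp add: f_def norm_mult norm_gauss)
  have f_norm_int: "(LINT t|lborel. norm (f n t)) = real (Suc n) powr (- Re z) * (LINT t|lborel. norm (f 0 t))" for n
  proof -
    have eq: "of_real (norm (f n t)) = gauss 1 (real (Suc n) * exp t) * exp (of_real (Re z) * of_real t)" for n t
      by (simp add: fnorm gauss_def exp_of_real[symmetric])
    have "complex_of_real (LINT t|lborel. norm (f n t)) = exp (- of_real (Re z) * of_real (ln (real (Suc n)))) * laplace (\<lambda>t. gauss 1 (exp t)) (of_real (Re z))" for n
      unfolding integral_complex_of_real[symmetric] eq by (rule laplace_scale) simp
    from this[of n] this[of 0]
    have "complex_of_real (LINT t|lborel. norm (f n t)) = exp (- of_real (Re z) * of_real (ln (real (Suc n)))) * of_real (LINT t|lborel. norm (f 0 t))"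
      by simp
    also have "exp (- of_real (Re z) * of_real (ln (real (Suc n)))) = complex_of_real (real (Suc n) powr (- Re z))"
      by (simp add: powr_def exp_of_real[symmetric] del: of_nat_Suc)
    finally have "complex_of_real (LINT t|lborel. norm (f n t)) = of_real (real (Suc n) powr (- Re z) * (LINT t|lborel. norm (f 0 t)))"
      by simp
    thus ?thesis by (simp only: of_real_eq_iff)
  qed
  have s1: "AE t in lborel. summable (\<lambda>n. norm (f n t))"
    unfolding fnorm by (intro AE_I2 summable_mult2 theta_tail_summable) simp
  have s2: "summable (\<lambda>n. LINT t|lborel. norm (f n t))"
  proof -
    have "summable (\<lambda>n. real (Suc n) powr (- Re z) * (LINT t|lborel. norm (f 0 t)))"
      by (intro summable_mult2 summable_Suc_powr z)
    thus ?thesis by (simp only: f_norm_int[symmetric])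
  qed
  have sum_f: "(\<Sum>n. f n t) = of_real (theta_tail (exp t)) * exp (z * of_real t)" for t
  proof -
    have "(\<lambda>n. complex_of_real (exp (- (pi * (real (Suc n) * exp t)\<^sup>2)))) sums of_real (theta_tail (exp t))"
      unfolding theta_tail_def by (intro sums_of_real summable_sums theta_tail_summable) simp
    hence "(\<lambda>n. complex_of_real (exp (- (pi * (real (Suc n) * exp t)\<^sup>2))) * exp (z * of_real t)) sums (of_real (theta_tail (exp t)) * exp (z * of_real t))"
      by (rule sums_mult2)
    thus ?thesis by (simp add: sums_iff f_def gauss_def)
  qed
  show "integrable lborel (\<lambda>t. of_real (theta_tail (exp t)) * exp (z * of_real t))"
    using integrable_suminf[OF int s1 s2] unfolding sum_f .
  show "(\<lambda>n. 1 / of_nat (Suc n) powr z * Phi z) sums (LINT t|lborel. of_real (theta_tail (exp t)) * exp (z * of_real t))"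
    using sums_integral[OF int s1 s2] unfolding sum_f f_int .
qed

lemma integral_exp_half_line:
  assumes w: "Re w > 0"
  shows "integrable lborel (\<lambda>t. indicator {0<..} t *\<^sub>R exp (- w * of_real t))"
    and "(LINT t|lborel. indicator {0<..} t *\<^sub>R exp (- w * of_real t)) = 1 / w"
proof -
  show int: "integrable lborel (\<lambda>t. indicator {0<..} t *\<^sub>R exp (- w * of_real t))"
  proof (rule Bochner_Integration.integrable_bound[OF integrable_exp_abs[OF w]])
    show "AE t in lborel. norm (indicator {0<..} t *\<^sub>R exp (- w * of_real t)) \<le> norm (exp (- Re w * \<bar>t\<bar>))"
      by (intro AE_I2) (auto simp: indicator_def)
  qed measurable
  have "(LBINT t=0..\<infinity>. exp (- w * of_real t)) = 0 - (- 1 / w)"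
  proof (rule interval_integral_FTC_integrable[where F = "\<lambda>t. - exp (- w * of_real t) / w"])
    show "set_integrable lborel (einterval 0 \<infinity>) (\<lambda>t. exp (- w * of_real t))"
      using int by (simp add: set_integrable_def zero_ereal_def)
    show "((\<lambda>t. - exp (- w * of_real t) / w) has_vector_derivative exp (- w * of_real x)) (at x)" for x
    proof (rule has_vector_derivative_real_field[where f = "\<lambda>t. - exp (- w * t) / w"])
      show "((\<lambda>t. - exp (- w * t) / w) has_field_derivative exp (- w * of_real x)) (at (of_real x))"
        using w by (auto intro!: derivative_eq_intros)
    qed
    have "isCont (\<lambda>t. - exp (- w * complex_of_real t) / w) 0" using w by (auto intro!: continuous_intros)
    hence "((\<lambda>t. - exp (- w * complex_of_real t) / w) \<longlongrightarrow> - exp (- w * complex_of_real 0) / w) (at_right 0)"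
      unfolding isCont_def by (rule filterlim_mono[OF _ order.refl]) (simp add: at_le)
    thus "(((\<lambda>t. - exp (- w * complex_of_real t) / w) \<circ> real_of_ereal) \<longlongrightarrow> - 1 / w) (at_right 0)"
      by (simp add: zero_ereal_def ereal_tendsto_simps)
    have "((\<lambda>t. - exp (- w * complex_of_real t) / w) \<longlongrightarrow> 0) at_top"
    proof (rule Lim_null_comparison[OF always_eventually])
      show "\<forall>t. norm (- exp (- w * complex_of_real t) / w) \<le> exp (- Re w * t) / norm w"
        by (simp add: norm_divide)
      have "((\<lambda>t. exp (- Re w * t)) \<longlongrightarrow> 0) at_top" using w by real_asymp
      thus "((\<lambda>t. exp (- Re w * t) / norm w) \<longlongrightarrow> 0) at_top"
        by (rule tendsto_divide_zero)
    qed
    thus "(((\<lambda>t. - exp (- w * complex_of_real t) / w) \<circ> real_of_ereal) \<longlongrightarrow> 0) (at_left \<infinity>)"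
      by (simp add: ereal_tendsto_simps)
  qed (auto intro!: continuous_intros)
  thus "(LINT t|lborel. indicator {0<..} t *\<^sub>R exp (- w * of_real t)) = 1 / w"
    by (simp add: interval_lebesgue_integral_def set_lebesgue_integral_def zero_ereal_def)
qed

text \<open>The integral is split at \<open>t = 0\<close> and the negative half is reflected. There
  the functional equation of theta produces the reflected integrand and two elementary exponentials,
  whose integrals are the polar terms at 1 and 0.\<close>

lemma theta_laplace_eq:
  assumes z: "Re z > 1"
  shows "(LINT t|lborel. of_real (theta_tail (exp t)) * exp (z * of_real t)) =
          theta_mellin z + 1 / (2 * (z - 1)) - 1 / (2 * z)"
proof -
  let ?W = "\<lambda>t. complex_of_real (theta_tail (exp t))"
  let ?ip = "\<lambda>t. indicator {0<..} t :: real"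
  let ?in = "\<lambda>t. indicator {..<0} t :: real"
  note int = theta_laplace(1)[OF z]
  have ip: "integrable lborel (\<lambda>t. ?ip t *\<^sub>R (?W t * exp (z * of_real t)))"
    and in': "integrable lborel (\<lambda>t. ?in t *\<^sub>R (?W t * exp (z * of_real t)))"
    using int by (auto intro!: integrable_mult_indicator)
  have "(LINT t|lborel. ?W t * exp (z * of_real t)) = (LINT t|lborel. ?ip t *\<^sub>R (?W t * exp (z * of_real t)) + ?in t *\<^sub>R (?W t * exp (z * of_real t)))"
    by (intro integral_cong_AE AE_I'[of "{0}"]) (auto simp: indicator_def split: if_splits)
  also have "\<dots> = (LINT t|lborel. ?ip t *\<^sub>R (?W t * exp (z * of_real t))) + (LINT t|lborel. ?in t *\<^sub>R (?W t * exp (z * of_real t)))"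
    by (rule Bochner_Integration.integral_add[OF ip in'])
  also have "(LINT t|lborel. ?in t *\<^sub>R (?W t * exp (z * of_real t))) =
      \<bar>-1\<bar> *\<^sub>R (LINT t|lborel. ?in (0 + (-1) * t) *\<^sub>R (?W (0 + (-1) * t) * exp (z * of_real (0 + (-1) * t))))"
    by (rule lborel_integral_real_affine) simp
  also have "\<dots> = (LINT t|lborel. ?ip t *\<^sub>R (?W t * exp ((1 - z) * of_real t)) +
       (1 / 2 * (?ip t *\<^sub>R exp (- (z - 1) * of_real t)) - 1 / 2 * (?ip t *\<^sub>R exp (- z * of_real t))))"
  proof -
    have pt: "?in (0 + (-1) * t) *\<^sub>R (?W (0 + (-1) * t) * exp (z * of_real (0 + (-1) * t))) =
       ?ip t *\<^sub>R (?W t * exp ((1 - z) * of_real t)) +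
       (1 / 2 * (?ip t *\<^sub>R exp (- (z - 1) * of_real t)) - 1 / 2 * (?ip t *\<^sub>R exp (- z * of_real t)))" for t
    proof -
    have "1 + 2 * theta_tail (exp (- t)) = (1 + 2 * theta_tail (exp t)) * exp t"
      using theta_functional_equation[of "exp (- t)"] by (simp add: exp_minus field_simps)
    hence "theta_tail (exp (- t)) = exp t * theta_tail (exp t) + exp t / 2 - 1 / 2" by (simp add: algebra_simps)
    hence "?W (- t) = exp (of_real t) * ?W t + exp (of_real t) / 2 - 1 / 2" by (simp add: exp_of_real)
    hence "?W (- t) * exp (- (z * of_real t)) = (exp (of_real t) * ?W t + exp (of_real t) / 2 - 1 / 2) * exp (- (z * of_real t))"
      by (simp only:)
    also have "\<dots> = ?W t * (exp (of_real t) * exp (- (z * of_real t))) + exp (of_real t) * exp (- (z * of_real t)) / 2 - exp (- (z * of_real t)) / 2"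
      by (simp add: field_simps)
    also have "exp (of_real t) * exp (- (z * of_real t)) = exp ((1 - z) * of_real t)"
      by (simp add: exp_add[symmetric] algebra_simps)
    finally show ?thesis by (cases "t > 0") simp_all
    qed
    show ?thesis unfolding pt by simp
  qed
  also have "\<dots> = (LINT t|lborel. ?ip t *\<^sub>R (?W t * exp ((1 - z) * of_real t))) +
       (1 / 2 * (1 / (z - 1)) - 1 / 2 * (1 / z))"
  proof -
    have e1: "integrable lborel (\<lambda>t. 1 / 2 * (?ip t *\<^sub>R exp (- (z - 1) * of_real t)))"
      "integrable lborel (\<lambda>t. 1 / 2 * (?ip t *\<^sub>R exp (- z * of_real t)))"
      by (intro integrable_mult_right integral_exp_half_line; use z in simp)+
    have z': "Re (z - 1) > 0" "Re z > 0" using z by auto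
    show ?thesis
      unfolding Bochner_Integration.integral_add[OF theta_half_integrable Bochner_Integration.integrable_diff[OF e1]]
        Bochner_Integration.integral_diff[OF e1] integral_mult_right_zero
        integral_exp_half_line(2)[OF z'(1)] integral_exp_half_line(2)[OF z'(2)] ..
  qed
  finally have "(LINT t|lborel. ?W t * exp (z * of_real t)) = (LINT t|lborel. ?ip t *\<^sub>R (?W t * exp (z * of_real t))) +
     (LINT t|lborel. ?ip t *\<^sub>R (?W t * exp ((1 - z) * of_real t))) + (1 / 2 * (1 / (z - 1)) - 1 / 2 * (1 / z))"
    by simp
  also have "(LINT t|lborel. ?ip t *\<^sub>R (?W t * exp (z * of_real t))) +
     (LINT t|lborel. ?ip t *\<^sub>R (?W t * exp ((1 - z) * of_real t))) = theta_mellin z"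
    unfolding theta_mellin_def
    by (subst Bochner_Integration.integral_add[OF theta_half_integrable theta_half_integrable, symmetric])
       (simp add: distrib_left scaleR_add_right)
  finally show ?thesis by (simp only: times_divide_times_eq mult_1_left add_diff_eq)
qed

text \<open>The polar term at 0 is absorbed by writing \<open>rGamma (z / 2) / (2 * z)\<close> as
  \<open>rGamma (z / 2 + 1) / 4\<close>, which is entire. Only the singularity at 1 remains, where
  the value 0 follows the normalisation of \<open>riemann_zeta\<close>.\<close>

definition zeta_cont :: "complex \<Rightarrow> complex" where
  "zeta_cont z = (if z = 1 then 0 else
     2 * of_real pi powr (z / 2) * (rGamma (z / 2) * (theta_mellin z + 1 / (2 * (z - 1))) - rGamma (z / 2 + 1) / 4))"

lemma zeta_cont_Phi:
  assumes "Re z > 0" "z \<noteq> 1"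
  shows "zeta_cont z * Phi z = theta_mellin z + 1 / (2 * (z - 1)) - 1 / (2 * z)"
proof -
  let ?c = "2 * of_real pi powr (z / 2) :: complex"
  have z0: "z \<noteq> 0" using assms by auto
  have "rGamma (z / 2 + 1) = 2 / z * rGamma (z / 2)"
    using rGamma_plus1[of "z / 2"] z0 by (simp add: field_simps)
  hence "zeta_cont z = (?c * rGamma (z / 2)) * (theta_mellin z + 1 / (2 * (z - 1)) - 1 / (2 * z))"
    using assms z0 by (simp add: zeta_cont_def algebra_simps)
  hence "zeta_cont z * Phi z = (?c * rGamma (z / 2) * Phi z) * (theta_mellin z + 1 / (2 * (z - 1)) - 1 / (2 * z))"
    by (simp only: mult_ac)
  thus ?thesis by (simp only: Phi_rGamma[OF assms(1)] mult_1)
qed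

lemma zeta_cont_sums:
  assumes z: "Re z > 1"
  shows "(\<lambda>n. 1 / of_nat (Suc n) powr z) sums zeta_cont z"
proof -
  have z': "Re z > 0" "z \<noteq> 1" using z by auto
  have "(\<lambda>n. 1 / of_nat (Suc n) powr z * Phi z) sums (zeta_cont z * Phi z)"
    unfolding zeta_cont_Phi[OF z'] using theta_laplace(2)[OF z] unfolding theta_laplace_eq[OF z] .
  hence "(\<lambda>n. 1 / of_nat (Suc n) powr z * Phi z / Phi z) sums (zeta_cont z * Phi z / Phi z)"
    by (rule sums_divide)
  thus ?thesis using Phi_nonzero[OF z'(1)] by (simp del: of_nat_Suc)
qed

lemma zeta_cont_holomorphic: "zeta_cont holomorphic_on (- {1})"
proof -
  have "(\<lambda>z. 2 * of_real pi powr (z / 2) * (rGamma (z / 2) * (theta_mellin z + 1 / (2 * (z - 1))) - rGamma (z / 2 + 1) / 4)) holomorphic_on (- {1})"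
    by (intro holomorphic_intros holomorphic_on_subset[OF theta_mellin_holomorphic]) auto
  thus ?thesis by (rule holomorphic_transform) (auto simp: zeta_cont_def)
qed

text \<open>The definite description is resolved by the identity theorem on the punctured plane,
  which is connected; the prescribed value at 1 settles the remaining point.\<close>

lemma riemann_zeta_eq: "riemann_zeta = zeta_cont"
  unfolding riemann_zeta_def
proof (rule the_equality)
  show "zeta_cont holomorphic_on - {1} \<and> zeta_cont 1 = 0 \<and>
     (\<forall>s. 1 < Re s \<longrightarrow> (\<lambda>n. 1 / of_nat (Suc n) powr s) sums zeta_cont s)"
    using zeta_cont_holomorphic zeta_cont_sums by (auto simp: zeta_cont_def simp del: of_nat_Suc)
  fix F assume F: "F holomorphic_on - {1} \<and> F 1 = 0 \<and> (\<forall>s. 1 < Re s \<longrightarrow> (\<lambda>n. 1 / of_nat (Suc n) powr s) sums F s)"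
  show "F = zeta_cont"
  proof
    fix z
    show "F z = zeta_cont z"
    proof (cases "z = 1")
      case False
      show ?thesis
      proof (rule analytic_continuation_open[where s = "{z. Re z > 1}" and s' = "- {1}" and f = F and g = zeta_cont])
        show "open {z. Re z > 1}" by (rule open_halfspace_Re_gt)
        show "{z. Re z > 1} \<noteq> {}" by (auto intro: exI[of _ 2])
        show "connected (- {1 :: complex})" by (rule connected_punctured_universe) simp
        show "F w = zeta_cont w" if "w \<in> {z. Re z > 1}" for w
          using F zeta_cont_sums[of w] that sums_unique2 by blast
      qed (use F zeta_cont_holomorphic False in auto)
    qed (use F in \<open>auto simp: zeta_cont_def\<close>)
  qed
qed

lemma zeta_holomorphic: "riemann_zeta holomorphic_on (- {1})"
  and zeta_sums: "Re z > 1 \<Longrightarrow> (\<lambda>n. 1 / of_nat (Suc n) powr z) sums riemann_zeta z"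
  using zeta_cont_holomorphic zeta_cont_sums by (simp_all add: riemann_zeta_eq del: of_nat_Suc)

text \<open>The expression for the product with \<open>Phi\<close> is invariant under
  \<open>z \<mapsto> 1 - z\<close>. The open critical strip is where the integrals for
  \<open>Phi z\<close> and \<open>Phi (1 - z)\<close> both converge.\<close>

lemma zeta_functional_equation:
  assumes "0 < Re z" "Re z < 1"
  shows "riemann_zeta z * Phi z = riemann_zeta (1 - z) * Phi (1 - z)"
proof -
  have "z \<noteq> 1" "1 - z \<noteq> 1" "z \<noteq> 0" using assms by auto
  hence "zeta_cont (1 - z) * Phi (1 - z) = theta_mellin z + 1 / (2 * ((1 - z) - 1)) - 1 / (2 * (1 - z))"
      "zeta_cont z * Phi z = theta_mellin z + 1 / (2 * (z - 1)) - 1 / (2 * z)"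
    using zeta_cont_Phi[of z] zeta_cont_Phi[of "1 - z"] assms theta_mellin_reflect[of z] by simp_all
  moreover have "2 * ((1 - z) - 1) = - (2 * z)" "2 * (1 - z) = - (2 * (z - 1))" by (simp_all add: algebra_simps)
  ultimately show ?thesis unfolding riemann_zeta_eq by (simp only: divide_minus_right) simp
qed

text \<open>The first term of the Dirichlet series is 1, and the others sum to at most
  \<open>pi\<^sup>2 / 6 - 1\<close>, which is less than 1.\<close>

lemma zeta_lower_bound:
  assumes "Re z \<ge> 2" shows "norm (riemann_zeta z) \<ge> 2 - pi\<^sup>2 / 6"
proof -
  have s: "(\<lambda>n. 1 / of_nat (Suc n) powr z) sums riemann_zeta z" using assms by (intro zeta_sums) auto
  have le: "norm (1 / of_nat (Suc n) powr z) \<le> 1 / (real (Suc n))\<^sup>2" for n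
  proof -
    have "norm (1 / of_nat (Suc n) powr z) = real (Suc n) powr (- Re z)" by (rule norm_powr_Suc)
    also have "\<dots> \<le> real (Suc n) powr (- 2)" using assms by (intro powr_mono) auto
    also have "\<dots> = 1 / (real (Suc n))\<^sup>2" by (simp add: powr_minus divide_inverse del: of_nat_Suc)
    finally show ?thesis .
  qed
  have sq: "(\<lambda>n. 1 / (real (Suc n))\<^sup>2) sums (pi\<^sup>2 / 6)" using inverse_squares_sums by (simp add: add.commute)
  have e0: "of_nat (Suc 0) = (1 :: complex)" "real (Suc 0) = 1" by simp_all
  have "(\<lambda>n. 1 / of_nat (Suc (Suc n)) powr z) sums (riemann_zeta z - 1)"
    using s sums_Suc_iff[of "\<lambda>n. 1 / of_nat (Suc n) powr z" "riemann_zeta z - 1"] by (simp del: of_nat_Suc add: e0)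
  moreover have "(\<lambda>n. 1 / (real (Suc (Suc n)))\<^sup>2) sums (pi\<^sup>2 / 6 - 1)"
    using sq sums_Suc_iff[of "\<lambda>n. 1 / (real (Suc n))\<^sup>2" "pi\<^sup>2 / 6 - 1"] by (simp del: of_nat_Suc add: e0)
  ultimately have "norm (riemann_zeta z - 1) \<le> pi\<^sup>2 / 6 - 1"
    by (rule norm_sums_le) (rule le)
  moreover have "1 - norm (riemann_zeta z) \<le> norm (riemann_zeta z - 1)"
    using norm_triangle_ineq2[of 1 "riemann_zeta z"] by (simp add: norm_minus_commute)
  ultimately show ?thesis by simp
qed

lemma pi_squared_lt: "pi\<^sup>2 < 12"
proof -
  have "pi \<le> 3.2" using pi_approx by simp
  hence "pi\<^sup>2 \<le> 3.2\<^sup>2" by (intro power_mono) auto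
  thus ?thesis by (simp add: power2_eq_square)
qed

subsection \<open>Polynomial growth of zeta\<close>

text \<open>The pole is multiplied away; the value 1 at the removed point is the residue of zeta, so
  this function is holomorphic across 1.\<close>

definition zeta_pole_factor :: "complex \<Rightarrow> complex" where
  "zeta_pole_factor z = (if z = 1 then 1 else (z - 1) * riemann_zeta z)"

text \<open>With \<open>m = Suc n\<close> this is \<open>s - 1\<close> times the difference between
  \<open>m powr (- s)\<close> and the integral of \<open>x powr (- s)\<close> over
  \<open>[m, m + 1]\<close>, the first-order Euler-Maclaurin remainder. The factor
  \<open>s - 1\<close> clears the denominator of the integral.\<close>

definition zeta_em_term :: "nat \<Rightarrow> complex \<Rightarrow> complex" where
  "zeta_em_term n s = (s - 1) * (1 / of_nat (Suc n) powr s) +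
     (of_nat (Suc (Suc n)) powr (1 - s) - of_nat (Suc n) powr (1 - s))"

text \<open>The mean value inequality is used twice: for the oscillation of
  \<open>w powr (- s)\<close> on the unit segment, and for an antiderivative of that oscillation.
  One power of the index is gained, so the series converges for \<open>Re s > 0\<close>.\<close>

lemma zeta_em_term_bound:
  assumes s: "Re s > 0"
  shows "norm (zeta_em_term n s) \<le> norm (s - 1) * norm s * real (Suc n) powr (- Re s - 1)"
proof -
  let ?m = "real (Suc n)"
  let ?S = "closed_segment (complex_of_real ?m) (of_real (?m + 1))"
  have S: "\<exists>x\<ge>?m. w = of_real x \<and> x \<le> ?m + 1" if w: "w \<in> ?S" for w
  proof -
    from w[unfolded in_segment(1)] obtain u
      where u: "0 \<le> u" "u \<le> 1" "w = (1 - u) *\<^sub>R complex_of_real ?m + u *\<^sub>R of_real (?m + 1)"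
      by (elim exE conjE) (rule that; assumption)
    hence "w = of_real (?m + u)" by (simp add: scaleR_conv_of_real algebra_simps)
    thus ?thesis using u by (intro exI[of _ "?m + u"]) auto
  qed
  have nonpos: "w \<notin> \<real>\<^sub>\<le>\<^sub>0" if "w \<in> ?S" for w using S[OF that] by (auto simp: complex_nonpos_Reals_iff)
  have der: "((\<lambda>w. w powr a) has_field_derivative a * w powr (a - 1)) (at w within ?S)" if "w \<in> ?S" for w a
    using nonpos[OF that] by (auto intro!: derivative_eq_intros has_field_derivative_powr)
  have np: "norm (w powr a) = Re w powr Re a" if "w \<in> ?S" for w a
  proof -
    obtain x where x: "x \<ge> ?m" "w = of_real x" using S[OF \<open>w \<in> ?S\<close>] by auto
    hence "x > 0" by (auto intro: less_le_trans[OF _ x(1)])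
    thus ?thesis using x by (simp add: norm_powr_real_powr)
  qed
  have step: "norm (w powr (- s) - of_real ?m powr (- s)) \<le> norm s * ?m powr (- Re s - 1)" if w: "w \<in> ?S" for w
  proof -
    have "norm (w powr (- s) - of_real ?m powr (- s)) \<le> norm s * ?m powr (- Re s - 1) * norm (w - of_real ?m)"
    proof (rule field_differentiable_bound[where S = ?S and f' = "\<lambda>w. - s * w powr (- s - 1)"])
      show "norm (- s * v powr (- s - 1)) \<le> norm s * ?m powr (- Re s - 1)" if "v \<in> ?S" for v
      proof -
        have "Re v \<ge> ?m" using S[OF that] by auto
        hence "Re v powr (- Re s - 1) \<le> ?m powr (- Re s - 1)" using s by (intro powr_mono2') auto
        thus ?thesis using np[OF that, of "- s - 1"] by (simp add: norm_mult mult_left_mono)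
      qed
    qed (use w der[of _ "- s"] in auto)
    also have "\<dots> \<le> norm s * ?m powr (- Re s - 1) * 1"
    proof -
      obtain x where "x \<ge> ?m" "w = of_real x" "x \<le> ?m + 1" using S[OF w] by auto
      hence "norm (w - of_real ?m) = \<bar>x - ?m\<bar>" "\<bar>x - ?m\<bar> \<le> 1"
        by (simp_all only: of_real_diff[symmetric] norm_of_real)
      hence "norm (w - of_real ?m) \<le> 1" by simp
      thus ?thesis by (intro mult_left_mono) auto
    qed
    finally show ?thesis by simp
  qed
  \<comment> \<open>The increment of \<open>g\<close> over the segment is
    \<open>zeta_em_term n s\<close>, and its derivative is the oscillation bounded by
    \<open>step\<close>.\<close>
  define g where "g w = (s - 1) * (of_real ?m powr (- s)) * w + w powr (1 - s)" for w
  have "norm (g (of_real (?m + 1)) - g (of_real ?m)) \<le> norm (s - 1) * (norm s * ?m powr (- Re s - 1)) * norm (complex_of_real (?m + 1) - of_real ?m)"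
  proof (rule field_differentiable_bound[where S = ?S and f' = "\<lambda>w. (s - 1) * (of_real ?m powr (- s) - w powr (- s))"])
    show "(g has_field_derivative (s - 1) * (of_real ?m powr (- s) - w powr (- s))) (at w within ?S)" if w: "w \<in> ?S" for w
    proof -
      have "(g has_field_derivative (s - 1) * (of_real ?m powr (- s)) * 1 + (1 - s) * w powr (1 - s - 1)) (at w within ?S)"
        unfolding g_def by (intro DERIV_add DERIV_cmult DERIV_ident der[OF w])
      also have "(s - 1) * (of_real ?m powr (- s)) * 1 + (1 - s) * w powr (1 - s - 1) = (s - 1) * (of_real ?m powr (- s) - w powr (- s))"
        by (simp add: algebra_simps)
      finally show ?thesis .
    qed
    show "norm ((s - 1) * (of_real ?m powr (- s) - w powr (- s))) \<le> norm (s - 1) * (norm s * ?m powr (- Re s - 1))" if w: "w \<in> ?S" for w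
      unfolding norm_mult using step[OF w] by (intro mult_left_mono) (auto simp: norm_minus_commute)
  qed auto
  also have "norm (complex_of_real (?m + 1) - of_real ?m) = 1" by simp
  also have "g (of_real (?m + 1)) - g (of_real ?m) = zeta_em_term n s"
  proof -
    have "g a - g b = (s - 1) * (of_real ?m powr (- s)) * (a - b) + (a powr (1 - s) - b powr (1 - s))" for a b
      by (simp add: g_def algebra_simps)
    moreover have "complex_of_real (?m + 1) - of_real ?m = 1" by simp
    moreover have "complex_of_real ?m powr (- s) = 1 / of_nat (Suc n) powr s" by (simp add: powr_minus divide_inverse del: of_nat_Suc)
    moreover have "complex_of_real (?m + 1) = of_nat (Suc (Suc n))" "complex_of_real ?m = of_nat (Suc n)" by simp_all
    ultimately show ?thesis by (simp only: zeta_em_term_def mult_1_right)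
  qed
  finally show ?thesis by (simp add: mult.assoc)
qed

lemma zeta_em_sums:
  assumes s: "Re s > 1"
  shows "(\<lambda>n. zeta_em_term n s) sums ((s - 1) * riemann_zeta s - 1)"
proof -
  have "(\<lambda>n. of_nat (Suc n) powr (1 - s)) \<longlonglongrightarrow> 0"
  proof (rule Lim_null_comparison[OF always_eventually])
    show "\<forall>n. norm (of_nat (Suc n) powr (1 - s)) \<le> real (Suc n) powr (- (Re s - 1))"
    proof
      fix n
      have "norm (1 / of_nat (Suc n) powr (s - 1)) = real (Suc n) powr (- Re (s - 1))" by (rule norm_powr_Suc)
      moreover have "1 / of_nat (Suc n) powr (s - 1) = (of_nat (Suc n) :: complex) powr (1 - s)"
        using powr_minus[of "of_nat (Suc n) :: complex" "s - 1"] by (simp add: divide_inverse del: of_nat_Suc)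
      ultimately show "norm ((of_nat (Suc n) :: complex) powr (1 - s)) \<le> real (Suc n) powr (- (Re s - 1))" by simp
    qed
    have "((\<lambda>x. x powr (- (Re s - 1))) \<longlongrightarrow> 0) at_top" using s by (intro tendsto_neg_powr filterlim_ident) auto
    moreover have "filterlim (\<lambda>n. real (Suc n)) at_top sequentially"
      by (rule filterlim_compose[OF filterlim_real_sequentially filterlim_Suc])
    ultimately show "(\<lambda>n. real (Suc n) powr (- (Re s - 1))) \<longlonglongrightarrow> 0" by (rule filterlim_compose)
  qed
  hence "(\<lambda>n. of_nat (Suc (Suc n)) powr (1 - s) - of_nat (Suc n) powr (1 - s)) sums (0 - of_nat (Suc 0) powr (1 - s))"
    by (rule telescope_sums)
  moreover have "(\<lambda>n. (s - 1) * (1 / of_nat (Suc n) powr s)) sums ((s - 1) * riemann_zeta s)"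
    by (intro sums_mult zeta_sums s)
  ultimately show ?thesis unfolding zeta_em_term_def
    using sums_add by fastforce
qed

text \<open>The abscissa \<open>1/4\<close> leaves an open neighbourhood of the closed half-plane
  \<open>Re s \<ge> 1/2\<close> and still gives the uniform summable exponent
  \<open>- 5/4\<close>.\<close>

lemma zeta_em_holomorphic: "(\<lambda>s. \<Sum>n. zeta_em_term n s) holomorphic_on {s. Re s > 1/4}"
proof (rule holomorphic_uniform_sequence)
  show "open {s. Re s > 1/4}" by (rule open_halfspace_Re_gt)
  show "(\<lambda>s. \<Sum>i<n. zeta_em_term i s) holomorphic_on {s. Re s > 1/4}" for n
    unfolding zeta_em_term_def powr_Suc_exp by (intro holomorphic_intros) (auto simp del: of_nat_Suc)
  fix z :: complex assume "z \<in> {s. Re s > 1/4}"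
  then obtain d where d: "d > 0" "cball z d \<subseteq> {s. Re s > 1/4}"
    using open_halfspace_Re_gt open_contains_cball by blast
  define K where "K = norm z + d + 1"
  have "uniform_limit (cball z d) (\<lambda>n s. \<Sum>i<n. zeta_em_term i s) (\<lambda>s. \<Sum>n. zeta_em_term n s) sequentially"
  proof (rule Weierstrass_m_test)
    fix n x assume x: "x \<in> cball z d"
    have "norm x \<le> norm z + d" using x norm_triangle_ineq2[of x z] by (auto simp: dist_norm norm_minus_commute)
    hence nx: "norm x \<le> K" "norm (x - 1) \<le> K" using norm_triangle_ineq4[of x 1] by (auto simp: K_def)
    have Re: "Re x > 1/4" using x d by auto
    have K0: "K \<ge> 0" using nx(1) norm_ge_zero[of x] by linarith
    have "norm (zeta_em_term n x) \<le> norm (x - 1) * norm x * real (Suc n) powr (- Re x - 1)"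
      using Re by (intro zeta_em_term_bound) auto
    also have "\<dots> \<le> (K * K) * real (Suc n) powr (- (5/4))"
      using nx Re K0 by (intro mult_mono powr_mono) auto
    finally show "norm (zeta_em_term n x) \<le> (K * K) * real (Suc n) powr (- (5/4))" .
  qed (intro summable_mult summable_Suc_powr, simp)
  thus "\<exists>d>0. cball z d \<subseteq> {s. Re s > 1/4} \<and> uniform_limit (cball z d) (\<lambda>n s. \<Sum>i<n. zeta_em_term i s) (\<lambda>s. \<Sum>n. zeta_em_term n s) sequentially"
    using d by blast
qed

lemma zeta_pole_factor_eq:
  assumes "Re z > 1/4"
  shows "zeta_pole_factor z = 1 + (\<Sum>n. zeta_em_term n z)"
proof (cases "z = 1")
  case True
  have "zeta_em_term n 1 = 0" for n by (simp add: zeta_em_term_def del: of_nat_Suc)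
  thus ?thesis using True by (simp add: zeta_pole_factor_def)
next
  case False
  have "(z - 1) * riemann_zeta z = 1 + (\<Sum>n. zeta_em_term n z)"
  proof (rule analytic_continuation_open[where s = "{s. Re s > 1}" and s' = "{s. Re s > 1/4} - {1}"
        and f = "\<lambda>z. (z - 1) * riemann_zeta z" and g = "\<lambda>z. 1 + (\<Sum>n. zeta_em_term n z)"])
    show "open {z. Re z > 1}" by (rule open_halfspace_Re_gt)
    show "open ({s. Re s > 1/4} - {1})" by (intro open_Diff open_halfspace_Re_gt closed_singleton)
    show "{z. Re z > 1} \<noteq> {}" by (auto intro: exI[of _ 2])
    show "connected ({s. Re s > 1/4} - {1::complex})"
      by (intro connected_open_delete open_halfspace_Re_gt convex_connected convex_halfspace_Re_gt) simp
    show "(\<lambda>z. (z - 1) * riemann_zeta z) holomorphic_on {s. Re s > 1/4} - {1}"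
      by (intro holomorphic_intros holomorphic_on_subset[OF zeta_holomorphic]) auto
    show "(\<lambda>z. 1 + (\<Sum>n. zeta_em_term n z)) holomorphic_on {s. Re s > 1/4} - {1}"
      by (intro holomorphic_intros holomorphic_on_subset[OF zeta_em_holomorphic]) auto
    show "(w - 1) * riemann_zeta w = 1 + (\<Sum>n. zeta_em_term n w)" if "w \<in> {s. Re s > 1}" for w
      using zeta_em_sums[of w] that by (auto simp: sums_iff)
  qed (use False assms in auto)
  thus ?thesis using False by (simp add: zeta_pole_factor_def)
qed

lemma zeta_pole_factor_holomorphic: "zeta_pole_factor holomorphic_on {z. Re z > 1/4}"
  by (rule holomorphic_transform[OF holomorphic_on_add[OF holomorphic_on_const zeta_em_holomorphic]])
    (auto simp: zeta_pole_factor_eq)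

lemma zeta_pole_factor_growth:
  obtains C where "C > 0" "\<And>z. Re z \<ge> 1/2 \<Longrightarrow> norm (zeta_pole_factor z) \<le> C * (1 + norm z)\<^sup>2"
proof -
  define S where "S = (\<Sum>n. real (Suc n) powr (- (3/2)))"
  have sm: "summable (\<lambda>n. real (Suc n) powr (- (3/2)))" by (rule summable_Suc_powr) simp
  have S: "S \<ge> 0" unfolding S_def by (rule suminf_nonneg[OF sm]) auto
  show ?thesis
  proof (rule that[of "1 + S"])
    fix z assume z: "Re z \<ge> 1/2"
    have nz: "norm (z - 1) \<le> 1 + norm z" using norm_triangle_ineq4[of z 1] by simp
    have le: "norm (zeta_em_term n z) \<le> (1 + norm z)\<^sup>2 * real (Suc n) powr (- (3/2))" for n
    proof -
      have "norm (zeta_em_term n z) \<le> norm (z - 1) * norm z * real (Suc n) powr (- Re z - 1)"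
        using z by (intro zeta_em_term_bound) auto
      also have "\<dots> \<le> ((1 + norm z) * (1 + norm z)) * real (Suc n) powr (- (3/2))"
        using z nz by (intro mult_mono powr_mono) auto
      finally show ?thesis by (simp only: power2_eq_square)
    qed
    have "norm (\<Sum>n. zeta_em_term n z) \<le> (\<Sum>n. (1 + norm z)\<^sup>2 * real (Suc n) powr (- (3/2)))"
    proof (rule norm_sums_le)
      show "(\<lambda>n. (1 + norm z)\<^sup>2 * real (Suc n) powr (- (3/2))) sums (\<Sum>n. (1 + norm z)\<^sup>2 * real (Suc n) powr (- (3/2)))"
        by (intro summable_sums summable_mult sm)
      show "(\<lambda>n. zeta_em_term n z) sums (\<Sum>n. zeta_em_term n z)"
        by (intro summable_sums summable_comparison_test'[OF summable_mult[OF sm], of 0 _ "(1 + norm z)\<^sup>2"] le)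
    qed (rule le)
    also have "\<dots> = (1 + norm z)\<^sup>2 * S" unfolding S_def by (rule suminf_mult[OF sm])
    finally have "norm (zeta_pole_factor z) \<le> 1 + (1 + norm z)\<^sup>2 * S"
      using z by (subst zeta_pole_factor_eq) (auto intro: norm_triangle_le)
    moreover have "1 \<le> (1 + norm z)\<^sup>2" by (rule one_le_power) simp
    moreover have "(1 + S) * (1 + norm z)\<^sup>2 = (1 + norm z)\<^sup>2 + (1 + norm z)\<^sup>2 * S" by (simp only: distrib_right mult_1 mult.commute)
    ultimately show "norm (zeta_pole_factor z) \<le> (1 + S) * (1 + norm z)\<^sup>2" by linarith
  qed (use S in simp)
qed

section \<open>The local functional equation\<close>

text \<open>The shear \<open>t = s + r\<close> turns a product of two Mellin transforms into an
  outer integral over the ratio of the two multiplicative variables.\<close>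

lemma integral_mult_shear:
  fixes U V :: "real \<Rightarrow> complex"
  assumes U: "integrable lborel U" and V: "integrable lborel V"
  shows "(LINT s|lborel. U s) * (LINT t|lborel. V t) = (LINT r|lborel. LINT s|lborel. U s * V (s + r))"
proof -
  note [measurable] = borel_measurable_integrable[OF U, simplified] borel_measurable_integrable[OF V, simplified]
  have shift: "(LINT r|lborel. g (s + r)) = (LINT t|lborel. g t)" for g :: "real \<Rightarrow> 'a :: {banach, second_countable_topology}" and s
    using lborel_integral_real_affine[of 1 g s] by simp
  have Vs: "integrable lborel (\<lambda>r. V (s + r))" for s
    using lborel_integrable_real_affine[OF V, of 1 s] by simp
  have "integrable (lborel \<Otimes>\<^sub>M lborel) (\<lambda>(s, r). U s * V (s + r))"
  proof (rule lborel_pair.Fubini_integrable)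
    show "(\<lambda>(s, r). U s * V (s + r)) \<in> borel_measurable (lborel \<Otimes>\<^sub>M lborel)"
      unfolding case_prod_beta by measurable
    show "AE s in lborel. integrable lborel (\<lambda>r. case (s, r) of (s, r) \<Rightarrow> U s * V (s + r))"
      using Vs by simp
    have "(LINT r|lborel. norm (U s * V (s + r))) = norm (U s) * (LINT t|lborel. norm (V t))" for s
      using shift[of "\<lambda>r. norm (V r)" s] by (simp add: norm_mult)
    thus "integrable lborel (\<lambda>s. LINT r|lborel. norm (case (s, r) of (s, r) \<Rightarrow> U s * V (s + r)))"
      using U by simp
  qed
  from lborel_pair.Fubini_integral[OF this]
  have "(LINT r|lborel. LINT s|lborel. U s * V (s + r)) = (LINT s|lborel. LINT r|lborel. U s * V (s + r))" .
  also have "\<dots> = (LINT s|lborel. U s * (LINT t|lborel. V t))" using shift[of V] by simp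
  finally show ?thesis by simp
qed

lemma fourier_parseval:
  assumes f: "integrable lborel f" and g: "integrable lborel g"
  shows "(LINT y|lborel. fourier f y * g y) = (LINT x|lborel. f x * fourier g x)"
proof -
  have "(LINT y|lborel. fourier f y * g y) = (LINT y|lborel. LINT x|lborel. f x * g y * cis (2 * pi * x * y))"
    unfolding fourier_cis by (subst integral_mult_left_zero[symmetric]) (simp only: mult_ac)
  also have "\<dots> = (LINT x|lborel. LINT y|lborel. f x * g y * cis (2 * pi * x * y))"
    by (rule Fubini_mult_bounded[OF f g]) (auto simp: case_prod_beta)
  also have "\<dots> = (LINT x|lborel. f x * fourier g x)"
    unfolding fourier_cis by (subst integral_mult_right_zero[symmetric]) (simp only: mult_ac)
  finally show ?thesis .
qed

lemma fourier_even:
  assumes "\<And>x. f (- x) = f x" shows "fourier f (- y) = fourier f y"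
proof -
  have "fourier f (- y) = \<bar>-1\<bar> *\<^sub>R (LINT x|lborel. f (0 + (-1) * x) * cis (2 * pi * (0 + (-1) * x) * (- y)))"
    unfolding fourier_cis by (rule lborel_integral_real_affine) simp
  thus ?thesis by (simp add: fourier_cis assms)
qed

lemma fourier_H_plus: "f \<in> H_plus \<Longrightarrow> fourier f \<in> H_plus"
  by (auto simp: H_plus_def fourier_schwartz fourier_even)

lemma schwartz_gauss_integrable:
  assumes "f \<in> schwartz" shows "integrable lborel (\<lambda>x. f x * gauss a x)"
proof -
  note [measurable] = borel_measurable_continuous_onI[OF schwartz_continuous[OF assms]]
  show ?thesis
    by (rule Bochner_Integration.integrable_bound[OF schwartz_integrable[OF assms]])
      (auto simp: norm_mult norm_gauss_le_1 mult_left_le)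
qed

text \<open>Tate's argument: after a shear, the product of the Mellin transforms of \<open>f\<close> and of the Gaussian
  is an integral over the pairings of \<open>f\<close> with all dilated Gaussians.\<close>

lemma mellin_Phi_product:
  assumes f: "f \<in> H_plus" and z: "0 < Re z" "Re z < 1"
  shows "mellin f z * Phi (1 - z) =
    (LINT r|lborel. exp ((1 - z) * of_real r) * (LINT x|lborel. f x * gauss (exp r) x) / 2)"
proof -
  have S: "f \<in> schwartz" and ev: "f (- x) = f x" for x using f by (auto simp: H_plus_def)
  note [measurable] = borel_measurable_continuous_onI[OF schwartz_continuous[OF S]]
  define U where "U s = f (exp s) * exp (z * of_real s)" for s
  define V where "V t = gauss 1 (exp t) * exp ((1 - z) * of_real t)" for t
  have U: "integrable lborel U" unfolding U_def
    by (rule laplace_class_integrable[OF schwartz_laplace_class[OF S], of 0 2]) (use z in auto)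
  have V: "integrable lborel V" unfolding V_def
    by (rule laplace_class_integrable[OF schwartz_laplace_class[OF gauss_schwartz0[OF zero_less_one]], of 0 2]) (use z in auto)
  have "mellin f z * Phi (1 - z) = (LINT s|lborel. U s) * (LINT t|lborel. V t)"
    unfolding mellin_schwartz(2)[OF S] Phi_laplace laplace_def U_def V_def ..
  also have "\<dots> = (LINT r|lborel. LINT s|lborel. U s * V (s + r))"
    by (rule integral_mult_shear[OF U V])
  also have "\<dots> = (LINT r|lborel. exp ((1 - z) * of_real r) * (LINT x|lborel. f x * gauss (exp r) x) / 2)"
  proof (intro Bochner_Integration.integral_cong refl)
    fix r
    have "(LINT s|lborel. U s * V (s + r)) = (LINT s|lborel. exp ((1 - z) * of_real r) * ((f (exp s) * gauss (exp r) (exp s)) * exp (1 * of_real s)))"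
    proof (intro Bochner_Integration.integral_cong refl)
      fix s
      \<comment> \<open>The exponents \<open>z\<close> and \<open>1 - z\<close> add up to 1 in
        \<open>s\<close>, so the inner integral is an additive integral of \<open>f\<close> against
        a dilated Gaussian, and \<open>z\<close> survives in the outer integral only.\<close>
      have "exp (z * of_real s) * exp ((1 - z) * of_real (s + r)) = exp ((1 - z) * of_real r) * exp (1 * of_real s)"
        by (simp add: exp_add[symmetric] algebra_simps)
      moreover have "gauss 1 (exp (s + r)) = gauss (exp r) (exp s)" by (simp add: gauss_def exp_add mult.commute)
      ultimately have eq: "(exp (z * of_real s) * exp ((1 - z) * of_real (s + r))) * (f (exp s) * gauss 1 (exp (s + r))) =
          (exp ((1 - z) * of_real r) * exp (1 * of_real s)) * (f (exp s) * gauss (exp r) (exp s))" by (simp only:)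
      have "U s * V (s + r) = (exp (z * of_real s) * exp ((1 - z) * of_real (s + r))) * (f (exp s) * gauss 1 (exp (s + r)))"
        unfolding U_def V_def by (simp only: mult_ac)
      also note eq
      also have "(exp ((1 - z) * of_real r) * exp (1 * of_real s)) * (f (exp s) * gauss (exp r) (exp s)) =
          exp ((1 - z) * of_real r) * ((f (exp s) * gauss (exp r) (exp s)) * exp (1 * of_real s))" by (simp only: mult_ac)
      finally show "U s * V (s + r) = exp ((1 - z) * of_real r) * ((f (exp s) * gauss (exp r) (exp s)) * exp (1 * of_real s))" .
    qed
    also have "\<dots> = exp ((1 - z) * of_real r) * laplace (\<lambda>s. f (exp s) * gauss (exp r) (exp s)) 1"
      unfolding laplace_def by (rule integral_mult_right_zero)
    also have "laplace (\<lambda>s. f (exp s) * gauss (exp r) (exp s)) 1 = mellin (\<lambda>x. f x * gauss (exp r) x) 1"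
      by (rule mellin_laplace(1)[symmetric]) measurable
    also have "\<dots> = (LINT x|lborel. f x * gauss (exp r) x) / 2"
    proof -
      have "2 * mellin (\<lambda>x. f x * gauss (exp r) x) 1 = (LINT x|lborel. f x * gauss (exp r) x)"
        by (rule mellin_1_even[OF schwartz_gauss_integrable[OF S]]) (simp add: ev gauss_even)
      thus ?thesis by (metis nonzero_mult_div_cancel_left zero_neq_numeral)
    qed
    finally show "(LINT s|lborel. U s * V (s + r)) = exp ((1 - z) * of_real r) * (LINT x|lborel. f x * gauss (exp r) x) / 2" by simp
  qed
  finally show ?thesis .
qed

text \<open>\<open>f\<close> enters \<open>mellin_Phi_product\<close> only through its pairings with
  dilated Gaussians. Parseval's formula moves the Fourier transform to the Gaussian, which inverts
  the dilation and produces a factor \<open>exp r\<close>; with the reflection of \<open>r\<close>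
  this exchanges \<open>z\<close> and \<open>1 - z\<close>.\<close>

theorem local_functional_equation:
  assumes f: "f \<in> H_plus" and z: "0 < Re z" "Re z < 1"
  shows "mellin f z * Phi (1 - z) = mellin (fourier f) (1 - z) * Phi z"
proof -
  have S: "f \<in> schwartz" using f by (auto simp: H_plus_def)
  have "mellin (fourier f) (1 - z) * Phi z =
      (LINT r|lborel. exp (z * of_real r) * (LINT x|lborel. fourier f x * gauss (exp r) x) / 2)"
    using mellin_Phi_product[OF fourier_H_plus[OF f], of "1 - z"] z by simp
  also have "\<dots> = \<bar>-1\<bar> *\<^sub>R (LINT r|lborel. exp (z * of_real (0 + (-1) * r)) * (LINT x|lborel. fourier f x * gauss (exp (0 + (-1) * r)) x) / 2)"
    by (rule lborel_integral_real_affine) simp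
  also have "\<dots> = (LINT r|lborel. exp ((1 - z) * of_real r) * (LINT x|lborel. f x * gauss (exp r) x) / 2)"
  proof -
    have "exp (z * of_real (0 + (-1) * r)) * (LINT x|lborel. fourier f x * gauss (exp (0 + (-1) * r)) x) / 2 =
          exp ((1 - z) * of_real r) * (LINT x|lborel. f x * gauss (exp r) x) / 2" for r
    proof -
      have "(LINT x|lborel. fourier f x * gauss (exp (- r)) x) = (LINT x|lborel. f x * fourier (gauss (exp (- r))) x)"
        by (rule fourier_parseval[OF schwartz_integrable[OF S] gauss_integrable]) simp
      also have "\<dots> = (LINT x|lborel. of_real (exp r) * (f x * gauss (exp r) x))"
        by (subst fourier_gauss) (simp_all add: exp_minus field_simps)
      also have "\<dots> = of_real (exp r) * (LINT x|lborel. f x * gauss (exp r) x)" by (rule integral_mult_right_zero)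
      finally have eq: "(LINT x|lborel. fourier f x * gauss (exp (- r)) x) = of_real (exp r) * (LINT x|lborel. f x * gauss (exp r) x)" .
      have "exp (z * of_real (0 + (-1) * r)) * of_real (exp r) = exp ((1 - z) * of_real r)"
        by (simp add: exp_of_real[symmetric] exp_add[symmetric] algebra_simps)
      thus ?thesis using eq by (simp add: mult.assoc[symmetric])
    qed
    thus ?thesis by simp
  qed
  also have "\<dots> = mellin f z * Phi (1 - z)" by (rule mellin_Phi_product[OF f z, symmetric])
  finally show ?thesis by simp
qed

lemma zeta_mellin_functional_equation:
  assumes f: "f \<in> H_plus" and z: "0 < Re z" "Re z < 1"
  shows "riemann_zeta z * mellin f z = riemann_zeta (1 - z) * mellin (fourier f) (1 - z)"
proof -
  have "(riemann_zeta z * mellin f z) * Phi (1 - z) = riemann_zeta z * (mellin (fourier f) (1 - z) * Phi z)"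
    using local_functional_equation[OF f z] by simp
  also have "\<dots> = mellin (fourier f) (1 - z) * (riemann_zeta (1 - z) * Phi (1 - z))"
    using zeta_functional_equation[OF z] by (simp add: mult_ac)
  finally have "(riemann_zeta z * mellin f z) * Phi (1 - z) = (riemann_zeta (1 - z) * mellin (fourier f) (1 - z)) * Phi (1 - z)"
    by (simp add: mult_ac)
  thus ?thesis using Phi_nonzero[of "1 - z"] z by simp
qed

lemma fourier_fourier_H_plus: 
  assumes "f \<in> H_plus" shows "fourier (fourier f) x = f x"
proof -
  have S: "f \<in> schwartz" and ev: "f (- x) = f x" using assms by (auto simp: H_plus_def)
  have "fourier (fourier f) (- (- x)) = f (- x)"
    using schwartz_continuous[OF S, of UNIV]
    by (intro fourier_inversion schwartz_integrable fourier_schwartz S) (auto simp: continuous_on_eq_continuous_at)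
  thus ?thesis by (simp add: ev)
qed

section \<open>The image of \<open>H_cap\<close>\<close>

text \<open>Zeros of the pole factor are isolated because its value at 1 is 1. Identities between
  quotients by zeta thus hold in punctured neighbourhoods and extend by limits.\<close>

lemma zeta_nonzero_eventually:
  assumes z: "Re z > 1/4"
  shows "eventually (\<lambda>w. riemann_zeta w \<noteq> 0 \<and> w \<noteq> 1 \<and> Re w > 1/4) (at z)"
proof -
  let ?S = "{z. Re z > 1/4}"
  have S: "open ?S" "connected ?S"
    by (rule open_halfspace_Re_gt) (intro convex_connected convex_halfspace_Re_gt)
  have "eventually (\<lambda>w. zeta_pole_factor w \<noteq> 0) (at z)"
  proof (cases "zeta_pole_factor z = 0")
    case True
    obtain r where r: "r > 0" "\<And>w. w \<in> ball z r - {z} \<Longrightarrow> zeta_pole_factor w \<noteq> 0"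
      by (rule isolated_zeros[OF zeta_pole_factor_holomorphic S, of z 1]) (use True z in \<open>auto simp: zeta_pole_factor_def\<close>)
    thus ?thesis unfolding eventually_at by (intro exI[of _ r]) (auto simp: dist_commute)
  next
    case False
    have "isCont zeta_pole_factor z"
      using holomorphic_on_imp_continuous_on[OF zeta_pole_factor_holomorphic] z
      unfolding continuous_on_eq_continuous_at[OF S(1)] by simp
    hence "(zeta_pole_factor \<longlongrightarrow> zeta_pole_factor z) (at z)" by (simp add: isCont_def)
    thus ?thesis using False by (rule tendsto_imp_eventually_ne)
  qed
  moreover have "eventually (\<lambda>w. w \<in> ?S) (at z)"
    using S z by (intro eventually_at_in_open') auto
  moreover have "eventually (\<lambda>w. w \<noteq> 1) (at z)" by (rule eventually_neq_at_within)
  ultimately show ?thesis by eventually_elim (auto simp: zeta_pole_factor_def)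
qed

text \<open>Comparison with \<open>g\<close> may fail near the real axis, where the pole of zeta
  lies; there continuity on a compact rectangle is enough.\<close>

lemma strip_decay_off_compact:
  assumes dec: "strip_decay g a b" and cont: "continuous_on {z. a \<le> Re z \<and> Re z \<le> b} h" and B: "B \<ge> 0"
    and le: "\<And>z. a \<le> Re z \<Longrightarrow> Re z \<le> b \<Longrightarrow> \<bar>Im z\<bar> \<ge> 1 \<Longrightarrow> norm (h z) \<le> B * (1 + \<bar>Im z\<bar>) ^ m * norm (g z)"
  shows "strip_decay h a b"
  unfolding strip_decay_def
proof
  fix k
  have "compact (h ` cbox (Complex a (-1)) (Complex b 1))"
    by (intro compact_continuous_image continuous_on_subset[OF cont]) (auto simp: in_cbox_complex_iff)
  from compact_imp_bounded[OF this] obtain M where "\<forall>y\<in>h ` cbox (Complex a (-1)) (Complex b 1). norm y \<le> M"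
    unfolding bounded_iff by blast
  have M: "norm (h z) \<le> M" if "a \<le> Re z" "Re z \<le> b" "\<bar>Im z\<bar> \<le> 1" for z
  proof -
    have "z \<in> cbox (Complex a (-1)) (Complex b 1)" using that by (auto simp: in_cbox_complex_iff)
    with \<open>\<forall>y\<in>h ` cbox (Complex a (-1)) (Complex b 1). norm y \<le> M\<close> show ?thesis by blast
  qed
  obtain C where C: "C \<ge> 0" "\<And>z. a \<le> Re z \<Longrightarrow> Re z \<le> b \<Longrightarrow> (1 + \<bar>Im z\<bar>) ^ (k + m) * norm (g z) \<le> C"
    using strip_decayD[OF dec] by blast
  have "(1 + \<bar>Im z\<bar>) ^ k * norm (h z) \<le> B * C + 2 ^ k * \<bar>M\<bar>" if z: "a \<le> Re z" "Re z \<le> b" for z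
  proof (cases "\<bar>Im z\<bar> \<ge> 1")
    case True
    have "(1 + \<bar>Im z\<bar>) ^ k * norm (h z) \<le> (1 + \<bar>Im z\<bar>) ^ k * (B * (1 + \<bar>Im z\<bar>) ^ m * norm (g z))"
      by (intro mult_left_mono le z True) auto
    also have "\<dots> = B * ((1 + \<bar>Im z\<bar>) ^ (k + m) * norm (g z))" by (simp add: power_add)
    also have "\<dots> \<le> B * C" by (intro mult_left_mono C z B)
    also have "\<dots> \<le> B * C + 2 ^ k * \<bar>M\<bar>" by simp
    finally show ?thesis .
  next
    case False
    have "(1 + \<bar>Im z\<bar>) ^ k * norm (h z) \<le> 2 ^ k * \<bar>M\<bar>"
      using M[OF z] False by (intro mult_mono power_mono) auto
    also have "\<dots> \<le> B * C + 2 ^ k * \<bar>M\<bar>" using B C(1) by simp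
    finally show ?thesis .
  qed
  thus "\<exists>C. \<forall>z. a \<le> Re z \<longrightarrow> Re z \<le> b \<longrightarrow> (1 + \<bar>Im z\<bar>) ^ k * norm (h z) \<le> C" by blast
qed

lemma one_plus_norm_le:
  assumes "a \<le> Re z" "Re z \<le> b"
  shows "1 + norm z \<le> (1 + \<bar>a\<bar> + \<bar>b\<bar>) * (1 + \<bar>Im z\<bar>)"
proof -
  have "norm z \<le> \<bar>Re z\<bar> + \<bar>Im z\<bar>" by (rule cmod_le)
  also have "\<bar>Re z\<bar> \<le> \<bar>a\<bar> + \<bar>b\<bar>" using assms by auto
  finally have "1 + norm z \<le> (1 + \<bar>a\<bar> + \<bar>b\<bar>) + 1 * \<bar>Im z\<bar>" by simp
  also have "\<dots> \<le> (1 + \<bar>a\<bar> + \<bar>b\<bar>) + (1 + \<bar>a\<bar> + \<bar>b\<bar>) * \<bar>Im z\<bar>" by (intro add_left_mono mult_right_mono) auto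
  finally show ?thesis by (simp add: distrib_left)
qed

text \<open>The product of zeta and the Mellin transform with the singularity at 1 filled in: if the
  Mellin transform vanishes at 1, the first factor is its divided difference, and the second is
  holomorphic.\<close>

definition zeta_mellin :: "(real \<Rightarrow> complex) \<Rightarrow> complex \<Rightarrow> complex" where
  "zeta_mellin f z = (if z = 1 then deriv (mellin f) 1 else mellin f z / (z - 1)) * zeta_pole_factor z"

lemma zeta_mellin_eq: "z \<noteq> 1 \<Longrightarrow> zeta_mellin f z = riemann_zeta z * mellin f z"
  by (simp add: zeta_mellin_def zeta_pole_factor_def)

context
  fixes f assumes S: "f \<in> schwartz" and zero: "mellin f 1 = 0"
begin

lemma zeta_mellin_holomorphic: "zeta_mellin f holomorphic_on {z. Re z > 1/4}"
proof -
  have "(\<lambda>z. if z = 1 then deriv (mellin f) 1 else (mellin f z - mellin f 1) / (z - 1)) holomorphic_on {z. Re z > 0}"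
    using pole_lemma[OF mellin_schwartz(3)[OF S], of 1]
      interior_open[OF open_halfspace_Re_gt[of 0]] by simp
  moreover have "{z. Re z > 1/4} \<subseteq> {z. Re z > 0}" by auto
  ultimately have "(\<lambda>z. if z = 1 then deriv (mellin f) 1 else mellin f z / (z - 1)) holomorphic_on {z. Re z > 1/4}"
    unfolding zero diff_zero by (rule holomorphic_on_subset)
  thus ?thesis unfolding zeta_mellin_def
    by (intro holomorphic_on_mult zeta_pole_factor_holomorphic)
qed

lemma zeta_mellin_decay: "strip_decay (zeta_mellin f) (1/2) b"
proof -
  obtain C where C: "C > 0" "\<And>z. Re z \<ge> 1/2 \<Longrightarrow> norm (zeta_pole_factor z) \<le> C * (1 + norm z)\<^sup>2"
    using zeta_pole_factor_growth by blast
  define L where "L = 1 + \<bar>1/2\<bar> + \<bar>b\<bar>"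
  show ?thesis
  proof (rule strip_decay_off_compact[OF mellin_schwartz(4)[OF S], where B = "C * L\<^sup>2" and m = 2])
    show "continuous_on {z. 1/2 \<le> Re z \<and> Re z \<le> b} (zeta_mellin f)"
      by (rule holomorphic_on_imp_continuous_on[OF holomorphic_on_subset[OF zeta_mellin_holomorphic]]) auto
    fix z assume z: "1/2 \<le> Re z" "Re z \<le> b" "\<bar>Im z\<bar> \<ge> 1"
    hence z1: "z \<noteq> 1" by auto
    have "1 \<le> norm (z - 1)" using abs_Im_le_cmod[of "z - 1"] z by simp
    hence "norm (mellin f z / (z - 1)) \<le> norm (mellin f z)" by (simp add: norm_divide divide_le_eq mult_le_cancel_left1)
    moreover have "norm (zeta_pole_factor z) \<le> C * (L * (1 + \<bar>Im z\<bar>))\<^sup>2"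
      using C(1) order.trans[OF C(2)[OF z(1)] mult_left_mono[OF power_mono[OF one_plus_norm_le[OF z(1,2)]]]]
      unfolding L_def by auto
    ultimately have "norm (zeta_mellin f z) \<le> norm (mellin f z) * (C * (L * (1 + \<bar>Im z\<bar>))\<^sup>2)"
      unfolding zeta_mellin_def norm_mult using z1 by (intro mult_mono) auto
    thus "norm (zeta_mellin f z) \<le> C * L\<^sup>2 * (1 + \<bar>Im z\<bar>)\<^sup>2 * norm (mellin f z)"
      by (simp add: power_mult_distrib mult_ac)
  qed (use C in auto)
qed

end

section \<open>Summation over dilates as multiplication by zeta\<close>

text \<open>Dilation by \<open>Suc n\<close> is a translation by its logarithm in \<open>t\<close>
  and multiplies the integrand by a term of the Dirichlet series. The line \<open>Re z = 2\<close>
  lies in the region of absolute convergence, which justifies summing under the integral.\<close>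

lemma Z_inv_laplace:
  assumes int: "integrable lborel (\<lambda>\<tau>. g (Complex 2 \<tau>))"
  shows "(\<lambda>n. inv_laplace g 2 (t + ln (real (Suc n)))) sums inv_laplace (\<lambda>z. riemann_zeta z * g z) 2 t"
proof -
  note [measurable] = borel_measurable_integrable[OF int, simplified]
  have [measurable]: "(\<lambda>\<tau>. exp (- Complex 2 \<tau> * of_real s)) \<in> borel_measurable borel" for s
    unfolding exp_minus_Complex_times by measurable
  define F where "F n \<tau> = g (Complex 2 \<tau>) * exp (- Complex 2 \<tau> * of_real (t + ln (real (Suc n))))" for n \<tau>
  have Feq: "F n \<tau> = 1 / of_nat (Suc n) powr (Complex 2 \<tau>) * (g (Complex 2 \<tau>) * exp (- Complex 2 \<tau> * of_real t))" for n \<tau>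
  proof -
    have "exp (- Complex 2 \<tau> * of_real (t + ln (real (Suc n)))) = exp (- Complex 2 \<tau> * of_real (ln (real (Suc n)))) * exp (- Complex 2 \<tau> * of_real t)"
      by (simp only: exp_add[symmetric] of_real_add distrib_left add.commute)
    thus ?thesis unfolding F_def powr_Suc_exp by (simp only: mult_ac)
  qed
  have [measurable]: "F n \<in> borel_measurable borel" for n unfolding F_def by measurable
  have Fnorm: "norm (F n \<tau>) = real (Suc n) powr (- 2) * (norm (g (Complex 2 \<tau>)) * exp (- 2 * t))" for n \<tau>
    unfolding Feq norm_mult norm_powr_Suc by simp
  have intF: "integrable lborel (F n)" for n
  proof (rule Bochner_Integration.integrable_bound)
    show "integrable lborel (\<lambda>\<tau>. real (Suc n) powr (- 2) * (norm (g (Complex 2 \<tau>)) * exp (- 2 * t)))"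
      by (intro integrable_mult_right integrable_mult_left integrable_norm int)
  qed (auto simp: Fnorm simp del: of_nat_Suc)
  have s: "summable (\<lambda>n. real (Suc n) powr (- 2))" by (rule summable_Suc_powr) simp
  have s1: "AE \<tau> in lborel. summable (\<lambda>n. norm (F n \<tau>))"
    unfolding Fnorm by (intro AE_I2 summable_mult2 s)
  have "(LINT \<tau>|lborel. norm (F n \<tau>)) = real (Suc n) powr (- 2) * (LINT \<tau>|lborel. norm (g (Complex 2 \<tau>)) * exp (- 2 * t))" for n
    unfolding Fnorm by (rule integral_mult_right_zero)
  hence s2: "summable (\<lambda>n. LINT \<tau>|lborel. norm (F n \<tau>))"
    by (simp only:) (intro summable_mult2 s)
  have "(\<Sum>n. F n \<tau>) = riemann_zeta (Complex 2 \<tau>) * g (Complex 2 \<tau>) * exp (- Complex 2 \<tau> * of_real t)" for \<tau>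
  proof -
    have "(\<lambda>n. F n \<tau>) sums (riemann_zeta (Complex 2 \<tau>) * (g (Complex 2 \<tau>) * exp (- Complex 2 \<tau> * of_real t)))"
      unfolding Feq by (intro sums_mult2 zeta_sums) simp
    thus ?thesis by (simp add: sums_iff mult.assoc)
  qed
  hence "(\<lambda>n. LINT \<tau>|lborel. F n \<tau>) sums (LINT \<tau>|lborel. riemann_zeta (Complex 2 \<tau>) * g (Complex 2 \<tau>) * exp (- Complex 2 \<tau> * of_real t))"
    using sums_integral[OF intF s1 s2] by simp
  hence "(\<lambda>n. (LINT \<tau>|lborel. F n \<tau>) / of_real (2 * pi)) sums ((LINT \<tau>|lborel. riemann_zeta (Complex 2 \<tau>) * g (Complex 2 \<tau>) * exp (- Complex 2 \<tau> * of_real t)) / of_real (2 * pi))"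
    by (rule sums_divide)
  thus ?thesis unfolding inv_laplace_def F_def .
qed

text \<open>Both inclusions rest on this. The comparison is made on the line
  \<open>Re z = 2\<close>, and only \<open>h\<close>, being entire, is moved from there to the line
  used by \<open>inv_mellin\<close>.\<close>

lemma Z_map_eq_inv_mellin:
  assumes h: "h \<in> entire_schwartz"
    and f: "\<And>x. x > 0 \<Longrightarrow> f x = inv_laplace g 2 (ln x)"
    and int: "integrable lborel (\<lambda>\<tau>. g (Complex 2 \<tau>))"
    and hg: "\<And>\<tau>. h (Complex 2 \<tau>) = riemann_zeta (Complex 2 \<tau>) * g (Complex 2 \<tau>)"
  shows "Z_map f = inv_mellin h"
proof
  fix x
  show "Z_map f x = inv_mellin h x"
  proof (cases "x > 0")
    case True
    have "f (real (Suc n) * x) = inv_laplace g 2 (ln x + ln (real (Suc n)))" for n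
      using True f[of "real (Suc n) * x"] by (simp add: ln_mult add.commute del: of_nat_Suc)
    hence "(\<lambda>n. f (real (Suc n) * x)) sums inv_laplace (\<lambda>z. riemann_zeta z * g z) 2 (ln x)"
      using Z_inv_laplace[OF int, of "ln x"] by simp
    hence "Z_map f x = inv_laplace (\<lambda>z. riemann_zeta z * g z) 2 (ln x)"
      using True by (simp add: Z_map_def sums_iff del: of_nat_Suc)
    also have "\<dots> = inv_laplace h 2 (ln x)" by (simp add: inv_laplace_def hg)
    also have "\<dots> = inv_laplace h 0 (ln x)" by (rule entire_schwartz_shift[OF h])
    finally show ?thesis using True by (simp add: inv_mellin_def)
  qed (simp add: Z_map_def inv_mellin_def)
qed

theorem Z_map_H_cap:
  assumes f: "f \<in> H_cap"
  shows "Z_map f \<in> H_minus" "mellin (Z_map f) \<in> entire_schwartz_zeta"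
proof -
  have fp: "f \<in> H_plus" and f0: "f 0 = 0" and Ff0: "fourier f 0 = 0" using f by (auto simp: H_cap_def)
  define f2 where "f2 = fourier f"
  have f2p: "f2 \<in> H_plus" unfolding f2_def by (rule fourier_H_plus[OF fp])
  have S: "f \<in> schwartz" "f2 \<in> schwartz" and ev: "f (- x) = f x" "f2 (- x) = f2 x" for x
    using fp f2p by (auto simp: H_plus_def)
  have m1: "mellin f 1 = 0"
    using mellin_1_even[OF schwartz_integrable[OF S(1)] ev(1)] Ff0 by (simp add: fourier_cis)
  have m2: "mellin f2 1 = 0"
    using mellin_1_even[OF schwartz_integrable[OF S(2)] ev(2)] fourier_fourier_H_plus[OF fp, of 0] f0
    by (simp add: f2_def fourier_cis[of "fourier f" 0])
  \<comment> \<open>\<open>h\<close> is glued along the critical line from a formula for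
    \<open>f\<close> and the reflected formula for its Fourier transform. The functional equation
    makes them agree in the strip \<open>0 < Re z < 1\<close>, so \<open>h\<close> is entire and
    each formula gives decay on its own side.\<close>
  define h where "h z = (if Re z \<ge> 1/2 then zeta_mellin f z else zeta_mellin f2 (1 - z))" for z
  have overlap: "zeta_mellin f z = zeta_mellin f2 (1 - z)" if z: "0 < Re z" "Re z < 1" for z
  proof -
    have "z \<noteq> 1" "1 - z \<noteq> 1" using z by auto
    thus ?thesis using zeta_mellin_functional_equation[OF fp z] by (simp add: zeta_mellin_eq f2_def)
  qed
  have h1: "h z = zeta_mellin f z" if "Re z > 0" for z using that overlap[of z] by (auto simp: h_def)
  have h2: "h z = zeta_mellin f2 (1 - z)" if "Re z < 1" for z using that overlap[of z] by (auto simp: h_def)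
  have "h holomorphic_on {z. Re z > 1/4}"
    by (rule holomorphic_transform[OF zeta_mellin_holomorphic[OF S(1) m1]]) (auto simp: h1)
  moreover have "h holomorphic_on {z. Re z < 3/4}"
  proof (rule holomorphic_transform[of "\<lambda>z. zeta_mellin f2 (1 - z)"])
    have "zeta_mellin f2 \<circ> (\<lambda>z. 1 - z) holomorphic_on {z. Re z < 3/4}"
      by (rule holomorphic_on_compose_gen[OF _ zeta_mellin_holomorphic[OF S(2) m2]]) (auto intro!: holomorphic_intros)
    thus "(\<lambda>z. zeta_mellin f2 (1 - z)) holomorphic_on {z. Re z < 3/4}" by (simp add: o_def)
  qed (auto simp: h2)
  ultimately have "h holomorphic_on ({z. Re z > 1/4} \<union> {z. Re z < 3/4})"
    by (rule holomorphic_on_Un) (rule open_halfspace_Re_gt open_halfspace_Re_lt)+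
  also have "{z. Re z > 1/4} \<union> {z. Re z < 3/4} = UNIV" by auto
  finally have hol: "h holomorphic_on UNIV" .
  have d1: "strip_decay h (1/2) b" for b
    by (rule strip_decay_cong[OF zeta_mellin_decay[OF S(1) m1]]) (auto simp: h1)
  have d2: "strip_decay h a (1/2)" for a
  proof -
    have "strip_decay (\<lambda>z. zeta_mellin f2 (1 - z)) a (1/2)"
      using strip_decay_reflect[OF zeta_mellin_decay[OF S(2) m2, of "1 - a"]] by simp
    thus ?thesis by (rule strip_decay_cong) (auto simp: h2)
  qed
  have hS: "h \<in> entire_schwartz"
  proof (rule entire_schwartzI[OF hol])
    fix a b
    show "strip_decay h a b" by (rule strip_decay_join[OF d2 d1])
  qed
  have dec: "strip_decay (mellin g) a b" if "g \<in> schwartz" "a > 0" for g a b using mellin_schwartz(4) that by blast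
  have line: "integrable lborel (\<lambda>\<tau>. mellin f (Complex 2 \<tau>))"
    by (rule strip_decay_line_integrable(2)[OF dec[OF S(1), of 1 3]])
      (auto intro: holomorphic_on_imp_continuous_on[OF holomorphic_on_subset[OF mellin_schwartz(3)[OF S(1)]]])
  have Zf: "Z_map f = inv_mellin h"
  proof (rule Z_map_eq_inv_mellin[OF hS _ line])
    fix x :: real assume x: "x > 0"
    have "inv_laplace (laplace (\<lambda>t. f (exp t))) 2 (ln x) = f (exp (ln x))"
    proof (rule inv_laplace_laplace)
      have "integrable lborel (\<lambda>t. f (exp t) * exp (2 * of_real t))"
        using laplace_class_integrable[OF schwartz_laplace_class[OF S(1)], of 1 3 2] by simp
      thus "integrable lborel (\<lambda>t. f (exp t) * of_real (exp (2 * t)))" by (simp add: exp_of_real[symmetric])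
      show "isCont (\<lambda>t. f (exp t)) (ln x)"
        using laplace_class_continuous[OF schwartz_laplace_class[OF S(1)], of UNIV] by (simp add: continuous_on_eq_continuous_at)
      show "integrable lborel (\<lambda>\<tau>. laplace (\<lambda>t. f (exp t)) (Complex 2 \<tau>))" using line mellin_schwartz(2)[OF S(1)] by simp
    qed
    thus "f x = inv_laplace (mellin f) 2 (ln x)" using x by (simp add: mellin_schwartz(2)[OF S(1)])
  next
    fix \<tau>
    have "Complex 2 \<tau> \<noteq> 1" by (simp add: complex_eq_iff)
    thus "h (Complex 2 \<tau>) = riemann_zeta (Complex 2 \<tau>) * mellin f (Complex 2 \<tau>)"
      by (subst h1) (auto simp: zeta_mellin_eq)
  qed
  show "Z_map f \<in> H_minus" unfolding Zf by (rule inv_mellin_H_minus[OF hS])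
  have mZ: "mellin (Z_map f) = h" unfolding Zf by (rule mellin_inv_mellin[OF hS])
  \<comment> \<open>The quotient equals \<open>mellin f\<close> off a discrete set, and
    \<open>remove_sings\<close> takes the limit, so the equality persists at zeros of zeta and at
    1.\<close>
  have q1: "quot_zeta h z = mellin f z" if z: "Re z > 1/4" for z
    unfolding quot_zeta_def
  proof (rule remove_sings_eqI)
    have "isCont (mellin f) z"
      using holomorphic_on_imp_continuous_on[OF mellin_schwartz(3)[OF S(1)]] z
      by (subst (asm) continuous_on_eq_continuous_at[OF open_halfspace_Re_gt]) auto
    hence "(mellin f \<longlongrightarrow> mellin f z) (at z)" by (simp add: isCont_def)
    moreover have "eventually (\<lambda>w. mellin f w = h w / riemann_zeta w) (at z)"
      using zeta_nonzero_eventually[OF z] by eventually_elim (auto simp: h1 zeta_mellin_eq)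
    ultimately show "((\<lambda>w. h w / riemann_zeta w) \<longlongrightarrow> mellin f z) (at z)" by (rule Lim_transform_eventually)
  qed
  have q2: "quot_zeta_refl h z = mellin f2 (1 - z)" if z: "Re z < 3/4" for z
    unfolding quot_zeta_refl_def
  proof (rule remove_sings_eqI)
    have z': "Re (1 - z) > 1/4" using z by simp
    have "isCont (mellin f2) (1 - z)"
      using holomorphic_on_imp_continuous_on[OF mellin_schwartz(3)[OF S(2)]] z'
      by (subst (asm) continuous_on_eq_continuous_at[OF open_halfspace_Re_gt]) auto
    hence "isCont (\<lambda>w. mellin f2 (1 - w)) z"
      by (rule isCont_o2[rotated]) (intro continuous_intros)
    hence "((\<lambda>w. mellin f2 (1 - w)) \<longlongrightarrow> mellin f2 (1 - z)) (at z)" by (simp add: isCont_def)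
    moreover have "filterlim (\<lambda>w. 1 - w) (at (1 - z)) (at z)"
    proof (rule filterlim_atI)
      show "((\<lambda>w. 1 - w) \<longlongrightarrow> 1 - z) (at z)" by (intro tendsto_intros)
      show "eventually (\<lambda>w. 1 - w \<noteq> 1 - z) (at z)" by (simp add: eventually_at_filter)
    qed
    hence "eventually (\<lambda>w. riemann_zeta (1 - w) \<noteq> 0 \<and> 1 - w \<noteq> 1 \<and> Re (1 - w) > 1/4) (at z)"
      using zeta_nonzero_eventually[OF z'] by (rule eventually_compose_filterlim[rotated])
    hence "eventually (\<lambda>w. mellin f2 (1 - w) = h w / riemann_zeta (1 - w)) (at z)"
    proof (rule eventually_mp[rotated], intro always_eventually allI impI)
      fix w assume w: "riemann_zeta (1 - w) \<noteq> 0 \<and> 1 - w \<noteq> 1 \<and> Re (1 - w) > 1/4"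
      hence "h w = zeta_mellin f2 (1 - w)" by (intro h2) auto
      thus "mellin f2 (1 - w) = h w / riemann_zeta (1 - w)" using w by (simp add: zeta_mellin_eq)
    qed
    ultimately show "((\<lambda>w. h w / riemann_zeta (1 - w)) \<longlongrightarrow> mellin f2 (1 - z)) (at z)"
      by (rule Lim_transform_eventually)
  qed
  have "(\<lambda>t. quot_zeta h (Complex s t)) \<in> schwartz" if s: "s \<ge> 1/2" for s
  proof -
    have "(\<lambda>t. mellin f (Complex s t)) \<in> schwartz"
      by (rule strip_lines_schwartz[where a = 0 and b = "s + 1"])
        (use s in \<open>auto intro: holomorphic_on_subset[OF mellin_schwartz(3)[OF S(1)]] dec[OF S(1)]\<close>)
    thus ?thesis using s by (simp add: q1)
  qed
  moreover have "(\<lambda>t. quot_zeta_refl h (Complex s t)) \<in> schwartz" if s: "s \<le> 1/2" for s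
  proof -
    have "(\<lambda>t. mellin f2 (1 - Complex s t)) \<in> schwartz"
    proof (rule strip_lines_schwartz[where a = "s - 1" and b = 1 and h = "\<lambda>z. mellin f2 (1 - z)"])
      have "mellin f2 \<circ> (\<lambda>z. 1 - z) holomorphic_on {z. s - 1 < Re z \<and> Re z < 1}"
        by (rule holomorphic_on_compose_gen[OF _ mellin_schwartz(3)[OF S(2)]]) (auto intro!: holomorphic_intros)
      thus "(\<lambda>z. mellin f2 (1 - z)) holomorphic_on {z. s - 1 < Re z \<and> Re z < 1}" by (simp add: o_def)
      show "strip_decay (\<lambda>z. mellin f2 (1 - z)) a' b'" if "b' < 1" for a' b'
        using strip_decay_reflect[OF dec[OF S(2), of "1 - b'" "1 - a'"]] that by simp
    qed (use s in auto)
    thus ?thesis using s by (simp add: q2)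
  qed
  ultimately show "mellin (Z_map f) \<in> entire_schwartz_zeta"
    unfolding mZ entire_schwartz_zeta_def using hS by blast
qed

section \<open>Bounds for quotients without poles\<close>

text \<open>The quotient of the two norms is the pseudohyperbolic distance in the right half-plane;
  discarding the imaginary parts leaves a linear inequality between the real parts.\<close>

lemma harnack_half_plane:
  fixes p p0 :: complex
  assumes "Re p > 0" "Re p0 > 0" "0 \<le> \<rho>" "\<rho> < 1" and le: "norm (p - p0) \<le> \<rho> * norm (p + cnj p0)"
  shows "Re p \<le> (1 + \<rho>) / (1 - \<rho>) * Re p0"
proof -
  let ?a = "Re p" and ?b = "Re p0"
  have "(norm (p - p0))\<^sup>2 \<le> (\<rho> * norm (p + cnj p0))\<^sup>2" using le by (intro power_mono) auto
  hence 1: "(?a - ?b)\<^sup>2 + (Im p - Im p0)\<^sup>2 \<le> \<rho>\<^sup>2 * ((?a + ?b)\<^sup>2 + (Im p - Im p0)\<^sup>2)"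
    by (simp add: power_mult_distrib cmod_power2)
  have "\<rho>\<^sup>2 \<le> 1" using assms by (simp add: power_le_one)
  hence "\<rho>\<^sup>2 * (Im p - Im p0)\<^sup>2 \<le> 1 * (Im p - Im p0)\<^sup>2" by (intro mult_right_mono) auto
  moreover have "\<rho>\<^sup>2 * ((?a + ?b)\<^sup>2 + (Im p - Im p0)\<^sup>2) = \<rho>\<^sup>2 * (?a + ?b)\<^sup>2 + \<rho>\<^sup>2 * (Im p - Im p0)\<^sup>2"
    by (rule distrib_left)
  ultimately have "(?a - ?b)\<^sup>2 \<le> (\<rho> * (?a + ?b))\<^sup>2" using 1 unfolding power_mult_distrib by linarith
  hence "\<bar>?a - ?b\<bar> \<le> \<bar>\<rho> * (?a + ?b)\<bar>" by (simp add: abs_le_square_iff)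
  also have "\<dots> = \<rho> * (?a + ?b)" using assms by simp
  finally have "?a * (1 - \<rho>) \<le> (1 + \<rho>) * ?b" by (simp add: algebra_simps)
  thus ?thesis using assms by (simp add: field_simps)
qed

text \<open>\<open>ln M\<close> minus a logarithm of \<open>Q\<close> has positive real part.
  Composed with the Moebius map that sends the half-plane to the unit disc and the central value to
  0, it satisfies the hypotheses of Schwarz's lemma.\<close>

lemma harnack_disc:
  assumes hol: "Q holomorphic_on ball 0 R" and nz: "\<And>w. w \<in> ball 0 R \<Longrightarrow> Q w \<noteq> 0"
    and M: "\<And>w. w \<in> ball 0 R \<Longrightarrow> norm (Q w) < M" and z: "norm z < R"
  shows "M / norm (Q z) \<le> (M / norm (Q 0)) powr ((R + norm z) / (R - norm z))"
proof -
  have R: "R > 0" using z norm_ge_zero[of z] by linarith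
  have M0: "M > 0" using M[of 0] R norm_ge_zero[of "Q 0"] by (simp del: norm_ge_zero)
  have b0: "0 \<in> ball 0 R" using R by simp
  obtain q where q: "q holomorphic_on ball 0 R" "\<And>w. w \<in> ball 0 R \<Longrightarrow> exp (q w) = Q w"
    using holomorphic_logarithm_exists[OF convex_ball open_ball hol nz b0] by blast
  define p where "p w = of_real (ln M) - q w" for w
  have Rep: "Re (p w) = ln (M / norm (Q w))" if w: "w \<in> ball 0 R" for w
  proof -
    have "norm (Q w) = exp (Re (q w))" using q(2)[OF w] by (metis norm_exp_eq_Re)
    thus ?thesis using M0 by (simp add: p_def ln_div)
  qed
  have Rep_pos: "Re (p w) > 0" if w: "w \<in> ball 0 R" for w
    unfolding Rep[OF w] using M[OF w] nz[OF w] by (intro ln_gt_zero) (simp add: less_divide_eq)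
  define \<phi> where "\<phi> w = (p (of_real R * w) - p 0) / (p (of_real R * w) + cnj (p 0))" for w
  have sub: "of_real R * w \<in> ball 0 R" if "norm w < 1" for w :: complex
    using that R by (simp add: norm_mult)
  have denom: "norm (p w - p 0) < norm (p w + cnj (p 0))" if w: "w \<in> ball 0 R" for w
  proof -
    have "0 < Re (p w) * Re (p 0)" using Rep_pos[OF w] Rep_pos[OF b0] by simp
    hence "(Re (p w) - Re (p 0))\<^sup>2 < (Re (p w) + Re (p 0))\<^sup>2" by (simp add: power2_eq_square algebra_simps)
    hence "(norm (p w - p 0))\<^sup>2 < (norm (p w + cnj (p 0)))\<^sup>2" by (simp add: cmod_power2)
    thus ?thesis by (rule power_less_imp_less_base) simp
  qed
  have ne: "p w + cnj (p 0) \<noteq> 0" if w: "w \<in> ball 0 R" for w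
    using denom[OF w] norm_ge_zero[of "p w - p 0"] by auto
  define \<xi> where "\<xi> = z / of_real R"
  have \<xi>: "norm \<xi> < 1" "of_real R * \<xi> = z" using z R by (auto simp: \<xi>_def norm_divide)
  have "norm (\<phi> \<xi>) \<le> norm \<xi>"
  proof (rule Schwarz_Lemma(1))
    show "\<phi> holomorphic_on ball 0 1"
    proof -
      have "(q \<circ> (\<lambda>w. of_real R * w)) holomorphic_on ball 0 1"
        by (rule holomorphic_on_compose_gen[OF _ q(1)]) (use sub in \<open>auto intro!: holomorphic_intros\<close>)
      thus ?thesis unfolding \<phi>_def p_def using ne[OF sub]
        by (intro holomorphic_intros) (auto simp: o_def p_def)
    qed
    show "\<phi> 0 = 0" by (simp add: \<phi>_def)
    show "norm (\<phi> w) < 1" if "norm w < 1" for w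
      unfolding \<phi>_def norm_divide using denom[OF sub[OF that]] ne[OF sub[OF that]] by simp
  qed (use \<xi> in auto)
  hence "norm (p z - p 0) \<le> norm \<xi> * norm (p z + cnj (p 0))"
    using ne[of z] z unfolding \<phi>_def norm_divide \<xi>(2) by (simp add: divide_le_eq)
  hence "Re (p z) \<le> (1 + norm \<xi>) / (1 - norm \<xi>) * Re (p 0)"
    using z \<xi>(1) Rep_pos[of z] Rep_pos[OF b0] by (intro harnack_half_plane) auto
  also have "(1 + norm \<xi>) / (1 - norm \<xi>) = (R + norm z) / (R - norm z)"
    using R z by (simp add: \<xi>_def norm_divide field_simps)
  finally have "ln (M / norm (Q z)) \<le> (R + norm z) / (R - norm z) * ln (M / norm (Q 0))"
    using z Rep[of z] Rep[OF b0] by simp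
  moreover have "M / norm (Q z) > 0" "M / norm (Q 0) > 0" using M0 nz[of z] nz[OF b0] z by simp_all
  moreover have "exp (ln (M / norm (Q z))) = M / norm (Q z)" by (rule exp_ln) fact
  ultimately have "M / norm (Q z) \<le> exp ((R + norm z) / (R - norm z) * ln (M / norm (Q 0)))"
    using exp_le_cancel_iff[of "ln (M / norm (Q z))"] by presburger
  thus ?thesis unfolding powr_def using \<open>M / norm (Q 0) > 0\<close> by auto
qed

text \<open>Dividing the denominator by a Blaschke factor for one of its zeros \<open>a\<close> in the smaller disc does not change
  absolute values on the circle, but increases the value at the centre by the factor \<open>R / norm a\<close>.
  Hence this can happen only finitely often, and then Harnack's inequality applies.\<close>

lemma quotient_bound_induct:
  assumes R: "0 < R'" "R' < R" and U: "open U" "cball 0 R \<subseteq> U" and G: "G holomorphic_on U"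
    and z: "norm z < R'" and M: "M > 0"
    and Q: "Q holomorphic_on U" "\<And>w. norm w = R \<Longrightarrow> norm (Q w) \<le> M"
       "\<And>w. norm w = R \<Longrightarrow> norm (Q w * G w) \<le> M" "Q 0 \<noteq> 0" "M < norm (Q 0) * (R / R') ^ n"
  shows "norm (G z) \<le> (2 * M / norm (Q 0)) powr ((R' + norm z) / (R' - norm z))"
  using Q
proof (induction n arbitrary: Q)
  have max: "norm (F w) \<le> M" if F: "(F :: complex \<Rightarrow> complex) holomorphic_on U" "\<And>w. norm w = R \<Longrightarrow> norm (F w) \<le> M" and w: "norm w \<le> R" for F w
  proof (rule maximum_modulus_frontier[where S = "cball 0 R" and f = F])
    have "F holomorphic_on cball 0 R" using F(1) U(2) by (rule holomorphic_on_subset)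
    thus "F holomorphic_on interior (cball 0 R)" "continuous_on (closure (cball 0 R)) F"
      by (auto intro: holomorphic_on_imp_continuous_on holomorphic_on_subset)
    show "norm (F w) \<le> M" if "w \<in> frontier (cball 0 R)" for w
      using that R by (intro F(2)) (auto simp: frontier_cball)
  qed (use w in auto)
  {
    case 0
    \<comment> \<open>For \<open>n = 0\<close> the hypothesis puts \<open>norm (Q 0)\<close> above
      the maximum on the circle, which is impossible.\<close>
    thus ?case using max[OF 0(1,2), of 0] R by simp
  next
    case (Suc n)
    define \<kappa> where "\<kappa> = (R' + norm z) / (R' - norm z)"
    have \<kappa>: "\<kappa> \<ge> 0" using z R by (simp add: \<kappa>_def)
    show ?case
    proof (cases "\<exists>a. norm a < R' \<and> Q a = 0")
      case False
      have le: "norm (Q w) \<le> M" if "norm w < R'" for w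
        by (rule max[OF Suc.prems(1,2)]) (use that R in auto)
      \<comment> \<open>Doubling \<open>M\<close> supplies the strict bound required by
        \<open>harnack_disc\<close>.\<close>
      have "2 * M / norm (Q z) \<le> (2 * M / norm (Q 0)) powr \<kappa>"
        unfolding \<kappa>_def
      proof (rule harnack_disc[OF _ _ _ z])
        show "Q holomorphic_on ball 0 R'" using Suc.prems(1) U R by (auto elim!: holomorphic_on_subset)
        show "norm (Q w) < 2 * M" if "w \<in> ball 0 R'" for w using le[of w] that M by auto
      qed (use False in auto)
      moreover have "norm (G z) \<le> 2 * M / norm (Q z)"
      proof -
        have "norm (Q z * G z) \<le> M"
          by (rule max[OF holomorphic_on_mult[OF Suc.prems(1) G] Suc.prems(3)]) (use z R in auto)
        moreover have "Q z \<noteq> 0" using False z by auto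
        ultimately show ?thesis using M by (simp add: norm_mult field_simps)
      qed
      ultimately show ?thesis unfolding \<kappa>_def by linarith
    next
      case True
      then obtain a where a: "norm a < R'" "Q a = 0" by blast
      have a0: "a \<noteq> 0" using a Suc.prems by auto
      define Q1 where "Q1 w = (if w = a then deriv Q a else Q w / (w - a))" for w
      define Q2 where "Q2 w = Q1 w * ((of_real (R\<^sup>2) - cnj a * w) / of_real R)" for w
      have "Q1 holomorphic_on U"
        using pole_lemma_open[OF Suc.prems(1) U(1), of a] unfolding Q1_def a(2) diff_zero .
      hence Q2_hol: "Q2 holomorphic_on U" unfolding Q2_def using R by (intro holomorphic_intros) auto
      have norm_eq: "norm (Q2 w) = norm (Q w)" if w: "norm w = R" for w
      proof -
        have wa: "w \<noteq> a" using w a R by auto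
        have "of_real (R\<^sup>2) = w * cnj w" using w by (simp add: complex_norm_square[symmetric])
        hence "of_real (R\<^sup>2) - cnj a * w = w * cnj (w - a)" by (simp add: algebra_simps)
        hence "norm ((of_real (R\<^sup>2) - cnj a * w) / of_real R) = norm (w - a)"
          using w R by (simp only: norm_divide norm_mult complex_mod_cnj norm_of_real) simp
        thus ?thesis using wa by (simp only: Q2_def Q1_def if_False norm_mult norm_divide) simp
      qed
      have Q20: "norm (Q2 0) = norm (Q 0) * (R / norm a)"
        using a0 R by (simp add: Q2_def Q1_def norm_mult norm_divide power2_eq_square)
      have ratio: "R / R' \<le> R / norm a" using a a0 R by (intro divide_left_mono) auto
      have "norm (Q 0) * 1 \<le> norm (Q 0) * (R / norm a)"
        using a a0 R by (intro mult_left_mono) (auto simp: field_simps)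
      hence Q2_ge: "norm (Q 0) \<le> norm (Q2 0)" by (simp add: Q20)
      have Q2_nz: "Q2 0 \<noteq> 0" using Q2_ge Suc.prems(4) by auto
      have "norm (G z) \<le> (2 * M / norm (Q2 0)) powr \<kappa>"
        unfolding \<kappa>_def
      proof (rule Suc.IH[OF Q2_hol])
        show "norm (Q2 w) \<le> M" if "norm w = R" for w using Suc.prems(2)[OF that] norm_eq[OF that] by simp
        show "norm (Q2 w * G w) \<le> M" if "norm w = R" for w
          using Suc.prems(3)[OF that] norm_eq[OF that] by (simp add: norm_mult)
        have "M < norm (Q 0) * (R / R') * (R / R') ^ n" using Suc.prems(5) by simp
        also have "\<dots> \<le> norm (Q2 0) * (R / R') ^ n"
          unfolding Q20 using ratio R by (intro mult_right_mono mult_left_mono) auto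
        finally show "M < norm (Q2 0) * (R / R') ^ n" .
      qed (rule Q2_nz)
      also have "\<dots> \<le> (2 * M / norm (Q 0)) powr \<kappa>"
        using Q2_ge Q2_nz Suc.prems(4) M \<kappa> by (intro powr_mono2 divide_left_mono) (auto intro: mult_pos_pos)
      finally show ?thesis unfolding \<kappa>_def .
    qed
  }
qed

text \<open>The number of zeros of \<open>Q\<close> does not enter the bound: it only drives the
  induction, and \<open>n\<close> is any exponent large enough to start it.\<close>

lemma quotient_bound:
  assumes U: "open U" "cball w0 R \<subseteq> U" and G: "G holomorphic_on U" and Q: "Q holomorphic_on U"
    and M: "M > 0" "\<And>w. w \<in> cball w0 R \<Longrightarrow> norm (Q w) \<le> M" "\<And>w. w \<in> cball w0 R \<Longrightarrow> norm (Q w * G w) \<le> M"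
    and Q0: "Q w0 \<noteq> 0" and z: "norm (z - w0) < R"
  shows "norm (G z) \<le> (2 * M / norm (Q w0)) powr (4 * R / (R - norm (z - w0)))"
proof -
  define r where "r = norm (z - w0)"
  have r: "0 \<le> r" "r < R" using z by (auto simp: r_def)
  \<comment> \<open>With the midpoint between \<open>r\<close> and \<open>R\<close> both gaps are
    half of \<open>R - r\<close>: zeros are removed up to radius \<open>R'\<close>, and the Harnack
    exponent is \<open>(R + 3 * r) / (R - r)\<close>.\<close>
  define R' where "R' = (R + r) / 2"
  have R': "0 < R'" "R' < R" "r < R'" using r by (auto simp: R'_def field_simps)
  have "1 < R / R'" using R' by simp
  then obtain n where n: "M / norm (Q w0) < (R / R') ^ n" using real_arch_pow by blast
  have "w0 \<in> cball w0 R" using r by simp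
  hence Mge: "norm (Q w0) \<le> M" by (rule M(2))
  let ?U = "(\<lambda>w. w - w0) ` U"
  have sub: "(\<lambda>w. w + w0) ` ?U \<subseteq> U" by auto
  have hol: "(\<lambda>w. F (w + w0)) holomorphic_on ?U" if "F holomorphic_on U" for F
  proof -
    have "F \<circ> (\<lambda>w. w + w0) holomorphic_on ?U"
      by (rule holomorphic_on_compose_gen[OF _ that sub]) (intro holomorphic_intros)
    thus ?thesis by (simp add: o_def)
  qed
  have "norm (G ((z - w0) + w0)) \<le> (2 * M / norm (Q (0 + w0))) powr ((R' + norm (z - w0)) / (R' - norm (z - w0)))"
  proof (rule quotient_bound_induct[where U = ?U and G = "\<lambda>w. G (w + w0)" and Q = "\<lambda>w. Q (w + w0)" and n = n and R = R, OF R'(1,2)])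
    show "open ?U" using U(1) by (simp add: open_translation_subtract)
    show "cball 0 R \<subseteq> ?U"
    proof
      fix w :: complex assume "w \<in> cball 0 R"
      hence "w + w0 \<in> U" using U(2) by (auto simp: dist_norm)
      thus "w \<in> ?U" by (intro image_eqI[of _ _ "w + w0"]) auto
    qed
    show "M < norm (Q (0 + w0)) * (R / R') ^ n" using n Q0 by (simp add: field_simps)
    show "norm (Q (w + w0)) \<le> M" "norm (Q (w + w0) * G (w + w0)) \<le> M" if "norm w = R" for w
      using M(2,3)[of "w + w0"] that by (auto simp: dist_norm)
  qed (use hol[OF G] hol[OF Q] R' M(1) Q0 in \<open>auto simp: r_def\<close>)
  also have "\<dots> \<le> (2 * M / norm (Q w0)) powr (4 * R / (R - norm (z - w0)))"
  proof -
    have "1 \<le> 2 * M / norm (Q w0)" using Mge Q0 M(1) by (simp add: field_simps)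
    moreover have "(R' + r) / (R' - r) = (R + 3 * r) / (R - r)" using r by (simp add: R'_def field_simps)
    moreover have "(R + 3 * r) / (R - r) \<le> 4 * R / (R - r)" using r by (intro divide_right_mono) auto
    ultimately show ?thesis by (simp add: r_def[symmetric] powr_mono)
  qed
  finally show ?thesis by simp
qed

text \<open>The factors \<open>exp (- L / (z - c))\<close> with \<open>c\<close> a corner on the line \<open>Re z = 1/2\<close> exactly compensate the blow-up of the
  interior bound \<open>exp (L / (Re z - 1/2))\<close> on the horizontal sides.\<close>

lemma corner_bound:
  assumes cont: "continuous_on (cbox (Complex (1/2) (T - 1)) (Complex 2 (T + 1))) G"
    and hol: "G holomorphic_on box (Complex (1/2) (T - 1)) (Complex 2 (T + 1))"
    and L: "L \<ge> 0" and M: "M \<ge> 1"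
    and left: "\<And>y. \<bar>y - T\<bar> \<le> 1 \<Longrightarrow> norm (G (Complex (1/2) y)) \<le> M"
    and right: "\<And>y. \<bar>y - T\<bar> \<le> 1 \<Longrightarrow> norm (G (Complex 2 y)) \<le> M"
    and hori: "\<And>x y. 1/2 < x \<Longrightarrow> x \<le> 2 \<Longrightarrow> \<bar>y - T\<bar> = 1 \<Longrightarrow> norm (G (Complex x y)) \<le> exp (L / (x - 1/2))"
    and x: "1/2 \<le> x" "x \<le> 2"
  shows "norm (G (Complex x T)) \<le> (M + 1) * exp (2 * L)"
proof (cases "x = 1/2")
  case True
  have "M * 1 \<le> (M + 1) * exp (2 * L)" using M L by (intro mult_mono) auto
  moreover have "norm (G (Complex (1/2) T)) \<le> M" by (rule left) simp
  ultimately show ?thesis unfolding True by simp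
next
  case False
  let ?box = "cbox (Complex (1/2) (T - 1)) (Complex 2 (T + 1))"
  have "uniformly_continuous_on ?box G"
    by (rule compact_uniformly_continuous[OF cont compact_cbox])
  then obtain d where d: "d > 0" "\<And>w w'. w \<in> ?box \<Longrightarrow> w' \<in> ?box \<Longrightarrow> dist w' w < d \<Longrightarrow> dist (G w') (G w) < 1"
    unfolding uniformly_continuous_on_def by (metis zero_less_one)
  \<comment> \<open>The corner factors are singular on the critical line, so the rectangle starts
    slightly to its right. Uniform continuity carries the bound from the line to the shifted side at
    the cost of adding 1.\<close>
  define \<eta> where "\<eta> = min (d / 2) (x - 1/2)"
  have \<eta>: "\<eta> > 0" "\<eta> < d" "1/2 + \<eta> \<le> x" using d(1) False x by (auto simp: \<eta>_def)
  define c1 where "c1 = Complex (1/2) (T + 1)"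
  define c2 where "c2 = Complex (1/2) (T - 1)"
  define F where "F w = G w * exp (- of_real L / (w - c1)) * exp (- of_real L / (w - c2))" for w
  have Re_div: "Re (- of_real L / w) = - L * (Re w / (norm w)\<^sup>2)" for w
    by (simp add: Re_divide cmod_power2)
  have exp_le: "norm (exp (- of_real L / (w - c))) \<le> 1" if "Re w > 1/2" "c \<in> {c1, c2}" for w c
    unfolding norm_exp_eq_Re Re_div using that L by (auto simp: c1_def c2_def)
  have F_le: "norm (F w) \<le> norm (G w)" if "Re w > 1/2" for w
  proof -
    have "norm (F w) \<le> norm (G w) * 1 * 1"
      unfolding F_def norm_mult using exp_le[OF that] by (intro mult_mono) auto
    thus ?thesis by simp
  qed
  have ne: "w \<noteq> c1" "w \<noteq> c2" if "Re w > 1/2" for w using that by (auto simp: c1_def c2_def)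
  have "norm (F (Complex x T)) \<le> M + 1"
  proof (rule max_modulus_rectangle[where F = F and a = "1/2 + \<eta>" and b = 2 and c = "T - 1" and d = "T + 1"])
    have gt: "Re w > 1/2" if "w \<in> cbox (Complex (1/2 + \<eta>) (T - 1)) (Complex 2 (T + 1))" for w
      using that \<eta> by (auto simp: in_cbox_complex_iff)
    show "continuous_on (cbox (Complex (1/2 + \<eta>) (T - 1)) (Complex 2 (T + 1))) F"
      unfolding F_def using ne[OF gt] \<eta>
      by (intro continuous_intros continuous_on_subset[OF cont]) (auto simp: in_cbox_complex_iff)
    show "F holomorphic_on box (Complex (1/2 + \<eta>) (T - 1)) (Complex 2 (T + 1))"
      unfolding F_def using ne \<eta>
      by (intro holomorphic_intros holomorphic_on_subset[OF hol]) (auto simp: in_box_complex_iff c1_def c2_def complex_eq_iff)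
    show "norm (F (Complex (1/2 + \<eta>) y)) \<le> M + 1" if y: "T - 1 \<le> y" "y \<le> T + 1" for y
    proof -
      have "dist (Complex (1/2 + \<eta>) y) (Complex (1/2) y) < d"
        using \<eta> by (simp add: dist_norm cmod_def)
      hence "dist (G (Complex (1/2 + \<eta>) y)) (G (Complex (1/2) y)) < 1"
        using y \<eta> x by (intro d(2)) (auto simp: in_cbox_complex_iff)
      hence "norm (G (Complex (1/2 + \<eta>) y)) < norm (G (Complex (1/2) y)) + 1"
        using norm_triangle_ineq2[of "G (Complex (1/2 + \<eta>) y)" "G (Complex (1/2) y)"] by (simp add: dist_norm)
      also have "\<dots> \<le> M + 1" using left[of y] y by auto
      finally show ?thesis using F_le[of "Complex (1/2 + \<eta>) y"] \<eta> by simp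
    qed
    show "norm (F (Complex 2 y)) \<le> M + 1" if y: "T - 1 \<le> y" "y \<le> T + 1" for y
    proof -
      have "\<bar>y - T\<bar> \<le> 1" using y by (simp add: abs_le_iff)
      thus ?thesis using F_le[of "Complex 2 y"] right[of y] by simp
    qed
    have hor: "norm (F (Complex u y)) \<le> M + 1" if u: "1/2 + \<eta> \<le> u" "u \<le> 2" and y: "y = T + 1 \<and> c = c1 \<and> c' = c2 \<or> y = T - 1 \<and> c = c2 \<and> c' = c1" for u y c c'
    proof -
      have u': "u > 1/2" using u \<eta> by linarith
      have "Complex u y - c = of_real (u - 1/2)" using y by (auto simp: c1_def c2_def complex_eq_iff)
      hence "norm (exp (- of_real L / (Complex u y - c))) = exp (- L / (u - 1/2))"
        unfolding norm_exp_eq_Re by (simp only: of_real_minus[symmetric] of_real_divide[symmetric] Re_complex_of_real)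
      moreover have "norm (exp (- of_real L / (Complex u y - c'))) \<le> 1" using u' y by (intro exp_le) auto
      moreover have "norm (G (Complex u y)) \<le> exp (L / (u - 1/2))" using u u' y by (intro hori) auto
      moreover have "norm (F (Complex u y)) = norm (G (Complex u y)) * norm (exp (- of_real L / (Complex u y - c))) * norm (exp (- of_real L / (Complex u y - c')))"
        using y by (auto simp: F_def norm_mult mult_ac)
      ultimately have "norm (F (Complex u y)) \<le> exp (L / (u - 1/2)) * exp (- L / (u - 1/2)) * 1"
        by (simp only:) (intro mult_mono; simp)
      also have "\<dots> = 1" by (simp add: exp_minus)
      finally show ?thesis using M by simp
    qed
    show "norm (F (Complex u (T - 1))) \<le> M + 1" "norm (F (Complex u (T + 1))) \<le> M + 1" if "1/2 + \<eta> \<le> u" "u \<le> 2" for u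
      using hor[OF that, of "T - 1" c2 c1] hor[OF that, of "T + 1" c1 c2] by auto
  qed (use \<eta> x in auto)
  moreover have "norm (G (Complex x T)) \<le> norm (F (Complex x T)) * exp (2 * L)"
  proof -
    \<comment> \<open>At height \<open>T\<close> the corners are at vertical distance 1, so each
      corner factor is at least \<open>exp (- L)\<close>; removing both costs
      \<open>exp (2 * L)\<close>.\<close>
    have e: "exp (- L) \<le> norm (exp (- of_real L / (Complex x T - c)))" if "c \<in> {c1, c2}" for c
    proof -
      have n2: "(norm (Complex x T - c))\<^sup>2 = (x - 1/2)\<^sup>2 + 1" using that by (auto simp: c1_def c2_def cmod_power2)
      have "(x - 1/2) \<le> (x - 1/2)\<^sup>2 + 1"
        using sum_squares_ge_zero[of "x - 1/2 - 1/2" 0] by (simp add: power2_eq_square algebra_simps)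
      hence "(x - 1/2) / ((x - 1/2)\<^sup>2 + 1) \<le> 1" by (subst divide_le_eq) (auto simp: add_nonneg_pos)
      hence "L * ((x - 1/2) / ((x - 1/2)\<^sup>2 + 1)) \<le> L * 1" using L by (intro mult_left_mono)
      moreover have re: "Re (Complex x T - c) = x - 1/2" using that by (auto simp: c1_def c2_def)
      moreover have "Re (- of_real L / (Complex x T - c)) = - (L * ((x - 1/2) / ((x - 1/2)\<^sup>2 + 1)))"
        unfolding Re_div n2 re by simp
      ultimately show ?thesis unfolding norm_exp_eq_Re by simp
    qed
    have "exp (- L) * exp (- L) \<le> norm (exp (- of_real L / (Complex x T - c1))) * norm (exp (- of_real L / (Complex x T - c2)))"
      by (intro mult_mono e) auto
    hence "norm (G (Complex x T)) * (exp (- L) * exp (- L)) \<le> norm (F (Complex x T))"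
      unfolding F_def norm_mult mult.assoc by (intro mult_left_mono) auto
    hence "norm (G (Complex x T)) * (exp (- L) * exp (- L)) * exp (2 * L) \<le> norm (F (Complex x T)) * exp (2 * L)"
      by (intro mult_right_mono) auto
    moreover have "exp (- L) * exp (- L) * exp (2 * L) = 1" by (simp add: exp_add[symmetric])
    ultimately show ?thesis by (simp only: mult.assoc mult_1_right)
  qed
  ultimately show ?thesis by (meson exp_ge_zero mult_right_mono order.trans)
qed

text \<open>The strip is cut at \<open>Re z = 2\<close>. To the right zeta is bounded below and
  \<open>G\<close> inherits the decay of \<open>h\<close>. To the left a polynomial bound allows
  \<open>strip_decay_of_lines\<close>, with the given decay on the lines \<open>1/2\<close> and
  2.\<close>

theorem quotient_strip_decay:
  assumes G: "G analytic_on {z. Re z \<ge> 1/2}" and h: "h \<in> entire_schwartz"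
    and eq: "\<And>z. Re z \<ge> 1/2 \<Longrightarrow> z \<noteq> 1 \<Longrightarrow> G z * riemann_zeta z = h z"
    and lines: "\<And>s. s \<ge> 1/2 \<Longrightarrow> rapid (\<lambda>t. G (Complex s t))"
  shows "strip_decay G (1/2) b"
proof -
  obtain V where V: "open V" "{z. Re z \<ge> 1/2} \<subseteq> V" "G holomorphic_on V"
    using G by (auto simp: analytic_on_holomorphic)
  have hol: "G holomorphic_on A" if "A \<subseteq> {z. Re z \<ge> 1/2}" for A
    using V that by (auto intro: holomorphic_on_subset)
  have cont: "continuous_on A G" if "A \<subseteq> {z. Re z \<ge> 1/2}" for A
    using hol[OF that] by (rule holomorphic_on_imp_continuous_on)
  define c0 where "c0 = 2 - pi\<^sup>2 / 6"
  have c0: "c0 > 0" using pi_squared_lt by (simp add: c0_def)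
  have zeta_ge: "norm (riemann_zeta z) \<ge> c0" if "Re z \<ge> 2" for z unfolding c0_def by (rule zeta_lower_bound[OF that])
  have G_le: "norm (G z) \<le> 1 / c0 * norm (h z)" if z: "Re z \<ge> 2" for z
  proof -
    have "z \<noteq> 1" using z by auto
    hence "norm (h z) = norm (G z) * norm (riemann_zeta z)" using eq[of z] z by (auto simp: norm_mult[symmetric])
    also have "\<dots> \<ge> norm (G z) * c0" using zeta_ge[OF z] by (intro mult_left_mono) auto
    finally show ?thesis using c0 by (simp add: field_simps)
  qed
  have right: "strip_decay G 2 b"
    by (rule strip_decay_mult_poly_growth[OF entire_schwartz_strip_decay[OF h], where B = "1 / c0" and m = 0])
      (use c0 G_le in auto)
  obtain B where B: "B \<ge> 0" "\<And>z. 1/2 \<le> Re z \<Longrightarrow> Re z \<le> 7/2 \<Longrightarrow> (1 + \<bar>Im z\<bar>) ^ 0 * norm (h z) \<le> B"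
    using strip_decayD[OF entire_schwartz_strip_decay[OF h]] by blast
  obtain C where C: "C > 0" "\<And>z. Re z \<ge> 1/2 \<Longrightarrow> norm (zeta_pole_factor z) \<le> C * (1 + norm z)\<^sup>2"
    using zeta_pole_factor_growth by blast
  obtain M1 where M1: "M1 \<ge> 0" "\<And>t. norm (G (Complex (1/2) t)) \<le> M1"
    using rapid_bounded[OF lines[of "1/2"]] by auto
  define M where "M = max 1 (max M1 (B / c0))"
  \<comment> \<open>A polynomial bound for the base in \<open>quotient_bound\<close>: twice the
    bound on zeta and \<open>h\<close> in the disc, divided by the lower bound for zeta at the
    centre. Adding 1 makes it at least 1, so that powers are monotone in it.\<close>
  define P where "P T = 2 * (2 * C * (6 + \<bar>T\<bar>)\<^sup>2 + B) / c0 + 1" for T :: real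
  have P1: "P T \<ge> 1" for T using B(1) C(1) c0 by (simp add: P_def)
  have P_mono: "P T \<le> P T'" if "\<bar>T\<bar> \<le> \<bar>T'\<bar>" for T T'
    unfolding P_def using that C(1) c0 by (intro add_right_mono divide_right_mono mult_left_mono power_mono) auto
  \<comment> \<open>The disc of radius \<open>3/2\<close> about \<open>Complex 2 T\<close> touches
    the critical line, and \<open>\<bar>T\<bar> \<ge> 2\<close> keeps it at distance at least
    \<open>1/2\<close> from the pole at 1. The exponent 6 is \<open>4 * (3/2)\<close>.\<close>
  have inner: "norm (G (Complex x T)) \<le> P T powr (6 / (x - 1/2))" if x: "1/2 < x" "x \<le> 2" and T: "\<bar>T\<bar> \<ge> 2" for x T
  proof -
    define w0 where "w0 = Complex 2 T"
    let ?M = "2 * C * (6 + \<bar>T\<bar>)\<^sup>2 + B"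
    have ball: "1/2 \<le> Re w \<and> Re w \<le> 7/2 \<and> 1/2 \<le> \<bar>Im w\<bar> \<and> norm w \<le> 5 + \<bar>T\<bar>" if w: "w \<in> cball w0 (3/2)" for w
    proof -
      have n: "norm (w0 - w) \<le> 3/2" using w by (simp add: dist_norm)
      hence re: "\<bar>2 - Re w\<bar> \<le> 3/2" and im: "\<bar>T - Im w\<bar> \<le> 3/2"
        using abs_Re_le_cmod[of "w0 - w"] abs_Im_le_cmod[of "w0 - w"] by (auto simp: w0_def)
      have "norm w \<le> \<bar>Re w\<bar> + \<bar>Im w\<bar>" by (rule cmod_le)
      moreover have "1/2 \<le> Re w" "Re w \<le> 7/2" using abs_le_D1[OF re] abs_le_D2[OF re] by linarith+
      moreover have "\<bar>T\<bar> - \<bar>Im w\<bar> \<le> 3/2" "\<bar>Im w\<bar> - \<bar>T\<bar> \<le> 3/2"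
        using abs_triangle_ineq2[of T "Im w"] abs_triangle_ineq2[of "Im w" T] im
        by (simp_all add: abs_minus_commute)
      ultimately show ?thesis using T by linarith
    qed
    have w1: "w \<noteq> 1" if "w \<in> cball w0 (3/2)" for w using ball[OF that] by auto
    have "norm (G (Complex x T)) \<le> (2 * ?M / norm (riemann_zeta w0)) powr (4 * (3/2) / (3/2 - norm (Complex x T - w0)))"
    proof (rule quotient_bound[where U = "V - {1}"])
      show "open (V - {1})" using V(1) by (intro open_Diff) auto
      show "cball w0 (3/2) \<subseteq> V - {1}" using ball V(2) w1 by fastforce
      show "G holomorphic_on V - {1}" using V(3) by (rule holomorphic_on_subset) auto
      show "riemann_zeta holomorphic_on V - {1}" using zeta_holomorphic by (rule holomorphic_on_subset) auto
      show M0: "?M > 0" using C(1) B(1) by (intro add_pos_nonneg mult_pos_pos) (auto intro!: zero_less_power)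
      show "norm (riemann_zeta w) \<le> ?M" if w: "w \<in> cball w0 (3/2)" for w
      proof -
        have "1/2 \<le> norm (w - 1)" using abs_Im_le_cmod[of "w - 1"] ball[OF w] by simp
        hence "norm (riemann_zeta w) * (1/2) \<le> norm (riemann_zeta w) * norm (w - 1)" by (intro mult_left_mono) auto
        also have "\<dots> = norm (zeta_pole_factor w)" using w1[OF w] by (simp add: zeta_pole_factor_def norm_mult)
        also have "\<dots> \<le> C * (1 + norm w)\<^sup>2" using ball[OF w] by (intro C) auto
        also have "\<dots> \<le> C * (6 + \<bar>T\<bar>)\<^sup>2" using ball[OF w] C(1) by (intro mult_left_mono power_mono) auto
        finally show ?thesis using B(1) by simp
      qed
      show "norm (riemann_zeta w * G w) \<le> ?M" if w: "w \<in> cball w0 (3/2)" for w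
      proof -
        have "riemann_zeta w * G w = h w" using eq[of w] ball[OF w] w1[OF w] by (simp add: mult.commute)
        hence "norm (riemann_zeta w * G w) \<le> B" using B(2)[of w] ball[OF w] by simp
        also have "\<dots> \<le> ?M" using C(1) by simp
        finally show ?thesis .
      qed
      show "riemann_zeta w0 \<noteq> 0" using zeta_ge[of w0] c0 by (auto simp: w0_def)
      have "Complex x T - w0 = of_real (x - 2)" by (simp add: w0_def complex_eq_iff)
      thus "norm (Complex x T - w0) < 3/2" using x by (simp only: norm_of_real; simp)
    qed
    also have "3/2 - norm (Complex x T - w0) = x - 1/2"
    proof -
      have "Complex x T - w0 = of_real (x - 2)" by (simp add: w0_def complex_eq_iff)
      hence "norm (Complex x T - w0) = 2 - x" using x by (simp only: norm_of_real; simp)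
      thus ?thesis by simp
    qed
    also have "(2 * ?M / norm (riemann_zeta w0)) powr (4 * (3/2) / (x - 1/2)) \<le> P T powr (4 * (3/2) / (x - 1/2))"
    proof (rule powr_mono2)
      have "2 * ?M / norm (riemann_zeta w0) \<le> 2 * ?M / c0"
        using zeta_ge[of w0] c0 C(1) B(1) by (intro divide_left_mono mult_pos_pos) (auto simp: w0_def)
      thus "2 * ?M / norm (riemann_zeta w0) \<le> P T" by (simp add: P_def)
    qed (use x C(1) B(1) in auto)
    finally show ?thesis by simp
  qed
  \<comment> \<open>\<open>\<bar>T\<bar> \<ge> 3\<close> makes the inner bound available on the
    horizontal sides at heights \<open>T - 1\<close> and \<open>T + 1\<close>. With
    \<open>L = 6 * ln P\<close>, removing the corner factors costs the twelfth power of
    \<open>P\<close>.\<close>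
  have outer: "norm (G (Complex x T)) \<le> (M + 1) * P (\<bar>T\<bar> + 1) ^ 12" if x: "1/2 \<le> x" "x \<le> 2" and T: "\<bar>T\<bar> \<ge> 3" for x T
  proof -
    define L where "L = 6 * ln (P (\<bar>T\<bar> + 1))"
    have L: "L \<ge> 0" using P1[of "\<bar>T\<bar> + 1"] by (simp add: L_def)
    have "norm (G (Complex x T)) \<le> (M + 1) * exp (2 * L)"
    proof (rule corner_bound[OF _ _ L _ _ _ _ x])
      show "continuous_on (cbox (Complex (1/2) (T - 1)) (Complex 2 (T + 1))) G"
        by (rule cont) (auto simp: in_cbox_complex_iff)
      show "G holomorphic_on box (Complex (1/2) (T - 1)) (Complex 2 (T + 1))"
        by (rule hol) (auto simp: in_box_complex_iff)
      show "M \<ge> 1" by (simp add: M_def)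
      show "norm (G (Complex (1/2) y)) \<le> M" for y using M1(2)[of y] by (simp add: M_def)
      show "norm (G (Complex 2 y)) \<le> M" for y
      proof -
        have "norm (G (Complex 2 y)) \<le> 1 / c0 * norm (h (Complex 2 y))" by (rule G_le) simp
        also have "\<dots> \<le> 1 / c0 * B" using B(2)[of "Complex 2 y"] c0 by (intro mult_left_mono) auto
        finally show ?thesis by (simp add: M_def)
      qed
      show "norm (G (Complex u y)) \<le> exp (L / (u - 1/2))" if u: "1/2 < u" "u \<le> 2" and y: "\<bar>y - T\<bar> = 1" for u y
      proof -
        have y': "\<bar>y\<bar> \<ge> 2" "\<bar>y\<bar> \<le> \<bar>\<bar>T\<bar> + 1\<bar>" 
          using abs_triangle_ineq2[of T y] abs_triangle_ineq2[of y T] y T by (simp_all add: abs_minus_commute)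
        have "norm (G (Complex u y)) \<le> P y powr (6 / (u - 1/2))" by (rule inner[OF u y'(1)])
        also have "\<dots> \<le> P (\<bar>T\<bar> + 1) powr (6 / (u - 1/2))"
          using P_mono[OF y'(2)] P1[of y] u by (intro powr_mono2) auto
        also have "\<dots> = exp (L / (u - 1/2))" using P1[of "\<bar>T\<bar> + 1"] by (simp add: powr_def L_def)
        finally show ?thesis .
      qed
    qed
    also have "exp (2 * L) = P (\<bar>T\<bar> + 1) ^ 12"
    proof -
      have "exp (2 * L) = exp (real 12 * ln (P (\<bar>T\<bar> + 1)))" by (simp add: L_def)
      thus ?thesis using P1[of "\<bar>T\<bar> + 1"] by (simp only: exp_of_nat_mult) simp
    qed
    finally show ?thesis .
  qed
  have "compact (G ` cbox (Complex (1/2) (-3)) (Complex 2 3))"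
    by (intro compact_continuous_image cont) (auto simp: in_cbox_complex_iff)
  from compact_imp_bounded[OF this] obtain M3 where M3': "\<forall>y\<in>G ` cbox (Complex (1/2) (-3)) (Complex 2 3). norm y \<le> M3"
    unfolding bounded_iff by blast
  have M3: "norm (G z) \<le> M3" if "1/2 \<le> Re z" "Re z \<le> 2" "\<bar>Im z\<bar> \<le> 3" for z
  proof -
    have "z \<in> cbox (Complex (1/2) (-3)) (Complex 2 3)" using that by (auto simp: in_cbox_complex_iff)
    thus ?thesis using M3' by blast
  qed
  \<comment> \<open>The 49 comes from
    \<open>6 + (\<bar>T\<bar> + 1) \<le> 7 * (1 + \<bar>T\<bar>)\<close>. As \<open>P\<close> is
    quadratic, its twelfth power gives growth of degree 24.\<close>
  define K where "K = 2 * (2 * C * 49 + B) / c0 + 1"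
  have PK: "P (\<bar>T\<bar> + 1) \<le> K * (1 + \<bar>T\<bar>)\<^sup>2" for T
  proof -
    define q where "q = (1 + \<bar>T\<bar>)\<^sup>2"
    have q1: "q \<ge> 1" by (simp add: q_def one_le_power)
    have "(6 + \<bar>\<bar>T\<bar> + 1\<bar>)\<^sup>2 \<le> (7 * (1 + \<bar>T\<bar>))\<^sup>2" by (intro power_mono) auto
    also have "\<dots> = 49 * q" by (simp only: power_mult_distrib q_def) simp
    finally have "2 * C * (6 + \<bar>\<bar>T\<bar> + 1\<bar>)\<^sup>2 + B \<le> 2 * C * (49 * q) + B * q"
      using C(1) B(1) q1 by (intro add_mono mult_left_mono) (auto simp: mult_le_cancel_left1)
    hence "2 * (2 * C * (6 + \<bar>\<bar>T\<bar> + 1\<bar>)\<^sup>2 + B) / c0 \<le> 2 * (2 * C * (49 * q) + B * q) / c0"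
      using c0 by (intro divide_right_mono mult_left_mono) auto
    hence "P (\<bar>T\<bar> + 1) \<le> 2 * (2 * C * (49 * q) + B * q) / c0 + q" unfolding P_def using q1 by simp
    also have "\<dots> = K * q" by (simp add: K_def field_simps add_divide_distrib)
    finally show ?thesis by (simp add: q_def)
  qed
  have K1: "K \<ge> 1" using C(1) B(1) c0 by (simp add: K_def)
  have left: "strip_decay G (1/2) 2"
  proof (rule strip_decay_of_lines[where B = "\<bar>M3\<bar> + (M + 1) * K ^ 12" and N = 24])
    show "continuous_on {z. 1/2 \<le> Re z \<and> Re z \<le> 2} G" by (rule cont) auto
    show "G holomorphic_on {z. 1/2 < Re z \<and> Re z < 2}" by (rule hol) auto
    show "rapid (\<lambda>t. G (Complex (1/2) t))" "rapid (\<lambda>t. G (Complex 2 t))" by (rule lines; simp)+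
    fix z assume z: "1/2 \<le> Re z" "Re z \<le> 2"
    have one: "1 \<le> (1 + \<bar>Im z\<bar>) ^ 24" by (simp add: one_le_power)
    have M0: "M + 1 \<ge> 0" by (simp add: M_def)
    show "norm (G z) \<le> (\<bar>M3\<bar> + (M + 1) * K ^ 12) * (1 + \<bar>Im z\<bar>) ^ 24"
    proof (cases "\<bar>Im z\<bar> \<le> 3")
      case True
      have "norm (G z) \<le> \<bar>M3\<bar> * 1" using M3[OF z True] by simp
      also have "\<dots> \<le> (\<bar>M3\<bar> + (M + 1) * K ^ 12) * (1 + \<bar>Im z\<bar>) ^ 24"
        using one M0 K1 by (intro mult_mono) auto
      finally show ?thesis .
    next
      case False
      have "norm (G z) \<le> (M + 1) * P (\<bar>Im z\<bar> + 1) ^ 12" using outer[OF z, of "Im z"] False by simp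
      also have "\<dots> \<le> (M + 1) * (K * (1 + \<bar>Im z\<bar>)\<^sup>2) ^ 12"
        using PK[of "Im z"] P1[of "\<bar>Im z\<bar> + 1"] M0 by (intro mult_left_mono power_mono) auto
      also have "\<dots> = ((M + 1) * K ^ 12) * (1 + \<bar>Im z\<bar>) ^ 24"
        by (simp add: power_mult_distrib power_mult[symmetric])
      also have "\<dots> \<le> (\<bar>M3\<bar> + (M + 1) * K ^ 12) * (1 + \<bar>Im z\<bar>) ^ 24"
        by (intro mult_right_mono) auto
      finally show ?thesis .
    qed
  qed
  show ?thesis by (rule strip_decay_join[OF left right])
qed

section \<open>Quotients by the zeta function\<close>

lemma filterlim_Complex_at: "filterlim (\<lambda>t. Complex s t) (at (Complex s t0)) (at t0)"
  unfolding filterlim_at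
proof
  show "\<forall>\<^sub>F t in at t0. Complex s t \<in> UNIV \<and> Complex s t \<noteq> Complex s t0"
    by (auto simp: eventually_at_filter)
  show "((\<lambda>t. Complex s t) \<longlongrightarrow> Complex s t0) (at t0)"
    by (auto intro!: tendsto_intros simp: Complex_eq)
qed

lemma filtermap_reflect: "filtermap (\<lambda>w. 1 - w) (at (z :: complex)) = at (1 - z)"
proof (rule filtermap_fun_inverse)
  show "filterlim (\<lambda>w. 1 - w) (at (1 - z)) (at z)" "filterlim (\<lambda>w. 1 - w) (at z) (at (1 - z))"
    by (auto simp: filterlim_at eventually_at_filter intro!: tendsto_eq_intros always_eventually)
qed auto

text \<open>A pole would make the quotient unbounded along the vertical line through it. The third
  conclusion is stated with the pole factor so that it also covers \<open>z = 1\<close>, where it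
  forces the quotient to vanish.\<close>

lemma quot_zeta_pole_free:
  assumes h: "h holomorphic_on UNIV" and z: "Re z \<ge> 1/2" and r: "rapid (\<lambda>t. quot_zeta h (Complex (Re z) t))"
  shows "\<not> is_pole (\<lambda>w. h w / riemann_zeta w) z" "quot_zeta h analytic_on {z}"
    "quot_zeta h z * zeta_pole_factor z = h z * (z - 1)"
proof -
  let ?q = "\<lambda>w. h w / riemann_zeta w"
  have z': "Re z > 1/4" using z by simp
  have h_an: "h analytic_on {z}" using h by (metis analytic_on_open analytic_on_subset open_UNIV subset_UNIV)
  have Z_an: "zeta_pole_factor analytic_on {z}"
    using zeta_pole_factor_holomorphic z' open_halfspace_Re_gt[of "1/4"] unfolding analytic_at by blast
  have ev: "eventually (\<lambda>w. riemann_zeta w \<noteq> 0 \<and> w \<noteq> 1 \<and> Re w > 1/4) (at z)" by (rule zeta_nonzero_eventually[OF z'])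
  have ev': "eventually (\<lambda>w. h w * (w - 1) / zeta_pole_factor w = ?q w) (at z)"
    using ev by eventually_elim (simp add: zeta_pole_factor_def)
  \<comment> \<open>Near \<open>z\<close> the quotient is rewritten with functions analytic at
    \<open>z\<close>, including the case \<open>z = 1\<close>, which makes it meromorphic
    there.\<close>
  have "(\<lambda>w. h w * (w - 1) / zeta_pole_factor w) meromorphic_on {z}"
    using h_an Z_an by (intro meromorphic_intros analytic_on_imp_meromorphic_on)
  also have "?this \<longleftrightarrow> ?q meromorphic_on {z}"
    by (rule meromorphic_on_cong[OF _ refl]) (use ev' in blast)
  finally have mero: "?q meromorphic_on {z}" .
  have iso: "isolated_singularity_at ?q z" using mero by (rule meromorphic_on_isolated_singularity) 
  have ne: "not_essential ?q z" using mero by (rule meromorphic_on_not_essential)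
  have eq: "eventually (\<lambda>w. quot_zeta h w = ?q w) (at z)"
    unfolding quot_zeta_def by (rule eventually_remove_sings_eq_at[OF iso])
  show np: "\<not> is_pole ?q z"
  proof
    assume "is_pole ?q z"
    hence "filterlim (quot_zeta h) at_infinity (at z)"
      unfolding is_pole_def using filterlim_cong[OF refl refl eq] by blast
    hence "filterlim (\<lambda>t. quot_zeta h (Complex (Re z) t)) at_infinity (at (Im z))"
      using filterlim_compose[OF _ filterlim_Complex_at[of "Re z" "Im z"]] by simp
    moreover obtain C where C: "\<And>t. norm (quot_zeta h (Complex (Re z) t)) \<le> C"
      using rapid_bounded[OF r] by blast
    ultimately have "eventually (\<lambda>t. C + 1 \<le> norm (quot_zeta h (Complex (Re z) t))) (at (Im z))"
      unfolding filterlim_at_infinity_conv_norm_at_top filterlim_at_top by simp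
    hence "eventually (\<lambda>t. False) (at (Im z))"
    proof eventually_elim
      case (elim t)
      thus ?case using C[of t] by linarith
    qed
    thus False by simp
  qed
  then obtain c where c: "?q \<midarrow>z\<rightarrow> c" using ne by (auto simp: not_essential_def)
  show an: "quot_zeta h analytic_on {z}"
    unfolding quot_zeta_def by (rule remove_sings_analytic_at[OF iso c])
  have "((\<lambda>w. quot_zeta h w * zeta_pole_factor w) \<longlongrightarrow> quot_zeta h z * zeta_pole_factor z) (at z)"
    using analytic_at_imp_isCont[OF an] analytic_at_imp_isCont[OF Z_an] by (intro tendsto_mult) (auto simp: isCont_def)
  moreover have "eventually (\<lambda>w. quot_zeta h w * zeta_pole_factor w = h w * (w - 1)) (at z)"
    using eq ev by eventually_elim (simp add: zeta_pole_factor_def)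
  ultimately have "((\<lambda>w. h w * (w - 1)) \<longlongrightarrow> quot_zeta h z * zeta_pole_factor z) (at z)"
    by (rule Lim_transform_eventually)
  moreover have "((\<lambda>w. h w * (w - 1)) \<longlongrightarrow> h z * (z - 1)) (at z)"
    using analytic_at_imp_isCont[OF h_an] by (intro tendsto_intros) (auto simp: isCont_def)
  ultimately show "quot_zeta h z * zeta_pole_factor z = h z * (z - 1)"
    by (rule tendsto_unique[OF at_neq_bot])
qed

lemma entire_schwartz_reflect:
  assumes "h \<in> entire_schwartz" shows "(\<lambda>w. h (1 - w)) \<in> entire_schwartz"
proof (rule entire_schwartzI)
  have "h \<circ> (\<lambda>w. 1 - w) holomorphic_on UNIV"
    by (rule holomorphic_on_compose_gen[where t = UNIV]) (use assms in \<open>auto simp: entire_schwartz_def intro!: holomorphic_intros\<close>)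
  thus "(\<lambda>w. h (1 - w)) holomorphic_on UNIV" by (simp add: o_def)
  show "strip_decay (\<lambda>w. h (1 - w)) a b" for a b
    using strip_decay_reflect[OF entire_schwartz_strip_decay[OF assms, of "1 - b" "1 - a"]] by simp
qed

text \<open>Reflection reduces every statement about the left half-plane to the right half-plane for
  the reflected \<open>h\<close>.\<close>

lemma quot_zeta_reflect: "quot_zeta (\<lambda>w. h (1 - w)) z = quot_zeta_refl h (1 - z)"
  using remove_sings_compose[OF filtermap_reflect, of "\<lambda>w. h w / riemann_zeta (1 - w)" z]
  by (simp add: quot_zeta_def quot_zeta_refl_def o_def)

lemma rapid_reflect: "rapid f \<Longrightarrow> rapid (\<lambda>t. f (- t))"
proof -
  assume f: "rapid f"
  show ?thesis unfolding rapid_def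
  proof
    fix k
    obtain C where C: "\<And>x. (1 + \<bar>x\<bar>) ^ k * norm (f x) \<le> C" using rapidD[OF f] by metis
    show "\<exists>C. \<forall>x. (1 + \<bar>x\<bar>) ^ k * norm (f (- x)) \<le> C"
    proof (intro exI allI)
      show "(1 + \<bar>x\<bar>) ^ k * norm (f (- x)) \<le> C" for x using C[of "- x"] by simp
    qed
  qed
qed

lemma entire_schwartz_zeta_rapid:
  assumes h: "h \<in> entire_schwartz_zeta" and s: "s \<ge> 1/2"
  shows "rapid (\<lambda>t. quot_zeta h (Complex s t))" "rapid (\<lambda>t. quot_zeta (\<lambda>w. h (1 - w)) (Complex s t))"
proof -
  show "rapid (\<lambda>t. quot_zeta h (Complex s t))"
    using h s by (auto simp: entire_schwartz_zeta_def intro: schwartz_rapid)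
  have "rapid (\<lambda>t. quot_zeta_refl h (Complex (1 - s) t))"
    using h s by (auto simp: entire_schwartz_zeta_def intro: schwartz_rapid)
  moreover have "1 - Complex s t = Complex (1 - s) (- t)" for t by (simp add: complex_eq_iff)
  ultimately show "rapid (\<lambda>t. quot_zeta (\<lambda>w. h (1 - w)) (Complex s t))"
    unfolding quot_zeta_reflect using rapid_reflect by simp
qed

lemma entire_schwartz_zeta_no_poles:
  assumes h: "h \<in> entire_schwartz_zeta"
  shows "Re z \<ge> 1/2 \<Longrightarrow> \<not> is_pole (\<lambda>w. h w / riemann_zeta w) z"
    and "Re z \<le> 1/2 \<Longrightarrow> \<not> is_pole (\<lambda>w. h w / riemann_zeta (1 - w)) z"
proof -
  have E: "h \<in> entire_schwartz" using h by (simp add: entire_schwartz_zeta_def)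
  have hol: "h holomorphic_on UNIV" "(\<lambda>w. h (1 - w)) holomorphic_on UNIV"
    using E entire_schwartz_reflect[OF E] by (auto simp: entire_schwartz_def)
  show "\<not> is_pole (\<lambda>w. h w / riemann_zeta w) z" if "Re z \<ge> 1/2"
    by (rule quot_zeta_pole_free(1)[OF hol(1) that entire_schwartz_zeta_rapid(1)[OF h that]])
  show "\<not> is_pole (\<lambda>w. h w / riemann_zeta (1 - w)) z" if "Re z \<le> 1/2"
  proof -
    have z: "Re (1 - z) \<ge> 1/2" using that by simp
    have "\<not> is_pole (\<lambda>w. h (1 - w) / riemann_zeta w) (1 - z)"
      by (rule quot_zeta_pole_free(1)[OF hol(2) z entire_schwartz_zeta_rapid(2)[OF h z]])
    thus ?thesis
      using is_pole_compose_iff[OF filtermap_reflect[of "1 - z"], of "\<lambda>w. h w / riemann_zeta (1 - w)"] by (simp add: o_def)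
  qed
qed

text \<open>What the reconstruction needs from a quotient, in a form shared by \<open>G\<close> and
  \<open>G2\<close>. The equation leaves out 1, where \<open>riemann_zeta\<close> has its
  conventional value; the pole is recorded by \<open>G 1 = 0\<close>.\<close>

definition zeta_quotient :: "(complex \<Rightarrow> complex) \<Rightarrow> (complex \<Rightarrow> complex) \<Rightarrow> bool" where
  "zeta_quotient h G \<longleftrightarrow> G analytic_on {z. Re z \<ge> 1/2} \<and> (\<forall>b. strip_decay G (1/2) b) \<and> G 1 = 0 \<and>
     (\<forall>z. Re z \<ge> 1/2 \<longrightarrow> z \<noteq> 1 \<longrightarrow> G z * riemann_zeta z = h z)"

lemma zeta_quotient_quot_zeta:
  assumes h: "h \<in> entire_schwartz" and r: "\<And>s. s \<ge> 1/2 \<Longrightarrow> rapid (\<lambda>t. quot_zeta h (Complex s t))"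
  shows "zeta_quotient h (quot_zeta h)"
proof -
  have hol: "h holomorphic_on UNIV" using h by (simp add: entire_schwartz_def)
  note free = quot_zeta_pole_free[OF hol _ r]
  have an: "quot_zeta h analytic_on {z. Re z \<ge> 1/2}"
    using free(2) by (subst analytic_on_analytic_at) auto
  have eq: "quot_zeta h z * riemann_zeta z = h z" if "Re z \<ge> 1/2" "z \<noteq> 1" for z
    using free(3)[of z] that by (simp add: zeta_pole_factor_def)
  show ?thesis
    unfolding zeta_quotient_def
    using an eq free(3)[of 1] quotient_strip_decay[OF an h eq r] by (auto simp: zeta_pole_factor_def)
qed


section \<open>The preimage under the zeta operator\<close>

lemma even_integral_exp:
  fixes F :: "real \<Rightarrow> complex"
  assumes m [measurable]: "F \<in> borel_measurable borel" and ev: "\<And>x. F (- x) = F x"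
    and int: "integrable lborel (\<lambda>t. F (exp t) * of_real (exp t))"
  shows "integrable lborel F" "(LINT x|lborel. F x) = 2 * (LINT t|lborel. F (exp t) * of_real (exp t))"
proof -
  have m': "(\<lambda>t. F (exp t)) \<in> borel_measurable borel" by measurable
  have "integrable lborel (\<lambda>t. exp t *\<^sub>R F (exp t))" using int by (simp add: scaleR_conv_of_real mult.commute)
  hence "set_integrable lborel {0<..} F" using exp_substitution(1)[of F, OF m'] by blast
  hence 1: "integrable lborel (\<lambda>x. indicator {0<..} x *\<^sub>R F x)" unfolding set_integrable_def .
  have 2: "integrable lborel (\<lambda>x. indicator {0<..} (0 + (-1) * x) *\<^sub>R F (0 + (-1) * x))"
    by (rule lborel_integrable_real_affine[OF 1]) simp
  have "integrable lborel (\<lambda>x. indicator {0<..} x *\<^sub>R F x + indicator {0<..} (0 + (-1) * x) *\<^sub>R F (0 + (-1) * x))"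
    using 1 2 by (rule Bochner_Integration.integrable_add)
  also have "?this \<longleftrightarrow> integrable lborel F"
    by (rule integrable_cong_AE)
      (auto intro!: AE_I'[of "{0}"] simp: null_sets_def indicator_def ev split: if_splits)
  finally show i: "integrable lborel F" .
  have "(LINT x|lborel. F x) = 2 * mellin F 1" by (rule mellin_1_even[OF i ev, symmetric])
  thus "(LINT x|lborel. F x) = 2 * (LINT t|lborel. F (exp t) * of_real (exp t))"
    unfolding mellin_laplace(1)[OF m'] laplace_def by (simp add: exp_of_real)
qed

text \<open>The value at 0 is a placeholder, since continuity there is not known at this stage; away
  from 0 the function will be identified with a Fourier transform.\<close>

definition even_inv_mellin :: "(complex \<Rightarrow> complex) \<Rightarrow> real \<Rightarrow> complex" where
  "even_inv_mellin G x = (if x = 0 then 0 else inv_laplace G 2 (ln \<bar>x\<bar>))"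

lemma even_inv_mellin_even: "even_inv_mellin G (- x) = even_inv_mellin G x"
  by (simp add: even_inv_mellin_def)

lemma even_inv_mellin_exp: "even_inv_mellin G (exp t) = inv_laplace G 2 t"
  by (simp add: even_inv_mellin_def)

context
  fixes h G assumes Q: "zeta_quotient h G"
begin

lemma zeta_quotient_continuous: "continuous_on {z. Re z \<ge> 1/2} G"
  using Q by (auto simp: zeta_quotient_def intro: holomorphic_on_imp_continuous_on analytic_imp_holomorphic)

lemma zeta_quotient_line:
  assumes "\<sigma> \<ge> 1/2"
  shows "continuous_on A (\<lambda>\<tau>. G (Complex \<sigma> \<tau>))" "integrable lborel (\<lambda>\<tau>. G (Complex \<sigma> \<tau>))"
    "rapid (\<lambda>\<tau>. G (Complex \<sigma> \<tau>))"
proof -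
  have d: "strip_decay G (1/2) \<sigma>" using Q by (simp add: zeta_quotient_def)
  have c: "continuous_on {z. 1/2 \<le> Re z \<and> Re z \<le> \<sigma>} G"
    by (rule continuous_on_subset[OF zeta_quotient_continuous]) auto
  show "continuous_on A (\<lambda>\<tau>. G (Complex \<sigma> \<tau>))" "integrable lborel (\<lambda>\<tau>. G (Complex \<sigma> \<tau>))"
    using strip_decay_line_integrable[OF d c] assms by auto
  show "rapid (\<lambda>\<tau>. G (Complex \<sigma> \<tau>))" using d assms by (rule strip_decay_rapid) simp
qed

text \<open>The closed strip includes the critical line, so the contour can be placed exactly on it,
  as the pairing requires.\<close>

lemma zeta_quotient_shift:
  assumes "\<sigma> \<ge> 1/2" shows "inv_laplace G 2 t = inv_laplace G \<sigma> t"
proof (rule inv_laplace_shift[where a = "1/2" and b = "max 2 \<sigma>"])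
  show "continuous_on {z. 1/2 \<le> Re z \<and> Re z \<le> max 2 \<sigma>} G"
    by (rule continuous_on_subset[OF zeta_quotient_continuous]) auto
  have "G holomorphic_on {z. Re z \<ge> 1/2}" using Q by (auto simp: zeta_quotient_def intro: analytic_imp_holomorphic)
  thus "G holomorphic_on {z. 1/2 < Re z \<and> Re z < max 2 \<sigma>}" by (rule holomorphic_on_subset) auto
  show "strip_decay G (1/2) (max 2 \<sigma>)" using Q by (simp add: zeta_quotient_def)
qed (use assms in auto)

lemma zeta_quotient_bound:
  assumes "\<sigma> \<ge> 1/2"
  obtains C where "\<And>t. exp (\<sigma> * t) * norm (inv_laplace G 2 t) \<le> C"
proof (rule inv_laplace_bound[OF zeta_quotient_line(2)[OF assms]])
  fix C assume "\<And>t. exp (\<sigma> * t) * norm (inv_laplace G \<sigma> t) \<le> C"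
  thus ?thesis using that[of C] zeta_quotient_shift[OF assms] by simp
qed

lemma inv_laplace_zeta_quotient_continuous: "continuous_on UNIV (inv_laplace G 2)"
proof -
  let ?H = "\<lambda>\<tau>. G (Complex 2 \<tau>)"
  have m: "?H \<in> borel_measurable borel"
    by (intro borel_measurable_continuous_onI zeta_quotient_line) simp
  note sm = trig_integral_smooth(1)[OF m rapid_moments[OF zeta_quotient_line(3) m], where c = "-1" and n = 0]
  have "isCont (\<lambda>t. LINT \<tau>|lborel. ?H \<tau> * cis (- 1 * \<tau> * t)) t" for t
    using has_vector_derivative_continuous[OF sm[of t]] by simp
  hence "continuous_on UNIV (\<lambda>t. LINT \<tau>|lborel. ?H \<tau> * cis (- 1 * \<tau> * t))"
    by (simp only: continuous_on_eq_continuous_at open_UNIV) auto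
  thus ?thesis unfolding inv_laplace_cis[abs_def] by (intro continuous_intros) auto
qed

lemma inv_laplace_zeta_quotient_integrable:
  assumes "\<sigma> > 1/2"
  shows "integrable lborel (\<lambda>t. inv_laplace G 2 t * of_real (exp (\<sigma> * t)))"
proof -
  define \<delta> where "\<delta> = \<sigma> - 1/2"
  have \<delta>: "\<delta> > 0" using assms by (simp add: \<delta>_def)
  obtain C1 where C1: "\<And>t. exp ((1/2) * t) * norm (inv_laplace G 2 t) \<le> C1" using zeta_quotient_bound[of "1/2"] by auto
  obtain C2 where C2: "\<And>t. exp ((\<sigma> + \<delta>) * t) * norm (inv_laplace G 2 t) \<le> C2"
    using zeta_quotient_bound[of "\<sigma> + \<delta>"] \<delta> assms by auto
  have "norm (inv_laplace G 2 t * of_real (exp (\<sigma> * t))) \<le> max C1 C2 * exp (- \<delta> * \<bar>t\<bar>)" for t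
    by (rule exp_interpolate[where \<alpha> = "1/2" and \<beta> = "\<sigma> + \<delta>"])
      (use \<delta> C1 C2 in \<open>auto simp: \<delta>_def le_max_iff_disj\<close>)
  hence "rapid (\<lambda>t. inv_laplace G 2 t * of_real (exp (\<sigma> * t)))" by (rule rapid_exp_decay[OF \<delta>])
  thus ?thesis
    by (rule rapid_integrable)
      (intro borel_measurable_continuous_onI continuous_intros inv_laplace_zeta_quotient_continuous)
qed

lemma even_inv_mellin_measurable [measurable]: "even_inv_mellin G \<in> borel_measurable borel"
proof -
  note [measurable] = borel_measurable_continuous_onI[OF inv_laplace_zeta_quotient_continuous]
  show ?thesis unfolding even_inv_mellin_def by measurable
qed

lemma even_inv_mellin_moments: "integrable lborel (\<lambda>x. \<bar>x\<bar> ^ k * norm (even_inv_mellin G x))"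
proof -
  let ?F = "\<lambda>x. of_real (\<bar>x\<bar> ^ k) * even_inv_mellin G x"
  \<comment> \<open>The extra exponential is the Jacobian of \<open>x = exp t\<close>; it also keeps
    the weight above \<open>1/2\<close> when \<open>k = 0\<close>.\<close>
  have "?F (exp t) * of_real (exp t) = inv_laplace G 2 t * of_real (exp (real (Suc k) * t))" for t
  proof -
    have "exp (real (Suc k) * t) = exp t ^ k * exp t" by (simp only: exp_of_nat_mult power_Suc2)
    thus ?thesis by (simp add: even_inv_mellin_exp mult_ac)
  qed
  hence "integrable lborel (\<lambda>t. ?F (exp t) * of_real (exp t))"
    using inv_laplace_zeta_quotient_integrable[of "real (Suc k)"] by simp
  hence "integrable lborel ?F" by (rule even_integral_exp(1)[rotated 2]) (simp_all add: even_inv_mellin_even)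
  hence "integrable lborel (\<lambda>x. norm (?F x))" by (rule integrable_norm)
  thus ?thesis by (simp add: norm_mult norm_power)
qed

lemma even_inv_mellin_integrable: "integrable lborel (even_inv_mellin G)"
  using even_inv_mellin_moments[of 0] by (subst integrable_norm_iff[symmetric]) auto

text \<open>The integral is twice the value at 1 of the Laplace transform, which by inversion on the
  line \<open>Re z = 1\<close> is \<open>G 1 = 0\<close>.\<close>

lemma even_inv_mellin_integral: "(LINT x|lborel. even_inv_mellin G x) = 0"
proof -
  have i: "integrable lborel (\<lambda>t. inv_laplace G 2 t * of_real (exp (1 * t)))"
    by (rule inv_laplace_zeta_quotient_integrable) simp
  have "laplace (inv_laplace G 1) (Complex 1 0) = G (Complex 1 0)"
  proof (rule laplace_inv_laplace)
    show "integrable lborel (\<lambda>\<tau>. G (Complex 1 \<tau>))" by (rule zeta_quotient_line) simp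
    show "isCont (\<lambda>\<tau>. G (Complex 1 \<tau>)) 0"
      using zeta_quotient_line(1)[of 1 UNIV] by (simp add: continuous_on_eq_continuous_at)
    show "integrable lborel (\<lambda>t. inv_laplace G 1 t * of_real (exp (1 * t)))"
      using i zeta_quotient_shift[of 1] by simp
  qed
  moreover have "Complex 1 0 = 1" by (simp add: complex_eq_iff)
  moreover have "G 1 = 0" using Q by (simp add: zeta_quotient_def)
  ultimately have "laplace (inv_laplace G 1) 1 = 0" by simp
  moreover have "(LINT x|lborel. even_inv_mellin G x) = 2 * (LINT t|lborel. even_inv_mellin G (exp t) * of_real (exp t))"
    by (rule even_integral_exp(2)) (use i in \<open>auto simp: even_inv_mellin_even even_inv_mellin_exp\<close>)
  ultimately show ?thesis
    using zeta_quotient_shift[of 1] by (simp add: laplace_def even_inv_mellin_exp exp_of_real)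
qed

text \<open>Inversion on the critical line contributes \<open>exp (- t / 2)\<close>, and half of the
  measure \<open>exp t\<close> remains. It turns \<open>\<eta>\<close> into an integrable function
  whose transform is the Mellin transform at the conjugate point of the line; evenness doubles
  \<open>1 / (2 * pi)\<close>.\<close>

lemma even_inv_mellin_pairing:
  assumes \<eta>: "\<eta> \<in> H_plus"
  shows "(LINT x|lborel. even_inv_mellin G x * \<eta> x) =
    (LINT \<tau>|lborel. G (Complex (1/2) \<tau>) * mellin \<eta> (Complex (1/2) (- \<tau>))) / of_real pi"
proof -
  have S: "\<eta> \<in> schwartz" and ev: "\<And>x. \<eta> (- x) = \<eta> x" using \<eta> by (auto simp: H_plus_def)
  note [measurable] = borel_measurable_continuous_onI[OF schwartz_continuous[OF S]]
    borel_measurable_continuous_onI[OF inv_laplace_zeta_quotient_continuous]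
  define g where "g \<tau> = G (Complex (1/2) \<tau>)" for \<tau>
  define v where "v t = \<eta> (exp t) * of_real (exp ((1/2) * t))" for t
  have g: "integrable lborel g" unfolding g_def by (rule zeta_quotient_line) simp
  have v: "integrable lborel v"
  proof -
    have "set_integrable lborel {0<..} (mellin_integrand \<eta> (1/2))" by (rule mellin_schwartz(1)[OF S]) simp
    hence "integrable lborel (\<lambda>t. \<eta> (exp t) * exp (1/2 * of_real t))" by (subst (asm) mellin_laplace(2)) auto
    thus ?thesis by (simp add: v_def[abs_def] flip: exp_of_real)
  qed
  obtain B where B: "\<And>x. norm (\<eta> x) \<le> B" using rapid_bounded[OF schwartz_rapid[OF S]] by blast
  have "integrable lborel (\<lambda>t. B *\<^sub>R (inv_laplace G 2 t * of_real (exp (1 * t))))"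
    by (intro integrable_scaleR_right inv_laplace_zeta_quotient_integrable) simp
  hence i: "integrable lborel (\<lambda>t. inv_laplace G 2 t * \<eta> (exp t) * of_real (exp t))"
  proof (rule Bochner_Integration.integrable_bound)
    show "AE t in lborel. norm (inv_laplace G 2 t * \<eta> (exp t) * of_real (exp t)) \<le> norm (B *\<^sub>R (inv_laplace G 2 t * of_real (exp (1 * t))))"
    proof (rule AE_I2)
      fix t
      have "norm (\<eta> (exp t)) * (norm (inv_laplace G 2 t) * exp t) \<le> \<bar>B\<bar> * (norm (inv_laplace G 2 t) * exp t)"
        using B[of "exp t"] by (intro mult_right_mono) auto
      thus "norm (inv_laplace G 2 t * \<eta> (exp t) * of_real (exp t)) \<le> norm (B *\<^sub>R (inv_laplace G 2 t * of_real (exp (1 * t))))"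
        by (simp add: norm_mult mult_ac)
    qed
  qed measurable
  have "(LINT x|lborel. even_inv_mellin G x * \<eta> x) = 2 * (LINT t|lborel. even_inv_mellin G (exp t) * \<eta> (exp t) * of_real (exp t))"
    by (rule even_integral_exp(2)) (use i in \<open>auto simp: ev even_inv_mellin_even even_inv_mellin_exp\<close>)
  also have "(LINT t|lborel. even_inv_mellin G (exp t) * \<eta> (exp t) * of_real (exp t)) =
      (LINT t|lborel. (LINT \<tau>|lborel. g \<tau> * v t * cis (- \<tau> * t)) / of_real (2 * pi))"
  proof (intro Bochner_Integration.integral_cong refl)
    fix t
    have e: "exp (- (1/2) * t) * exp t = exp ((1/2) * t)" for t :: real unfolding exp_add[symmetric] by simp
    have "even_inv_mellin G (exp t) * \<eta> (exp t) * of_real (exp t) =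
        (LINT \<tau>|lborel. g \<tau> * cis (- \<tau> * t)) / of_real (2 * pi) * (\<eta> (exp t) * of_real (exp (- (1/2) * t) * exp t))"
      using zeta_quotient_shift[of "1/2" t] inv_laplace_cis[of G "1/2" t] by (simp add: even_inv_mellin_exp g_def)
    also have "\<dots> = (LINT \<tau>|lborel. g \<tau> * cis (- \<tau> * t)) * v t / of_real (2 * pi)"
      unfolding e v_def by simp
    also have "(LINT \<tau>|lborel. g \<tau> * cis (- \<tau> * t)) * v t = (LINT \<tau>|lborel. g \<tau> * v t * cis (- \<tau> * t))"
      by (subst integral_mult_left_zero[symmetric]) (simp only: mult_ac)
    finally show "even_inv_mellin G (exp t) * \<eta> (exp t) * of_real (exp t) = (LINT \<tau>|lborel. g \<tau> * v t * cis (- \<tau> * t)) / of_real (2 * pi)" .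
  qed
  also have "\<dots> = (LINT t|lborel. LINT \<tau>|lborel. g \<tau> * v t * cis (- \<tau> * t)) / of_real (2 * pi)" by simp
  also have "(LINT t|lborel. LINT \<tau>|lborel. g \<tau> * v t * cis (- \<tau> * t)) = (LINT \<tau>|lborel. LINT t|lborel. g \<tau> * v t * cis (- \<tau> * t))"
    by (rule Fubini_mult_bounded[OF g v]) auto
  also have "\<dots> = (LINT \<tau>|lborel. G (Complex (1/2) \<tau>) * mellin \<eta> (Complex (1/2) (- \<tau>)))"
  proof (intro Bochner_Integration.integral_cong refl)
    fix \<tau>
    show "(LINT t|lborel. g \<tau> * v t * cis (- \<tau> * t)) = G (Complex (1/2) \<tau>) * mellin \<eta> (Complex (1/2) (- \<tau>))"
      unfolding mellin_schwartz(2)[OF S] laplace_def exp_Complex_times g_def v_def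
      by (subst integral_mult_right_zero[symmetric]) (simp only: mult_ac)
  qed
  finally show ?thesis by simp
qed

end


section \<open>Identification of the two inverse transforms by testing against Gaussians\<close>

lemma even_inv_mellin_isCont:
  assumes "zeta_quotient h G" "x \<noteq> 0" shows "isCont (even_inv_mellin G) x"
proof -
  have "continuous_on (- {0}) (\<lambda>x. inv_laplace G 2 (ln \<bar>x\<bar>))"
    by (rule continuous_on_compose2[OF inv_laplace_zeta_quotient_continuous[OF assms(1)]])
      (auto intro!: continuous_intros)
  hence "continuous_on (- {0}) (even_inv_mellin G)"
    by (rule continuous_on_eq) (auto simp: even_inv_mellin_def)
  thus ?thesis using assms(2) by (simp add: continuous_on_eq_continuous_at open_Compl)
qed

lemma continuous_on_Complex [continuous_intros]:
  "continuous_on A f \<Longrightarrow> continuous_on A (\<lambda>x. Complex s (f x))"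
  unfolding Complex_eq by (intro continuous_intros)

lemma fourier_shift: "fourier (\<lambda>x. f (x - c)) y = cis (2 * pi * c * y) * fourier f y"
proof -
  have "fourier (\<lambda>x. f (x - c)) y = \<bar>1\<bar> *\<^sub>R (LINT x|lborel. f (c + 1 * x - c) * cis (2 * pi * (c + 1 * x) * y))"
    unfolding fourier_cis by (rule lborel_integral_real_affine) simp
  also have "\<dots> = (LINT x|lborel. cis (2 * pi * c * y) * (f x * cis (2 * pi * x * y)))"
    by (simp add: distrib_left distrib_right cis_mult[symmetric] mult_ac)
  also have "\<dots> = cis (2 * pi * c * y) * fourier f y" unfolding fourier_cis by simp
  finally show ?thesis .
qed

lemma integrable_mult_bounded:
  fixes f g :: "real \<Rightarrow> complex"
  assumes f: "integrable lborel f" and [measurable]: "g \<in> borel_measurable borel" and g: "\<And>x. norm (g x) \<le> B"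
  shows "integrable lborel (\<lambda>x. f x * g x)"
proof (rule Bochner_Integration.integrable_bound)
  note [measurable] = borel_measurable_integrable[OF f, simplified]
  show "(\<lambda>x. f x * g x) \<in> borel_measurable lborel" by measurable
  show "integrable lborel (\<lambda>x. B *\<^sub>R norm (f x))" using f by (intro integrable_scaleR_right integrable_norm)
  show "AE x in lborel. norm (f x * g x) \<le> norm (B *\<^sub>R norm (f x))"
  proof (rule AE_I2)
    fix x
    have "norm (f x) * norm (g x) \<le> norm (f x) * \<bar>B\<bar>" using g[of x] by (intro mult_left_mono) auto
    thus "norm (f x * g x) \<le> norm (B *\<^sub>R norm (f x))" by (simp add: norm_mult mult.commute)
  qed
qed

lemma fourier_add:
  assumes "integrable lborel f" "integrable lborel g"
  shows "fourier (\<lambda>x. f x + g x) y = fourier f y + fourier g y"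
  unfolding fourier_cis distrib_right
  by (intro Bochner_Integration.integral_add integrable_mult_bounded[where B = 1] assms) auto

lemma fourier_cmult: "fourier (\<lambda>x. c * f x) y = c * fourier f y"
  unfolding fourier_cis mult.assoc by simp

context
  fixes h G G2 assumes Q: "zeta_quotient h G" and Q2: "zeta_quotient (\<lambda>w. h (1 - w)) G2"
begin

text \<open>Multiplied by zeta at \<open>z\<close> and at \<open>1 - z\<close>, both sides equal
  \<open>h z\<close> times the two sides of the functional equation for \<open>\<eta>\<close>. The
  factors can be cancelled off the isolated zeros of zeta, and continuity along the line covers the
  zeros.\<close>

lemma critical_line_identity:
  assumes \<eta>: "\<eta> \<in> H_plus"
  shows "G (Complex (1/2) \<tau>) * mellin \<eta> (Complex (1/2) (- \<tau>)) =
    G2 (Complex (1/2) (- \<tau>)) * mellin (fourier \<eta>) (Complex (1/2) \<tau>)"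
proof -
  have S: "\<eta> \<in> schwartz" "fourier \<eta> \<in> schwartz" using \<eta> by (auto simp: H_plus_def intro: fourier_schwartz)
  define L where "L \<tau> = G (Complex (1/2) \<tau>) * mellin \<eta> (Complex (1/2) (- \<tau>))" for \<tau>
  define R where "R \<tau> = G2 (Complex (1/2) (- \<tau>)) * mellin (fourier \<eta>) (Complex (1/2) \<tau>)" for \<tau>
  have m: "continuous_on UNIV (\<lambda>\<tau>. mellin f (Complex (1/2) (k \<tau>)))" if "f \<in> schwartz" "continuous_on UNIV k" for f and k :: "real \<Rightarrow> real"
    by (rule continuous_on_compose2[OF holomorphic_on_imp_continuous_on[OF mellin_schwartz(3)[OF that(1)]]])
      (auto intro!: continuous_intros that(2))
  have g: "continuous_on UNIV (\<lambda>\<tau>. F (Complex (1/2) (k \<tau>)))" if "zeta_quotient f F" "continuous_on UNIV k" for f F and k :: "real \<Rightarrow> real"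
    by (rule continuous_on_compose2[OF zeta_quotient_continuous[OF that(1)]]) (auto intro!: continuous_intros that(2))
  have c: "continuous_on UNIV (\<lambda>x::real. - x)" "continuous_on UNIV (\<lambda>x::real. x)"
    by (auto intro!: continuous_intros)
  have "continuous_on UNIV L" "continuous_on UNIV R"
    unfolding L_def R_def
    by (rule continuous_on_mult[OF g[OF Q c(2)] m[OF S(1) c(1)]] continuous_on_mult[OF g[OF Q2 c(1)] m[OF S(2) c(2)]])+
  hence lim: "(L \<longlongrightarrow> L \<tau>) (at \<tau>)" "(R \<longlongrightarrow> R \<tau>) (at \<tau>)"
    by (auto simp: continuous_on_eq_continuous_at isCont_def)
  have "eventually (\<lambda>w. riemann_zeta w \<noteq> 0 \<and> w \<noteq> 1 \<and> Re w > 1/4) (at (Complex (1/2) \<tau>))"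
    by (rule zeta_nonzero_eventually) simp
  hence "eventually (\<lambda>t. riemann_zeta (Complex (1/2) t) \<noteq> 0) (at \<tau>)"
    using filterlim_iff[THEN iffD1, OF filterlim_Complex_at[of "1/2" \<tau>]] by (force elim: eventually_mono)
  hence "eventually (\<lambda>t. L t = R t) (at \<tau>)"
  proof eventually_elim
    case (elim t)
    define z where "z = Complex (1/2) t"
    have z': "Complex (1/2) (- t) = 1 - z" by (simp add: z_def complex_eq_iff)
    have re: "0 < Re z" "Re z < 1" "z \<noteq> 1" "Re (1 - z) \<ge> 1/2" "1 - z \<noteq> 1" "Re z \<ge> 1/2"
      by (auto simp: z_def complex_eq_iff)
    have nz: "riemann_zeta z \<noteq> 0" using elim by (simp add: z_def)
    have nz': "riemann_zeta (1 - z) \<noteq> 0"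
      using zeta_functional_equation[OF re(1,2)] nz Phi_nonzero[of z] re by auto
    have 1: "G z * riemann_zeta z = h z" using Q re by (auto simp: zeta_quotient_def)
    have "\<forall>w. Re w \<ge> 1/2 \<longrightarrow> w \<noteq> 1 \<longrightarrow> G2 w * riemann_zeta w = h (1 - w)"
      using Q2 unfolding zeta_quotient_def by blast
    hence 2: "G2 (1 - z) * riemann_zeta (1 - z) = h z" using re(4,5) by simp
    have 3: "riemann_zeta (1 - z) * mellin \<eta> (1 - z) = riemann_zeta z * mellin (fourier \<eta>) z"
      using zeta_mellin_functional_equation[OF \<eta>, of "1 - z"] re by simp
    have "L t * (riemann_zeta z * riemann_zeta (1 - z)) = (G z * riemann_zeta z) * (riemann_zeta (1 - z) * mellin \<eta> (1 - z))"
      by (simp add: L_def z' z_def[symmetric])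
    also have "\<dots> = R t * (riemann_zeta z * riemann_zeta (1 - z))"
      unfolding 1 3 2[symmetric] by (simp add: R_def z' z_def[symmetric])
    finally show ?case using nz nz' by simp
  qed
  hence "(R \<longlongrightarrow> L \<tau>) (at \<tau>)" using lim(1) by (rule Lim_transform_eventually[rotated])
  hence "L \<tau> = R \<tau>" using lim(2) by (intro tendsto_unique[OF at_neq_bot])
  thus ?thesis by (simp add: L_def R_def)
qed

lemma even_inv_mellin_parseval:
  assumes \<eta>: "\<eta> \<in> H_plus"
  shows "(LINT x|lborel. even_inv_mellin G x * \<eta> x) = (LINT x|lborel. even_inv_mellin G2 x * fourier \<eta> x)"
proof -
  have "(LINT \<tau>|lborel. G (Complex (1/2) \<tau>) * mellin \<eta> (Complex (1/2) (- \<tau>))) =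
      (LINT \<tau>|lborel. G2 (Complex (1/2) (- \<tau>)) * mellin (fourier \<eta>) (Complex (1/2) \<tau>))"
    unfolding critical_line_identity[OF \<eta>] ..
  also have "\<dots> = \<bar>-1\<bar> *\<^sub>R (LINT \<tau>|lborel. G2 (Complex (1/2) (- (0 + (-1) * \<tau>))) * mellin (fourier \<eta>) (Complex (1/2) (0 + (-1) * \<tau>)))"
    by (rule lborel_integral_real_affine) simp
  finally show ?thesis
    unfolding even_inv_mellin_pairing[OF Q \<eta>] even_inv_mellin_pairing[OF Q2 fourier_H_plus[OF \<eta>]] by simp
qed

text \<open>Parseval's identity is tested on even pairs of Gaussians concentrating at
  \<open>x\<close> and \<open>- x\<close>. One side tends to \<open>2 * even_inv_mellin G x\<close>
  by continuity away from 0; on the other the transformed Gaussians flatten, leaving the Fourier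
  integral.\<close>

lemma even_inv_mellin_fourier:
  assumes x: "x \<noteq> 0"
  shows "even_inv_mellin G x = fourier (even_inv_mellin G2) x"
proof -
  define e where "e = even_inv_mellin G"
  define e2 where "e2 = even_inv_mellin G2"
  have e: "integrable lborel e" "integrable lborel e2"
    unfolding e_def e2_def by (rule even_inv_mellin_integrable[OF Q] even_inv_mellin_integrable[OF Q2])+
  have ev: "e (- y) = e y" "e2 (- y) = e2 y" for y by (simp_all add: e_def e2_def even_inv_mellin_even)
  define p where "p n c y = of_nat (Suc n) * gauss (real (Suc n)) (y - c)" for n c y
  \<comment> \<open>Symmetrisation is needed because the pairing is available for even test
    functions only.\<close>
  define \<eta> where "\<eta> n y = p n x y + p n (- x) y" for n y
  have pS: "p n c \<in> schwartz" for n c unfolding p_def by (intro schwartz_cmult gauss_schwartz) simp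
  have p_even: "p n c (- y) = p n (- c) y" for n c y
    using gauss_even[of "real (Suc n)" "y + c"] by (simp add: p_def)
  have \<eta>: "\<eta> n \<in> H_plus" for n
    using schwartz_add[OF pS pS] by (auto simp: H_plus_def \<eta>_def[abs_def] p_even)
  have Fp: "fourier (p n c) y = cis (2 * pi * c * y) * gauss (1 / real (Suc n)) y" for n c y
    unfolding p_def fourier_cmult fourier_shift
    by (subst fourier_gauss) (simp_all del: of_nat_Suc)
  have F\<eta>: "fourier (\<eta> n) y = (cis (2 * pi * x * y) + cis (2 * pi * (- x) * y)) * gauss (1 / real (Suc n)) y" for n y
    unfolding \<eta>_def fourier_add[OF schwartz_integrable[OF pS] schwartz_integrable[OF pS]] Fp distrib_right ..
  have ep: "integrable lborel (\<lambda>y. e y * p n c y)" for n c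
    using rapid_bounded[OF schwartz_rapid[OF pS]] borel_measurable_continuous_onI[OF schwartz_continuous[OF pS]]
    by (metis integrable_mult_bounded[OF e(1)])
  have "(\<lambda>n. LINT y|lborel. e y * p n c y) \<longlonglongrightarrow> e c" if "c \<noteq> 0" for c
    unfolding p_def by (rule gauss_approximate_identity[OF e(1)]) (use even_inv_mellin_isCont[OF Q that] in \<open>simp add: e_def\<close>)
  from tendsto_add[OF this[OF x] this[of "- x"]] have "(\<lambda>n. LINT y|lborel. e y * \<eta> n y) \<longlonglongrightarrow> 2 * e x"
    using x ep by (simp add: ev \<eta>_def distrib_left)
  moreover have "(LINT y|lborel. e y * \<eta> n y) = (LINT y|lborel. e2 y * fourier (\<eta> n) y)" for n
    unfolding e_def e2_def by (rule even_inv_mellin_parseval[OF \<eta>])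
  ultimately have lim1: "(\<lambda>n. LINT y|lborel. e2 y * fourier (\<eta> n) y) \<longlonglongrightarrow> 2 * e x" by simp
  have "(\<lambda>n. LINT y|lborel. e2 y * fourier (\<eta> n) y) \<longlonglongrightarrow> (LINT y|lborel. e2 y * (cis (2 * pi * x * y) + cis (2 * pi * (- x) * y)))"
  proof (rule integral_dominated_convergence)
    note [measurable] = borel_measurable_integrable[OF e(2), simplified]
    show "(\<lambda>y. e2 y * (cis (2 * pi * x * y) + cis (2 * pi * (- x) * y))) \<in> borel_measurable lborel" by measurable
    show "(\<lambda>y. e2 y * fourier (\<eta> n) y) \<in> borel_measurable lborel" for n unfolding F\<eta> by measurable
    show "integrable lborel (\<lambda>y. norm (e2 y) * 2)" using e(2) by (intro integrable_mult_left integrable_norm)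
    show "AE y in lborel. (\<lambda>n. e2 y * fourier (\<eta> n) y) \<longlonglongrightarrow> e2 y * (cis (2 * pi * x * y) + cis (2 * pi * (- x) * y))"
    proof (rule AE_I2)
      fix y
      have "(\<lambda>n. 1 / real (Suc n) * y) \<longlonglongrightarrow> 0"
        by (rule tendsto_mult_left_zero[OF LIMSEQ_Suc[OF lim_1_over_n]])
      hence "(\<lambda>n. exp (- (pi * (1 / real (Suc n) * y)\<^sup>2))) \<longlonglongrightarrow> exp (- (pi * 0\<^sup>2))"
        by (intro tendsto_intros)
      hence "(\<lambda>n. exp (- (pi * (1 / real (Suc n) * y)\<^sup>2))) \<longlonglongrightarrow> 1" by simp
      hence "(\<lambda>n. gauss (1 / real (Suc n)) y) \<longlonglongrightarrow> of_real 1" unfolding gauss_def by (rule tendsto_of_real)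
      from tendsto_mult[OF tendsto_const tendsto_mult[OF tendsto_const this]]
      show "(\<lambda>n. e2 y * fourier (\<eta> n) y) \<longlonglongrightarrow> e2 y * (cis (2 * pi * x * y) + cis (2 * pi * (- x) * y))"
        unfolding F\<eta> of_real_1 mult_1_right by blast
    qed
    show "AE y in lborel. norm (e2 y * fourier (\<eta> n) y) \<le> norm (e2 y) * 2" for n
    proof (rule AE_I2)
      fix y
      have "norm (cis (2 * pi * x * y) + cis (2 * pi * (- x) * y)) \<le> 1 + 1" by (rule norm_triangle_mono) auto
      hence "norm (fourier (\<eta> n) y) \<le> (1 + 1) * 1" unfolding F\<eta> norm_mult by (intro mult_mono norm_gauss_le_1) auto
      thus "norm (e2 y * fourier (\<eta> n) y) \<le> norm (e2 y) * 2" unfolding norm_mult by (intro mult_left_mono) auto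
    qed
  qed
  also have "(LINT y|lborel. e2 y * (cis (2 * pi * x * y) + cis (2 * pi * (- x) * y))) = fourier e2 x + fourier e2 (- x)"
    unfolding fourier_cis distrib_left
    by (subst Bochner_Integration.integral_add)
      (auto intro!: integrable_mult_bounded[OF e(2), where B = 1] simp: mult_ac)
  finally have "(\<lambda>n. LINT y|lborel. e2 y * fourier (\<eta> n) y) \<longlonglongrightarrow> 2 * fourier e2 x"
    using fourier_even[of e2 x] ev by simp
  hence "2 * e x = 2 * fourier e2 x" using lim1 LIMSEQ_unique by blast
  thus ?thesis by (simp add: e_def e2_def)
qed

text \<open>The preimage is taken in this form because moments of \<open>even_inv_mellin G2\<close>
  make it smooth at 0 as well, while its agreement with \<open>even_inv_mellin G\<close> elsewhere
  gives decay. Its value at 0 and its integral are the vanishing integrals of the two inverse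
  transforms.\<close>

lemma fourier_even_inv_mellin_H_cap: "fourier (even_inv_mellin G2) \<in> H_cap"
proof -
  let ?f = "fourier (even_inv_mellin G2)"
  note int2 = even_inv_mellin_integrable[OF Q2]
  have ev: "?f (- x) = ?f x" for x by (rule fourier_even) (rule even_inv_mellin_even)
  have "rapid ?f"
  proof (rule rapidI)
    fix k :: nat
    define B where "B = (LINT x|lborel. norm (even_inv_mellin G2 x))"
    have B: "norm (?f x) \<le> B" for x unfolding B_def by (rule fourier_norm_le[OF int2])
    have B0: "B \<ge> 0" using B[of 0] norm_ge_zero order.trans by blast
    \<comment> \<open>The weight \<open>Suc k\<close> is at least \<open>1/2\<close> also for
      \<open>k = 0\<close>, so \<open>zeta_quotient_bound\<close> applies; the additional power is
      harmless where \<open>\<bar>x\<bar> > 1\<close>.\<close>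
    obtain C where C: "\<And>t. exp (real (Suc k) * t) * norm (inv_laplace G 2 t) \<le> C"
      using zeta_quotient_bound[OF Q, of "real (Suc k)"] by auto
    have C0: "C \<ge> 0" by (rule order.trans[OF _ C[of 0]]) simp
    have "\<bar>x\<bar> ^ k * norm (?f x) \<le> B + C" for x
    proof (cases "\<bar>x\<bar> \<le> 1")
      case True
      have "\<bar>x\<bar> ^ k * norm (?f x) \<le> 1 * B" using B True by (intro mult_mono power_le_one) auto
      thus ?thesis using C0 by simp
    next
      case False
      hence x: "x \<noteq> 0" by auto
      have "\<bar>x\<bar> ^ k * norm (?f x) \<le> \<bar>x\<bar> ^ Suc k * norm (?f x)"
        using False by (intro mult_right_mono power_increasing) auto
      also have "\<dots> = exp (real (Suc k) * ln \<bar>x\<bar>) * norm (inv_laplace G 2 (ln \<bar>x\<bar>))"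
        using x even_inv_mellin_fourier[OF x] unfolding exp_of_nat_mult by (simp add: even_inv_mellin_def)
      also have "\<dots> \<le> C" by (rule C)
      finally show ?thesis using B0 by simp
    qed
    thus "\<exists>C. \<forall>x. \<bar>x\<bar> ^ k * norm (?f x) \<le> C" by blast
  qed
  hence "(\<lambda>t. LINT x|lborel. even_inv_mellin G2 x * cis ((2 * pi) * x * t)) \<in> schwartz"
    by (intro trig_integral_schwartz even_inv_mellin_measurable[OF Q2] even_inv_mellin_moments[OF Q2])
      (simp add: fourier_cis[abs_def])
  hence S: "?f \<in> schwartz" by (simp add: fourier_cis[abs_def])
  have "fourier ?f 0 = (LINT x|lborel. ?f x)" by (simp add: fourier_cis[of ?f])
  also have "\<dots> = (LINT x|lborel. even_inv_mellin G x)"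
  proof (rule integral_cong_AE)
    show "?f \<in> borel_measurable lborel" "even_inv_mellin G \<in> borel_measurable lborel"
      using borel_measurable_continuous_onI[OF schwartz_continuous[OF S]] even_inv_mellin_measurable[OF Q] by auto
    show "AE x in lborel. ?f x = even_inv_mellin G x"
      by (rule AE_I'[of "{0}"]) (use even_inv_mellin_fourier[symmetric] in \<open>auto simp: null_sets_def\<close>)
  qed
  also have "\<dots> = 0" by (rule even_inv_mellin_integral[OF Q])
  finally show ?thesis
    using S ev even_inv_mellin_integral[OF Q2] by (simp add: H_cap_def H_plus_def fourier_cis[of _ 0])
qed

end

theorem entire_schwartz_zeta_mellin:
  assumes h: "h \<in> entire_schwartz_zeta"
  obtains f where "f \<in> H_cap" "mellin (Z_map f) = h"
proof -
  have E: "h \<in> entire_schwartz" using h by (simp add: entire_schwartz_zeta_def)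
  define G where "G = quot_zeta h"
  define G2 where "G2 = quot_zeta (\<lambda>w. h (1 - w))"
  have Q: "zeta_quotient h G"
    unfolding G_def by (intro zeta_quotient_quot_zeta E entire_schwartz_zeta_rapid h)
  have Q2: "zeta_quotient (\<lambda>w. h (1 - w)) G2"
    unfolding G2_def by (intro zeta_quotient_quot_zeta entire_schwartz_reflect E entire_schwartz_zeta_rapid h)
  have "Z_map (fourier (even_inv_mellin G2)) = inv_mellin h"
  proof (rule Z_map_eq_inv_mellin[OF E])
    show "fourier (even_inv_mellin G2) x = inv_laplace G 2 (ln x)" if "x > 0" for x
      using even_inv_mellin_fourier[OF Q Q2, of x] that by (simp add: even_inv_mellin_def)
    show "integrable lborel (\<lambda>\<tau>. G (Complex 2 \<tau>))" by (rule zeta_quotient_line[OF Q]) simp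
    show "h (Complex 2 \<tau>) = riemann_zeta (Complex 2 \<tau>) * G (Complex 2 \<tau>)" for \<tau>
      using Q by (auto simp: zeta_quotient_def complex_eq_iff mult.commute)
  qed
  thus ?thesis
    using that[OF fourier_even_inv_mellin_H_cap[OF Q Q2]] mellin_inv_mellin[OF E] by simp
qed

theorem theorem4p1:
  shows
   "(\<forall>f\<in>H_minus. \<forall>s. set_integrable lborel {0<..} (mellin_integrand f s)) \<and>
    (\<forall>f\<in>H_minus. \<forall>g\<in>H_minus. \<forall>s. mellin (\<lambda>x. f x + g x) s = mellin f s + mellin g s) \<and>
    (\<forall>f\<in>H_minus. \<forall>c s. mellin (\<lambda>x. c * f x) s = c * mellin f s) \<and>
    bij_betw mellin H_minus entire_schwartz \<and>
    Z_map ` H_cap \<subseteq> H_minus \<and>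
    mellin ` (Z_map ` H_cap) = entire_schwartz_zeta \<and>
    (\<forall>h\<in>entire_schwartz_zeta.
       (\<forall>z. Re z \<ge> 1/2 \<longrightarrow> \<not> is_pole (\<lambda>w. h w / riemann_zeta w) z) \<and>
       (\<forall>z. Re z \<le> 1/2 \<longrightarrow> \<not> is_pole (\<lambda>w. h w / riemann_zeta (1 - w)) z))"
proof (intro conjI ballI allI impI)
  show "mellin (\<lambda>x. f x + g x) s = mellin f s + mellin g s" if "f \<in> H_minus" "g \<in> H_minus" for f g s
    using that by (intro mellin_add mellin_H_minus(1))
  show "mellin ` (Z_map ` H_cap) = entire_schwartz_zeta"
  proof
    show "mellin ` (Z_map ` H_cap) \<subseteq> entire_schwartz_zeta" using Z_map_H_cap(2) by auto
    show "entire_schwartz_zeta \<subseteq> mellin ` (Z_map ` H_cap)"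
      using entire_schwartz_zeta_mellin by (metis imageI subsetI)
  qed
qed (use mellin_H_minus(1) mellin_cmult bij_betw_mellin Z_map_H_cap(1) entire_schwartz_zeta_no_poles in auto)

end
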